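(* Let $k\ge4$ be a fixed integer and let $j,\ell$ be integers with $1\le j\le\ell$ and $\gcd(j,\ell)=1$. Then, as $x\to\infty$, $$\sum_{\substack{2\le n\le x\\ p_1(n)\equiv j\ (\mathrm{mod}\ \ell)}}\frac{\mu(n)\omega(n)^{k-1}}{n}\ll\frac{(\log\log x)^{k+\frac12}}{\sqrt{\log x}}.$$ Consequently $$\sum_{\substack{n=2\\ p_1(n)\equiv j\ (\mathrm{mod}\ \ell)}}^{\infty}\frac{\mu(n)\omega(n)^{k-1}}{n}=0,$$ the series converging as the limit of its partial sums over $n\le x$.
   Context: $\mu$ is the Möbius function, $\omega(n)$ is the number of distinct prime factors of $n$, and for $n\ge2$, $p_1(n)$ is the smallest prime factor of $n$. $f\ll g$ means $|f|\le Kg$ for some constant $K$ (possibly depending on $k$ and $\ell$) for all sufficiently large $x$. *)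

theory Defs
  imports Complex_Main "HOL-Computational_Algebra.Squarefree" "HOL-Number_Theory.Number_Theory"
begin

definition omega :: "nat \<Rightarrow> nat"
  where "omega n = card (prime_factors n)"

definition moebius_mu :: "nat \<Rightarrow> int"
  where "moebius_mu n = (if squarefree n then (-1) ^ omega n else 0)"

text \<open>Meaningful only for \<open>n \<ge> 2\<close>.\<close>

definition least_prime_factor :: "nat \<Rightarrow> nat"
  where "least_prime_factor n = (LEAST p. prime p \<and> p dvd n)"

definition moebius_omega_sum :: "nat \<Rightarrow> nat \<Rightarrow> nat \<Rightarrow> real \<Rightarrow> real"
  where "moebius_omega_sum k j l x =
    (\<Sum>n | 2 \<le> n \<and> real n \<le> x \<and> [least_prime_factor n = j] (mod l).
       real_of_int (moebius_mu n) * real (omega n) ^ (k - 1) / real n)"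

end

theory Submission
  imports Defs "HOL-Probability.Probability" "HOL-Complex_Analysis.Complex_Analysis" "HOL-Real_Asymp.Real_Asymp"
begin

text \<open>
  Weight \<open>\<mu>(d)\<close> by \<open>(1 - v)\<close> raised to the power \<open>\<omega>(d)\<close> and group the integers \<open>d\<close> by their least
  prime factor \<open>p\<close>. For a function \<open>f\<close> on the primes with mean \<open>\<delta>\<close>, the sum of
  \<open>\<mu>(d) (1 - v)^\<omega>(d) f(p) / d\<close> over \<open>2 \<le> d \<le> N\<close> equals \<open>- \<delta>\<close> up to \<open>O(1 / sqrt (ln N))\<close>, uniformly for
  complex \<open>v\<close> with \<open>\<bar>v\<bar> \<le> 2 / ln (1 + ln N)\<close>. Substituting \<open>1 - v = exp w\<close>, the weight \<open>\<omega>(d)^(k-1)\<close>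
  is the \<open>(k-1)\<close>-st derivative at \<open>w = 0\<close>; it kills the constant \<open>\<delta>\<close>, and Cauchy's inequality on a
  circle of radius \<open>1 / ln (1 + ln N)\<close> costs only powers of \<open>ln ln N\<close>.

  The uniform estimate needs \<open>\<Sum>\<mu>(n)/n\<close> and the primes in residue classes with error terms that save
  two logarithms. Both follow from a Tauberian theorem (Gaussian smoothing of a Laplace transform and a
  shift of contour) applied in the region \<open>Re s \<ge> 1 - c / (ln T)^10\<close>, \<open>\<bar>Im s\<bar> \<le> T\<close>, where the
  \<open>3\<close>-\<open>4\<close>-\<open>1\<close> inequality bounds \<open>1 / \<zeta>\<close> and \<open>L' / L\<close> by powers of \<open>ln T\<close>.
\<close>

section \<open>Prime sums and sums of multiplicative functions\<close>

text \<open>By Moebius inversion the weight \<open>1 - v\<close> on primes above a threshold turns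
  into the strongly multiplicative function with value \<open>v\<close> there. Its mean saves a
  logarithm only while \<open>norm v\<close> times the sum of \<open>1/q\<close> stays bounded; this
  limits \<open>v\<close> to size \<open>1 / ln (1 + ln N)\<close>. The rate
  \<open>1 / sqrt (ln N)\<close> comes from a cut at \<open>P\<close> near
  \<open>exp (sqrt (ln N))\<close>. Least prime factors up to \<open>P\<close> cost
  \<open>ln P / ln N\<close>, larger ones cost \<open>1 / ln P\<close> through a sieve bound, and
  this cut makes the two equal. Two logarithms are asked of the arithmetic input because its error
  is summed against \<open>1/m\<close>: the series of \<open>1 / (m (ln m)^2)\<close> converges, the
  one with a single logarithm does not. For the residue class, orthogonality of characters is
  replaced by a spectral argument: the class indicator is split into joint eigenfunctions of
  multiplication by units, and each of these is a multiple of a character. The outcome has exponent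
  \<open>k - 1\<close> on the double logarithm, which lies below the claimed
  \<open>k + 1/2\<close>.\<close>

lemma sum_divisors_swap:
  fixes g :: "nat \<Rightarrow> nat \<Rightarrow> 'a :: comm_monoid_add"
  shows "(\<Sum>n=1..N. \<Sum>d | d dvd n. g d (n div d)) = (\<Sum>d=1..N. \<Sum>m=1..N div d. g d m)"
proof -
  have "(\<Sum>n=1..N. \<Sum>d | d dvd n. g d (n div d)) = (\<Sum>(n,d)\<in>(SIGMA n:{1..N}. {d. d dvd n}). g d (n div d))"
    by (subst sum.Sigma) auto
  also have "\<dots> = (\<Sum>(d,m)\<in>(SIGMA d:{1..N}. {1..N div d}). g d m)"
  proof (rule sum.reindex_bij_witness[where i = "\<lambda>(d,m). (d * m, d)" and j = "\<lambda>(n,d). (d, n div d)"])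
    fix a assume "a \<in> (SIGMA n:{1..N}. {d. d dvd n})"
    then obtain d k where a: "a = (d * k, d)" "d * k \<ge> 1" "d * k \<le> N" by (auto elim!: dvdE)
    then have "d \<ge> 1" "k \<ge> 1" by (auto simp: Suc_le_eq)
    moreover have "d \<le> N" using a(3) \<open>k \<ge> 1\<close> by (metis le_trans mult.right_neutral mult_le_mono2)
    ultimately show "(case a of (n, d) \<Rightarrow> (d, n div d)) \<in> (SIGMA d:{1..N}. {1..N div d})"
      using a by (auto simp: less_eq_div_iff_mult_less_eq mult.commute)
    show "(case case a of (n, d) \<Rightarrow> (d, n div d) of (d, m) \<Rightarrow> (d * m, d)) = a"
      "(case case a of (n, d) \<Rightarrow> (d, n div d) of (d, m) \<Rightarrow> g d m) = (case a of (n, d) \<Rightarrow> g d (n div d))"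
      using a by auto
  qed (auto simp: less_eq_div_iff_mult_less_eq mult.commute)
  also have "\<dots> = (\<Sum>d=1..N. \<Sum>m=1..N div d. g d m)"
    by (subst sum.Sigma) auto
  finally show ?thesis .
qed

section \<open>Chebyshev and Mertens bounds for primes\<close>

lemma ln_fact_eq_mangoldt_sum: "ln (fact N :: real) = (\<Sum>d=1..N. mangoldt d * real (N div d))"
proof -
  have "ln (fact N :: real) = (\<Sum>n=1..N. ln (real n))"
    by (subst fact_prod, simp only: of_nat_prod, subst ln_prod) auto
  also have "\<dots> = (\<Sum>n=1..N. \<Sum>d | d dvd n. mangoldt d)"
    by (intro sum.cong refl) (subst mangoldt_sum, auto)
  also have "\<dots> = (\<Sum>d=1..N. \<Sum>m=1..N div d. mangoldt d)"
    by (rule sum_divisors_swap)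
  finally show ?thesis by (simp add: mult.commute)
qed

text \<open>Chebyshev's argument: in the logarithm of the central binomial coefficient,
  \<open>mangoldt n\<close> has coefficient \<open>(2*M) div n - 2 * (M div n)\<close>, which is
  never negative and equals 1 on the upper half \<open>{M<..2*M}\<close>. Since that coefficient is
  at most \<open>4^M\<close>, halving \<open>N\<close> closes the induction.\<close>

lemma sum_mangoldt_le: "(\<Sum>n=1..N. mangoldt n) \<le> 4 * real N"
proof (induction N rule: less_induct)
  case (less N)
  define psi where "psi = (\<lambda>N::nat. \<Sum>n=1..N. mangoldt n :: real)"
  have even_step: "psi (2*M) \<le> psi M + 2 * real M * ln 2" for M
  proof -
    have "psi (2*M) - psi M = (\<Sum>n\<in>{M<..2*M}. mangoldt n)"
    proof -
      have "{1..2*M} = {1..M} \<union> {M<..2*M}" by auto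
      then have "psi (2*M) = psi M + (\<Sum>n\<in>{M<..2*M}. mangoldt n)"
        unfolding psi_def by (simp only:, subst sum.union_disjoint) auto
      then show ?thesis by simp
    qed
    also have "\<dots> \<le> (\<Sum>n\<in>{M<..2*M}. mangoldt n * (real ((2*M) div n) - 2 * real (M div n)))"
    proof (intro sum_mono)
      fix n assume "n \<in> {M<..2*M}"
      then have "(2*M) div n \<ge> 1" "M div n = 0" by (auto simp: less_eq_div_iff_mult_less_eq)
      then have "1 \<le> real ((2*M) div n) - 2 * real (M div n)" by simp
      then show "mangoldt n \<le> mangoldt n * (real ((2*M) div n) - 2 * real (M div n))"
        using mult_left_mono[OF _ mangoldt_nonneg[of n], of 1] by simp
    qed
    also have "\<dots> \<le> (\<Sum>n=1..2*M. mangoldt n * (real ((2*M) div n) - 2 * real (M div n)))"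
    proof (rule sum_mono2)
      fix n assume "n \<in> {1..2*M} - {M<..2*M}"
      have "2 * (M div n) \<le> (2*M) div n"
        using \<open>n \<in> _\<close> by (simp add: less_eq_div_iff_mult_less_eq mult.assoc)
      then have "0 \<le> real ((2*M) div n) - 2 * real (M div n)" by linarith
      then show "0 \<le> mangoldt n * (real ((2*M) div n) - 2 * real (M div n))"
        by (simp add: mangoldt_nonneg)
    qed auto
    also have "\<dots> = ln (fact (2*M)) - 2 * (\<Sum>n=1..2*M. mangoldt n * real (M div n))"
      by (simp add: ln_fact_eq_mangoldt_sum algebra_simps sum_subtractf sum_distrib_left)
    also have "(\<Sum>n=1..2*M. mangoldt n * real (M div n)) = ln (fact M)"
      unfolding ln_fact_eq_mangoldt_sum by (intro sum.mono_neutral_right) auto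
    also have "ln (fact (2*M)) - 2 * ln (fact M) = ln (real ((2*M) choose M))"
    proof -
      have "real ((2*M) choose M) = fact (2*M) / (fact M * fact M)"
        by (subst binomial_fact) (auto simp: mult_2)
      then show ?thesis by (simp add: ln_div ln_mult)
    qed
    also have "\<dots> \<le> ln (2 ^ (2*M))"
    proof -
      have "(2*M) choose M \<le> 2 ^ (2*M)" by (rule binomial_le_pow2)
      then have "real ((2*M) choose M) \<le> 2 ^ (2*M)" by (metis of_nat_le_iff of_nat_numeral of_nat_power)
      moreover have "(2*M) choose M > 0" by (simp add: zero_less_binomial)
      ultimately show ?thesis by (subst ln_le_cancel_iff) (auto simp del: zero_less_binomial_iff)
    qed
    finally show ?thesis by (simp add: ln_realpow)
  qed
  show ?case
  proof (cases "N \<le> 1")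
    case True
    then consider "N = 0" | "N = 1" by linarith
    then show ?thesis by cases auto
  next
    case False
    define M where "M = N div 2"
    have M: "M < N" "M \<ge> 1" using False by (auto simp: M_def)
    have IH: "psi M \<le> 4 * real M" unfolding psi_def using less[OF M(1)] .
    have l2: "ln 2 \<le> (1::real)" using ln_2_less_1 by linarith
    have le: "psi (2*M) \<le> 6 * real M" 
      using even_step[of M] IH mult_left_mono[OF l2, of "2 * real M"] by simp
    show ?thesis
    proof (cases "even N")
      case True
      then have "N = 2*M" by (simp add: M_def)
      then show ?thesis using le unfolding psi_def by simp
    next
      case False
      then have N: "N = Suc (2*M)" by (auto simp: M_def)
      \<comment> \<open>The even case only needs \<open>6 * M\<close> out of the available
        \<open>8 * M\<close>; the slack absorbs the last term, since
        \<open>ln N \<le> N - 1 = 2 * M\<close>.\<close>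
      have "psi N = psi (2*M) + mangoldt N" unfolding psi_def N by simp
      also have "mangoldt N \<le> ln (real N)" by (rule mangoldt_le) (simp add: N)
      also have "ln (real N) \<le> real N - 1" by (rule ln_le_minus_one) (simp add: N)
      finally have "psi N \<le> 6 * real M + 2 * real M" using le N by simp
      then show ?thesis using N unfolding psi_def by simp
    qed
  qed
qed

lemma real_div_less: "real N / real d < real (N div d) + 1"
proof -
  have "\<lfloor>real N / real d\<rfloor> = int (N div d)" using floor_divide_of_nat_eq[of N d, where ?'a = real] by simp
  then show ?thesis by linarith
qed

text \<open>Mertens' first theorem: dropping the floor in the formula for \<open>ln (fact N)\<close>
  produces \<open>N\<close> times the sum, and the total rounding error is a Chebyshev sum, at most
  \<open>4 * N\<close>. Crude Stirling bounds on \<open>ln (fact N)\<close> finish both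
  directions.\<close>

lemma sum_mangoldt_over_n_bounds:
  assumes "N \<ge> 1"
  shows "\<bar>(\<Sum>n=1..N. mangoldt n / real n) - ln (real N)\<bar> \<le> 4"
proof -
  define A where "A = (\<Sum>n=1..N. mangoldt n / real n :: real)"
  have lnf: "ln (fact N) = (\<Sum>d=1..N. mangoldt d * real (N div d))" by (rule ln_fact_eq_mangoldt_sum)
  have "ln (fact N) \<le> (\<Sum>d=1..N. mangoldt d * (real N / real d))"
    unfolding lnf by (intro sum_mono mult_left_mono mangoldt_nonneg) (rule of_nat_div_le_of_nat)
  also have "\<dots> = real N * A" by (simp add: A_def sum_distrib_left field_simps)
  finally have 1: "ln (fact N) \<le> real N * A" .
  have "real N * A = (\<Sum>d=1..N. mangoldt d * (real N / real d))" by (simp add: A_def sum_distrib_left field_simps)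
  also have "\<dots> \<le> (\<Sum>d=1..N. mangoldt d * (real (N div d) + 1))"
  proof (intro sum_mono mult_left_mono mangoldt_nonneg)
    fix d assume "d \<in> {1..N}"
    show "real N / real d \<le> real (N div d) + 1"
      using real_div_less[of N d] by linarith
  qed
  also have "\<dots> = ln (fact N) + (\<Sum>d=1..N. mangoldt d)" by (simp add: lnf algebra_simps sum.distrib)
  also have "\<dots> \<le> ln (fact N) + 4 * real N" using sum_mangoldt_le[of N] by simp
  finally have 2: "real N * A \<le> ln (fact N) + 4 * real N" .
  have "fact N \<le> real N ^ N" using fact_le_power[of N] by simp
  then have "ln (fact N) \<le> ln (real N ^ N)" by (subst ln_le_cancel_iff) (use assms in auto)
  then have 3: "ln (fact N) \<le> real N * ln (real N)" using assms by (simp add: ln_realpow)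
  \<comment> \<open>One term of the exponential series is at most the whole, so
    \<open>N^N / fact N \<le> exp N\<close>: the lower Stirling bound.\<close>
  have "(\<Sum>n\<in>{N}. real N ^ n /\<^sub>R fact n) \<le> (\<Sum>n. real N ^ n /\<^sub>R fact n)"
    by (rule sum_le_suminf) (auto intro: summable_exp)
  then have "real N ^ N / fact N \<le> exp (real N)" by (simp add: exp_def field_simps)
  then have "ln (real N ^ N / fact N) \<le> ln (exp (real N))" by (subst ln_le_cancel_iff) (use assms in auto)
  then have 4: "real N * ln (real N) - real N \<le> ln (fact N)" using assms by (simp add: ln_div ln_realpow)
  have "real N * A \<le> real N * (ln (real N) + 4)" using 2 3 by (simp add: algebra_simps)
  moreover have "real N * (ln (real N) - 1) \<le> real N * A" using 1 4 by (simp add: algebra_simps)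
  ultimately have "A \<le> ln (real N) + 4" "ln (real N) - 1 \<le> A" using assms by simp_all
  then show ?thesis by (simp add: A_def abs_le_iff)
qed

definition prime_recip_sum :: "nat \<Rightarrow> nat \<Rightarrow> real" where
  "prime_recip_sum P N = (\<Sum>q | prime q \<and> P < q \<and> q \<le> N. 1 / real q)"

text \<open>Mertens' second theorem as an upper bound, by partial summation from the first. The
  remainder \<open>r\<close> is at most 4 in absolute value; its two boundary values and its
  variation together give \<open>8 / ln P \<le> 8 / ln 2\<close>.\<close>

lemma prime_recip_sum_le:
  assumes "2 \<le> P" "P \<le> N"
  shows "prime_recip_sum P N \<le> ln (ln (real N)) - ln (ln (real P)) + 8 / ln 2"
proof -
  define M where "M = (\<lambda>N::nat. \<Sum>n=1..N. mangoldt n / real n :: real)"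
  define r where "r = (\<lambda>N. M N - ln (real N))"
  define T where "T = (\<lambda>N::nat. \<Sum>n\<in>{P<..N}. mangoldt n / (real n * ln (real n)) :: real)"
  have r: "\<bar>r n\<bar> \<le> 4" if "n \<ge> 1" for n
    using sum_mangoldt_over_n_bounds[OF that] by (simp add: r_def M_def)
  \<comment> \<open>Partial summation in closed form, so that it can be proved by induction:
    boundary terms \<open>r / ln\<close>, and 4 times the total decrease of
    \<open>1 / ln\<close>.\<close>
  have T: "T N \<le> ln (ln (real N)) - ln (ln (real P)) + r N / ln (real N) - r P / ln (real P) + 4 * (1 / ln (real P) - 1 / ln (real N))"
    using assms(2)
  proof (induction N rule: dec_induct)
    case base
    then show ?case by (simp add: T_def)
  next
    case (step n)
    define L where "L = ln (real n)"
    define L' where "L' = ln (real (Suc n))"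
    have n: "n \<ge> 2" using step assms by linarith
    have L: "0 < L" "L < L'" using n by (auto simp: L_def L'_def)
    have "{P<..Suc n} = insert (Suc n) {P<..n}" using step by auto
    then have "T (Suc n) = T n + mangoldt (Suc n) / (real (Suc n) * L')" unfolding T_def L'_def by simp
    also have "mangoldt (Suc n) / (real (Suc n) * L') = (M (Suc n) - M n) / L'"
      by (simp add: M_def)
    also have "M (Suc n) - M n = (L' - L) + r (Suc n) - r n" by (simp add: r_def L_def L'_def)
    finally have 1: "T (Suc n) = T n + (L' - L) / L' + r (Suc n) / L' - r n / L'" 
      by (simp add: add_divide_distrib diff_divide_distrib)
    \<comment> \<open>Discrete substitute for the integral of \<open>1 / (t ln t)\<close>.\<close>
    have "ln (L / L') \<le> L / L' - 1" using L by (intro ln_le_minus_one) auto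
    then have 2: "(L' - L) / L' \<le> ln L' - ln L" using L by (simp add: ln_div diff_divide_distrib)
    have "r n * (1 / L - 1 / L') \<le> 4 * (1 / L - 1 / L')"
      using r[of n] n L by (intro mult_right_mono) (auto simp: frac_le)
    then have 3: "r n / L - r n / L' \<le> 4 * (1/L) - 4 * (1/L')" by (simp add: algebra_simps)
    show ?case using step.IH 1 2 3 unfolding L_def[symmetric] L'_def[symmetric] by (simp add: algebra_simps)
  qed
  have "prime_recip_sum P N \<le> (\<Sum>q | prime q \<and> P < q \<and> q \<le> N. mangoldt q / (real q * ln (real q)))"
    unfolding prime_recip_sum_def by (intro sum_mono) (auto simp: prime_gt_1_nat dest!: prime_gt_1_nat)
  also have "\<dots> \<le> T N" unfolding T_def 
    by (intro sum_mono2) (use assms in \<open>auto intro!: divide_nonneg_nonneg mult_nonneg_nonneg mangoldt_nonneg\<close>)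
  also have "r N / ln (real N) \<le> 4 / ln (real N)" using r[of N] assms by (intro divide_right_mono) auto
  moreover have "- (r P / ln (real P)) \<le> 4 / ln (real P)" 
    using r[of P] assms by (simp add: field_simps)
  moreover have "4 / ln (real P) \<le> 4 / ln 2" using assms by (intro divide_left_mono) (auto)
  ultimately show ?thesis using T by (simp add: algebra_simps)
qed

section \<open>Mean values of nonnegative strongly multiplicative functions\<close>

definition strong_mult :: "(nat \<Rightarrow> 'a) \<Rightarrow> nat \<Rightarrow> 'a :: comm_monoid_mult" where
  "strong_mult \<eta> n = (\<Prod>q\<in>prime_factors n. \<eta> q)"

lemma strong_mult_nonneg: 
  fixes \<eta> :: "nat \<Rightarrow> real"
  shows "(\<And>q. prime q \<Longrightarrow> 0 \<le> \<eta> q) \<Longrightarrow> 0 \<le> strong_mult \<eta> n"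
  unfolding strong_mult_def by (intro prod_nonneg) auto

lemma prime_factors_prime_power_mult:
  fixes q :: nat
  assumes "prime q" "m > 0" "i > 0"
  shows "prime_factors (q ^ i * m) = insert q (prime_factors m)"
  using assms by (subst prime_factors_product) (auto simp: prime_factorization_prime_power prime_factors_power prime_prime_factors)

text \<open>A truncated sum is at most its Euler product. Every \<open>m\<close> supported on
  \<open>insert q A\<close> is a power of \<open>q\<close> times a number supported on
  \<open>A\<close>; the map may hit numbers beyond \<open>N\<close>, which is harmless as all terms
  are nonnegative. The geometric series over the positive powers of \<open>q\<close> gives
  \<open>1 / (q - 1)\<close>.\<close>

lemma sum_strong_mult_euler:
  fixes \<eta> :: "nat \<Rightarrow> real"
  assumes "finite A" "\<And>q. q \<in> A \<Longrightarrow> prime q" and eta: "\<And>q. prime q \<Longrightarrow> 0 \<le> \<eta> q"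
  shows "(\<Sum>m | m \<in> {1..N} \<and> prime_factors m \<subseteq> A. strong_mult \<eta> m / real m) \<le> (\<Prod>q\<in>A. 1 + \<eta> q / (real q - 1))"
  using assms(1,2)
proof (induction A rule: finite_induct)
  case empty
  have "{m. m \<in> {1..N} \<and> prime_factors m \<subseteq> {}} \<subseteq> {1}" 
    by (auto simp: prime_factorization_empty_iff)
  then have "(\<Sum>m | m \<in> {1..N} \<and> prime_factors m \<subseteq> {}. strong_mult \<eta> m / real m) \<le> (\<Sum>m\<in>{1}. strong_mult \<eta> m / real m)"
    by (intro sum_mono2) (auto simp: strong_mult_nonneg eta strong_mult_def)
  then show ?case by (simp add: strong_mult_def)
next
  case (insert q A)
  define S where "S = (\<lambda>A. {m. m \<in> {1..N} \<and> prime_factors m \<subseteq> A})"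
  define F where "F = (\<lambda>m. strong_mult \<eta> m / real m)"
  define g where "g = (\<lambda>(i,m). q ^ i * m :: nat)"
  have q: "prime q" using insert.prems by auto
  have q2: "q \<ge> 2" using q prime_ge_2_nat by blast
  have F0: "F m \<ge> 0" for m unfolding F_def by (intro divide_nonneg_nonneg strong_mult_nonneg eta) auto
  have sub: "S (insert q A) \<subseteq> g ` ({0..N} \<times> S A)"
  proof
    fix m assume m: "m \<in> S (insert q A)"
    then have m0: "m > 0" "m \<le> N" "prime_factors m \<subseteq> insert q A" by (auto simp: S_def)
    obtain m' where m': "m = q ^ multiplicity q m * m'" "\<not> q dvd m'"
      using multiplicity_decompose'[of m q] m0 q by (metis gr0_conv_Suc nat.simps(3) not_prime_unit)
    have m'0: "m' > 0" using m' m0 by (cases m') auto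
    have "m' dvd m" using m' by (metis dvd_triv_right)
    then have "prime_factors m' \<subseteq> prime_factors m" using m0 by (intro dvd_prime_factors) auto
    then have "prime_factors m' \<subseteq> A" using m0 m'(2) by auto
    moreover have "m' \<le> N" using \<open>m' dvd m\<close> m0 by (meson dvd_imp_le order_trans)
    \<comment> \<open>A crude bound on the exponent, from \<open>k < 2^k \<le> m\<close>, whose only
      role is to keep the index set finite.\<close>
    moreover have "multiplicity q m \<le> N"
    proof -
      have "multiplicity q m < 2 ^ multiplicity q m" by (rule less_exp)
      also have "\<dots> \<le> q ^ multiplicity q m" using q2 by (rule power_mono) simp
      also have "\<dots> \<le> m" using m0 by (intro dvd_imp_le multiplicity_dvd)
      finally show ?thesis using m0 by simp
    qed
    ultimately have "(multiplicity q m, m') \<in> {0..N} \<times> S A" using m'0 by (auto simp: S_def)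
    then show "m \<in> g ` ({0..N} \<times> S A)" using m'(1) unfolding g_def by (metis (mono_tags, lifting) case_prod_conv image_eqI)
  qed
  have finS: "finite (S A)" unfolding S_def by simp
  have "sum F (S (insert q A)) \<le> sum F (g ` ({0..N} \<times> S A))"
    using sub finS by (intro sum_mono2) (auto simp: F0)
  also have "\<dots> \<le> sum (F \<circ> g) ({0..N} \<times> S A)"
    using finS F0 by (intro sum_image_le) auto
  also have "\<dots> = (\<Sum>i\<in>{0..N}. \<Sum>m\<in>S A. F (q ^ i * m))"
    by (simp add: sum.cartesian_product g_def case_prod_unfold comp_def)
  also have "\<dots> = (\<Sum>i\<in>{0..N}. \<Sum>m\<in>S A. (if i = 0 then 1 else \<eta> q / real q ^ i) * F m)"
  proof (intro sum.cong refl)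
    fix i m assume "m \<in> S A"
    then have m: "m > 0" "q \<notin> prime_factors m" using insert.hyps by (auto simp: S_def)
    show "F (q ^ i * m) = (if i = 0 then 1 else \<eta> q / real q ^ i) * F m"
    proof (cases "i = 0")
      case False
      then have "prime_factors (q ^ i * m) = insert q (prime_factors m)"
        using m q by (intro prime_factors_prime_power_mult) auto
      then have "strong_mult \<eta> (q ^ i * m) = \<eta> q * strong_mult \<eta> m"
        using m(2) by (simp add: strong_mult_def)
      then show ?thesis using False by (simp add: F_def)
    qed auto
  qed
  also have "\<dots> = (\<Sum>i\<in>{0..N}. if i = 0 then 1 else \<eta> q / real q ^ i) * sum F (S A)"
    by (simp add: sum_product)
  also have "\<dots> \<le> (1 + \<eta> q / (real q - 1)) * (\<Prod>q\<in>A. 1 + \<eta> q / (real q - 1))"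
  proof (intro mult_mono)
    have "(\<Sum>i\<in>{0..N}. if i = 0 then 1 else \<eta> q / real q ^ i) = 1 + (\<Sum>i\<in>{1..N}. \<eta> q / real q ^ i)"
      by (subst sum.atLeast_Suc_atMost) (auto intro!: sum.cong)
    also have "(\<Sum>i\<in>{1..N}. \<eta> q / real q ^ i) = \<eta> q * (\<Sum>i\<in>{1..N}. (1 / real q) ^ i)"
      by (simp add: sum_distrib_left power_one_over divide_inverse power_inverse)
    also have "(\<Sum>i\<in>{1..N}. (1 / real q) ^ i) \<le> 1 / (real q - 1)"
    proof -
      have "(real q - 1) * (\<Sum>i\<in>{1..N}. (1 / real q) ^ i) = 1 - (1 / real q) ^ N"
      proof (induction N)
        case (Suc n)
        have "real q * (1 / real q) ^ Suc n = (1 / real q) ^ n" using q2 by simp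
        then show ?case using Suc by (simp add: algebra_simps del: power_Suc)
      qed simp
      also have "\<dots> \<le> 1" by simp
      finally show ?thesis using q2 by (simp add: field_simps)
    qed
    finally show "(\<Sum>i\<in>{0..N}. if i = 0 then 1 else \<eta> q / real q ^ i) \<le> 1 + \<eta> q / (real q - 1)"
      using eta[OF q] by (simp add: mult_left_mono)
    show "sum F (S A) \<le> (\<Prod>q\<in>A. 1 + \<eta> q / (real q - 1))"
      using insert.IH insert.prems unfolding F_def S_def by auto
    show "0 \<le> 1 + \<eta> q / (real q - 1)" using eta[OF q] q2 by (intro add_nonneg_nonneg divide_nonneg_nonneg) auto
    show "0 \<le> sum F (S A)" by (intro sum_nonneg F0)
  qed
  finally show ?case using insert.hyps unfolding F_def S_def by simp
qed

text \<open>\<open>1 + x \<le> exp x\<close> turns the Euler product into an exponential. Replacing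
  \<open>q - 1\<close> by \<open>q\<close> costs at most twice the sum of
  \<open>1/(q-1) - 1/q\<close>; extended to all integers from 2 it telescopes to at most 1, whence
  \<open>exp 2\<close>.\<close>

lemma sum_strong_mult_harmonic_le:
  fixes \<eta> :: "nat \<Rightarrow> real"
  assumes eta: "\<And>q. prime q \<Longrightarrow> 0 \<le> \<eta> q" "\<And>q. prime q \<Longrightarrow> \<eta> q \<le> 2"
  shows "(\<Sum>m=1..N. strong_mult \<eta> m / real m) \<le> exp 2 * exp (\<Sum>q | prime q \<and> q \<le> N. \<eta> q / real q)"
proof -
  define A where "A = {q. prime q \<and> q \<le> N}"
  have fA: "finite A" unfolding A_def by simp
  have "(\<Sum>m=1..N. strong_mult \<eta> m / real m) = (\<Sum>m | m \<in> {1..N} \<and> prime_factors m \<subseteq> A. strong_mult \<eta> m / real m)"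
    by (intro sum.cong) (auto simp: A_def dest: prime_factors_dvd dvd_imp_le intro: order_trans[OF dvd_imp_le])
  also have "\<dots> \<le> (\<Prod>q\<in>A. 1 + \<eta> q / (real q - 1))"
    by (rule sum_strong_mult_euler) (use eta fA in \<open>auto simp: A_def\<close>)
  also have "\<dots> \<le> (\<Prod>q\<in>A. exp (\<eta> q / (real q - 1)))"
    by (intro prod_mono) (use eta in \<open>auto simp: A_def intro!: add_nonneg_nonneg divide_nonneg_nonneg dest: prime_gt_0_nat\<close>)
  also have "\<dots> = exp (\<Sum>q\<in>A. \<eta> q / (real q - 1))" by (simp add: exp_sum fA)
  also have "(\<Sum>q\<in>A. \<eta> q / (real q - 1)) \<le> (\<Sum>q\<in>A. \<eta> q / real q + 2 * (1 / (real q - 1) - 1 / real q))"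
  proof (intro sum_mono)
    fix q assume "q \<in> A"
    then have q: "prime q" "q \<ge> 2" using prime_ge_2_nat by (auto simp: A_def)
    have "\<eta> q / (real q - 1) = \<eta> q / real q + \<eta> q * (1 / (real q - 1) - 1 / real q)"
      using q by (simp add: field_simps)
    also have "\<eta> q * (1 / (real q - 1) - 1 / real q) \<le> 2 * (1 / (real q - 1) - 1 / real q)"
      using q eta by (intro mult_right_mono) (auto simp: frac_le)
    finally show "\<eta> q / (real q - 1) \<le> \<eta> q / real q + 2 * (1 / (real q - 1) - 1 / real q)" by simp
  qed
  also have "\<dots> = (\<Sum>q\<in>A. \<eta> q / real q) + 2 * (\<Sum>q\<in>A. 1 / (real q - 1) - 1 / real q)"
    by (simp add: sum.distrib sum_distrib_left)
  also have "(\<Sum>q\<in>A. 1 / (real q - 1) - 1 / real q) \<le> (\<Sum>q\<in>{2..N}. 1 / (real q - 1) - 1 / real q)"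
    by (intro sum_mono2) (auto simp: A_def prime_ge_2_nat frac_le)
  also have "\<dots> \<le> 1"
  proof (cases "N \<ge> 1")
    case True
    then have "(\<Sum>q\<in>{2..N}. 1 / (real q - 1) - 1 / real q) = 1 - 1 / real N"
    proof (induction N rule: dec_induct)
      case (step n)
      have "(\<Sum>q\<in>{2..Suc n}. 1 / (real q - 1) - 1 / real q) = 
              (\<Sum>q\<in>{2..n}. 1 / (real q - 1) - 1 / real q) + (1 / real n - 1 / real (Suc n))"
        using step.hyps by simp
      then show ?case using step.IH by linarith
    qed auto
    then show ?thesis by simp
  qed auto
  finally show ?thesis by (simp add: A_def exp_add mult.commute)
qed

text \<open>\<open>1 + ln N\<close> is split into \<open>ln n\<close> and the remainder
  \<open>1 + ln (N/n)\<close>. The first part is expanded by \<Lambda> and handled by Chebyshev's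
  bound, giving \<open>8 * N * H\<close>; the second is at most \<open>N/n\<close>, giving
  \<open>N * H\<close>. Here \<open>H\<close> is the harmonic sum, bounded by the Euler
  product.\<close>

lemma hall_bound:
  fixes \<eta> :: "nat \<Rightarrow> real"
  assumes eta: "\<And>q. prime q \<Longrightarrow> 0 \<le> \<eta> q" "\<And>q. prime q \<Longrightarrow> \<eta> q \<le> 2" and N: "N \<ge> 1"
  shows "(1 + ln (real N)) * (\<Sum>n=1..N. strong_mult \<eta> n) \<le> 
           10 * exp 2 * real N * exp (\<Sum>q | prime q \<and> q \<le> N. \<eta> q / real q)"
proof -
  define h where "h = strong_mult \<eta>"
  define H where "H = (\<Sum>m=1..N. h m / real m)"
  have h0: "h n \<ge> 0" for n unfolding h_def by (intro strong_mult_nonneg eta)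
  \<comment> \<open>Because prime powers weigh the same as primes, multiplying by one changes
    \<open>h\<close> by the factor 1 or \<open>\<eta> q \<le> 2\<close>, whether or not the prime
    already divides \<open>m\<close>.\<close>
  have hm: "mangoldt d * h (d * m) \<le> mangoldt d * (2 * h m)" if "m > 0" for d m
  proof (cases "primepow d")
    case True
    then obtain q k where q: "prime q" "k > 0" "d = q ^ k" by (auto simp: primepow_def)
    have "prime_factors (d * m) = insert q (prime_factors m)"
      unfolding q(3) using q that by (intro prime_factors_prime_power_mult) auto
    then have "h (d * m) = (if q \<in> prime_factors m then 1 else \<eta> q) * h m"
      by (auto simp: h_def strong_mult_def insert_absorb)
    also have "\<dots> \<le> 2 * h m" using eta(2)[OF q(1)] by (intro mult_right_mono h0) auto
    finally show ?thesis by (intro mult_left_mono mangoldt_nonneg)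
  qed (auto simp: mangoldt_def)
  have "(\<Sum>n=1..N. h n * ln (real n)) = (\<Sum>n=1..N. \<Sum>d | d dvd n. mangoldt d * h (d * (n div d)))"
  proof (intro sum.cong refl)
    fix n assume "n \<in> {1..N}"
    then have "ln (real n) = (\<Sum>d | d dvd n. mangoldt d)" by (subst mangoldt_sum) auto
    then show "h n * ln (real n) = (\<Sum>d | d dvd n. mangoldt d * h (d * (n div d)))"
      by (simp add: sum_distrib_left mult.commute)
  qed
  also have "\<dots> = (\<Sum>d=1..N. \<Sum>m=1..N div d. mangoldt d * h (d * m))" by (rule sum_divisors_swap)
  also have "\<dots> \<le> (\<Sum>d=1..N. \<Sum>m=1..N div d. mangoldt d * (2 * h m))"
    by (intro sum_mono hm) auto
  also have "\<dots> = (\<Sum>n=1..N. \<Sum>d | d dvd n. mangoldt d * (2 * h (n div d)))" by (rule sum_divisors_swap[symmetric])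
  also have "\<dots> = (\<Sum>n=1..N. \<Sum>d | d dvd n. mangoldt (n div d) * (2 * h d))"
  proof (rule sum.cong [OF refl])
    fix n assume "n \<in> {1..N}"
    then show "(\<Sum>d | d dvd n. mangoldt d * (2 * h (n div d))) = (\<Sum>d | d dvd n. mangoldt (n div d) * (2 * h d))"
      by (intro sum.reindex_bij_witness[where i = "\<lambda>d. n div d" and j = "\<lambda>d. n div d"]) auto
  qed
  also have "\<dots> = (\<Sum>d=1..N. \<Sum>m=1..N div d. mangoldt m * (2 * h d))" 
    by (rule sum_divisors_swap[where g = "\<lambda>d m. mangoldt m * (2 * h d)"])
  also have "\<dots> = (\<Sum>d=1..N. 2 * h d * (\<Sum>m=1..N div d. mangoldt m))"
    by (simp add: sum_distrib_left mult_ac)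
  also have "\<dots> \<le> (\<Sum>d=1..N. 2 * h d * (4 * (real N / real d)))"
  proof (intro sum_mono mult_left_mono)
    fix d assume "d \<in> {1..N}"
    have "(\<Sum>m=1..N div d. mangoldt m) \<le> 4 * real (N div d)" by (rule sum_mangoldt_le)
    also have "\<dots> \<le> 4 * (real N / real d)" using of_nat_div_le_of_nat[of N d, where ?'a = real] by simp
    finally show "(\<Sum>m=1..N div d. mangoldt m) \<le> 4 * (real N / real d)" .
  qed (auto simp: h0)
  also have "\<dots> = 8 * real N * H" by (simp add: H_def sum_distrib_left mult_ac)
  finally have 1: "(\<Sum>n=1..N. h n * ln (real n)) \<le> 8 * real N * H" .
  have "(\<Sum>n=1..N. h n * (1 + ln (real N) - ln (real n))) \<le> (\<Sum>n=1..N. h n * (real N / real n))"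
  proof (intro sum_mono mult_left_mono h0)
    fix n assume n: "n \<in> {1..N}"
    then have "ln (real N / real n) \<le> real N / real n - 1" by (intro ln_le_minus_one) auto
    then show "1 + ln (real N) - ln (real n) \<le> real N / real n" using n N by (simp add: ln_div)
  qed
  also have "\<dots> = real N * H" by (simp add: H_def sum_distrib_left mult.commute)
  finally have 2: "(1 + ln (real N)) * (\<Sum>n=1..N. h n) - (\<Sum>n=1..N. h n * ln (real n)) \<le> real N * H"
    by (simp add: sum_distrib_left algebra_simps sum_subtractf sum.distrib)
  have H: "H \<le> exp 2 * exp (\<Sum>q | prime q \<and> q \<le> N. \<eta> q / real q)"
    unfolding H_def h_def by (intro sum_strong_mult_harmonic_le eta)
  have "H \<ge> 0" unfolding H_def by (intro sum_nonneg) (auto simp: h0)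
  then have "0 \<le> real N * H" by simp
  moreover have "8 * real N * H = 8 * (real N * H)" "10 * real N * H = 10 * (real N * H)" by simp_all
  ultimately have "(1 + ln (real N)) * (\<Sum>n=1..N. h n) \<le> 10 * real N * H" using 1 2 by linarith
  also have "\<dots> \<le> 10 * real N * (exp 2 * exp (\<Sum>q | prime q \<and> q \<le> N. \<eta> q / real q))"
    using H by (intro mult_left_mono) auto
  finally show ?thesis by (simp add: h_def mult_ac)
qed

section \<open>Moebius sums and least prime factors\<close>

text \<open>Together with \<open>squarefree_eq_prod_primes\<close> this identifies finite sets of
  primes with squarefree numbers, so that divisor sums containing \<mu> become sums over subsets of
  \<open>prime_factors n\<close>.\<close>

lemma prod_primes_facts:
  fixes X :: "nat set"
  assumes "finite X" "\<And>q. q \<in> X \<Longrightarrow> prime q"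
  shows "prime_factors (\<Prod>X) = X" "squarefree (\<Prod>X)" "\<Prod>X > 0" 
    "n > 0 \<Longrightarrow> X \<subseteq> prime_factors n \<Longrightarrow> \<Prod>X dvd n"
proof -
  have pf: "prime_factorization (\<Prod>X) = mset_set X"
    using prime_factorization_prod_mset_primes[of "mset_set X"] assms
    by (simp add: prod_unfold_prod_mset)
  then show "prime_factors (\<Prod>X) = X" using assms by simp
  show "squarefree (\<Prod>X)"
    using assms by (intro squarefree_prod_coprime) (auto intro: primes_coprime squarefree_prime)
  show pos: "\<Prod>X > 0" using assms by (intro prod_pos) (auto simp: prime_gt_0_nat)
  show "\<Prod>X dvd n" if "n > 0" "X \<subseteq> prime_factors n"
  proof -
    have "mset_set X \<subseteq># prime_factorization n"
      unfolding subseteq_mset_def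
    proof
      fix a show "count (mset_set X) a \<le> count (prime_factorization n) a"
      proof (cases "a \<in> X")
        case True
        then have "a \<in># prime_factorization n" using that by auto
        then show ?thesis using True assms by (simp add: Suc_le_eq)
      qed (simp add: assms)
    qed
    then show ?thesis using that pos by (simp add: pf[symmetric] prime_factorization_subset_iff_dvd)
  qed
qed

lemma squarefree_eq_prod_primes: "squarefree (d::nat) \<Longrightarrow> \<Prod>(prime_factors d) = d"
proof -
  assume sq: "squarefree d"
  then have d: "d \<noteq> 0" using not_squarefree_0 by metis
  have "d = (\<Prod>p\<in>prime_factors d. p ^ multiplicity p d)" using d using d by (intro prime_factorization_nat) simp
  also have "\<dots> = (\<Prod>p\<in>prime_factors d. p)"
    using sq d by (intro prod.cong) (auto simp: squarefree_factorial_semiring')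
  finally show ?thesis by simp
qed

section \<open>Moebius inversion for strongly multiplicative weights\<close>

abbreviation mu :: "nat \<Rightarrow> complex" where "mu n \<equiv> of_int (moebius_mu n)"

lemma norm_mu_le: "norm (mu n) \<le> 1"
  by (simp add: moebius_mu_def norm_power)

text \<open>Expanding the product of \<open>1 - c q\<close> over the primes of \<open>n\<close>
  gives one signed term for each set of primes, that is, for each squarefree divisor.\<close>

lemma mu_divisor_sum:
  fixes c :: "nat \<Rightarrow> complex"
  assumes "n > 0"
  shows "(\<Sum>d | d dvd n. mu d * strong_mult c d) = strong_mult (\<lambda>q. 1 - c q) n"
proof -
  have "(\<Sum>d | d dvd n. mu d * strong_mult c d) = (\<Sum>d | d dvd n \<and> squarefree d. mu d * strong_mult c d)"
    using assms by (intro sum.mono_neutral_right) (auto simp: moebius_mu_def)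
  also have "\<dots> = (\<Sum>X\<in>Pow (prime_factors n). (-1) ^ card X * (\<Prod>q\<in>X. c q))"
  proof (rule sum.reindex_bij_witness[where i = "\<lambda>X. \<Prod>X" and j = prime_factors])
    fix d assume "d \<in> {d. d dvd n \<and> squarefree d}"
    then show "\<Prod>(prime_factors d) = d" "prime_factors d \<in> Pow (prime_factors n)"
      "(-1) ^ card (prime_factors d) * (\<Prod>q\<in>prime_factors d. c q) = mu d * strong_mult c d"
      using assms by (auto simp: squarefree_eq_prod_primes moebius_mu_def omega_def strong_mult_def
          dest: subsetD[OF dvd_prime_factors[of n d, rotated]])
  next
    fix X assume "X \<in> Pow (prime_factors n)"
    then have X: "X \<subseteq> prime_factors n" "finite X" "\<And>q. q \<in> X \<Longrightarrow> prime q"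
      by (auto intro: finite_subset)
    show "prime_factors (\<Prod>X) = X" "\<Prod>X \<in> {d. d dvd n \<and> squarefree d}"
      using prod_primes_facts[OF X(2,3)] X assms by auto
  qed
  also have "\<dots> = strong_mult (\<lambda>q. 1 - c q) n"
    unfolding strong_mult_def by (subst prod_diff_conv_sum) auto
  finally show ?thesis .
qed

lemma mu_divisor_sum_1: 
  assumes "n > 0"
  shows "(\<Sum>d | d dvd n. mu d) = (if n = 1 then 1 else 0)"
proof -
  have "(\<Sum>d | d dvd n. mu d) = (\<Sum>d | d dvd n. mu d * strong_mult (\<lambda>_. 1) d)"
    by (simp add: strong_mult_def)
  also have "\<dots> = strong_mult (\<lambda>q. 1 - 1) n" by (rule mu_divisor_sum[OF assms])
  also have "\<dots> = (if n = 1 then 1 else 0)"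
    using assms by (auto simp: strong_mult_def prime_factorization_empty_iff card_gt_0_iff)
  finally show ?thesis .
qed

lemma sum_strong_mult_eq:
  fixes c :: "nat \<Rightarrow> complex"
  shows "(\<Sum>n=1..Y. strong_mult (\<lambda>q. 1 - c q) n) = (\<Sum>m=1..Y. mu m * strong_mult c m * of_nat (Y div m))"
proof -
  have "(\<Sum>n=1..Y. strong_mult (\<lambda>q. 1 - c q) n) = (\<Sum>n=1..Y. \<Sum>d | d dvd n. mu d * strong_mult c d)"
    by (intro sum.cong refl mu_divisor_sum[symmetric]) auto
  also have "\<dots> = (\<Sum>d=1..Y. \<Sum>m=1..Y div d. mu d * strong_mult c d)"
    by (rule sum_divisors_swap)
  finally show ?thesis by (simp add: mult_ac)
qed

definition mu_harm :: "nat \<Rightarrow> complex" where "mu_harm N = (\<Sum>n=1..N. mu n / of_nat n)"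

text \<open>Grouping the pairs by \<open>n = e * m\<close> leaves \<open>1/n\<close> times the
  divisor sum of \<mu>, so only \<open>n = 1\<close> survives.\<close>

lemma sum_mu_harm: 
  assumes "Z \<ge> 1"
  shows "(\<Sum>e=1..Z. mu_harm (Z div e) / of_nat e) = 1"
proof -
  have "(\<Sum>e=1..Z. mu_harm (Z div e) / of_nat e) = (\<Sum>e=1..Z. \<Sum>m=1..Z div e. mu m / of_nat (e * m))"
    by (simp add: mu_harm_def sum_divide_distrib mult.commute)
  also have "\<dots> = (\<Sum>n=1..Z. \<Sum>e | e dvd n. mu (n div e) / of_nat (e * (n div e)))"
    by (rule sum_divisors_swap[symmetric])
  also have "\<dots> = (\<Sum>n=1..Z. \<Sum>e | e dvd n. mu e / of_nat n)"
  proof (rule sum.cong [OF refl])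
    fix n assume "n \<in> {1..Z}"
    then show "(\<Sum>e | e dvd n. mu (n div e) / of_nat (e * (n div e))) = (\<Sum>e | e dvd n. mu e / of_nat n)"
      by (intro sum.reindex_bij_witness[where i = "\<lambda>d. n div d" and j = "\<lambda>d. n div d"]) auto
  qed
  also have "\<dots> = (\<Sum>n=1..Z. (if n = 1 then 1 else 0) / of_nat n)"
    by (intro sum.cong refl) (simp add: sum_divide_distrib[symmetric] mu_divisor_sum_1)
  also have "\<dots> = (\<Sum>n\<in>{1}. (if n = 1 then 1 else 0) / of_nat n)"
    using assms by (intro sum.mono_neutral_right) auto
  finally show ?thesis by simp
qed

text \<open>An exact truncated form of the factorization of the Dirichlet series by
  \<open>1 / \<zeta>\<close>. Expanding the weight on the right by \<open>mu_divisor_sum\<close>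
  leaves an inner sum of \<open>mu_harm\<close> that is exactly 1 by \<open>sum_mu_harm\<close>, so
  no error term appears. It transfers the cancellation in the sums of \<open>mu n / n\<close> to
  arbitrary weights \<open>c\<close>.\<close>

lemma harm_sum_mu_strong_mult:
  fixes c :: "nat \<Rightarrow> complex"
  shows "(\<Sum>m=1..Y. mu m * strong_mult c m / of_nat m) = 
           (\<Sum>a=1..Y. strong_mult (\<lambda>q. 1 - c q) a / of_nat a * mu_harm (Y div a))"
proof -
  define B where "B = (\<lambda>m. mu m * strong_mult c m)"
  have "(\<Sum>a=1..Y. strong_mult (\<lambda>q. 1 - c q) a / of_nat a * mu_harm (Y div a)) =
        (\<Sum>a=1..Y. \<Sum>d | d dvd a. B d * mu_harm (Y div (d * (a div d))) / of_nat (d * (a div d)))"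
    by (intro sum.cong refl) (auto simp: mu_divisor_sum[symmetric] B_def sum_distrib_right sum_divide_distrib)
  also have "\<dots> = (\<Sum>d=1..Y. \<Sum>e=1..Y div d. B d * mu_harm (Y div (d * e)) / of_nat (d * e))"
    by (rule sum_divisors_swap)
  also have "\<dots> = (\<Sum>d=1..Y. B d / of_nat d * (\<Sum>e=1..Y div d. mu_harm (Y div d div e) / of_nat e))"
    by (simp add: sum_distrib_left div_mult2_eq field_simps)
  also have "\<dots> = (\<Sum>d=1..Y. B d / of_nat d)"
  proof (intro sum.cong refl)
    fix d assume "d \<in> {1..Y}"
    then have "Y div d \<ge> 1" by (auto simp: less_eq_div_iff_mult_less_eq)
    from sum_mu_harm[OF this] show "B d / of_nat d * (\<Sum>e=1..Y div d. mu_harm (Y div d div e) / of_nat e) = B d / of_nat d"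
      by simp
  qed
  finally show ?thesis by (simp add: B_def)
qed

section \<open>Grouping squarefree numbers by their least prime factor\<close>

lemma least_prime_factor_props:
  assumes "n \<ge> 2"
  shows "prime (least_prime_factor n)" "least_prime_factor n dvd n" 
    "\<And>q. prime q \<Longrightarrow> q dvd n \<Longrightarrow> least_prime_factor n \<le> q"
proof -
  have "\<exists>p. prime p \<and> p dvd n" using assms by (intro prime_factor_nat) auto
  then have "prime (least_prime_factor n) \<and> least_prime_factor n dvd n"
    unfolding least_prime_factor_def by (rule LeastI_ex)
  then show "prime (least_prime_factor n)" "least_prime_factor n dvd n" by auto
  show "least_prime_factor n \<le> q" if "prime q" "q dvd n" for q
    unfolding least_prime_factor_def using that by (intro Least_le) auto
qed

lemma least_prime_factor_mult:
  assumes "prime p" "m > 0" "\<And>q. q \<in> prime_factors m \<Longrightarrow> p < q"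
  shows "least_prime_factor (p * m) = p"
  unfolding least_prime_factor_def
proof (rule Least_equality)
  fix q assume q: "prime q \<and> q dvd p * m"
  then have "q dvd p \<or> q dvd m" using prime_dvd_mult_iff by blast
  then show "p \<le> q"
  proof
    assume "q dvd p" then show ?thesis using q assms(1) primes_dvd_imp_eq[of q p] by simp
  next
    assume "q dvd m" then show ?thesis using assms q by (simp add: in_prime_factors_iff less_imp_le)
  qed
qed (use assms in auto)

definition rough_squarefree :: "nat \<Rightarrow> nat \<Rightarrow> bool" where
  "rough_squarefree p m \<longleftrightarrow> squarefree m \<and> (\<forall>q\<in>prime_factors m. p < q)"

text \<open>In \<open>d = p * m\<close> with \<open>p\<close> the least prime factor, squarefreeness
  prevents \<open>p\<close> from dividing \<open>m\<close>, so all primes of \<open>m\<close> are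
  strictly larger; conversely each such pair gives back \<open>p\<close>.\<close>

lemma sum_by_least_prime_factor:
  fixes X :: "nat \<Rightarrow> nat \<Rightarrow> 'a :: comm_monoid_add"
  shows "(\<Sum>d | d \<in> {2..N} \<and> squarefree d. X (least_prime_factor d) (d div least_prime_factor d)) =
         (\<Sum>p | prime p \<and> p \<le> N. \<Sum>m | m \<in> {1..N div p} \<and> rough_squarefree p m. X p m)"
proof -
  let ?lpf = least_prime_factor
  have "(\<Sum>d | d \<in> {2..N} \<and> squarefree d. X (?lpf d) (d div ?lpf d)) =
        (\<Sum>(p,m)\<in>(SIGMA p:{p. prime p \<and> p \<le> N}. {m. m \<in> {1..N div p} \<and> rough_squarefree p m}). X p m)"
  proof (rule sum.reindex_bij_witness[where i = "\<lambda>(p,m). p * m" and j = "\<lambda>d. (?lpf d, d div ?lpf d)"])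
    fix d assume "d \<in> {d. d \<in> {2..N} \<and> squarefree d}"
    then have d: "d \<ge> 2" "d \<le> N" "squarefree d" by auto
    note l = least_prime_factor_props[OF d(1)]
    obtain m where m: "d = ?lpf d * m" using l(2) by (auto elim!: dvdE)
    then have m0: "m > 0" using d by (cases m) auto
    have lp: "?lpf d > 0" using l(1) by (simp add: prime_gt_0_nat)
    have dm: "d div ?lpf d = m" using m lp by (metis nonzero_mult_div_cancel_left less_numeral_extra(3))
    have sm: "squarefree m" using d(3) m by (metis squarefree_multD(2))
    have "?lpf d < q" if "q \<in> prime_factors m" for q
    proof -
      have q: "prime q" "q dvd m" using that by auto
      then have "q dvd d" using m by (metis dvd_mult)
      then have "?lpf d \<le> q" using l(3) q by auto
      moreover have "?lpf d \<noteq> q"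
      proof
        assume "?lpf d = q"
        then have "q ^ 2 dvd d" using m q(2) by (metis mult_dvd_mono dvd_refl power2_eq_square)
        then have "q dvd 1" using d(3) by (rule squarefreeD[rotated])
        then show False using q by auto
      qed
      ultimately show ?thesis by simp
    qed
    then have "rough_squarefree (?lpf d) m" using sm by (auto simp: rough_squarefree_def)
    moreover have "?lpf d \<le> N" using l(2) d by (meson dvd_imp_le le_trans less_le_trans pos2)
    moreover have "m \<le> N div ?lpf d" using m d(2) lp by (metis less_eq_div_iff_mult_less_eq mult.commute)
    ultimately show "(?lpf d, d div ?lpf d) \<in> (SIGMA p:{p. prime p \<and> p \<le> N}. {m. m \<in> {1..N div p} \<and> rough_squarefree p m})"
      using l(1) m0 by (auto simp: dm)
    show "(case (?lpf d, d div ?lpf d) of (p, m) \<Rightarrow> p * m) = d" using dm m by simp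
  next
    fix b assume "b \<in> (SIGMA p:{p. prime p \<and> p \<le> N}. {m. m \<in> {1..N div p} \<and> rough_squarefree p m})"
    then obtain p m where b: "b = (p, m)" "prime p" "p \<le> N" "m \<ge> 1" "m \<le> N div p" "rough_squarefree p m" by auto
    have l: "?lpf (p * m) = p" using b by (intro least_prime_factor_mult) (auto simp: rough_squarefree_def)
    then show "(?lpf (case b of (p, m) \<Rightarrow> p * m), (case b of (p, m) \<Rightarrow> p * m) div ?lpf (case b of (p, m) \<Rightarrow> p * m)) = b"
      using b by (auto simp: prime_gt_0_nat)
    have "coprime p m"
    proof (rule prime_imp_coprime[OF b(2)])
      show "\<not> p dvd m" using b by (auto simp: rough_squarefree_def in_prime_factors_iff)
    qed
    then have "squarefree (p * m)" using b
      by (intro squarefree_mult_coprime) (auto simp: rough_squarefree_def squarefree_prime)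
    moreover have "p * m \<le> N" using b by (metis less_eq_div_iff_mult_less_eq mult.commute prime_gt_0_nat)
    moreover have "p * m \<ge> 2" using b(2,4) prime_ge_2_nat[of p] by (metis le_trans mult.right_neutral mult_le_mono2)
    ultimately show "(case b of (p, m) \<Rightarrow> p * m) \<in> {d. d \<in> {2..N} \<and> squarefree d}" using b by auto
  qed auto
  also have "\<dots> = (\<Sum>p | prime p \<and> p \<le> N. \<Sum>m | m \<in> {1..N div p} \<and> rough_squarefree p m. X p m)"
    by (subst sum.Sigma) auto
  finally show ?thesis .
qed

section \<open>Sums weighted by powers of a logarithm\<close>

lemma sum_div_swap:
  fixes g :: "nat \<Rightarrow> nat \<Rightarrow> 'a :: comm_monoid_add"
  shows "(\<Sum>d=1..N. \<Sum>m=1..N div d. g d m) = (\<Sum>m=1..N. \<Sum>d=1..N div m. g d m)"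
proof -
  have "(\<Sum>d=1..N. \<Sum>m=1..N div d. g d m) = (\<Sum>n=1..N. \<Sum>d | d dvd n. g d (n div d))"
    by (rule sum_divisors_swap[symmetric])
  also have "\<dots> = (\<Sum>n=1..N. \<Sum>d | d dvd n. g (n div d) d)"
  proof (rule sum.cong [OF refl])
    fix n assume "n \<in> {1..N}"
    then show "(\<Sum>d | d dvd n. g d (n div d)) = (\<Sum>d | d dvd n. g (n div d) d)"
      by (intro sum.reindex_bij_witness[where i = "\<lambda>d. n div d" and j = "\<lambda>d. n div d"]) auto
  qed
  also have "\<dots> = (\<Sum>m=1..N. \<Sum>d=1..N div m. g d m)"
    by (rule sum_divisors_swap[where g = "\<lambda>m d. g d m"])
  finally show ?thesis .
qed

text \<open>Discrete counterpart of the derivative of \<open>- 1 / (1 + ln t)\<close>; it makes the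
  sum in \<open>sum_inverse_ln_square\<close> telescope.\<close>

lemma inverse_ln_diff_ge:
  assumes "j \<ge> 2"
  shows "1 / (real j * (1 + ln (real j))\<^sup>2) \<le> 1 / (1 + ln (real (j - 1))) - 1 / (1 + ln (real j))"
proof -
  define x y where "x = 1 + ln (real j)" and "y = 1 + ln (real (j - 1))"
  have y: "y \<ge> 1" "y \<le> x" using assms by (auto simp: x_def y_def)
  have "ln (real (j - 1) / real j) \<le> real (j - 1) / real j - 1" using assms by (intro ln_le_minus_one) auto
  then have d: "x - y \<ge> 1 / real j" using assms by (simp add: x_def y_def ln_div field_simps of_nat_diff)
  have "1 / (real j * x\<^sup>2) = (1 / real j) / x\<^sup>2" by simp
  also have "\<dots> \<le> (x - y) / x\<^sup>2" using d by (intro divide_right_mono) auto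
  also have "\<dots> \<le> (x - y) / (x * y)" using y by (intro divide_left_mono) (auto simp: power2_eq_square)
  also have "\<dots> = 1 / y - 1 / x" using y by (simp add: field_simps)
  finally show ?thesis by (simp add: x_def y_def)
qed

lemma sum_inverse_ln_square:
  assumes "Q \<ge> 1"
  shows "(\<Sum>j\<in>{Q<..N}. 1 / (real j * (1 + ln (real j))\<^sup>2)) \<le> 1 / (1 + ln (real Q))"
proof (cases "Q \<le> N")
  case True
  then have "(\<Sum>j\<in>{Q<..N}. 1 / (real j * (1 + ln (real j))\<^sup>2)) \<le> 1 / (1 + ln (real Q)) - 1 / (1 + ln (real N))"
  proof (induction N rule: dec_induct)
    case (step n)
    have "{Q<..Suc n} = insert (Suc n) {Q<..n}" using step by auto
    then have "(\<Sum>j\<in>{Q<..Suc n}. 1 / (real j * (1 + ln (real j))\<^sup>2)) = 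
      (\<Sum>j\<in>{Q<..n}. 1 / (real j * (1 + ln (real j))\<^sup>2)) + 1 / (real (Suc n) * (1 + ln (real (Suc n)))\<^sup>2)" by simp
    then show ?case using step.IH inverse_ln_diff_ge[of "Suc n"] step.hyps assms by (simp del: of_nat_Suc)
  qed auto
  moreover have "1 / (1 + ln (real N)) \<ge> 0" using True assms by simp
  ultimately show ?thesis by linarith
qed (use assms in auto)

lemma harm_le: 
  assumes "N \<ge> 1"
  shows "(\<Sum>j=1..N. 1 / real j) \<le> 1 + ln (real N)"
  using assms
proof (induction N rule: dec_induct)
  case (step n)
  have "ln (real n / real (Suc n)) \<le> real n / real (Suc n) - 1" using step by (intro ln_le_minus_one) auto
  then have "1 / real (Suc n) \<le> ln (real (Suc n)) - ln (real n)" using step by (simp add: ln_div field_simps)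
  then show ?case using step.IH by simp
qed auto

lemma ln_div_nat_ge:
  assumes "1 \<le> m" "m \<le> N"
  shows "ln (real (N div m)) \<ge> ln (real N) - ln (real m) - ln 2" "ln (real (N div m)) \<ge> 0"
proof -
  have M: "N div m \<ge> 1" using assms by (simp add: less_eq_div_iff_mult_less_eq)
  then show "ln (real (N div m)) \<ge> 0" by simp
  have "real N / real m \<le> 2 * real (N div m)" using real_div_less[of N m] M by linarith
  then have "ln (real N / real m) \<le> ln (2 * real (N div m))" using assms M by (subst ln_le_cancel_iff) auto
  then show "ln (real (N div m)) \<ge> ln (real N) - ln (real m) - ln 2" using assms M by (simp add: ln_div ln_mult)
qed

text \<open>A mean-value saving of one logarithm for \<open>G\<close> survives convolution with a
  kernel that decays like the inverse square of a logarithm. The kernel at \<open>Y div a\<close> is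
  spread over all \<open>m \<le> Y div a\<close>, so that after exchanging the sums the hypothesis
  on \<open>G\<close> applies at \<open>Y div m\<close>.\<close>

lemma log_convolution_bound:
  fixes G :: "nat \<Rightarrow> real"
  assumes G: "\<And>a. G a \<ge> 0" and GD: "\<And>z. 1 \<le> z \<Longrightarrow> z \<le> Y \<Longrightarrow> (1 + ln (real z)) * (\<Sum>a=1..z. G a) \<le> D * real z"
    and Y: "Y \<ge> 1" and D: "D \<ge> 0"
  shows "(\<Sum>a=1..Y. G a / real a / (1 + ln (real (Y div a)))\<^sup>2) \<le> 16 * D / (1 + ln (real Y))"
proof -
  define w where "w = (\<lambda>m::nat. 1 / (1 + ln (real m))\<^sup>2)"
  define L where "L = 1 + ln (real Y)"
  have L: "L \<ge> 1" using Y by (simp add: L_def)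
  \<comment> \<open>\<open>1/a\<close> is at most \<open>2/Y\<close> times the number of
    \<open>m \<le> Y div a\<close>, and \<open>w\<close> is decreasing, so its value at the end
    point is below each \<open>w m\<close>.\<close>
  have "(\<Sum>a=1..Y. G a / real a / (1 + ln (real (Y div a)))\<^sup>2) \<le> (\<Sum>a=1..Y. \<Sum>m=1..Y div a. 2 / real Y * G a * w m)"
  proof (intro sum_mono)
    fix a assume a: "a \<in> {1..Y}"
    define y where "y = Y div a"
    have y: "y \<ge> 1" using a by (simp add: y_def less_eq_div_iff_mult_less_eq)
    have "real Y / real a \<le> 2 * real y" using real_div_less[of Y a] y unfolding y_def by linarith
    then have "1 / real a \<le> 2 / real Y * real y" using a Y by (simp add: field_simps)
    then have "G a * (1 / real a) * w y \<le> G a * (2 / real Y * real y) * w y"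
      by (intro mult_right_mono mult_left_mono G) (auto simp: w_def)
    also have "\<dots> = (\<Sum>m=1..y. 2 / real Y * G a * w y)" by simp
    also have "\<dots> \<le> (\<Sum>m=1..y. 2 / real Y * G a * w m)"
    proof (intro sum_mono mult_left_mono)
      fix m assume m: "m \<in> {1..y}"
      show "w y \<le> w m" unfolding w_def using m by (intro divide_left_mono power_mono) (auto intro!: mult_pos_pos zero_less_power add_pos_nonneg)
    qed (auto simp: G)
    finally show "G a / real a / (1 + ln (real (Y div a)))\<^sup>2 \<le> (\<Sum>m=1..Y div a. 2 / real Y * G a * w m)"
      by (simp add: w_def y_def)
  qed
  also have "\<dots> = (\<Sum>m=1..Y. \<Sum>a=1..Y div m. 2 / real Y * G a * w m)" by (rule sum_div_swap)
  also have "\<dots> = (\<Sum>m=1..Y. 2 / real Y * w m * (\<Sum>a=1..Y div m. G a))"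
    by (intro sum.cong refl, subst sum_distrib_left, intro sum.cong refl) (simp add: mult_ac)
  also have "\<dots> \<le> (\<Sum>m=1..Y. 2 * D * (2 * w m / real m / L + 4 / L\<^sup>2 / real m))"
  proof (intro sum_mono)
    fix m assume m: "m \<in> {1..Y}"
    define t where "t = Y div m"
    have t: "t \<ge> 1" "t \<le> Y" using m by (auto simp: t_def less_eq_div_iff_mult_less_eq)
    define u where "u = 1 + ln (real t)"
    have u: "u \<ge> 1" using t by (simp add: u_def)
    have "(\<Sum>a=1..t. G a) \<le> D * real t / u" using GD[OF t] u by (simp add: u_def field_simps)
    also have "\<dots> \<le> D * (real Y / real m) / u"
      using of_nat_div_le_of_nat[of Y m, where ?'a = real] D u unfolding t_def
      by (intro divide_right_mono mult_left_mono) auto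
    finally have "2 / real Y * w m * (\<Sum>a=1..t. G a) \<le> 2 / real Y * w m * (D * (real Y / real m) / u)"
      by (intro mult_left_mono) (auto simp: w_def)
    also have "\<dots> = 2 * D * (w m / u) / real m" using Y by (simp add: field_simps)
    \<comment> \<open>Since \<open>m * (Y div m)\<close> is at least \<open>Y/2\<close>, one of the
      two logarithms is at least half of \<open>L\<close>. Either \<open>u\<close> is large and
      \<open>w m\<close> stays summable against \<open>1/m\<close>, or \<open>m\<close> is large and
      \<open>w m\<close> is of size \<open>1 / L^2\<close>, which the harmonic sum reduces to
      \<open>1 / L\<close>.\<close>
    also have "w m / u \<le> 2 * w m / L + 4 / L\<^sup>2"
    proof -
      define x where "x = 1 + ln (real m)"
      have x: "x \<ge> 1" using m by (simp add: x_def)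
      have "L \<le> x + u" using ln_div_nat_ge(1)[of m Y] m ln_2_less_1 by (simp add: L_def x_def u_def t_def)
      then consider "u \<ge> L / 2" | "x \<ge> L / 2" by linarith
      then show ?thesis
      proof cases
        case 1
        have "w m / u \<le> w m / (L / 2)" using 1 L u by (intro divide_left_mono) (auto simp: w_def)
        also have "\<dots> = 2 * w m / L + 0" by simp
        also have "\<dots> \<le> 2 * w m / L + 4 / L\<^sup>2" by (intro add_left_mono) simp
        finally show ?thesis .
      next
        case 2
        have "(L / 2)\<^sup>2 \<le> x\<^sup>2" using 2 L by (intro power_mono) auto
        then have "w m \<le> 1 / (L/2)\<^sup>2" unfolding w_def x_def[symmetric] using L x by (intro divide_left_mono) auto
        also have "\<dots> = 4 / L\<^sup>2" by (simp add: power_divide)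
        finally have "w m \<le> 4 / L\<^sup>2" .
        moreover have "w m / u \<le> w m / 1" using u by (intro divide_left_mono) (auto simp: w_def)
        moreover have "2 * w m / L \<ge> 0" using L by (simp add: w_def)
        ultimately show ?thesis by simp
      qed
    qed
    then have "2 * D * (w m / u) / real m \<le> 2 * D * (2 * w m / L + 4 / L\<^sup>2) / real m"
      using D by (intro divide_right_mono mult_left_mono) auto
    finally show "2 / real Y * w m * (\<Sum>a=1..Y div m. G a) \<le> 2 * D * (2 * w m / real m / L + 4 / L\<^sup>2 / real m)"
      unfolding t_def by (simp add: add_divide_distrib distrib_left mult.commute[of L])
  qed
  also have "\<dots> = 2 * D * (2 / L * (\<Sum>m=1..Y. w m / real m) + 4 / L\<^sup>2 * (\<Sum>m=1..Y. 1 / real m))"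
    by (simp add: sum_distrib_left sum.distrib distrib_left sum_divide_distrib mult_ac)
  also have "\<dots> \<le> 2 * D * (2 / L * 2 + 4 / L\<^sup>2 * L)"
  proof (intro mult_left_mono add_mono)
    have "(\<Sum>m=1..Y. w m / real m) = w 1 + (\<Sum>m\<in>{1<..Y}. 1 / (real m * (1 + ln (real m))\<^sup>2))"
    proof -
      have "{1..Y} = insert 1 {1<..Y}" using Y by auto
      then show ?thesis by (simp add: w_def mult.commute)
    qed
    then show "(\<Sum>m=1..Y. w m / real m) \<le> 2" using sum_inverse_ln_square[of 1 Y] by (simp add: w_def)
    show "(\<Sum>m=1..Y. 1 / real m) \<le> L" unfolding L_def by (rule harm_le[OF Y])
  qed (use D L in auto)
  also have "\<dots> = 16 * D / L" using L by (simp add: power2_eq_square field_simps)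
  finally show ?thesis by (simp add: L_def)
qed

text \<open>Mertens' constant for the bound from the first prime on: \<open>1/2\<close> is the prime
  2, the rest is \<open>prime_recip_sum_le\<close> at \<open>P = 2\<close>.\<close>

definition CM :: real where "CM = 1/2 - ln (ln 2) + 8 / ln 2"

lemma CM_ge: "8 / ln 2 \<le> CM" "CM \<ge> 0"
proof -
  have "ln (ln 2) \<le> (0::real)" using ln_le_minus_one[of "ln (2::real)"] ln_2_less_1 by simp
  then show "8 / ln 2 \<le> CM" unfolding CM_def by linarith
  moreover have "8 / ln (2::real) \<ge> 0" by simp
  ultimately show "CM \<ge> 0" by linarith
qed

lemmas CM_pos = CM_ge(2)

lemma sum_prime_recip_le:
  assumes "n \<ge> 1"
  shows "(\<Sum>q | prime q \<and> q \<le> n. 1 / real q) \<le> ln (1 + ln (real n)) + CM"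
proof (cases "n = 1")
  case True
  then have "{q. prime q \<and> q \<le> n} = {}" using prime_gt_1_nat leD by blast
  then have "(\<Sum>q | prime q \<and> q \<le> n. 1 / real q) = 0" by (simp only: sum.empty)
  then show ?thesis using CM_pos True by simp
next
  case False
  then have n: "n \<ge> 2" using assms by simp
  have "{q. prime q \<and> q \<le> n} = insert 2 {q. prime q \<and> 2 < q \<and> q \<le> n}" 
    using n by (auto simp: le_neq_implies_less prime_ge_2_nat)
  then have "(\<Sum>q | prime q \<and> q \<le> n. 1 / real q) = 1/2 + prime_recip_sum 2 n"
    by (simp add: prime_recip_sum_def)
  also have "\<dots> \<le> 1/2 + (ln (ln (real n)) - ln (ln 2) + 8 / ln 2)" using prime_recip_sum_le[of 2 n] n by simp
  also have "\<dots> = ln (ln (real n)) + CM" by (simp add: CM_def)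
  also have "ln (ln (real n)) \<le> ln (1 + ln (real n))" using n by (subst ln_le_cancel_iff) (auto intro: add_pos_nonneg)
  finally show ?thesis by simp
qed

text \<open>\<open>10 * exp 2\<close> comes from \<open>hall_bound\<close>. In the exponent, 2
  bounds weight times double logarithm, and \<open>3 * CM\<close> covers the applications of
  Mertens' bound, one of them with a weight as large as 2.\<close>

definition CK :: real where "CK = 10 * exp 2 * exp (2 + 3 * CM)"

lemma CK_pos: "CK > 0" by (simp add: CK_def)

text \<open>Primes up to \<open>p\<close> have weight 1 and contribute a factor of size
  \<open>ln p\<close>. The weight \<open>a\<close> on the larger ones is so small that their whole
  prime sum stays bounded, so \<open>hall_bound\<close> saves a full logarithm up to that
  factor.\<close>

lemma truncated_sum_bound:
  fixes a :: real
  assumes a: "0 \<le> a" "a \<le> 2" "a * ln (1 + ln (real N)) \<le> 2" and z: "1 \<le> z" "z \<le> N" and p: "p \<ge> 1"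
  shows "(1 + ln (real z)) * (\<Sum>n=1..z. strong_mult (\<lambda>q. if p < q then a else 1) n) \<le> CK * (1 + ln (real p)) * real z"
proof -
  let ?\<eta> = "\<lambda>q. if p < q then a else 1"
  have "(\<Sum>q | prime q \<and> q \<le> z. ?\<eta> q / real q) \<le> (\<Sum>q | prime q \<and> q \<le> z. (if q \<le> p then 1 / real q else 0) + a * (1 / real q))"
    using a by (intro sum_mono) auto
  also have "\<dots> = (\<Sum>q | prime q \<and> q \<le> z \<and> q \<le> p. 1 / real q) + a * (\<Sum>q | prime q \<and> q \<le> z. 1 / real q)"
    by (simp add: sum.distrib sum_distrib_left sum.If_cases Int_def conj_assoc)
  also have "(\<Sum>q | prime q \<and> q \<le> z \<and> q \<le> p. 1 / real q) \<le> (\<Sum>q | prime q \<and> q \<le> p. 1 / real q)"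
    by (intro sum_mono2) auto
  also have "\<dots> \<le> ln (1 + ln (real p)) + CM" by (rule sum_prime_recip_le[OF p])
  also have "a * (\<Sum>q | prime q \<and> q \<le> z. 1 / real q) \<le> a * (ln (1 + ln (real z)) + CM)"
    by (intro mult_left_mono sum_prime_recip_le z a)
  also have "\<dots> \<le> 2 + 2 * CM"
  proof -
    have "a * ln (1 + ln (real z)) \<le> a * ln (1 + ln (real N))"
      using a z by (intro mult_left_mono) (auto simp: add_pos_nonneg)
    moreover have "a * CM \<le> 2 * CM" using a CM_pos by (intro mult_right_mono) auto
    ultimately show ?thesis using a by (simp add: distrib_left)
  qed
  finally have "exp (\<Sum>q | prime q \<and> q \<le> z. ?\<eta> q / real q) \<le> exp (ln (1 + ln (real p)) + (2 + 3 * CM))" by simp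
  also have "\<dots> = (1 + ln (real p)) * exp (2 + 3 * CM)" using p by (simp only: exp_add, simp add: add_pos_nonneg)
  finally have E: "exp (\<Sum>q | prime q \<and> q \<le> z. ?\<eta> q / real q) \<le> (1 + ln (real p)) * exp (2 + 3 * CM)" .
  have "(1 + ln (real z)) * (\<Sum>n=1..z. strong_mult ?\<eta> n) \<le> 
           10 * exp 2 * real z * exp (\<Sum>q | prime q \<and> q \<le> z. ?\<eta> q / real q)"
    by (rule hall_bound) (use a z in auto)
  also have "\<dots> \<le> 10 * exp 2 * real z * ((1 + ln (real p)) * exp (2 + 3 * CM))"
    using E by (intro mult_left_mono) auto
  finally show ?thesis by (simp add: CK_def mult_ac)
qed

text \<open>An upper-bound sieve with weights: with no prime up to \<open>P\<close> allowed, the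
  exponential in \<open>hall_bound\<close> is of size \<open>ln N / ln P\<close>. The weight may
  exceed 1 only by \<open>O(1 / ln ln N)\<close>, which changes the exponent by a constant.\<close>

lemma rough_sum_bound:
  fixes w :: real
  assumes w: "0 \<le> w" "w \<le> 2" "(w - 1) * ln (1 + ln (real N)) \<le> 2" and P: "2 \<le> P" "P \<le> N"
  shows "(\<Sum>n=1..N. strong_mult (\<lambda>q. if P < q then w else 0) n) \<le> CK * real N / ln (real P)"
proof -
  let ?\<eta> = "\<lambda>q. if P < q then w else 0"
  define R where "R = prime_recip_sum P N"
  have lP: "ln (real P) > 0" "ln (real N) \<ge> ln (real P)" using P by auto
  have R0: "R \<ge> 0" unfolding R_def prime_recip_sum_def by (intro sum_nonneg) auto
  have R1: "R \<le> ln (ln (real N)) - ln (ln (real P)) + 8 / ln 2" unfolding R_def by (rule prime_recip_sum_le[OF P])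
  \<comment> \<open>The excess of the weight over 1 contributes a bounded amount; a weight below 1
    only helps.\<close>
  have "(w - 1) * R \<le> 2 + CM"
  proof (cases "w \<ge> 1")
    case True
    have "ln (ln (real P)) \<ge> ln (ln 2)" using P lP by simp
    moreover have "ln (ln (real N)) \<le> ln (1 + ln (real N))" using lP by simp
    ultimately have "R \<le> ln (1 + ln (real N)) + CM" using R1 by (simp add: CM_def)
    then have "(w - 1) * R \<le> (w - 1) * (ln (1 + ln (real N)) + CM)" using True by (intro mult_left_mono) auto
    also have "\<dots> = (w - 1) * ln (1 + ln (real N)) + (w - 1) * CM" by (simp add: distrib_left)
    also have "(w - 1) * CM \<le> 1 * CM" using w CM_pos by (intro mult_right_mono) auto
    finally show ?thesis using w by simp
  next
    case False
    then have "(w - 1) * R \<le> 0" using R0 by (intro mult_nonpos_nonneg) auto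
    then show ?thesis using CM_pos by simp
  qed
  moreover note CM_ge(1)
  moreover have "w * R = (w - 1) * R + R" by (simp add: algebra_simps)
  ultimately have wR: "w * R \<le> ln (ln (real N)) - ln (ln (real P)) + (2 + 3 * CM)" using R1 CM_pos by linarith
  have "(\<Sum>q | prime q \<and> q \<le> N. ?\<eta> q / real q) = (\<Sum>q | prime q \<and> q \<le> N. if P < q then w / real q else 0)"
    by (intro sum.cong) auto
  also have "\<dots> = (\<Sum>q\<in>{q. prime q \<and> q \<le> N} \<inter> {q. P < q}. w / real q)" by (simp add: sum.If_cases)
  also have "{q. prime q \<and> q \<le> N} \<inter> {q. P < q} = {q. prime q \<and> P < q \<and> q \<le> N}" by auto
  also have "(\<Sum>q | prime q \<and> P < q \<and> q \<le> N. w / real q) = w * R"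
    by (simp add: R_def prime_recip_sum_def sum_distrib_left)
  finally have "exp (\<Sum>q | prime q \<and> q \<le> N. ?\<eta> q / real q) \<le> exp (ln (ln (real N)) - ln (ln (real P)) + (2 + 3 * CM))"
    using wR by simp
  also have "\<dots> = ln (real N) / ln (real P) * exp (2 + 3 * CM)" using lP by (simp only: exp_add exp_diff, simp)
  finally have E: "exp (\<Sum>q | prime q \<and> q \<le> N. ?\<eta> q / real q) \<le> ln (real N) / ln (real P) * exp (2 + 3 * CM)" .
  have "(1 + ln (real N)) * (\<Sum>n=1..N. strong_mult ?\<eta> n) \<le> 
           10 * exp 2 * real N * exp (\<Sum>q | prime q \<and> q \<le> N. ?\<eta> q / real q)"
    by (rule hall_bound) (use w P in auto)
  also have "\<dots> \<le> 10 * exp 2 * real N * (ln (real N) / ln (real P) * exp (2 + 3 * CM))"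
    using E by (intro mult_left_mono) auto
  also have "\<dots> = CK * real N / ln (real P) * ln (real N)" by (simp add: CK_def)
  also have "\<dots> \<le> CK * real N / ln (real P) * (1 + ln (real N))" using lP CK_pos by (intro mult_left_mono) auto
  finally have "(1 + ln (real N)) * (\<Sum>n=1..N. strong_mult ?\<eta> n) \<le> (1 + ln (real N)) * (CK * real N / ln (real P))" by (simp add: mult.commute)
  then show ?thesis using lP by (subst (asm) mult_le_cancel_left_pos) auto
qed

section \<open>Prime functions twisted by a threshold weight\<close>

lemma abel_sum:
  fixes a c :: "nat \<Rightarrow> complex"
  shows "(\<Sum>i=1..t. a i * c i) = (\<Sum>i=1..t. a i) * c t - (\<Sum>j=1..t. (\<Sum>i=1..j-1. a i) * (c j - c (j - 1)))"
  by (induction t) (auto simp: algebra_simps)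

text \<open>The weight \<open>v\<close> raised to the number of prime factors of \<open>n\<close> exceeding \<open>i\<close>.\<close>

definition vpow :: "complex \<Rightarrow> nat \<Rightarrow> nat \<Rightarrow> complex" where
  "vpow v i n = strong_mult (\<lambda>q. if i < q then v else 1) n"

lemma vpow_step:
  assumes "i \<ge> 1"
  shows "vpow v (i - 1) n = (if i \<in> prime_factors n then v else 1) * vpow v i n"
proof (cases "i \<in> prime_factors n")
  case True
  have "vpow v (i - 1) n = v * (\<Prod>q\<in>prime_factors n - {i}. if i - 1 < q then v else 1)"
    unfolding vpow_def strong_mult_def using True assms by (subst prod.remove[of _ i]) auto
  also have "(\<Prod>q\<in>prime_factors n - {i}. if i - 1 < q then v else 1) = (\<Prod>q\<in>prime_factors n - {i}. if i < q then v else 1)"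
    using assms by (intro prod.cong) auto
  also have "\<dots> = vpow v i n" 
    unfolding vpow_def strong_mult_def using True assms by (subst prod.remove[of _ i]) auto
  finally show ?thesis using True by simp
next
  case False
  have "vpow v (i - 1) n = vpow v i n" 
    unfolding vpow_def strong_mult_def
  proof (rule prod.cong [OF refl])
    fix q assume "q \<in> prime_factors n"
    then have "(i - 1 < q) = (i < q)" using False assms by (cases "q = i") auto
    then show "(if i - 1 < q then v else 1) = (if i < q then v else 1)" by simp
  qed
  then show ?thesis using False by simp
qed

lemma norm_vpow: "norm (vpow v i n) = strong_mult (\<lambda>q. if i < q then norm v else 1) n"
  unfolding vpow_def strong_mult_def prod_norm[symmetric] by (intro prod.cong) auto

lemma norm_vpow_le_1: "norm v \<le> 1 \<Longrightarrow> norm (vpow v i n) \<le> 1"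
  unfolding norm_vpow strong_mult_def by (intro prod_le_1) auto

lemma norm_vpow_mono: "norm v \<le> 1 \<Longrightarrow> i \<le> j \<Longrightarrow> norm (vpow v i n) \<le> norm (vpow v j n)"
  unfolding norm_vpow strong_mult_def by (intro prod_mono) auto

lemma vpow_prime_mult: "prime p \<Longrightarrow> n > 0 \<Longrightarrow> vpow v p (p * n) = vpow v p n"
  using prime_factors_prime_power_mult[of p n 1]
  by (cases "p \<in> prime_factors n") (auto simp: vpow_def strong_mult_def insert_absorb)

lemma sum_over_primes:
  fixes h :: "nat \<Rightarrow> 'a :: comm_monoid_add"
  assumes "\<And>p. \<not> prime p \<Longrightarrow> h p = 0"
  shows "(\<Sum>p=1..N. h p) = (\<Sum>p | prime p \<and> p \<le> N. h p)"
  by (intro sum.mono_neutral_right) (use assms in \<open>auto simp: prime_gt_0_nat Suc_le_eq\<close>)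

text \<open>Raising the threshold past \<open>p\<close> removes a factor \<open>v\<close> exactly
  when \<open>p\<close> divides \<open>n\<close>. The increments telescope between threshold 0,
  where every prime carries \<open>v\<close>, and threshold \<open>n\<close>, where none
  does.\<close>

lemma vpow_telescope:
  assumes "n > 0"
  shows "(\<Sum>p | prime p \<and> p dvd n. (1 - v) * vpow v p n) = 1 - strong_mult (\<lambda>_. v) n"
proof -
  have "(\<Sum>i=1..n. vpow v i n - vpow v (i - 1) n) = vpow v n n - vpow v 0 n"
  proof -
    have "(\<Sum>i=1..k. vpow v i n - vpow v (i - 1) n) = vpow v k n - vpow v 0 n" for k
      by (induction k) auto
    then show ?thesis .
  qed
  also have "vpow v n n = 1"
    unfolding vpow_def strong_mult_def using assms
    by (intro prod.neutral) (auto dest!: in_prime_factors_imp_dvd dvd_imp_le simp: not_less[symmetric])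
  also have "vpow v 0 n = strong_mult (\<lambda>_. v) n"
    unfolding vpow_def strong_mult_def by (intro prod.cong refl) (auto simp: prime_gt_0_nat)
  also have "(\<Sum>i=1..n. vpow v i n - vpow v (i - 1) n) = (\<Sum>i=1..n. if i \<in> prime_factors n then (1 - v) * vpow v i n else 0)"
  proof (rule sum.cong [OF refl])
    fix i assume "i \<in> {1..n}"
    then show "vpow v i n - vpow v (i - 1) n = (if i \<in> prime_factors n then (1 - v) * vpow v i n else 0)"
      using vpow_step[of i v n] by (auto simp: algebra_simps)
  qed
  also have "\<dots> = (\<Sum>i\<in>{1..n} \<inter> prime_factors n. (1 - v) * vpow v i n)"
    by (subst sum.inter_restrict) auto
  also have "{1..n} \<inter> prime_factors n = {p. prime p \<and> p dvd n}"
    using assms by (auto simp: in_prime_factors_iff prime_gt_0_nat Suc_le_eq dvd_imp_le)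
  finally show ?thesis .
qed

text \<open>Source of the main term: with a constant in place of the prime function, the double sum
  collapses by \<open>vpow_telescope\<close>. What remains is \<open>N - 1\<close> minus a mean that
  is small because \<open>v\<close> is small.\<close>

lemma sum_prime_vpow_total:
  assumes "N \<ge> 1"
  shows "(1 - v) * (\<Sum>p | prime p \<and> p \<le> N. \<Sum>n=1..N div p. vpow v p n) = 
           of_nat (N - 1) - (\<Sum>n=2..N. strong_mult (\<lambda>_. v) n)"
proof -
  have "(1 - v) * (\<Sum>p | prime p \<and> p \<le> N. \<Sum>n=1..N div p. vpow v p n) = 
        (\<Sum>p=1..N. \<Sum>n=1..N div p. if prime p then (1 - v) * vpow v p (p * n) else 0)"
  proof -
    have "(1 - v) * (\<Sum>p | prime p \<and> p \<le> N. \<Sum>n=1..N div p. vpow v p n) = 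
          (\<Sum>p | prime p \<and> p \<le> N. \<Sum>n=1..N div p. if prime p then (1 - v) * vpow v p (p * n) else 0)"
      by (simp add: sum_distrib_left vpow_prime_mult)
    also have "\<dots> = (\<Sum>p=1..N. \<Sum>n=1..N div p. if prime p then (1 - v) * vpow v p (p * n) else 0)"
      by (subst sum_over_primes) auto
    finally show ?thesis .
  qed
  also have "\<dots> = (\<Sum>n=1..N. \<Sum>p | p dvd n. if prime p then (1 - v) * vpow v p (p * (n div p)) else 0)"
    by (rule sum_divisors_swap[symmetric])
  also have "\<dots> = (\<Sum>n=1..N. 1 - strong_mult (\<lambda>_. v) n)"
  proof (rule sum.cong [OF refl])
    fix n assume n: "n \<in> {1..N}"
    have "(\<Sum>p | p dvd n. if prime p then (1 - v) * vpow v p (p * (n div p)) else 0) =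
          (\<Sum>p | prime p \<and> p dvd n. (1 - v) * vpow v p n)"
      using n by (intro sum.mono_neutral_cong_right) auto
    then show "(\<Sum>p | p dvd n. if prime p then (1 - v) * vpow v p (p * (n div p)) else 0) = 1 - strong_mult (\<lambda>_. v) n"
      using vpow_telescope[of n v] n by simp
  qed
  also have "\<dots> = (\<Sum>n=2..N. 1 - strong_mult (\<lambda>_. v) n)"
    using assms by (subst sum.atLeast_Suc_atMost) (auto simp: strong_mult_def numeral_2_eq_2)
  finally show ?thesis by (simp add: sum_subtractf)
qed

text \<open>Abel summation with the threshold as summation variable. For fixed \<open>m\<close> the
  weight jumps only at the prime factors of \<open>m\<close>, and each jump is \<open>1 - v\<close>
  times the weight itself.\<close>

lemma prime_twisted_sum_pointwise:
  fixes f :: "nat \<Rightarrow> complex"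
  defines "F \<equiv> (\<lambda>t. \<Sum>p | prime p \<and> p \<le> t. f p)"
  assumes F: "\<And>n. n \<ge> 1 \<Longrightarrow> norm (F n) \<le> C * real n / (1 + ln (real n))\<^sup>2" and C: "C \<ge> 0"
    and v: "norm v \<le> 1" 
  shows "norm (\<Sum>p | prime p \<and> p \<le> t. f p * vpow v p m) \<le> norm (F t) * norm (vpow v t m) +
           (\<Sum>j | j \<in> {1..t} \<and> j \<in> prime_factors m. 8 * C * real j / (1 + ln (real j))\<^sup>2 * norm (vpow v j m))"
proof -
  define a where "a = (\<lambda>i. if prime i then f i else 0)"
  have A: "(\<Sum>i=1..t. a i) = F t" for t
    unfolding F_def a_def by (intro sum.mono_neutral_cong_right) (auto simp: prime_gt_0_nat Suc_le_eq)
  have "(\<Sum>p | prime p \<and> p \<le> t. f p * vpow v p m) = (\<Sum>i=1..t. a i * vpow v i m)"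
    unfolding a_def by (intro sum.mono_neutral_cong_left) (auto simp: prime_gt_0_nat Suc_le_eq)
  also have "\<dots> = F t * vpow v t m - (\<Sum>j=1..t. F (j - 1) * (vpow v j m - vpow v (j - 1) m))"
    by (subst abel_sum) (simp only: A)
  also have "norm \<dots> \<le> norm (F t * vpow v t m) + norm (\<Sum>j=1..t. F (j - 1) * (vpow v j m - vpow v (j - 1) m))"
    by (rule norm_triangle_ineq4)
  also have "norm (\<Sum>j=1..t. F (j - 1) * (vpow v j m - vpow v (j - 1) m)) \<le> 
     (\<Sum>j=1..t. if j \<in> prime_factors m then 8 * C * real j / (1 + ln (real j))\<^sup>2 * norm (vpow v j m) else 0)"
  proof (rule sum_norm_le)
    fix j assume j: "j \<in> {1..t}"
    show "norm (F (j - 1) * (vpow v j m - vpow v (j - 1) m)) \<le> 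
      (if j \<in> prime_factors m then 8 * C * real j / (1 + ln (real j))\<^sup>2 * norm (vpow v j m) else 0)"
    proof (cases "j \<in> prime_factors m")
      case True
      then have "prime j" by auto
      then have j2: "j \<ge> 2" by (rule prime_ge_2_nat)
      \<comment> \<open>Abel summation evaluates \<open>F\<close> at \<open>j - 1\<close>. Returning
        to \<open>j\<close> costs 2 in the logarithm, hence 4 in its square, and
        \<open>norm (1 - v) \<le> 2\<close> makes this 8.\<close>
      have lj: "1 + ln (real j) \<le> 2 * (1 + ln (real (j - 1)))"
      proof -
        have "ln (real j) \<le> ln (2 * real (j - 1))" using j2 by (subst ln_le_cancel_iff) auto
        also have "\<dots> = ln 2 + ln (real (j - 1))" using j2 by (subst ln_mult) auto
        finally have *: "ln (real j) \<le> ln 2 + ln (real (j - 1))" .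
        define L where "L = ln (real (j - 1))"
        have "L \<ge> 0" using j2 by (simp add: L_def)
        then show ?thesis using * ln_2_less_1 unfolding L_def[symmetric] by argo
      qed
      have p1: "1 + ln (real (j - 1)) > 0" using j2 by (intro add_pos_nonneg) auto
      have p2: "1 + ln (real j) > 0" using j2 by (intro add_pos_nonneg) auto
      have "norm (F (j - 1)) \<le> C * real (j - 1) / (1 + ln (real (j - 1)))\<^sup>2" using j2 by (intro F) auto
      also have "\<dots> \<le> C * real j / (1 + ln (real (j - 1)))\<^sup>2" using C by (intro divide_right_mono mult_left_mono) auto
      also have "\<dots> \<le> C * real j / ((1 + ln (real j)) / 2)\<^sup>2"
        using lj C p1 p2 by (intro divide_left_mono power_mono) auto
      also have "\<dots> = 4 * C * real j / (1 + ln (real j))\<^sup>2" by (simp add: power_divide)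
      finally have n1: "norm (F (j - 1)) \<le> 4 * C * real j / (1 + ln (real j))\<^sup>2" .
      have "vpow v j m - vpow v (j - 1) m = (1 - v) * vpow v j m"
        using True j vpow_step[of j v m] by (simp add: algebra_simps)
      moreover have "norm (1 - v) \<le> 2" using norm_triangle_ineq4[of 1 v] v by simp
      ultimately have n2: "norm (vpow v j m - vpow v (j - 1) m) \<le> 2 * norm (vpow v j m)"
        by (simp add: norm_mult mult_right_mono)
      have "norm (F (j - 1) * (vpow v j m - vpow v (j - 1) m)) \<le> 
              4 * C * real j / (1 + ln (real j))\<^sup>2 * (2 * norm (vpow v j m))"
        unfolding norm_mult using n1 n2 C by (intro mult_mono) auto
      then show ?thesis using True by simp
    next
      case False
      then have "vpow v (j - 1) m = vpow v j m" using j vpow_step[of j v m] by simp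
      then show ?thesis using False by simp
    qed
  qed
  also have "\<dots> = (\<Sum>j | j \<in> {1..t} \<and> j \<in> prime_factors m. 8 * C * real j / (1 + ln (real j))\<^sup>2 * norm (vpow v j m))"
    by (intro sum.mono_neutral_cong_right) auto
  finally show ?thesis by (simp add: norm_mult)
qed

text \<open>Telescoping in \<open>1 / (1 + ln N - ln m)\<close>, which increases with
  \<open>m\<close>. Consecutive denominators differ by at most 1 and are at least 1, so they agree
  up to the factor 2 of the bound.\<close>

lemma sum_inverse_co_ln_square:
  assumes "1 \<le> M" "M \<le> N"
  shows "(\<Sum>m=1..M. 1 / (real m * (1 + ln (real N) - ln (real m))\<^sup>2)) \<le> 2 / (1 + ln (real N) - ln (real M))"
  using assms
proof (induction M rule: dec_induct)
  case base
  define x where "x = 1 + ln (real N)"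
  have "x \<ge> 1" using assms by (simp add: x_def)
  then have "1 / x\<^sup>2 \<le> 2 / x" by (intro frac_le) (auto simp: power2_eq_square)
  then show ?case by (simp add: x_def)
next
  case (step n)
  define x y where "x = 1 + ln (real N) - ln (real (Suc n))" and "y = 1 + ln (real N) - ln (real n)"
  have "ln (real (Suc n)) \<le> ln (real N)" using step by simp
  then have x: "x \<ge> 1" by (simp add: x_def)
  have "ln (real n / real (Suc n)) \<le> real n / real (Suc n) - 1" using step by (intro ln_le_minus_one) auto
  then have d: "y - x \<ge> 1 / real (Suc n)" using step by (simp add: x_def y_def ln_div field_simps)
  have "ln (real (Suc n) / real n) \<le> real (Suc n) / real n - 1" using step by (intro ln_le_minus_one) auto
  also have "\<dots> \<le> 1" using step by (simp add: field_simps)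
  finally have "ln (real (Suc n) / real n) \<le> 1" .
  moreover have "ln (real (Suc n) / real n) = y - x" using step by (simp add: x_def y_def ln_div del: of_nat_Suc)
  ultimately have y: "y \<le> 2 * x" using x by linarith
  have "1 / real (Suc n) \<ge> 0" by simp
  then have xy: "x \<le> y" using d by linarith
  have "y > 0" using xy x by linarith
  have "1 / (real (Suc n) * x\<^sup>2) = (1 / real (Suc n)) / x\<^sup>2" by simp
  also have "\<dots> \<le> (y - x) / x\<^sup>2" using d by (intro divide_right_mono) auto
  also have "\<dots> = 2 * ((y - x) / (x * (2 * x)))" using x by (simp add: power2_eq_square field_simps)
  also have "\<dots> \<le> 2 * ((y - x) / (x * y))" 
    using y x xy \<open>y > 0\<close> by (intro mult_left_mono divide_left_mono mult_left_mono mult_pos_pos) auto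
  also have "\<dots> = 2 / x - 2 / y" using x \<open>y > 0\<close> by (simp add: field_simps)
  finally show ?case using step by (simp add: x_def[symmetric] y_def[symmetric] del: of_nat_Suc)
qed

text \<open>The prime sum is moved inside and bounded pointwise in \<open>m\<close>. In both
  resulting sums, the boundary terms and the jumps, an auxiliary cut \<open>Q\<close> separates a
  range where the mean of the weight saves a logarithm from one where the decay of the prime sum
  alone suffices.\<close>

lemma prime_twisted_sum_bound:
  fixes f :: "nat \<Rightarrow> complex"
  assumes F: "\<And>n. n \<ge> 1 \<Longrightarrow> norm (\<Sum>p | prime p \<and> p \<le> n. f p) \<le> C * real n / (1 + ln (real n))\<^sup>2" and C: "C \<ge> 0"
    and v: "norm v \<le> 1" "norm v * ln (1 + ln (real N)) \<le> 2" 
    and Q: "Q \<ge> 1" "Q ^ 4 \<le> N"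
  shows "norm (\<Sum>p | prime p \<and> p \<le> N. f p * (\<Sum>n=1..N div p. vpow v p n)) \<le> 
           (48 * C * CK + 24 * C) * real N * ((1 + ln (real Q)) / (1 + ln (real N)) + 1 / (1 + ln (real Q)))"
proof -
  define F where "F = (\<lambda>n. \<Sum>p | prime p \<and> p \<le> n. f p)"
  define LN where "LN = 1 + ln (real N)"
  define LQ where "LQ = 1 + ln (real Q)"
  have N: "N \<ge> 1" "Q \<le> N"
    using Q by (auto intro: order_trans[OF _ Q(2)] simp: self_le_power)
  have LN: "LN \<ge> 1" using N by (simp add: LN_def)
  have LQ: "LQ \<ge> 1" using Q by (simp add: LQ_def)
  have F': "norm (F n) \<le> C * real n / (1 + ln (real n))\<^sup>2" if "n \<ge> 1" for n
    using F[OF that] by (simp add: F_def)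
  define W where "W = (\<lambda>j m. 8 * C * real j / (1 + ln (real j))\<^sup>2 * norm (vpow v j m))"
  have W0: "W j m \<ge> 0" for j m using C by (simp add: W_def)
  have "(\<Sum>p | prime p \<and> p \<le> N. f p * (\<Sum>n=1..N div p. vpow v p n)) =
        (\<Sum>p=1..N. \<Sum>m=1..N div p. if prime p then f p * vpow v p m else 0)"
    by (subst sum_over_primes) (auto simp: sum_distrib_left intro!: sum.cong)
  also have "\<dots> = (\<Sum>m=1..N. \<Sum>p=1..N div m. if prime p then f p * vpow v p m else 0)" by (rule sum_div_swap)
  also have "\<dots> = (\<Sum>m=1..N. \<Sum>p | prime p \<and> p \<le> N div m. f p * vpow v p m)"
    by (intro sum.cong refl sum.mono_neutral_cong_right) (auto simp: prime_gt_0_nat Suc_le_eq)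
  also have "norm \<dots> \<le> (\<Sum>m=1..N. norm (F (N div m)) * norm (vpow v (N div m) m) + 
      (\<Sum>j | j \<in> {1..N div m} \<and> j \<in> prime_factors m. W j m))"
    unfolding W_def F_def by (intro sum_norm_le prime_twisted_sum_pointwise F C v)
  also have "\<dots> = (\<Sum>m=1..N. norm (F (N div m)) * norm (vpow v (N div m) m)) +
      (\<Sum>m=1..N. \<Sum>j | j \<in> {1..N div m} \<and> j \<in> prime_factors m. W j m)" by (rule sum.distrib)
  also have "(\<Sum>m=1..N. norm (F (N div m)) * norm (vpow v (N div m) m)) \<le> 
       (\<Sum>m=1..N. C * real N * (norm (vpow v Q m) / real m / (1 + ln (real (N div m)))\<^sup>2)
         + (if m \<le> N div Q then C * real N * (4 / (real m * (1 + ln (real N) - ln (real m))\<^sup>2)) else 0))"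
  proof (rule sum_mono)
    fix m assume m: "m \<in> {1..N}"
    define y where "y = N div m"
    have y: "y \<ge> 1" "real y \<le> real N / real m"
      using m of_nat_div_le_of_nat[of N m, where ?'a = real] by (auto simp: y_def less_eq_div_iff_mult_less_eq)
    have y': "1 \<le> real y" using y(1) by simp
    have yp: "1 + ln (real y) > 0" using y by (intro add_pos_nonneg) auto
    have FB: "norm (F y) \<le> C * (real N / real m) / (1 + ln (real y))\<^sup>2"
      using F'[OF y(1)] y(2) C by (elim order_trans) (intro divide_right_mono mult_left_mono, auto)
    show "norm (F (N div m)) * norm (vpow v (N div m) m) \<le> C * real N * (norm (vpow v Q m) / real m / (1 + ln (real (N div m)))\<^sup>2)
         + (if m \<le> N div Q then C * real N * (4 / (real m * (1 + ln (real N) - ln (real m))\<^sup>2)) else 0)"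
    \<comment> \<open>For small \<open>m\<close> the prime sum runs far enough to supply two
      logarithms, and the weight is bounded by 1. For large \<open>m\<close> the threshold
      \<open>N div m\<close> is at most \<open>Q\<close>, so the weight is dominated by the one with
      fixed threshold \<open>Q\<close>, to which \<open>log_convolution_bound\<close>
      applies.\<close>
    proof (cases "m \<le> N div Q")
      case True
      have "ln (real y) \<ge> ln (real N) - ln (real m) - ln 2" unfolding y_def by (intro ln_div_nat_ge) (use m in auto)
      then have le: "(1 + ln (real N) - ln (real m)) / 2 \<le> 1 + ln (real y)"
        using ln_2_less_1 ln_ge_zero[of "real y", OF y'] by argo
      have pos: "1 + ln (real N) - ln (real m) > 0" 
      proof -
        have "ln (real m) \<le> ln (real N)" using m by simp
        then show ?thesis by simp
      qed
      have "norm (F y) * norm (vpow v y m) \<le> norm (F y) * 1"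
        by (intro mult_left_mono norm_vpow_le_1 v) auto
      also have "\<dots> \<le> C * (real N / real m) / (1 + ln (real y))\<^sup>2" using FB by simp
      also have "\<dots> \<le> C * (real N / real m) / ((1 + ln (real N) - ln (real m)) / 2)\<^sup>2"
        using le pos C yp by (intro divide_left_mono power_mono) auto
      also have "\<dots> = C * real N * (4 / (real m * (1 + ln (real N) - ln (real m))\<^sup>2))" by (simp add: power_divide)
      finally show ?thesis using True C unfolding y_def by (simp add: add_increasing)
    next
      case False
      then have "N < Q * m" using Q(1) by (simp add: less_eq_div_iff_mult_less_eq mult.commute)
      then have "y \<le> Q" unfolding y_def by (intro less_imp_le less_mult_imp_div_less)
      then have "norm (F y) * norm (vpow v y m) \<le> C * (real N / real m) / (1 + ln (real y))\<^sup>2 * norm (vpow v Q m)"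
        using FB v C by (intro mult_mono norm_vpow_mono) auto
      then show ?thesis using False unfolding y_def by (simp add: mult_ac)
    qed
  qed
  also have "\<dots> = C * real N * (\<Sum>m=1..N. norm (vpow v Q m) / real m / (1 + ln (real (N div m)))\<^sup>2) +
       C * real N * (\<Sum>m\<in>{1..N div Q}. 4 / (real m * (1 + ln (real N) - ln (real m))\<^sup>2))"
  proof -
    have "(\<Sum>m=1..N. if m \<le> N div Q then C * real N * (4 / (real m * (1 + ln (real N) - ln (real m))\<^sup>2)) else 0) = 
          (\<Sum>m\<in>{1..N div Q}. C * real N * (4 / (real m * (1 + ln (real N) - ln (real m))\<^sup>2)))"
      by (intro sum.mono_neutral_cong_right) (auto intro: order_trans[OF _ div_le_dividend])
    then show ?thesis by (simp only: sum.distrib sum_distrib_left)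
  qed
  also have "\<dots> \<le> C * real N * (16 * (CK * LQ) / LN) + C * real N * (8 / LQ)"
  proof (intro add_mono mult_left_mono)
    show "(\<Sum>m=1..N. norm (vpow v Q m) / real m / (1 + ln (real (N div m)))\<^sup>2) \<le> 16 * (CK * LQ) / LN"
      unfolding LN_def
    proof (rule log_convolution_bound)
      fix z assume z: "1 \<le> z" "z \<le> N"
      show "(1 + ln (real z)) * (\<Sum>a = 1..z. norm (vpow v Q a)) \<le> CK * LQ * real z"
        unfolding norm_vpow LQ_def by (rule truncated_sum_bound[where N = N]) (use v z Q in auto)
    qed (use N LQ CK_pos in auto)
    show "(\<Sum>m\<in>{1..N div Q}. 4 / (real m * (1 + ln (real N) - ln (real m))\<^sup>2)) \<le> 8 / LQ"
    proof -
      define M where "M = N div Q"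
      have M: "1 \<le> M" "M \<le> N" using N Q by (auto simp: M_def less_eq_div_iff_mult_less_eq)
      have "real M \<le> real N / real Q" unfolding M_def by (rule of_nat_div_le_of_nat)
      then have "ln (real M) \<le> ln (real N / real Q)" using M N Q by (subst ln_le_cancel_iff) auto
      then have LQ': "LQ \<le> 1 + ln (real N) - ln (real M)" using M N Q by (simp add: ln_div LQ_def)
      have "(\<Sum>m\<in>{1..M}. 4 / (real m * (1 + ln (real N) - ln (real m))\<^sup>2)) = 
              4 * (\<Sum>m\<in>{1..M}. 1 / (real m * (1 + ln (real N) - ln (real m))\<^sup>2))"
        by (simp add: sum_distrib_left)
      also have "\<dots> \<le> 4 * (2 / (1 + ln (real N) - ln (real M)))"
        by (intro mult_left_mono sum_inverse_co_ln_square M) auto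
      also have "\<dots> \<le> 4 * (2 / LQ)" using LQ LQ' by (intro mult_left_mono divide_left_mono) auto
      finally show ?thesis by (simp add: M_def)
    qed
  qed (use C in auto)
  \<comment> \<open>A jump at \<open>j\<close> needs both \<open>j dvd m\<close> and
    \<open>j * m \<le> N\<close>; with \<open>m = j * k\<close> this reads
    \<open>j * j * k \<le> N\<close>, and the weight at \<open>m\<close> equals that at
    \<open>k\<close>.\<close>
  also have "(\<Sum>m=1..N. \<Sum>j | j \<in> {1..N div m} \<and> j \<in> prime_factors m. W j m) \<le> 
        (\<Sum>m=1..N. \<Sum>j | j dvd m. if prime j \<and> j * j * (m div j) \<le> N then W j (m div j) else 0)"
  proof (rule sum_mono)
    fix m assume m: "m \<in> {1..N}"
    have "(\<Sum>j | j \<in> {1..N div m} \<and> j \<in> prime_factors m. W j m) = 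
          (\<Sum>j | j \<in> {1..N div m} \<and> j \<in> prime_factors m. if prime j \<and> j * j * (m div j) \<le> N then W j (m div j) else 0)"
    proof (rule sum.cong [OF refl])
      fix j assume "j \<in> {j. j \<in> {1..N div m} \<and> j \<in> prime_factors m}"
      then have j: "j \<le> N div m" "prime j" "j dvd m" "j \<ge> 1" by auto
      then obtain k where k: "m = j * k" by (auto elim!: dvdE)
      have "j * m \<le> N" using j(1) m by (simp add: less_eq_div_iff_mult_less_eq)
      moreover have "m div j = k" "k > 0" using k j m by auto
      moreover have "vpow v j m = vpow v j k" unfolding k by (rule vpow_prime_mult) (use j \<open>k > 0\<close> in auto)
      ultimately show "W j m = (if prime j \<and> j * j * (m div j) \<le> N then W j (m div j) else 0)"
        using j k by (simp add: W_def mult.assoc)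
    qed
    also have "\<dots> \<le> (\<Sum>j | j dvd m. if prime j \<and> j * j * (m div j) \<le> N then W j (m div j) else 0)"
      using m by (intro sum_mono2) (auto simp: W0)
    finally show "(\<Sum>j | j \<in> {1..N div m} \<and> j \<in> prime_factors m. W j m) \<le> 
        (\<Sum>j | j dvd m. if prime j \<and> j * j * (m div j) \<le> N then W j (m div j) else 0)" .
  qed
  also have "\<dots> = (\<Sum>j=1..N. \<Sum>k=1..N div j. if prime j \<and> j * j * k \<le> N then W j k else 0)"
    by (rule sum_divisors_swap[where g = "\<lambda>j k. if prime j \<and> j * j * k \<le> N then W j k else 0"])
  also have "\<dots> \<le> (\<Sum>j=1..N. if j \<le> Q then 32 * C * CK * real N / LN * (1 / real j) 
                       else 8 * C * real N * (1 / (real j * (1 + ln (real j))\<^sup>2)))"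
  proof (rule sum_mono)
    fix j assume j: "j \<in> {1..N}"
    define M where "M = N div (j * j)"
    define lj where "lj = 1 + ln (real j)"
    have lj: "lj \<ge> 1" using j by (simp add: lj_def)
    have "(\<Sum>k=1..N div j. if prime j \<and> j * j * k \<le> N then W j k else 0) \<le> (\<Sum>k=1..N div j. if k \<le> M then W j k else 0)"
      using j by (intro sum_mono) (auto simp: W0 M_def less_eq_div_iff_mult_less_eq mult_ac)
    also have "\<dots> = (\<Sum>k=1..M. W j k)"
    proof -
      have "M \<le> N div j" unfolding M_def by (simp add: div_mult2_eq div_le_dividend)
      then show ?thesis by (intro sum.mono_neutral_cong_right) auto
    qed
    also have "\<dots> = 8 * C * real j / lj\<^sup>2 * (\<Sum>k=1..M. norm (vpow v j k))"
      by (simp add: W_def lj_def sum_distrib_left)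
    finally have B: "(\<Sum>k=1..N div j. if prime j \<and> j * j * k \<le> N then W j k else 0) \<le> 8 * C * real j / lj\<^sup>2 * (\<Sum>k=1..M. norm (vpow v j k))" .
    have MN: "real M \<le> real N / (real j * real j)" 
      using of_nat_div_le_of_nat[of N "j * j", where ?'a = real] by (simp add: M_def)
    show "(\<Sum>k=1..N div j. if prime j \<and> j * j * k \<le> N then W j k else 0) \<le> 
           (if j \<le> Q then 32 * C * CK * real N / LN * (1 / real j) else 8 * C * real N * (1 / (real j * (1 + ln (real j))\<^sup>2)))"
    \<comment> \<open>For \<open>j \<le> Q\<close> the condition \<open>Q ^ 4 \<le> N\<close> keeps
      the logarithm of \<open>N / j^2\<close> comparable to \<open>ln N\<close>, so the mean of the
      weight saves it and the harmonic sum costs \<open>LQ\<close>. For \<open>j > Q\<close> the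
      trivial bound leaves the convergent tail of \<open>1 / (j (1 + ln j)^2)\<close>.\<close>
    proof (cases "j \<le> Q")
      case True
      have j4: "j ^ 4 \<le> N" using power_mono[OF True, of 4] Q(2) by (meson le_trans zero_le)
      have jj: "j * j \<le> N" 
      proof -
        have "j * j \<ge> 1" using j by simp
        then have "j * j * 1 \<le> (j * j) * (j * j)" by (intro mult_le_mono) auto
        also have "\<dots> = j ^ 4" by (simp add: power4_eq_xxxx mult.assoc)
        finally show ?thesis using j4 by simp
      qed
      have M1: "M \<ge> 1" using jj j by (simp add: M_def less_eq_div_iff_mult_less_eq)
      have "4 * ln (real j) \<le> ln (real N)"
      proof -
        have "real j ^ 4 \<le> real N" using j4 by (metis of_nat_le_iff of_nat_power)
        then have "ln (real j ^ 4) \<le> ln (real N)" using j by (subst ln_le_cancel_iff) auto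
        then show ?thesis using j by (simp add: ln_realpow)
      qed
      moreover have "ln (real M) \<ge> ln (real N) - ln (real (j * j)) - ln 2"
        unfolding M_def by (intro ln_div_nat_ge) (use j jj in auto)
      moreover have "ln (real (j * j)) = 2 * ln (real j)" using j by (simp add: ln_mult)
      moreover have "ln (real M) \<ge> 0" using M1 by simp
      ultimately have lM: "1 + ln (real M) \<ge> LN / 4" using ln_2_less_1 LN unfolding LN_def by argo
      have "(1 + ln (real M)) * (\<Sum>n=1..M. norm (vpow v j n)) \<le> CK * lj * real M"
        unfolding norm_vpow lj_def 
        by (rule truncated_sum_bound[where N = N]) (use v j M1 in \<open>auto simp: M_def\<close>)
      moreover have "LN / 4 * (\<Sum>n=1..M. norm (vpow v j n)) \<le> (1 + ln (real M)) * (\<Sum>n=1..M. norm (vpow v j n))"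
        using lM by (intro mult_right_mono sum_nonneg) auto
      moreover have "CK * lj * real M \<le> CK * lj * (real N / (real j * real j))"
        using MN CK_pos lj by (intro mult_left_mono) auto
      ultimately have S0: "LN / 4 * (\<Sum>n=1..M. norm (vpow v j n)) \<le> CK * lj * (real N / (real j * real j))" by linarith
      have S: "(\<Sum>n=1..M. norm (vpow v j n)) \<le> 4 * CK * lj * (real N / (real j * real j)) / LN"
      proof -
        have aux: "x \<le> 4 * a / LN" if "LN / 4 * x \<le> a" for x a using that LN by (simp add: field_simps)
        show ?thesis using aux[OF S0] by (simp add: mult.assoc)
      qed
      have "8 * C * real j / lj\<^sup>2 * (\<Sum>k=1..M. norm (vpow v j k)) \<le> 8 * C * real j / lj\<^sup>2 * (4 * CK * lj * (real N / (real j * real j)) / LN)"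
        using S C by (intro mult_left_mono) auto
      also have "\<dots> = 32 * C * CK * real N / LN * (1 / real j) * (1 / lj)"
        using j lj by (simp add: field_simps power2_eq_square)
      also have "\<dots> \<le> 32 * C * CK * real N / LN * (1 / real j) * 1"
        using lj C CK_pos LN by (intro mult_left_mono) auto
      finally show ?thesis using B True by simp
    next
      case False
      have "(\<Sum>k=1..M. norm (vpow v j k)) \<le> (\<Sum>k=1..M. 1)" by (intro sum_mono norm_vpow_le_1 v)
      then have "(\<Sum>k=1..M. norm (vpow v j k)) \<le> real N / (real j * real j)" using MN by simp
      then have "8 * C * real j / lj\<^sup>2 * (\<Sum>k=1..M. norm (vpow v j k)) \<le> 8 * C * real j / lj\<^sup>2 * (real N / (real j * real j))"
        using C by (intro mult_left_mono) auto
      also have "\<dots> = 8 * C * real N * (1 / (real j * lj\<^sup>2))" using j lj by (simp add: field_simps)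
      finally show ?thesis using B False by (simp add: lj_def)
    qed
  qed
  also have "\<dots> = 32 * C * CK * real N / LN * (\<Sum>j=1..Q. 1 / real j) + 
                  8 * C * real N * (\<Sum>j\<in>{Q<..N}. 1 / (real j * (1 + ln (real j))\<^sup>2))"
  proof -
    have "{1..N} = {1..Q} \<union> {Q<..N}" using N Q by auto
    then show ?thesis by (simp only:) (subst sum.union_disjoint, auto simp: sum_distrib_left)
  qed
  also have "\<dots> \<le> 32 * C * CK * real N / LN * LQ + 8 * C * real N * (1 / LQ)"
    unfolding LQ_def using Q C CK_pos LN by (intro add_mono mult_left_mono harm_le sum_inverse_ln_square) auto
  finally have "norm (\<Sum>p | prime p \<and> p \<le> N. f p * (\<Sum>n=1..N div p. vpow v p n)) \<le> 
     C * real N * (16 * (CK * LQ) / LN) + C * real N * (8 / LQ) + (32 * C * CK * real N / LN * LQ + 8 * C * real N * (1 / LQ))" by simp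
  also have "\<dots> = 48 * C * CK * real N * (LQ / LN) + 16 * C * real N * (1 / LQ)" by (simp add: field_simps)
  also have "\<dots> \<le> (48 * C * CK + 24 * C) * real N * (LQ / LN) + (48 * C * CK + 24 * C) * real N * (1 / LQ)"
    using C CK_pos LN LQ by (intro add_mono mult_right_mono) auto
  finally show ?thesis by (simp add: LN_def LQ_def distrib_left)
qed

section \<open>The uniform weighted estimate\<close>

lemma strong_mult_complement:
  fixes v :: complex
  shows "strong_mult (\<lambda>q. 1 - (if p < q then 1 - v else 0)) n = vpow v p n"
  unfolding vpow_def strong_mult_def by (intro prod.cong) auto

text \<open>\<open>harm_sum_mu_strong_mult\<close> exchanges the weight \<open>1 - v\<close> for
  \<open>v\<close> at the primes above \<open>p\<close>. The mean of that weight saves one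
  logarithm, and the decay of \<open>mu_harm\<close> lets the saving pass through the
  convolution.\<close>

lemma small_prime_inner_sum:
  fixes v :: complex
  assumes M: "\<And>n. n \<ge> 1 \<Longrightarrow> norm (mu_harm n) \<le> C / (1 + ln (real n))\<^sup>2" and C: "C \<ge> 0"
    and v: "norm v \<le> 1" "norm v * ln (1 + ln (real N)) \<le> 2" and Y: "1 \<le> Y" "Y \<le> N" and p: "p \<ge> 1"
  shows "norm (\<Sum>m=1..Y. mu m * strong_mult (\<lambda>q. if p < q then 1 - v else 0) m / of_nat m) \<le> 
            16 * C * CK * (1 + ln (real p)) / (1 + ln (real Y))"
proof -
  have "(\<Sum>m=1..Y. mu m * strong_mult (\<lambda>q. if p < q then 1 - v else 0) m / of_nat m) =
        (\<Sum>a=1..Y. vpow v p a / of_nat a * mu_harm (Y div a))"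
    unfolding harm_sum_mu_strong_mult strong_mult_complement ..
  also have "norm \<dots> \<le> (\<Sum>a=1..Y. C * (norm (vpow v p a) / real a / (1 + ln (real (Y div a)))\<^sup>2))"
  proof (rule sum_norm_le)
    fix a assume a: "a \<in> {1..Y}"
    then have "Y div a \<ge> 1" by (simp add: less_eq_div_iff_mult_less_eq)
    then have "norm (vpow v p a / of_nat a * mu_harm (Y div a)) \<le> norm (vpow v p a) / real a * (C / (1 + ln (real (Y div a)))\<^sup>2)"
      unfolding norm_mult norm_divide norm_of_nat by (intro mult_left_mono M) auto
    then show "norm (vpow v p a / of_nat a * mu_harm (Y div a)) \<le> C * (norm (vpow v p a) / real a / (1 + ln (real (Y div a)))\<^sup>2)"
      by (simp add: mult.commute)
  qed
  also have "\<dots> = C * (\<Sum>a=1..Y. norm (vpow v p a) / real a / (1 + ln (real (Y div a)))\<^sup>2)"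
    by (rule sum_distrib_left[symmetric])
  also have "\<dots> \<le> C * (16 * (CK * (1 + ln (real p))) / (1 + ln (real Y)))"
  proof (intro mult_left_mono log_convolution_bound C)
    fix z assume z: "1 \<le> z" "z \<le> Y"
    show "(1 + ln (real z)) * (\<Sum>a = 1..z. norm (vpow v p a)) \<le> CK * (1 + ln (real p)) * real z"
      unfolding norm_vpow by (rule truncated_sum_bound[where N = N]) (use v z Y p in auto)
  qed (use Y p CK_pos in auto)
  finally show ?thesis by (simp add: mult_ac)
qed

lemma vpow_sum_bound:
  assumes v: "norm v \<le> 1" "norm v * ln (1 + ln (real N)) \<le> 2" and Y: "1 \<le> Y" "Y \<le> N" and p: "p \<ge> 1"
  shows "norm (\<Sum>n=1..Y. vpow v p n) \<le> CK * (1 + ln (real p)) * real Y / (1 + ln (real Y))"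
proof -
  have "norm (\<Sum>n=1..Y. vpow v p n) \<le> (\<Sum>n=1..Y. norm (vpow v p n))" by (rule norm_sum)
  moreover have "(1 + ln (real Y)) * (\<Sum>n=1..Y. norm (vpow v p n)) \<le> CK * (1 + ln (real p)) * real Y"
    unfolding norm_vpow by (rule truncated_sum_bound[where N = N]) (use v Y p in auto)
  moreover have "1 + ln (real Y) > 0" using Y by (intro add_pos_nonneg) auto
  ultimately have "(\<Sum>n=1..Y. norm (vpow v p n)) \<le> CK * (1 + ln (real p)) * real Y / (1 + ln (real Y))"
    by (subst pos_le_divide_eq) (simp_all add: mult.commute)
  then show ?thesis using norm_sum[of "vpow v p" "{1..Y}"] by linarith
qed

lemma sum_prime_log_over_p:
  assumes "P \<ge> 1"
  shows "(\<Sum>p | prime p \<and> p \<le> P. (1 + ln (real p)) / real p) \<le> 3 * (ln (real P) + 4)"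
proof -
  have "(\<Sum>p | prime p \<and> p \<le> P. (1 + ln (real p)) / real p) \<le> (\<Sum>p | prime p \<and> p \<le> P. 3 * (mangoldt p / real p))"
  proof (intro sum_mono)
    fix p assume "p \<in> {p. prime p \<and> p \<le> P}"
    then have p: "prime p" "p \<ge> 2" by (auto intro: prime_ge_2_nat)
    have "ln 2 \<le> ln (real p)" using p by simp
    moreover have "ln 2 > (1/2::real)" using ln2_ge_two_thirds by linarith
    ultimately have "1 + ln (real p) \<le> 3 * ln (real p)" by linarith
    then show "(1 + ln (real p)) / real p \<le> 3 * (mangoldt p / real p)"
      using p by (simp add: divide_right_mono)
  qed
  also have "\<dots> = 3 * (\<Sum>p | prime p \<and> p \<le> P. mangoldt p / real p)" by (simp add: sum_distrib_left)
  also have "(\<Sum>p | prime p \<and> p \<le> P. mangoldt p / real p) \<le> (\<Sum>n=1..P. mangoldt n / real n)"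
    by (intro sum_mono2) (auto simp: mangoldt_nonneg prime_gt_0_nat Suc_le_eq)
  also have "\<dots> \<le> ln (real P) + 4" using sum_mangoldt_over_n_bounds[OF assms] by (simp add: abs_le_iff)
  finally show ?thesis by simp
qed

lemma rough_squarefree_weight:
  assumes "p \<ge> 1"
  shows "mu m * strong_mult (\<lambda>q. if p < q then z else 0) m = (if rough_squarefree p m then mu m * z ^ omega m else 0)"
proof (cases "rough_squarefree p m")
  case True
  then have "strong_mult (\<lambda>q. if p < q then z else 0) m = (\<Prod>q\<in>prime_factors m. z)"
    unfolding strong_mult_def rough_squarefree_def by (intro prod.cong) auto
  then show ?thesis using True by (simp add: omega_def)
next
  case False
  then consider "\<not> squarefree m" | q where "q \<in> prime_factors m" "\<not> p < q" by (auto simp: rough_squarefree_def)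
  then show ?thesis
  proof cases
    case 1 then show ?thesis by (auto simp: moebius_mu_def)
  next
    case 2
    then have "strong_mult (\<lambda>q. if p < q then z else 0) m = 0" unfolding strong_mult_def by (auto intro!: bexI[of _ q])
    then show ?thesis using False by simp
  qed
qed

lemma mu_omega_prime_mult:
  assumes "prime p" "rough_squarefree p m"
  shows "mu (p * m) = - mu m" "omega (p * m) = Suc (omega m)"
proof -
  have m: "m > 0" "squarefree m" "p \<notin> prime_factors m" using assms by (auto simp: rough_squarefree_def intro!: Nat.gr0I)
  show om: "omega (p * m) = Suc (omega m)"
    using prime_factors_prime_power_mult[of p m 1] assms m by (simp add: omega_def)
  have "coprime p m" using m assms(1) by (intro prime_imp_coprime) (auto simp: in_prime_factors_iff)
  then have "squarefree (p * m)" using m assms(1) by (intro squarefree_mult_coprime) (auto simp: squarefree_prime)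
  then show "mu (p * m) = - mu m" using m om by (simp add: moebius_mu_def)
qed

text \<open>Each \<open>d\<close> is written as \<open>p * m\<close> with \<open>p\<close> its least
  prime factor. For small \<open>p\<close> the inner sum over \<open>m\<close> is small already. For
  large \<open>p\<close> the real quotient \<open>N / (p * m)\<close> is replaced by its integer
  part, which turns the inner sum into the mean \<open>T p\<close>. Then \<open>f\<close> is
  replaced by \<delta>, and \<open>sum_prime_vpow_total\<close> evaluates what is left.\<close>

lemma main_estimate:
  fixes f :: "nat \<Rightarrow> complex"
  assumes M: "\<And>n. n \<ge> 1 \<Longrightarrow> norm (mu_harm n) \<le> C1 / (1 + ln (real n))\<^sup>2"
    and f: "\<And>p. norm (f p) \<le> 1" and \<delta>: "norm \<delta> \<le> 1"
    and F: "\<And>n. n \<ge> 1 \<Longrightarrow> norm (\<Sum>p | prime p \<and> p \<le> n. f p - \<delta>) \<le> C2 * real n / (1 + ln (real n))\<^sup>2"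
  shows "\<exists>K. \<forall>N v. ln (real N) \<ge> 16 \<and> norm v \<le> 1 \<and> norm v * ln (1 + ln (real N)) \<le> 2 \<longrightarrow>
     norm ((\<Sum>d=2..N. mu d * (1 - v) ^ omega d * f (least_prime_factor d) / of_nat d) + \<delta>) \<le> K / sqrt (ln (real N))"
proof -
  have C1: "C1 \<ge> 0" using M[of 1] norm_ge_zero[of "mu_harm 1"] by (simp del: norm_ge_zero)
  have C2: "C2 \<ge> 0" using F[of 1] norm_ge_zero[of "\<Sum>p | prime p \<and> p \<le> 1. f p - \<delta>"] by (simp del: norm_ge_zero)
  \<comment> \<open>Twice the constants of \<open>E1\<close>, \<open>E2\<close>, \<open>E3\<close>,
    because \<open>norm z \<le> 2\<close>, then those of \<open>E4\<close> and \<open>E5\<close>;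
    the final 2 is for additive constants, absorbed by \<open>1 \<le> N / s\<close>.\<close>
  define K0 where "K0 = 384 * C1 * CK + 24 * CK + 6 * (48 * C2 * CK + 24 * C2) + 3 * CK + 2"
  have K: "norm ((\<Sum>d=2..N. mu d * (1 - v) ^ omega d * f (least_prime_factor d) / of_nat d) + \<delta>) \<le> K0 / sqrt (ln (real N))"
    if N16: "ln (real N) \<ge> 16" and v: "norm v \<le> 1" "norm v * ln (1 + ln (real N)) \<le> 2" for N v
  proof -
    define L where "L = ln (real N)"
    define s where "s = sqrt L"
    \<comment> \<open>With \<open>ln P\<close> close to \<open>s\<close>, the cost
      \<open>ln P / L\<close> of small primes and the cost \<open>1 / ln P\<close> of large ones are
      both of size \<open>1 / s\<close>. The condition \<open>L \<ge> 16\<close> gives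
      \<open>s \<ge> 4\<close> and so \<open>P ^ 4 \<le> N\<close>.\<close>
    define P where "P = nat \<lfloor>exp s\<rfloor>"
    define z where "z = 1 - v"
    have N1: "N \<ge> 2" using N16 by (cases "N = 0 \<or> N = 1") auto
    have s: "s \<ge> 4" "s * s = L" using N16 real_le_rsqrt[of 4 L] by (auto simp: s_def L_def)
    have expL: "exp L = real N" using N1 by (simp add: L_def)
    have Pexp: "real P \<le> exp s" "exp s < real P + 1"
    proof -
      have "real P = of_int \<lfloor>exp s\<rfloor>" by (simp add: P_def)
      then show "real P \<le> exp s" "exp s < real P + 1" by linarith+
    qed
    have "exp s \<ge> 1 + s" by (rule exp_ge_add_one_self)
    then have P3: "real P \<ge> 4" using Pexp s by linarith
    then have P2: "P \<ge> 2" by linarith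
    have lP: "ln (real P) \<le> s" using Pexp(1) P3 by (metis exp_le_cancel_iff exp_ln less_le_trans zero_less_numeral)
    have lP2: "ln (real P) \<ge> s - 1"
    proof -
      have "exp s \<le> 2 * real P" using Pexp P3 by linarith
      then have "ln (exp s) \<le> ln (2 * real P)" using P3 by (subst ln_le_cancel_iff) auto
      then show ?thesis using P3 ln_2_less_1 by (simp add: ln_mult)
    qed
    have lP3: "ln (real P) \<ge> s / 2" using lP2 s by linarith
    have P4N: "P ^ 4 \<le> N"
    proof -
      have "real P ^ 4 \<le> exp s ^ 4" using Pexp by (intro power_mono) auto
      also have "\<dots> = exp (4 * s)" by (simp add: exp_of_nat_mult[symmetric])
      also have "\<dots> \<le> exp L" using s mult_right_mono[of 4 s s] by simp
      finally show ?thesis unfolding expL by (metis of_nat_le_iff of_nat_power)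
    qed
    have PN: "P \<le> N" using P4N P2 by (meson le_trans less_imp_le self_le_power zero_less_numeral order_trans one_le_numeral)
    have z2: "norm z \<le> 2" unfolding z_def using norm_triangle_ineq4[of 1 v] v by simp
    define B where "B = (\<lambda>p m. mu m * strong_mult (\<lambda>q. if p < q then z else 0) m)"
    define J where "J = (\<lambda>p. \<Sum>m=1..N div p. B p m / of_nat m)"
    define T where "T = (\<lambda>p. \<Sum>n=1..N div p. vpow v p n)"
    \<comment> \<open>Rounding error: at most 1 for each cofactor \<open>m\<close>, by the identity
      \<open>Tp\<close> below. It is used only for \<open>p > P\<close>, where the cofactors have no
      prime up to \<open>P\<close> and are therefore few.\<close>
    define R where "R = (\<lambda>p. of_nat N / of_nat p * J p - T p)"
    have Tp: "T p = (\<Sum>m=1..N div p. B p m * of_nat (N div p div m))" for p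
      unfolding T_def B_def z_def strong_mult_complement[symmetric] by (rule sum_strong_mult_eq)
    have S: "of_nat N * (\<Sum>d=2..N. mu d * z ^ omega d * f (least_prime_factor d) / of_nat d) =
             - z * (\<Sum>p | prime p \<and> p \<le> N. f p * (of_nat N / of_nat p * J p))"
    proof -
      have "(\<Sum>d=2..N. mu d * z ^ omega d * f (least_prime_factor d) / of_nat d) =
            (\<Sum>d | d \<in> {2..N} \<and> squarefree d. mu d * z ^ omega d * f (least_prime_factor d) / of_nat d)"
        by (intro sum.mono_neutral_right) (auto simp: moebius_mu_def)
      also have "\<dots> = (\<Sum>d | d \<in> {2..N} \<and> squarefree d. (\<lambda>p m. mu (p * m) * z ^ omega (p * m) * f p / of_nat (p * m)) 
                        (least_prime_factor d) (d div least_prime_factor d))"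
        by (intro sum.cong) (auto simp: least_prime_factor_props)
      also have "\<dots> = (\<Sum>p | prime p \<and> p \<le> N. \<Sum>m | m \<in> {1..N div p} \<and> rough_squarefree p m. mu (p * m) * z ^ omega (p * m) * f p / of_nat (p * m))"
        by (rule sum_by_least_prime_factor)
      also have "\<dots> = (\<Sum>p | prime p \<and> p \<le> N. - z * f p / of_nat p * J p)"
      proof (rule sum.cong [OF refl])
        fix p assume "p \<in> {p. prime p \<and> p \<le> N}"
        then have p: "prime p" "p \<ge> 1" by (auto simp: prime_gt_0_nat Suc_le_eq)
        have "(\<Sum>m | m \<in> {1..N div p} \<and> rough_squarefree p m. mu (p * m) * z ^ omega (p * m) * f p / of_nat (p * m)) =
              (\<Sum>m\<in>{1..N div p}. - z * f p / of_nat p * (B p m / of_nat m))"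
          by (intro sum.mono_neutral_cong_left)
             (auto simp: B_def rough_squarefree_weight[OF p(2)] mu_omega_prime_mult[OF p(1)])
        then show "(\<Sum>m | m \<in> {1..N div p} \<and> rough_squarefree p m. mu (p * m) * z ^ omega (p * m) * f p / of_nat (p * m)) =
              - z * f p / of_nat p * J p" by (simp add: J_def sum_distrib_left)
      qed
      finally show ?thesis by (simp add: sum_distrib_left mult_ac)
    qed
    have split: "{p. prime p \<and> p \<le> N} = {p. prime p \<and> p \<le> P} \<union> {p. prime p \<and> P < p \<and> p \<le> N}" using PN by auto
    have splitsum: "sum h {p. prime p \<and> p \<le> N} = sum h {p. prime p \<and> p \<le> P} + sum h {p. prime p \<and> P < p \<and> p \<le> N}" 
      for h :: "nat \<Rightarrow> complex" unfolding split by (intro sum.union_disjoint) auto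
    define E1 where "E1 = (\<Sum>p | prime p \<and> p \<le> P. f p * (of_nat N / of_nat p * J p))"
    define E2 where "E2 = (\<Sum>p | prime p \<and> p \<le> P. f p * T p)"
    define E3 where "E3 = (\<Sum>p | prime p \<and> p \<le> N. (f p - \<delta>) * T p)"
    define E4 where "E4 = (\<Sum>p | prime p \<and> P < p \<and> p \<le> N. f p * R p)"
    define E5 where "E5 = (\<Sum>n=2..N. strong_mult (\<lambda>_. v) n)"
    \<comment> \<open>\<open>T\<close> is subtracted on the small primes (\<open>E2\<close>) so that
      the sum of \<open>T\<close> can run over all primes, as the exact evaluation \<open>zT\<close>
      requires.\<close>
    have sp: "(\<Sum>p | prime p \<and> p \<le> N. f p * (of_nat N / of_nat p * J p)) = E1 - E2 + E4 + E3 + \<delta> * (\<Sum>p | prime p \<and> p \<le> N. T p)"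
    proof -
      have "E4 = (\<Sum>p | prime p \<and> P < p \<and> p \<le> N. f p * (of_nat N / of_nat p * J p)) - (\<Sum>p | prime p \<and> P < p \<and> p \<le> N. f p * T p)"
        unfolding E4_def R_def by (simp add: right_diff_distrib sum_subtractf)
      moreover have "E3 = (\<Sum>p | prime p \<and> p \<le> N. f p * T p) - \<delta> * (\<Sum>p | prime p \<and> p \<le> N. T p)"
        unfolding E3_def by (simp add: left_diff_distrib sum_subtractf sum_distrib_left)
      ultimately show ?thesis unfolding E1_def E2_def by (simp add: splitsum)
    qed
    have zT: "z * (\<Sum>p | prime p \<and> p \<le> N. T p) = of_nat (N - 1) - E5"
      unfolding z_def T_def E5_def using N1 by (intro sum_prime_vpow_total) auto
    have main: "of_nat N * ((\<Sum>d=2..N. mu d * z ^ omega d * f (least_prime_factor d) / of_nat d) + \<delta>) = 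
       - z * (E1 - E2 + E4 + E3) + \<delta> * (1 + E5)"
    proof -
      have "of_nat N * ((\<Sum>d=2..N. mu d * z ^ omega d * f (least_prime_factor d) / of_nat d) + \<delta>) = 
          - z * (E1 - E2 + E4 + E3) - \<delta> * (z * (\<Sum>p | prime p \<and> p \<le> N. T p)) + of_nat N * \<delta>"
        unfolding distrib_left S sp by (simp add: algebra_simps)
      also have "\<dots> = - z * (E1 - E2 + E4 + E3) + \<delta> * (1 + E5)"
        unfolding zT using N1 by (simp add: algebra_simps of_nat_diff)
      finally show ?thesis .
    qed
    have smallp: "1 \<le> N div p" "N div p \<le> N" "1 + ln (real (N div p)) \<ge> L / 2" "p \<ge> 1" if p: "prime p" "p \<le> P" for p
    proof -
      show p1: "p \<ge> 1" using p by (simp add: prime_gt_0_nat Suc_le_eq)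
      show "1 \<le> N div p" "N div p \<le> N" using p p1 PN by (auto simp: less_eq_div_iff_mult_less_eq)
      have "ln (real p) \<le> ln (real P)" using p p1 by simp
      moreover have "ln (real (N div p)) \<ge> ln (real N) - ln (real p) - ln 2" by (intro ln_div_nat_ge) (use p p1 PN in auto)
      moreover have "s \<le> L / 4" using s mult_right_mono[of 4 s s] by simp
      ultimately show "1 + ln (real (N div p)) \<ge> L / 2" using lP ln_2_less_1 s unfolding L_def[symmetric] by linarith
    qed
    have Lpos: "L > 0" using N16 by (simp add: L_def)
    have sumP: "(\<Sum>p | prime p \<and> p \<le> P. (1 + ln (real p)) / real p) \<le> 6 * s"
    proof -
      have "3 * (ln (real P) + 4) \<le> 6 * s" using lP s(1) by simp
      then show ?thesis using sum_prime_log_over_p[of P] P2 by linarith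
    qed
    have sL: "s / L = 1 / s" using s Lpos by (simp add: field_simps)
    have E1: "norm E1 \<le> real N * (32 * C1 * CK * 6) / s"
    proof -
      have "norm E1 \<le> (\<Sum>p | prime p \<and> p \<le> P. real N * (32 * C1 * CK) / L * ((1 + ln (real p)) / real p))"
        unfolding E1_def
      proof (rule sum_norm_le)
        fix p assume "p \<in> {p. prime p \<and> p \<le> P}"
        then have p: "prime p" "p \<le> P" by auto
        note sm = smallp[OF p]
        have "norm (J p) \<le> 16 * C1 * CK * (1 + ln (real p)) / (1 + ln (real (N div p)))"
          unfolding J_def B_def z_def by (rule small_prime_inner_sum[OF M C1 v sm(1,2,4)])
        also have "\<dots> \<le> 16 * C1 * CK * (1 + ln (real p)) / (L / 2)"
          using sm C1 CK_pos Lpos by (intro divide_left_mono mult_nonneg_nonneg) auto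
        finally have "norm (J p) \<le> 32 * C1 * CK * (1 + ln (real p)) / L" by simp
        then have "1 * (real N / real p * norm (J p)) \<le> 1 * (real N / real p * (32 * C1 * CK * (1 + ln (real p)) / L))"
          by (intro mult_left_mono) auto
        moreover have "norm (f p) * (real N / real p * norm (J p)) \<le> 1 * (real N / real p * norm (J p))"
          by (intro mult_right_mono f) auto
        ultimately show "norm (f p * (of_nat N / of_nat p * J p)) \<le> real N * (32 * C1 * CK) / L * ((1 + ln (real p)) / real p)"
          by (simp add: norm_mult norm_divide mult_ac)
      qed
      also have "\<dots> = real N * (32 * C1 * CK) / L * (\<Sum>p | prime p \<and> p \<le> P. (1 + ln (real p)) / real p)"
        by (rule sum_distrib_left[symmetric])
      also have "\<dots> \<le> real N * (32 * C1 * CK) / L * (6 * s)" using sumP C1 CK_pos Lpos by (intro mult_left_mono) auto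
      also have "\<dots> = real N * (32 * C1 * CK * 6) * (s / L)" by simp
      finally show ?thesis unfolding sL by simp
    qed
    have E2: "norm E2 \<le> real N * (2 * CK * 6) / s"
    proof -
      have "norm E2 \<le> (\<Sum>p | prime p \<and> p \<le> P. real N * (2 * CK) / L * ((1 + ln (real p)) / real p))"
        unfolding E2_def
      proof (rule sum_norm_le)
        fix p assume "p \<in> {p. prime p \<and> p \<le> P}"
        then have p: "prime p" "p \<le> P" by auto
        note sm = smallp[OF p]
        have "norm (T p) \<le> CK * (1 + ln (real p)) * real (N div p) / (1 + ln (real (N div p)))"
          unfolding T_def by (rule vpow_sum_bound[OF v sm(1,2,4)])
        also have "\<dots> \<le> CK * (1 + ln (real p)) * real (N div p) / (L / 2)"
          using sm CK_pos Lpos by (intro divide_left_mono mult_nonneg_nonneg) auto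
        also have "\<dots> \<le> CK * (1 + ln (real p)) * (real N / real p) / (L / 2)"
          using sm CK_pos Lpos by (intro divide_right_mono mult_left_mono mult_nonneg_nonneg of_nat_div_le_of_nat) auto
        finally have "norm (T p) \<le> CK * (1 + ln (real p)) * (real N / real p) / (L / 2)" .
        moreover have "norm (f p) * norm (T p) \<le> 1 * norm (T p)" by (intro mult_right_mono f) auto
        ultimately show "norm (f p * T p) \<le> real N * (2 * CK) / L * ((1 + ln (real p)) / real p)"
          by (simp add: norm_mult mult_ac)
      qed
      also have "\<dots> = real N * (2 * CK) / L * (\<Sum>p | prime p \<and> p \<le> P. (1 + ln (real p)) / real p)"
        by (rule sum_distrib_left[symmetric])
      also have "\<dots> \<le> real N * (2 * CK) / L * (6 * s)" using sumP CK_pos Lpos by (intro mult_left_mono) auto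
      also have "\<dots> = real N * (2 * CK * 6) * (s / L)" by simp
      finally show ?thesis unfolding sL by simp
    qed
    have E3: "norm E3 \<le> real N * (3 * (48 * C2 * CK + 24 * C2)) / s"
    proof -
      have "norm E3 \<le> (48 * C2 * CK + 24 * C2) * real N * ((1 + ln (real P)) / (1 + ln (real N)) + 1 / (1 + ln (real P)))"
        unfolding E3_def T_def using P2 P4N by (intro prime_twisted_sum_bound F C2 v) auto
      also have "\<dots> \<le> (48 * C2 * CK + 24 * C2) * real N * (2 * s / L + 1 / s)"
      proof (intro mult_left_mono add_mono)
        show "(1 + ln (real P)) / (1 + ln (real N)) \<le> 2 * s / L"
          using lP s Lpos P2 unfolding L_def[symmetric] by (intro frac_le) auto
        show "1 / (1 + ln (real P)) \<le> 1 / s" using lP2 s by (intro divide_left_mono) auto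
      qed (use C2 CK_pos in auto)
      also have "2 * s / L + 1 / s = 3 / s" using sL by simp
      finally show ?thesis by (simp add: mult_ac)
    qed
    have E4: "norm z * norm E4 \<le> real N * (2 * CK) / s"
    proof -
      \<comment> \<open>The factor \<open>norm z\<close> in front supplies the missing weight of the
        least prime itself, so the double sum over \<open>(p, m)\<close> becomes a single sieve sum
        of \<open>b\<close> over squarefree \<open>d\<close>.\<close>
      define b where "b = (\<lambda>m. strong_mult (\<lambda>q. if P < q then norm z else 0) m)"
      have b0: "b m \<ge> 0" for m unfolding b_def by (intro strong_mult_nonneg) auto
      have "norm E4 \<le> (\<Sum>p | prime p \<and> P < p \<and> p \<le> N. \<Sum>m\<in>{1..N div p}. norm (B p m))"
        unfolding E4_def
      proof (rule sum_norm_le)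
        fix p assume "p \<in> {p. prime p \<and> P < p \<and> p \<le> N}"
        then have p: "prime p" "p \<ge> 1" by (auto simp: prime_gt_0_nat Suc_le_eq)
        have "R p = (\<Sum>m=1..N div p. B p m * (of_nat N / of_nat p / of_nat m - of_nat (N div p div m)))"
          unfolding R_def Tp J_def by (simp add: sum_distrib_left right_diff_distrib sum_subtractf mult_ac)
        also have "norm \<dots> \<le> (\<Sum>m=1..N div p. norm (B p m))"
        proof (rule sum_norm_le)
          fix m assume m: "m \<in> {1..N div p}"
          have e: "(of_nat N / of_nat p / of_nat m - of_nat (N div p div m) :: complex) = 
                     of_real (real N / real (p * m) - real (N div (p * m)))"
            by (simp add: div_mult2_eq)
          have "norm (of_nat N / of_nat p / of_nat m - of_nat (N div p div m) :: complex) \<le> 1"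
            unfolding e norm_of_real using real_div_less[of N "p * m"] of_nat_div_le_of_nat[of N "p * m", where ?'a = real] by linarith
          then show "norm (B p m * (of_nat N / of_nat p / of_nat m - of_nat (N div p div m))) \<le> norm (B p m)"
            unfolding norm_mult by (intro mult_left_le) auto
        qed
        finally have "norm (R p) \<le> (\<Sum>m=1..N div p. norm (B p m))" .
        moreover have "norm (f p) * norm (R p) \<le> 1 * norm (R p)" by (intro mult_right_mono f) auto
        ultimately show "norm (f p * R p) \<le> (\<Sum>m\<in>{1..N div p}. norm (B p m))" by (simp add: norm_mult)
      qed
      then have "norm z * norm E4 \<le> norm z * (\<Sum>p | prime p \<and> P < p \<and> p \<le> N. \<Sum>m\<in>{1..N div p}. norm (B p m))"
        by (intro mult_left_mono) auto
      also have "\<dots> = (\<Sum>p | prime p \<and> P < p \<and> p \<le> N. \<Sum>m | m \<in> {1..N div p} \<and> rough_squarefree p m. b (p * m))"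
        unfolding sum_distrib_left
      proof (rule sum.cong [OF refl])
        fix p assume p: "p \<in> {p. prime p \<and> P < p \<and> p \<le> N}" 
        then have p1: "p \<ge> 1" by auto
        show "(\<Sum>m\<in>{1..N div p}. norm z * norm (B p m)) = (\<Sum>m | m \<in> {1..N div p} \<and> rough_squarefree p m. b (p * m))"
        proof (rule sum.mono_neutral_cong_right)
          fix m assume "m \<in> {m \<in> {1..N div p}. rough_squarefree p m}"
          then have m: "m \<ge> 1" "rough_squarefree p m" by auto
          have "b (p * m) = norm z ^ omega (p * m)"
          proof -
            have "prime_factors (p * m) = insert p (prime_factors m)"
              using prime_factors_prime_power_mult[of p m 1] p m by simp
            then have "strong_mult (\<lambda>q. if P < q then norm z else 0) (p * m) = (\<Prod>q\<in>prime_factors (p * m). norm z)"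
              unfolding strong_mult_def using p m by (intro prod.cong refl) (auto simp: rough_squarefree_def)
            then show ?thesis by (simp add: b_def omega_def)
          qed
          moreover have "norm (mu m) = 1" using m by (simp add: moebius_mu_def rough_squarefree_def norm_power)
          ultimately show "norm z * norm (B p m) = b (p * m)"
            using mu_omega_prime_mult(2)[of p m] p m unfolding B_def rough_squarefree_weight[OF p1]
            by (simp add: norm_mult norm_power)
        next
          show "\<forall>m\<in>{1..N div p} - {m \<in> {1..N div p}. rough_squarefree p m}. norm z * norm (B p m) = 0"
            unfolding B_def rough_squarefree_weight[OF p1] by simp
        qed auto
      qed
      also have "\<dots> \<le> (\<Sum>p | prime p \<and> p \<le> N. \<Sum>m | m \<in> {1..N div p} \<and> rough_squarefree p m. b (p * m))"
        by (intro sum_mono2 sum_nonneg) (auto simp: b0)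
      also have "\<dots> = (\<Sum>d | d \<in> {2..N} \<and> squarefree d. (\<lambda>p m. b (p * m)) (least_prime_factor d) (d div least_prime_factor d))"
        by (rule sum_by_least_prime_factor[symmetric])
      also have "\<dots> = (\<Sum>d | d \<in> {2..N} \<and> squarefree d. b d)" 
        by (intro sum.cong) (auto simp: least_prime_factor_props)
      also have "\<dots> \<le> (\<Sum>d=1..N. b d)" by (intro sum_mono2) (auto simp: b0)
      also have "\<dots> \<le> CK * real N / ln (real P)" unfolding b_def
      proof (rule rough_sum_bound)
        have "norm z - 1 \<le> norm v" unfolding z_def using norm_triangle_ineq4[of 1 v] by simp
        then have "(norm z - 1) * ln (1 + ln (real N)) \<le> norm v * ln (1 + ln (real N))"
          using N1 by (intro mult_right_mono) auto
        then show "(norm z - 1) * ln (1 + ln (real N)) \<le> 2" using v by simp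
      qed (use z2 P2 PN in auto)
      also have "\<dots> \<le> CK * real N / (s / 2)" using lP3 s CK_pos by (intro divide_left_mono) auto
      finally show ?thesis by (simp add: mult_ac)
    qed
    have E5: "norm E5 \<le> real N * CK / s + 1"
    proof -
      \<comment> \<open>Threshold 1 lies below every prime, so this is the full strongly
        multiplicative sum, including the term \<open>n = 1\<close> that \<open>E5\<close>
        omits.\<close>
      have "norm (\<Sum>n=1..N. vpow v 1 n) \<le> CK * (1 + ln (real 1)) * real N / (1 + ln (real N))"
        using v N1 by (intro vpow_sum_bound) auto
      moreover have "E5 = (\<Sum>n=1..N. vpow v 1 n) - 1"
      proof -
        have "vpow v 1 n = strong_mult (\<lambda>_. v) n" for n unfolding vpow_def strong_mult_def
          by (intro prod.cong refl) (auto dest!: in_prime_factors_imp_prime prime_gt_1_nat)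
        then have "(\<Sum>n=1..N. vpow v 1 n) = strong_mult (\<lambda>_. v) 1 + E5"
          unfolding E5_def using N1 by (subst sum.atLeast_Suc_atMost) (auto simp: numeral_2_eq_2)
        then show ?thesis by (simp add: strong_mult_def)
      qed
      moreover have "CK * (1 + ln (real 1)) * real N / (1 + ln (real N)) \<le> CK * (1 + ln (real 1)) * real N / s"
      proof -
        have "s \<le> 1 + ln (real N)" using s mult_right_mono[of 1 s s] unfolding L_def[symmetric] by simp
        then show ?thesis using s CK_pos by (intro divide_left_mono) auto
      qed
      ultimately show ?thesis using norm_triangle_ineq4[of "\<Sum>n=1..N. vpow v 1 n" 1] by (simp add: mult.commute)
    qed
    have "real N \<ge> s"
    proof -
      have "s \<le> s * s" using s(1) mult_right_mono[of 1 s s] by simp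
      also have "\<dots> \<le> exp L" unfolding s(2) using exp_ge_add_one_self[of L] by linarith
      finally show ?thesis by (simp add: expL)
    qed
    then have Ns: "1 \<le> real N / s" using s by simp
    have n0: "norm (- z * (E1 - E2 + E4 + E3) + \<delta> * (1 + E5)) \<le> norm (z * (E1 - E2 + E4 + E3)) + norm (\<delta> * (1 + E5))"
      using norm_triangle_ineq[of "- z * (E1 - E2 + E4 + E3)" "\<delta> * (1 + E5)"] by simp
    have n1: "norm (\<delta> * (1 + E5)) \<le> 1 + norm E5"
      unfolding norm_mult using mult_mono[OF \<delta>, of "norm (1 + E5)" "1 + norm E5"] norm_triangle_ineq[of 1 E5] by simp
    have "z * (E1 - E2 + E4 + E3) = z * E1 - z * E2 + z * E3 + z * E4" by (simp add: algebra_simps)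
    also have "norm \<dots> \<le> norm (z * E1) + norm (z * E2) + norm (z * E3) + norm (z * E4)"
      by (intro order_trans[OF norm_triangle_ineq] add_mono order_trans[OF norm_triangle_ineq4] order_refl)
    also have "\<dots> \<le> 2 * norm E1 + 2 * norm E2 + 2 * norm E3 + real N * (2 * CK) / s"
      using z2 E4 unfolding norm_mult by (intro add_mono mult_right_mono) auto
    finally have n2: "norm (z * (E1 - E2 + E4 + E3)) \<le> 2 * norm E1 + 2 * norm E2 + 2 * norm E3 + real N * (2 * CK) / s" .
    have "norm (- z * (E1 - E2 + E4 + E3) + \<delta> * (1 + E5)) \<le> 
       2 * (real N * (32 * C1 * CK * 6) / s) + 2 * (real N * (2 * CK * 6) / s) + 2 * (real N * (3 * (48 * C2 * CK + 24 * C2)) / s)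
         + real N * (2 * CK) / s + (real N * CK / s + 2)"
      using E1 E2 E3 E5 n0 n1 n2 by linarith
    also have "\<dots> \<le> 2 * (real N * (32 * C1 * CK * 6) / s) + 2 * (real N * (2 * CK * 6) / s) + 2 * (real N * (3 * (48 * C2 * CK + 24 * C2)) / s)
         + real N * (2 * CK) / s + (real N * CK / s + 2 * (real N / s))" using Ns by linarith
    also have "\<dots> = real N * (K0 / s)" unfolding K0_def using s(1) by (simp add: field_simps)
    finally have "real N * norm ((\<Sum>d=2..N. mu d * z ^ omega d * f (least_prime_factor d) / of_nat d) + \<delta>) \<le> real N * (K0 / s)"
      unfolding main[symmetric] norm_mult norm_of_nat .
    then have "norm ((\<Sum>d=2..N. mu d * z ^ omega d * f (least_prime_factor d) / of_nat d) + \<delta>) \<le> K0 / s"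
      by (rule mult_left_le_imp_le) (use N1 in auto)
    then show ?thesis unfolding z_def s_def L_def .
  qed
  show ?thesis by (intro exI[of _ K0] allI impI) (use K in blast)
qed

section \<open>A quantitative Tauberian theorem\<close>

lemma gaussian_fourier:
  assumes h: "h > 0"
  shows "integrable lborel (\<lambda>t. normal_density 0 (1 / h) t * exp (\<i> * complex_of_real (t * w)))"
    and "(LINT t|lborel. normal_density 0 (1 / h) t * exp (\<i> * complex_of_real (t * w))) = complex_of_real (exp (- ((w / h)\<^sup>2 / 2)))"
proof -
  have "integrable lborel (\<lambda>t. complex_of_real (normal_density 0 (1 / h) t))"
    by (intro integrable_of_real integrable_normal_density) (use h in auto)
  then show 1: "integrable lborel (\<lambda>t. normal_density 0 (1 / h) t * exp (\<i> * complex_of_real (t * w)))"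
    by (rule Bochner_Integration.integrable_bound) (auto simp: norm_mult)
  have "char std_normal_distribution (w / h) = (LINT x|lborel. std_normal_density x *\<^sub>R exp (\<i> * complex_of_real ((w / h) * x)))"
    unfolding char_def by (subst integral_density) (auto simp: normal_density_nonneg)
  also have "\<dots> = \<bar>h\<bar> *\<^sub>R (LINT t|lborel. std_normal_density (0 + h * t) *\<^sub>R exp (\<i> * complex_of_real ((w / h) * (0 + h * t))))"
    by (rule lborel_integral_real_affine) (use h in auto)
  also have "\<dots> = (LINT t|lborel. h *\<^sub>R (std_normal_density (0 + h * t) *\<^sub>R exp (\<i> * complex_of_real ((w / h) * (0 + h * t)))))"
    using h by (simp only: integral_scaleR_right abs_of_pos)
  also have "\<dots> = (LINT t|lborel. normal_density 0 (1 / h) t * exp (\<i> * complex_of_real (t * w)))"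
  proof (rule Bochner_Integration.integral_cong [OF refl])
    fix t :: real
    have "h * std_normal_density (h * t) = normal_density 0 (1 / h) t"
      using h by (simp add: normal_density_def real_sqrt_divide power_mult_distrib power_divide field_simps)
    then show "h *\<^sub>R (std_normal_density (0 + h * t) *\<^sub>R exp (\<i> * complex_of_real ((w / h) * (0 + h * t)))) = 
      normal_density 0 (1 / h) t * exp (\<i> * complex_of_real (t * w))"
      using h by (simp add: scaleR_conv_of_real mult.commute flip: of_real_mult)
  qed
  finally show "(LINT t|lborel. normal_density 0 (1 / h) t * exp (\<i> * complex_of_real (t * w))) = complex_of_real (exp (- ((w / h)\<^sup>2 / 2)))"
    by (simp add: char_std_normal_distribution exp_of_real)
qed

text \<open>Parseval's formula for a Gaussian, by Fubini: damping the Fourier transform at frequency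
  scale \<open>1/h\<close> is averaging the function around \<open>v\<close> at scale
  \<open>h\<close>.\<close>

lemma gaussian_smoothing:
  fixes b :: "real \<Rightarrow> complex"
  assumes b: "integrable lborel b" and h: "h > 0"
  shows "(LINT t|lborel. normal_density 0 (1 / h) t * exp (\<i> * of_real (t * v)) * (LINT u|lborel. b u * exp (- \<i> * of_real (t * u))))
       = sqrt (2 * pi) * h * (LINT u|lborel. normal_density v h u * b u)" (is "?L = _")
proof -
  define g where "g = (\<lambda>t u. complex_of_real (normal_density 0 (1 / h) t) * exp (\<i> * of_real (t * (v - u))) * b u)"
  have [measurable]: "b \<in> borel_measurable borel" using b by auto
  have nd: "integrable lborel (\<lambda>t. normal_density 0 (1 / h) t)" using h by auto
  have gm: "case_prod g \<in> borel_measurable (lborel \<Otimes>\<^sub>M lborel)" unfolding g_def by measurable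
  have ng: "norm (g t u) = normal_density 0 (1 / h) t * norm (b u)" for t u
    by (simp add: g_def norm_mult)
  have gi: "integrable lborel (g t)" for t
  proof -
    have "integrable lborel (\<lambda>u. normal_density 0 (1 / h) t * norm (b u))" using b by auto
    then show ?thesis by (rule Bochner_Integration.integrable_bound) (auto simp: ng, auto simp: g_def)
  qed
  have gint: "integrable (lborel \<Otimes>\<^sub>M lborel) (case_prod g)"
  proof (rule lborel_pair.Fubini_integrable[OF gm])
    show "integrable lborel (\<lambda>x. \<integral> y. norm (case (x, y) of (x, xa) \<Rightarrow> g x xa) \<partial>lborel)"
      using nd by (simp add: ng)
    show "AE x in lborel. integrable lborel (\<lambda>y. case (x, y) of (x, xa) \<Rightarrow> g x xa)" using gi by simp
  qed
  have "?L = (LINT t|lborel. LINT u|lborel. g t u)"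
  proof (rule Bochner_Integration.integral_cong [OF refl])
    fix t :: real
    have "(LINT u|lborel. g t u) = (LINT u|lborel. (normal_density 0 (1 / h) t * exp (\<i> * of_real (t * v))) * (b u * exp (- \<i> * of_real (t * u))))"
      by (rule Bochner_Integration.integral_cong) (auto simp: g_def exp_add[symmetric] right_diff_distrib exp_diff exp_minus field_simps)
    then show "normal_density 0 (1 / h) t * exp (\<i> * of_real (t * v)) * (LINT u|lborel. b u * exp (- \<i> * of_real (t * u))) = (LINT u|lborel. g t u)"
      by simp
  qed
  also have "\<dots> = (LINT u|lborel. LINT t|lborel. g t u)"
    using lborel_pair.Fubini_integral[OF gint] by simp
  also have "\<dots> = (LINT u|lborel. complex_of_real (sqrt (2 * pi) * h) * (normal_density v h u * b u))"
  proof (rule Bochner_Integration.integral_cong [OF refl])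
    fix u :: real
    have "(LINT t|lborel. g t u) = (LINT t|lborel. normal_density 0 (1 / h) t * exp (\<i> * of_real (t * (v - u)))) * b u"
      unfolding g_def by (rule integral_mult_left_zero)
    also have "\<dots> = complex_of_real (exp (- (((v - u) / h)\<^sup>2 / 2))) * b u" 
      by (subst gaussian_fourier(2)[OF h]) simp
    also have "exp (- (((v - u) / h)\<^sup>2 / 2)) = sqrt (2 * pi) * h * normal_density v h u"
      using h by (simp add: normal_density_def real_sqrt_mult power_divide power2_commute)
    finally show "(LINT t|lborel. g t u) = complex_of_real (sqrt (2 * pi) * h) * (normal_density v h u * b u)" by simp
  qed
  also have "\<dots> = complex_of_real (sqrt (2 * pi) * h) * (LINT u|lborel. normal_density v h u * b u)"
    by (rule integral_mult_right_zero)
  finally show ?thesis by simp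
qed

lemma normal_density_mean_abs:
  assumes "h > 0"
  shows "integrable lborel (\<lambda>u. normal_density v h u * \<bar>u - v\<bar>)" "(LINT u|lborel. normal_density v h u * \<bar>u - v\<bar>) \<le> h"
proof -
  show "integrable lborel (\<lambda>u. normal_density v h u * \<bar>u - v\<bar>)"
    using integrable_normal_moment_abs[OF assms, of v 1] by simp
  have "(LINT u|lborel. normal_density v h u * \<bar>u - v\<bar>) = h * sqrt (2 / pi)"
    using integral_normal_moment_abs_odd[OF assms, of v 0] by simp
  moreover have "sqrt (2 / pi) \<le> 1" using pi_ge_two by simp
  ultimately show "(LINT u|lborel. normal_density v h u * \<bar>u - v\<bar>) \<le> h"
    using mult_left_mono[of "sqrt (2 / pi)" 1 h] assms by simp
qed

text \<open>Markov's inequality with the eighth moment, whose constant is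
  \<open>1 * 3 * 5 * 7 = 105\<close>. The eighth power is enough to beat the factor of size
  \<open>v ^ 5\<close> that the Tauberian argument puts in front of this tail.\<close>

lemma normal_density_tail:
  assumes "h > 0" "T > 0"
  shows "integrable lborel (\<lambda>t. normal_density 0 (1 / h) t * indicator {t. \<bar>t\<bar> > T} t)"
    "(LINT t|lborel. normal_density 0 (1 / h) t * indicator {t. \<bar>t\<bar> > T} t) \<le> 105 / (h * T) ^ 8"
proof -
  have I1: "integrable lborel (\<lambda>t. normal_density 0 (1 / h) t)" using assms by auto
  then show I: "integrable lborel (\<lambda>t. normal_density 0 (1 / h) t * indicator {t. \<bar>t\<bar> > T} t)"
    by (rule Bochner_Integration.integrable_bound) (auto simp: indicator_def)
  have M: "has_bochner_integral lborel (\<lambda>x. normal_density 0 (1 / h) x * (x - 0) ^ (2 * 4)) (fact (2 * 4) / ((2 / (1 / h)\<^sup>2)^4 * fact 4))"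
    by (rule normal_moment_even) (use assms in auto)
  have fct: "fact (2 * 4) / ((2 / (1 / h)\<^sup>2)^4 * fact 4) = 105 / h ^ 8"
    by (simp add: fact_numeral power_mult_distrib power_divide power_mult[symmetric] field_simps)
  have "(LINT t|lborel. normal_density 0 (1 / h) t * indicator {t. \<bar>t\<bar> > T} t) \<le> (LINT t|lborel. (normal_density 0 (1 / h) t * (t - 0) ^ (2 * 4)) / T ^ 8)"
  proof (rule integral_mono[OF I])
    show "integrable lborel (\<lambda>t. (normal_density 0 (1 / h) t * (t - 0) ^ (2 * 4)) / T ^ 8)"
      using M by (intro integrable_divide_zero) (auto simp: has_bochner_integral_iff)
    fix t :: real
    show "normal_density 0 (1 / h) t * indicator {t. \<bar>t\<bar> > T} t \<le> (normal_density 0 (1 / h) t * (t - 0) ^ (2 * 4)) / T ^ 8"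
    proof (cases "\<bar>t\<bar> > T")
      case True
      then have "T ^ 8 \<le> \<bar>t\<bar> ^ 8" using assms by (intro power_mono) auto
      then have "1 \<le> t ^ 8 / T ^ 8" using assms by (simp add: power_even_abs)
      then show ?thesis using True mult_left_mono[of 1 "t ^ 8 / T ^ 8" "normal_density 0 (1 / h) t"] by simp
    qed auto
  qed
  also have "\<dots> = (LINT t|lborel. normal_density 0 (1 / h) t * (t - 0) ^ (2 * 4)) / T ^ 8" by (rule integral_divide_zero)
  also have "\<dots> = 105 / h ^ 8 / T ^ 8" unfolding has_bochner_integral_integral_eq[OF M] fct ..
  finally show "(LINT t|lborel. normal_density 0 (1 / h) t * indicator {t. \<bar>t\<bar> > T} t) \<le> 105 / (h * T) ^ 8"
    by (simp add: power_mult_distrib)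
qed

lemma exp_indicator_integral:
  fixes a c :: real
  assumes a: "a > 0"
  shows "has_bochner_integral lborel (\<lambda>u. indicator {c..} u * exp (- (a * u))) (exp (- (a * c)) / a)"
proof -
  have "has_bochner_integral lborel (\<lambda>x. x ^ 0 * exp (- x) * indicator {0 ..} x :: real) (fact 0)"
    by (rule has_bochner_integral_I0i_power_exp_m')
  then have "has_bochner_integral lborel (\<lambda>x. indicator {0 ..} x * exp (- x) :: real) 1" by (simp add: mult.commute)
  then have "has_bochner_integral lborel (\<lambda>u. indicator {0 ..} (- a * c + a * u) * exp (- (- a * c + a * u)) :: real) (1 /\<^sub>R \<bar>a\<bar>)"
    using a by (subst (asm) lborel_has_bochner_integral_real_affine_iff[where c = a and t = "- a * c"]) auto
  then have "has_bochner_integral lborel (\<lambda>u. exp (- (a * c)) * (indicator {0 ..} (- a * c + a * u) * exp (- (- a * c + a * u))) :: real) (exp (- (a * c)) * (1 /\<^sub>R \<bar>a\<bar>))"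
    by (rule has_bochner_integral_mult_right)
  also have "(\<lambda>u. exp (- (a * c)) * (indicator {0 ..} (- a * c + a * u) * exp (- (- a * c + a * u))) :: real) = (\<lambda>u. indicator {c..} u * exp (- (a * u)))"
    using a by (intro ext) (auto simp: indicator_def exp_add[symmetric] field_simps)
  finally show ?thesis using a by (simp add: divide_inverse)
qed

section \<open>Contour shift and the pointwise Tauberian bound\<close>

lemma linear_exp_le:
  fixes u v :: real
  assumes "u \<ge> 0" "v \<ge> 1"
  shows "(1 + u) * exp (- (u / v)) \<le> (1 + 2 * v) * exp (- (1 / (2 * v) * u))"
proof -
  define x where "x = u / (2 * v)"
  have x: "x \<ge> 0" "u = 2 * v * x" using assms by (auto simp: x_def)
  have "1 + u \<le> (1 + 2 * v) * exp x"
  proof -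
    have "exp x \<ge> 1 + x" by (rule exp_ge_add_one_self)
    then have "(1 + 2 * v) * (1 + x) \<le> (1 + 2 * v) * exp x" using assms by (intro mult_left_mono) auto
    moreover have "1 + u \<le> (1 + 2 * v) * (1 + x)" using x assms by (simp add: algebra_simps)
    ultimately show ?thesis by linarith
  qed
  then have "(1 + u) * exp (- (u / v)) \<le> (1 + 2 * v) * exp x * exp (- (u / v))" by (intro mult_right_mono) auto
  also have "\<dots> = (1 + 2 * v) * exp (- (1 / (2 * v) * u))" using assms by (simp add: x_def exp_add[symmetric] field_simps)
  finally show ?thesis .
qed

text \<open>Shifting the contour from \<open>x1\<close> to \<open>x0\<close> without path integrals:
  an open rectangle is convex, so \<open>Q\<close> has a primitive there. The integral is the
  difference of the primitive at two corners, and going round the other three sides bounds it by the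
  mean value inequality.\<close>

lemma vertical_integral_bound:
  fixes Q :: "complex \<Rightarrow> complex"
  assumes hol: "Q holomorphic_on {s. a < Re s \<and> Re s < b \<and> \<bar>Im s\<bar> < T'}"
    and T: "0 < T" "T < T'" and a: "a < x0" "x0 < x1" "x1 < b"
    and left: "\<And>s. Re s = x0 \<Longrightarrow> \<bar>Im s\<bar> \<le> T \<Longrightarrow> norm (Q s) \<le> M1"
    and hor: "\<And>s. x0 \<le> Re s \<Longrightarrow> Re s \<le> x1 \<Longrightarrow> \<bar>Im s\<bar> = T \<Longrightarrow> norm (Q s) \<le> M2"
  obtains I where "((\<lambda>t. Q (Complex x1 t)) has_integral I) {-T..T}" "norm I \<le> M1 * (2 * T) + 2 * (M2 * (x1 - x0))"
proof -
  define S where "S = {s. a < Re s \<and> Re s < b \<and> \<bar>Im s\<bar> < T'}"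
  have S_eq: "S = box (Complex a (- T')) (Complex b T')" by (auto simp: S_def box_def Basis_complex_def)
  have "convex S" "open S" unfolding S_eq by auto
  then obtain P where P: "\<And>x. x \<in> S \<Longrightarrow> (P has_field_derivative Q x) (at x within S)"
    using holomorphic_convex_primitive'[of S Q] hol unfolding S_def by blast
  have hz: "norm (P (Complex x1 y) - P (Complex x0 y)) \<le> M2 * (x1 - x0)" if y: "\<bar>y\<bar> = T" for y
  proof -
    define H where "H = cbox (Complex x0 y) (Complex x1 y)"
    have H: "H \<subseteq> S" using y a T by (auto simp: H_def S_def cbox_def Basis_complex_def)
    have Hc: "convex H" unfolding H_def by (rule convex_box)
    have "norm (P (Complex x1 y) - P (Complex x0 y)) \<le> M2 * norm (Complex x1 y - Complex x0 y)"
    proof (rule field_differentiable_bound[OF Hc])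
      fix z assume z: "z \<in> H"
      then show "(P has_field_derivative Q z) (at z within H)" using P H by (meson has_field_derivative_subset subsetD)
      show "norm (Q z) \<le> M2" using z y by (intro hor) (auto simp: H_def cbox_def Basis_complex_def)
    qed (use a in \<open>auto simp: H_def cbox_def Basis_complex_def\<close>)
    also have "norm (Complex x1 y - Complex x0 y) = x1 - x0" using a by (simp add: complex_norm cmod_def)
    finally show ?thesis .
  qed
  have vt: "norm (P (Complex x0 T) - P (Complex x0 (- T))) \<le> M1 * (2 * T)"
  proof -
    define H where "H = cbox (Complex x0 (- T)) (Complex x0 T)"
    have H: "H \<subseteq> S" using a T by (auto simp: H_def S_def cbox_def Basis_complex_def)
    have Hc: "convex H" unfolding H_def by (rule convex_box)
    have "norm (P (Complex x0 T) - P (Complex x0 (- T))) \<le> M1 * norm (Complex x0 T - Complex x0 (- T))"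
    proof (rule field_differentiable_bound[OF Hc])
      fix z assume z: "z \<in> H"
      then show "(P has_field_derivative Q z) (at z within H)" using P H by (meson has_field_derivative_subset subsetD)
      show "norm (Q z) \<le> M1" using z by (intro left) (auto simp: H_def cbox_def Basis_complex_def)
    qed (use T in \<open>auto simp: H_def cbox_def Basis_complex_def\<close>)
    also have "norm (Complex x0 T - Complex x0 (- T)) = 2 * T" using T by (simp add: cmod_def real_sqrt_mult)
    finally show ?thesis .
  qed
  have "((\<lambda>t. \<i> * Q (Complex x1 t)) has_integral (P (Complex x1 T) - P (Complex x1 (- T)))) {-T..T}"
  proof (rule fundamental_theorem_of_calculus)
    fix t assume t: "t \<in> {-T..T}"
    then have "Complex x1 t \<in> S" using a T by (auto simp: S_def)
    then have "(P has_field_derivative Q (Complex x1 t)) (at (Complex x1 t))" using P \<open>open S\<close> by (metis at_within_open)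
    moreover have "((\<lambda>t. Complex x1 t) has_vector_derivative \<i>) (at t within {-T..T})"
    proof -
      have "((\<lambda>t. complex_of_real x1 + of_real t * \<i>) has_vector_derivative \<i>) (at t within {-T..T})"
        by (auto intro!: derivative_eq_intros)
      then show ?thesis by (simp add: Complex_eq mult.commute)
    qed
    ultimately have "((P \<circ> (\<lambda>t. Complex x1 t)) has_vector_derivative \<i> * Q (Complex x1 t)) (at t within {-T..T})"
      by (rule field_vector_diff_chain_within[OF _ has_field_derivative_at_within, rotated])
    then show "((\<lambda>t. P (Complex x1 t)) has_vector_derivative \<i> * Q (Complex x1 t)) (at t within {-T..T})" by (simp add: o_def)
  qed (use T in auto)
  then have "((\<lambda>t. - \<i> * (\<i> * Q (Complex x1 t))) has_integral - \<i> * (P (Complex x1 T) - P (Complex x1 (- T)))) {-T..T}"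
    by (rule has_integral_mult_right)
  then have "((\<lambda>t. Q (Complex x1 t)) has_integral - \<i> * (P (Complex x1 T) - P (Complex x1 (- T)))) {-T..T}"
    by (simp add: mult.assoc[symmetric])
  moreover have "norm (- \<i> * (P (Complex x1 T) - P (Complex x1 (- T)))) \<le> M1 * (2 * T) + 2 * (M2 * (x1 - x0))"
  proof -
    have e: "P (Complex x1 T) - P (Complex x1 (- T)) = (P (Complex x1 T) - P (Complex x0 T)) + 
        (P (Complex x0 T) - P (Complex x0 (- T))) - (P (Complex x1 (- T)) - P (Complex x0 (- T)))" by simp
    have "norm (P (Complex x1 T) - P (Complex x1 (- T))) \<le> norm (P (Complex x1 T) - P (Complex x0 T)) + 
        norm (P (Complex x0 T) - P (Complex x0 (- T))) + norm (P (Complex x1 (- T)) - P (Complex x0 (- T)))"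
      unfolding e by (intro order_trans[OF norm_triangle_ineq4] add_mono norm_triangle_ineq order_refl)
    then show ?thesis using hz[of T] hz[of "- T"] vt T by (simp add: norm_mult)
  qed
  ultimately show ?thesis by (rule that)
qed

text \<open>Coordinates are centred at the edge of absolute convergence: a point \<open>s\<close>
  here stands for \<open>1 + s\<close> in the Dirichlet series.\<close>

definition zregion :: "real \<Rightarrow> nat \<Rightarrow> real \<Rightarrow> complex set" where
  "zregion c \<kappa> T = {s. - (c / ln T ^ \<kappa>) < Re s \<and> Re s < 1 \<and> \<bar>Im s\<bar> < T}"

text \<open>The error terms of \<open>tauberian_pointwise\<close> written out. In the first bracket:
  the Gaussian tail beyond height \<open>v ^ 4\<close>, the shifted vertical edge, the two
  horizontal edges; the factor \<open>v ^ 3\<close> undoes the smoothing width. The last summand is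
  the variation of the function inside the smoothing window. The shifted edge beats every power of
  \<open>v\<close>, as \<open>v / (ln v)^10\<close> outgrows \<open>ln v\<close>.\<close>

definition tauber_bound :: "real \<Rightarrow> real \<Rightarrow> real \<Rightarrow> real \<Rightarrow> real" where
  "tauber_bound C K c v = 
     (105 * (1 + 2 * v) * (2 * v) * C / v ^ 8 + 
      K * ln (2 * v ^ 4) ^ 10 * exp 2 * (exp (- (c / (2 * ln (2 * v ^ 4) ^ 10)) * v) * (2 * v ^ 4) + 2 * (exp (- v\<^sup>2 / 2) * 2))) * v ^ 3
     + 3 * C * (1 + v) * (1 / v ^ 3 + exp (- v / 2))"

lemma tauber_bound_bigo:
  assumes "c > 0" "K > 0" "C > 0"
  shows "tauber_bound C K c \<in> O(\<lambda>v. 1 / v ^ 2)"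
  using assms unfolding tauber_bound_def by real_asymp

text \<open>Damping \<open>B\<close> by \<open>exp (- (u / v))\<close> makes it integrable and costs
  only the factor \<open>exp 1\<close> at \<open>u = v\<close>. The Fourier transform of the damped
  function is \<Phi> on the line \<open>Re s = 1 / v\<close>. The Gaussian average at
  \<open>v\<close> is computed by moving that line to the left of 0, and the Lipschitz hypothesis
  recovers the value from the average.\<close>

lemma tauberian_pointwise:
  fixes B \<Phi> :: "_ \<Rightarrow> complex"
  assumes meas: "B \<in> borel_measurable borel" and B0: "\<And>u. u < 0 \<Longrightarrow> B u = 0"
    and bnd: "\<And>u. u \<ge> 0 \<Longrightarrow> norm (B u) \<le> C * (1 + u)"
    and lip: "\<And>u v. 0 \<le> u \<Longrightarrow> 0 \<le> v \<Longrightarrow> norm (B u - B v) \<le> C * (1 + u + v) * (\<bar>u - v\<bar> + exp (- min u v))"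
    and lap: "\<And>s. Re s > 0 \<Longrightarrow> (LINT u|lborel. B u * exp (- (s * of_real u))) = \<Phi> s"
    and hol: "\<And>T. T \<ge> 3 \<Longrightarrow> \<Phi> holomorphic_on zregion c 10 T"
    and bnd\<Phi>: "\<And>T s. T \<ge> 3 \<Longrightarrow> s \<in> zregion c 10 T \<Longrightarrow> norm (\<Phi> s) \<le> K * ln T ^ 10"
    and pos: "c > 0" "c \<le> 1" "K > 0" "C > 0" and v: "v \<ge> 3"
  shows "norm (B v) \<le> exp 1 * tauber_bound C K c v"
proof -
  \<comment> \<open>With width \<open>1 / v^3\<close> the Lipschitz loss, of size
    \<open>v * h\<close>, is \<open>O(1 / v^2)\<close>. The height \<open>T = v^4\<close> gives
    \<open>h * T = v\<close>, so the frequency Gaussian is cut off at \<open>v\<close> standard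
    deviations.\<close>
  define h where "h = 1 / v ^ 3"
  define \<sigma> where "\<sigma> = 1 / v"
  define T where "T = v ^ 4"
  define G0 where "G0 = C * (1 + 2 * v) * (2 * v)"
  define b where "b = (\<lambda>u. B u * complex_of_real (exp (- (u / v))))"
  have h: "h > 0" "h \<le> 1" using v one_le_power[of v 3] by (auto simp: h_def)
  have \<sigma>: "\<sigma> > 0" "\<sigma> < 1" using v by (auto simp: \<sigma>_def)
  have hT: "h * T = v" using v by (simp add: h_def T_def field_simps eval_nat_numeral)
  have T3: "T \<ge> 3" using v self_le_power[of v 4] unfolding T_def by linarith
  note [measurable] = meas
  have [measurable]: "b \<in> borel_measurable borel" unfolding b_def by measurable
  have nb: "norm (b u) \<le> C * (1 + 2 * v) * (indicator {0..} u * exp (- (1 / (2 * v) * u)))" for u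
  proof (cases "u \<ge> 0")
    case True
    have "norm (b u) = norm (B u) * exp (- (u / v))" by (simp add: b_def norm_mult)
    also have "\<dots> \<le> C * (1 + u) * exp (- (u / v))" using bnd[OF True] by (intro mult_right_mono) auto
    also have "\<dots> = C * ((1 + u) * exp (- (u / v)))" by simp
    also have "\<dots> \<le> C * ((1 + 2 * v) * exp (- (1 / (2 * v) * u)))"
      using True v pos by (intro mult_left_mono linear_exp_le) auto
    finally show ?thesis using True by simp
  qed (simp add: b_def B0)
  have dom: "has_bochner_integral lborel (\<lambda>u. C * (1 + 2 * v) * (indicator {0..} u * exp (- (1 / (2 * v) * u)))) G0"
  proof -
    have "has_bochner_integral lborel (\<lambda>u. indicator {0..} u * exp (- (1 / (2 * v) * u))) (exp (- (1 / (2 * v) * 0)) / (1 / (2 * v)))"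
      by (rule exp_indicator_integral) (use v in auto)
    then have "has_bochner_integral lborel (\<lambda>u. indicator {0..} u * exp (- (1 / (2 * v) * u))) (2 * v)" by simp
    from has_bochner_integral_mult_right[OF this, of "C * (1 + 2 * v)"] show ?thesis by (simp add: G0_def)
  qed
  then have dint: "integrable lborel (\<lambda>u. C * (1 + 2 * v) * (indicator {0..} u * exp (- (1 / (2 * v) * u))))"
    by (simp add: has_bochner_integral_iff)
  have bint: "integrable lborel b"
    by (rule Bochner_Integration.integrable_bound[OF dint]) (use order_trans[OF nb abs_ge_self] in auto)
  define g where "g = (\<lambda>t::real. LINT u|lborel. b u * exp (- \<i> * of_real (t * u)))"
  have g\<Phi>: "g t = \<Phi> (Complex \<sigma> t)" for t
  proof -
    have "g t = (LINT u|lborel. B u * exp (- (Complex \<sigma> t * of_real u)))" unfolding g_def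
      by (rule Bochner_Integration.integral_cong)
         (auto simp: b_def \<sigma>_def Complex_eq exp_add[symmetric] exp_of_real[symmetric] algebra_simps)
    then show ?thesis using lap[of "Complex \<sigma> t"] \<sigma> by simp
  qed
  have gb: "norm (g t) \<le> G0" for t
  proof -
    have "norm (g t) \<le> (LINT u|lborel. C * (1 + 2 * v) * (indicator {0..} u * exp (- (1 / (2 * v) * u))))"
      unfolding g_def by (rule Bochner_Integration.integral_norm_bound_integral)
        (use dint nb bint in \<open>auto simp: norm_mult intro: Bochner_Integration.integrable_bound[OF bint]\<close>)
    then show ?thesis using dom by (simp add: has_bochner_integral_iff)
  qed
  have G0: "G0 \<ge> 0" using gb[of 0] norm_ge_zero[of "g 0"] by linarith
  have [measurable]: "g \<in> borel_measurable borel" unfolding g_def by measurable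
  define nd where "nd = (\<lambda>t. normal_density 0 (1 / h) t)"
  define F where "F = (\<lambda>t. nd t * exp (\<i> * of_real (t * v)) * g t)"
  have ndint: "integrable lborel nd" unfolding nd_def using h by auto
  have nF: "norm (F t) \<le> nd t * G0" for t
    unfolding F_def using gb[of t] by (auto simp: norm_mult nd_def intro: mult_left_mono)
  have [measurable]: "nd \<in> borel_measurable borel" unfolding nd_def by measurable
  have [measurable]: "F \<in> borel_measurable borel" unfolding F_def by measurable
  have Fint: "integrable lborel F"
    by (rule Bochner_Integration.integrable_bound[of _ "\<lambda>t. nd t * G0"]) (use ndint nF order_trans[OF nF abs_ge_self] in auto)
  have smooth: "integral\<^sup>L lborel F = sqrt (2 * pi) * h * (LINT u|lborel. normal_density v h u * b u)"
    using gaussian_smoothing[OF bint h(1), of v] unfolding F_def nd_def g_def .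
  have split: "integral\<^sup>L lborel F = (LINT t:{-T..T}|lborel. F t) + (LINT t|lborel. indicator {t. \<bar>t\<bar> > T} t *\<^sub>R F t)"
  proof -
    have "F t = indicator {-T..T} t *\<^sub>R F t + indicator {t. \<bar>t\<bar> > T} t *\<^sub>R F t" for t
      by (auto simp: indicator_def)
    then have "integral\<^sup>L lborel F = (LINT t|lborel. indicator {-T..T} t *\<^sub>R F t + indicator {t. \<bar>t\<bar> > T} t *\<^sub>R F t)" by simp
    also have "\<dots> = (LINT t:{-T..T}|lborel. F t) + (LINT t|lborel. indicator {t. \<bar>t\<bar> > T} t *\<^sub>R F t)"
      unfolding set_lebesgue_integral_def by (intro Bochner_Integration.integral_add integrable_mult_indicator Fint) auto
    finally show ?thesis .
  qed
  have tail: "norm (LINT t|lborel. indicator {t. \<bar>t\<bar> > T} t *\<^sub>R F t) \<le> G0 * 105 / v ^ 8"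
  proof -
    have "norm (LINT t|lborel. indicator {t. \<bar>t\<bar> > T} t *\<^sub>R F t) \<le> (LINT t|lborel. (normal_density 0 (1 / h) t * indicator {t. \<bar>t\<bar> > T} t) * G0)"
    proof (rule Bochner_Integration.integral_norm_bound_integral)
      show "integrable lborel (\<lambda>t. indicator {t. \<bar>t\<bar> > T} t *\<^sub>R F t)" by (intro integrable_mult_indicator Fint) auto
      show "integrable lborel (\<lambda>t. (normal_density 0 (1 / h) t * indicator {t. \<bar>t\<bar> > T} t) * G0)"
        using normal_density_tail(1)[OF h(1), of T] T3 by (intro integrable_mult_left) auto
      fix t show "norm (indicator {t. \<bar>t\<bar> > T} t *\<^sub>R F t) \<le> (normal_density 0 (1 / h) t * indicator {t. \<bar>t\<bar> > T} t) * G0"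
        using nF[of t] by (auto simp: indicator_def nd_def)
    qed
    also have "\<dots> = (LINT t|lborel. normal_density 0 (1 / h) t * indicator {t. \<bar>t\<bar> > T} t) * G0" by (rule integral_mult_left_zero)
    also have "\<dots> \<le> 105 / (h * T) ^ 8 * G0" using normal_density_tail(2)[OF h(1), of T] T3 G0 by (intro mult_right_mono) auto
    finally show ?thesis unfolding hT by (simp add: mult.commute)
  qed
  define L where "L = ln (2 * T)"
  \<comment> \<open>Half of the permitted width at height \<open>2 * T\<close>; the doubling of the
    height and the halving of the width keep the closed rectangle inside the open region.\<close>
  define \<eta> where "\<eta> = c / (2 * L ^ 10)"
  have L1: "L \<ge> 1" 
  proof -
    have "exp 1 \<le> 2 * T" using T3 exp_le by linarith
    then have "ln (exp 1) \<le> ln (2 * T)" using T3 by (subst ln_le_cancel_iff) auto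
    then show ?thesis by (simp add: L_def)
  qed
  have L10: "L ^ 10 \<ge> 1" using L1 by (rule one_le_power)
  have \<eta>: "\<eta> > 0" "\<eta> < c / L ^ 10" "\<eta> \<le> 1"
  proof -
    have "c \<le> 2 * L ^ 10" using pos L10 by linarith
    moreover have "L ^ 10 > 0" using L10 by linarith
    ultimately show "\<eta> > 0" "\<eta> < c / L ^ 10" "\<eta> \<le> 1"
      using pos by (auto simp: \<eta>_def field_simps)
  qed
  \<comment> \<open>The integrand \<open>F\<close> continued analytically from the line
    \<open>Re s = \<sigma>\<close>: the normal density becomes an entire Gaussian in
    \<open>s - \<sigma>\<close>. On the horizontal edges its size is governed by
    \<open>exp (- (h * T)^2 / 2) = exp (- v^2 / 2)\<close>.\<close>
  define Q where "Q = (\<lambda>s. \<Phi> s * exp ((s - of_real \<sigma>) * of_real v) * (of_real (h / sqrt (2 * pi)) * exp (of_real (h\<^sup>2) * (s - of_real \<sigma>)\<^sup>2 / 2)))"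
  have QF: "Q (Complex \<sigma> t) = F t" for t
  proof -
    have e: "Complex \<sigma> t - complex_of_real \<sigma> = \<i> * of_real t" by (simp add: Complex_eq)
    have "complex_of_real (nd t) = of_real (h / sqrt (2 * pi)) * exp (of_real (h\<^sup>2) * (\<i> * of_real t)\<^sup>2 / 2)"
    proof -
      have "nd t = h / sqrt (2 * pi) * exp (- (h\<^sup>2 * t\<^sup>2 / 2))" 
        using h by (simp add: nd_def normal_density_def real_sqrt_divide real_sqrt_mult power_divide field_simps)
      moreover have "of_real (h\<^sup>2) * (\<i> * of_real t)\<^sup>2 / 2 = complex_of_real (- (h\<^sup>2 * t\<^sup>2 / 2))" by (simp add: power_mult_distrib)
      ultimately show ?thesis by (simp only: of_real_mult exp_of_real)
    qed
    then show ?thesis unfolding Q_def e F_def g\<Phi> by (simp add: mult_ac)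
  qed
  have Qb: "norm (Q s) \<le> K * L ^ 10 * exp 2 * (exp ((Re s - \<sigma>) * v) * exp (- (h\<^sup>2 * (Im s)\<^sup>2 / 2)))"
    if s: "s \<in> zregion c 10 (2 * T)" "\<bar>Re s - \<sigma>\<bar> \<le> 2" for s
  proof -
    have 1: "norm (\<Phi> s) \<le> K * L ^ 10" unfolding L_def using T3 s by (intro bnd\<Phi>) auto
    have 2: "norm (exp ((s - of_real \<sigma>) * of_real v)) = exp ((Re s - \<sigma>) * v)" by simp
    have 3: "h / sqrt (2 * pi) \<le> 1"
    proof -
      have "1 \<le> sqrt (2 * pi)" using pi_ge_two by simp
      then have "h \<le> sqrt (2 * pi)" using h by linarith
      then show ?thesis by (simp add: divide_le_eq)
    qed
    have "Re (of_real (h\<^sup>2) * (s - of_real \<sigma>)\<^sup>2 / 2) = h\<^sup>2 * (Re s - \<sigma>)\<^sup>2 / 2 - h\<^sup>2 * (Im s)\<^sup>2 / 2"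
      by (simp add: Re_power2 power2_eq_square algebra_simps diff_divide_distrib)
    also have "\<dots> \<le> 2 - h\<^sup>2 * (Im s)\<^sup>2 / 2"
    proof -
      have "h\<^sup>2 \<le> 1" using h by (simp add: power_le_one)
      moreover have "(Re s - \<sigma>)\<^sup>2 \<le> 4" using s(2) abs_le_square_iff[of "Re s - \<sigma>" 2] by simp
      ultimately have "h\<^sup>2 * (Re s - \<sigma>)\<^sup>2 \<le> 1 * 4" by (intro mult_mono) auto
      then show ?thesis by simp
    qed
    finally have 4: "norm (exp (of_real (h\<^sup>2) * (s - of_real \<sigma>)\<^sup>2 / 2)) \<le> exp 2 * exp (- (h\<^sup>2 * (Im s)\<^sup>2 / 2))"
      unfolding norm_exp_eq_Re exp_add[symmetric] by simp
    have "norm (Q s) = norm (\<Phi> s) * exp ((Re s - \<sigma>) * v) * (h / sqrt (2 * pi) * norm (exp (of_real (h\<^sup>2) * (s - of_real \<sigma>)\<^sup>2 / 2)))"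
      unfolding Q_def norm_mult 2 using h by (simp add: norm_divide)
    also have "\<dots> \<le> K * L ^ 10 * exp ((Re s - \<sigma>) * v) * (1 * (exp 2 * exp (- (h\<^sup>2 * (Im s)\<^sup>2 / 2))))"
      using 1 3 4 h pos L10 by (intro mult_mono mult_nonneg_nonneg) auto
    finally show ?thesis by (simp add: mult_ac)
  qed
  obtain I where I: "((\<lambda>t. Q (Complex \<sigma> t)) has_integral I) {-T..T}" 
    "norm I \<le> K * L ^ 10 * exp 2 * exp (- \<eta> * v) * (2 * T) + 2 * (K * L ^ 10 * exp 2 * exp (- v\<^sup>2 / 2) * (\<sigma> - (- \<eta>)))"
  proof (rule vertical_integral_bound[of Q "- (c / L ^ 10)" 1 "2 * T" T "- \<eta>" \<sigma> "K * L ^ 10 * exp 2 * exp (- \<eta> * v)" "K * L ^ 10 * exp 2 * exp (- v\<^sup>2 / 2)"])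
    have "\<Phi> holomorphic_on zregion c 10 (2 * T)" using T3 by (intro hol) auto
    then show "Q holomorphic_on {s. - (c / L ^ 10) < Re s \<and> Re s < 1 \<and> \<bar>Im s\<bar> < 2 * T}"
      unfolding Q_def zregion_def L_def by (intro holomorphic_intros) auto
    show "norm (Q s) \<le> K * L ^ 10 * exp 2 * exp (- \<eta> * v)" if s: "Re s = - \<eta>" "\<bar>Im s\<bar> \<le> T" for s
    proof -
      have "s \<in> zregion c 10 (2 * T)" using s \<eta> T3 by (auto simp: zregion_def L_def)
      then have "norm (Q s) \<le> K * L ^ 10 * exp 2 * (exp ((Re s - \<sigma>) * v) * exp (- (h\<^sup>2 * (Im s)\<^sup>2 / 2)))"
        using s \<eta> \<sigma> by (intro Qb) auto
      also have "\<dots> \<le> K * L ^ 10 * exp 2 * (exp (- \<eta> * v) * 1)"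
      proof -
        have "(Re s - \<sigma>) * v \<le> - \<eta> * v" using s \<sigma> v by (intro mult_right_mono) auto
        then have "exp ((Re s - \<sigma>) * v) \<le> exp (- \<eta> * v)" by simp
        then show ?thesis using pos L10 by (intro mult_left_mono mult_mono) auto
      qed
      finally show ?thesis by simp
    qed
    show "norm (Q s) \<le> K * L ^ 10 * exp 2 * exp (- v\<^sup>2 / 2)" if s: "- \<eta> \<le> Re s" "Re s \<le> \<sigma>" "\<bar>Im s\<bar> = T" for s
    proof -
      have "s \<in> zregion c 10 (2 * T)" using s \<eta> T3 \<sigma> by (auto simp: zregion_def L_def)
      then have "norm (Q s) \<le> K * L ^ 10 * exp 2 * (exp ((Re s - \<sigma>) * v) * exp (- (h\<^sup>2 * (Im s)\<^sup>2 / 2)))"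
        using s \<eta> \<sigma> by (intro Qb) auto
      also have "h\<^sup>2 * (Im s)\<^sup>2 = v\<^sup>2" using s(3) hT by (metis power2_abs power_mult_distrib)
      also have "K * L ^ 10 * exp 2 * (exp ((Re s - \<sigma>) * v) * exp (- (v\<^sup>2 / 2))) \<le> K * L ^ 10 * exp 2 * (1 * exp (- (v\<^sup>2 / 2)))"
        using s v pos L10 by (intro mult_left_mono mult_mono) (auto intro: mult_nonpos_nonneg)
      finally show ?thesis by simp
    qed
  qed (use T3 \<eta> \<sigma> in auto)
  have Iset: "(LINT t:{-T..T}|lborel. F t) = I"
  proof -
    have "set_integrable lborel {-T..T} F" unfolding set_integrable_def by (intro integrable_mult_indicator Fint) auto
    from set_borel_integral_eq_integral(2)[OF this] show ?thesis using I(1) unfolding QF by (simp add: integral_unique)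
  qed
  define JB where "JB = 105 * (1 + 2 * v) * (2 * v) * C / v ^ 8 + K * L ^ 10 * exp 2 * (exp (- \<eta> * v) * (2 * v ^ 4) + 2 * (exp (- v\<^sup>2 / 2) * 2))"
  have J: "norm (integral\<^sup>L lborel F) \<le> JB"
  proof -
    have "2 * (K * L ^ 10 * exp 2 * exp (- v\<^sup>2 / 2) * (\<sigma> - (- \<eta>))) \<le> 2 * (K * L ^ 10 * exp 2 * exp (- v\<^sup>2 / 2) * 2)"
      using \<sigma> \<eta> pos L10 by (intro mult_left_mono) auto
    then have "norm (LINT t:{-T..T}|lborel. F t) \<le> K * L ^ 10 * exp 2 * (exp (- \<eta> * v) * (2 * v ^ 4) + 2 * (exp (- v\<^sup>2 / 2) * 2))"
      unfolding Iset using I(2) by (simp add: T_def algebra_simps)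
    then show ?thesis unfolding split JB_def using tail norm_triangle_ineq[of "LINT t:{-T..T}|lborel. F t" "LINT t|lborel. indicator {t. \<bar>t\<bar> > T} t *\<^sub>R F t"]
      by (simp add: G0_def mult_ac)
  qed
  have avg: "norm (LINT u|lborel. normal_density v h u * b u) \<le> JB * v ^ 3"
  proof -
    define A where "A = norm (LINT u|lborel. normal_density v h u * b u)"
    have "norm (integral\<^sup>L lborel F) = sqrt (2 * pi) * h * A"
      unfolding smooth A_def using h by (simp add: norm_mult)
    then have "1 * h * A \<le> JB"
    proof -
      have "1 \<le> sqrt (2 * pi)" using pi_ge_two by simp
      then have "1 * (h * A) \<le> sqrt (2 * pi) * (h * A)" using h by (intro mult_right_mono) (auto simp: A_def)
      then show ?thesis using J \<open>norm (integral\<^sup>L lborel F) = sqrt (2 * pi) * h * A\<close> by simp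
    qed
    then show ?thesis using v unfolding h_def A_def by (simp add: field_simps)
  qed
  have bl: "norm (b u - b v) \<le> 3 * C * (1 + v) * (\<bar>u - v\<bar> + exp (- v / 2))" for u
  proof -
    have bv: "norm (b v) \<le> C * (1 + v)"
    proof -
      have "norm (b v) = norm (B v) * exp (- 1)" using v by (simp add: b_def norm_mult)
      also have "\<dots> \<le> norm (B v) * 1" by (intro mult_left_mono) auto
      finally show ?thesis using bnd[of v] v by simp
    qed
    have cv: "C * (1 + v) \<ge> 0" using pos v by simp
    have e0: "3 * C * (1 + v) * exp (- v / 2) \<ge> 0" using cv by simp
    \<comment> \<open>In the first two ranges \<open>u\<close> is at distance more than
      \<open>v / 2 \<ge> 3/2\<close> from \<open>v\<close>, and the size bounds alone suffice. In
      the third, \<open>min u v\<close> is at least \<open>v / 2\<close>, which controls the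
      exponential in the Lipschitz hypothesis.\<close>
    consider "u < 0" | "0 \<le> u" "u < v / 2" | "u \<ge> v / 2" by linarith
    then show ?thesis
    proof cases
      case 1
      then have "norm (b u - b v) = norm (b v)" by (simp add: b_def B0)
      also have "\<dots> \<le> C * (1 + v) * 1" using bv by simp
      also have "\<dots> \<le> C * (1 + v) * (3 * \<bar>u - v\<bar>)" using 1 v cv by (intro mult_left_mono) auto
      finally show ?thesis using e0 by (simp add: algebra_simps)
    next
      case 2
      have "norm (b u) = norm (B u) * exp (- (u / v))" by (simp add: b_def norm_mult)
      also have "\<dots> \<le> norm (B u) * 1" using 2 v by (intro mult_left_mono) auto
      also have "\<dots> \<le> C * (1 + u)" using bnd[of u] 2 by simp
      also have "\<dots> \<le> C * (1 + v)" using 2 v pos by (intro mult_left_mono) auto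
      finally have "norm (b u - b v) \<le> C * (1 + v) * 2" using norm_triangle_ineq4[of "b u" "b v"] bv by simp
      also have "\<dots> \<le> C * (1 + v) * (3 * \<bar>u - v\<bar>)" using 2 v cv by (intro mult_left_mono) auto
      finally show ?thesis using e0 by (simp add: algebra_simps)
    next
      case 3
      then have u0: "u \<ge> 0" using v by simp
      have d: "b u - b v = (B u - B v) * of_real (exp (- (u / v))) + B v * of_real (exp (- (u / v)) - exp (- 1))"
        using v by (simp add: b_def algebra_simps)
      have "norm (B u - B v) * exp (- (u / v)) \<le> C * (1 + u + v) * (\<bar>u - v\<bar> + exp (- min u v)) * exp (- (u / v))"
        using lip[of u v] u0 v by (intro mult_right_mono) auto
      also have "\<dots> \<le> C * (1 + u + v) * (\<bar>u - v\<bar> + exp (- v / 2)) * exp (- (u / v))"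
        using 3 v u0 pos by (intro mult_right_mono mult_left_mono add_left_mono) auto
      also have "\<dots> = ((1 + u + v) * exp (- (u / v))) * (C * (\<bar>u - v\<bar> + exp (- v / 2)))" by (simp add: mult_ac)
      also have "\<dots> \<le> (2 * (1 + v)) * (C * (\<bar>u - v\<bar> + exp (- v / 2)))"
      proof (intro mult_right_mono)
        have "1 + u / v \<le> exp (u / v)" by (rule exp_ge_add_one_self)
        then have "(1 + v) * (1 + u / v) * exp (- (u / v)) \<le> (1 + v) * exp (u / v) * exp (- (u / v))" 
          using v by (intro mult_right_mono mult_left_mono) auto
        also have "\<dots> = 1 + v" by (simp add: exp_minus)
        finally have "(1 + v) * (1 + u / v) * exp (- (u / v)) \<le> 1 + v" .
        moreover have "1 + u + v \<le> (1 + v) * (1 + u / v)" using u0 v by (simp add: field_simps)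
        then have "(1 + u + v) * exp (- (u / v)) \<le> (1 + v) * (1 + u / v) * exp (- (u / v))" by (intro mult_right_mono) auto
        ultimately have "(1 + u + v) * exp (- (u / v)) \<le> 1 + v" by linarith
        also have "\<dots> \<le> 2 * (1 + v)" using v by simp
        finally show "(1 + u + v) * exp (- (u / v)) \<le> 2 * (1 + v)" .
      qed (use pos in auto)
      finally have p1: "norm ((B u - B v) * of_real (exp (- (u / v)))) \<le> 2 * C * (1 + v) * (\<bar>u - v\<bar> + exp (- v / 2))"
        by (simp add: norm_mult mult_ac)
      have ed: "\<bar>exp (- (u / v)) - exp (- 1)\<bar> \<le> \<bar>u - v\<bar>"
      proof -
        have lipe: "\<bar>exp (- x) - exp (- y)\<bar> \<le> \<bar>x - y\<bar>" if "x \<ge> 0" "y \<ge> 0" for x y :: real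
        proof -
          have *: "exp (- x) - exp (- y) \<le> y - x" if "0 \<le> x" "x \<le> y" for x y :: real
          proof -
            have "1 - exp (x - y) \<le> y - x" using exp_ge_add_one_self[of "x - y"] by linarith
            then have "exp (- x) * (1 - exp (x - y)) \<le> 1 * (y - x)" using that by (intro mult_mono) auto
            then show ?thesis by (simp add: algebra_simps exp_add[symmetric])
          qed
          show ?thesis using *[of x y] *[of y x] that by (cases "x \<le> y") auto
        qed
        have "\<bar>exp (- (u / v)) - exp (- 1)\<bar> \<le> \<bar>u / v - 1\<bar>" using lipe[of "u / v" 1] u0 v by simp
        also have "u / v - 1 = (u - v) / v" using v by (simp add: diff_divide_distrib)
        also have "\<bar>\<dots>\<bar> = \<bar>u - v\<bar> / v" using v by (simp add: abs_divide)
        also have "\<dots> \<le> \<bar>u - v\<bar> / 1" using v by (intro divide_left_mono) auto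
        finally show ?thesis by simp
      qed
      have p2: "norm (B v * of_real (exp (- (u / v)) - exp (- 1))) \<le> C * (1 + v) * \<bar>u - v\<bar>"
        unfolding norm_mult norm_of_real using bnd[of v] v ed cv by (intro mult_mono) auto
      have p3: "C * (1 + v) * \<bar>u - v\<bar> \<le> C * (1 + v) * (\<bar>u - v\<bar> + exp (- v / 2))"
        using cv by (intro mult_left_mono) auto
      have "norm (b u - b v) \<le> 2 * C * (1 + v) * (\<bar>u - v\<bar> + exp (- v / 2)) + C * (1 + v) * (\<bar>u - v\<bar> + exp (- v / 2))"
        unfolding d using p1 p2 p3 norm_triangle_ineq[of "(B u - B v) * of_real (exp (- (u / v)))" "B v * of_real (exp (- (u / v)) - exp (- 1))"]
        by linarith
      then show ?thesis by (simp add: algebra_simps)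
    qed
  qed
  have ndv: "integrable lborel (\<lambda>u. normal_density v h u)" using h by auto
  have nbint: "integrable lborel (\<lambda>u. normal_density v h u * b u)"
  proof (rule Bochner_Integration.integrable_bound)
    show "integrable lborel (\<lambda>u. 3 * C * (1 + v) * (normal_density v h u * \<bar>u - v\<bar>) + (3 * C * (1 + v) * exp (- v / 2) + norm (b v)) * normal_density v h u)"
      by (intro Bochner_Integration.integrable_add integrable_mult_right normal_density_mean_abs h ndv)
    show "AE u in lborel. norm (normal_density v h u * b u) \<le> norm (3 * C * (1 + v) * (normal_density v h u * \<bar>u - v\<bar>) + (3 * C * (1 + v) * exp (- v / 2) + norm (b v)) * normal_density v h u)"
    proof (rule AE_I2)
      fix u
      have "norm (b u) \<le> norm (b u - b v) + norm (b v)" using norm_triangle_ineq[of "b u - b v" "b v"] by simp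
      then have "norm (b u) \<le> 3 * C * (1 + v) * (\<bar>u - v\<bar> + exp (- v / 2)) + norm (b v)" using bl[of u] by linarith
      then have "normal_density v h u * norm (b u) \<le> normal_density v h u * (3 * C * (1 + v) * (\<bar>u - v\<bar> + exp (- v / 2)) + norm (b v))"
        by (intro mult_left_mono) auto
      also have "\<dots> = 3 * C * (1 + v) * (normal_density v h u * \<bar>u - v\<bar>) + (3 * C * (1 + v) * exp (- v / 2) + norm (b v)) * normal_density v h u"
        by (simp add: algebra_simps)
      finally show "norm (normal_density v h u * b u) \<le> norm (3 * C * (1 + v) * (normal_density v h u * \<bar>u - v\<bar>) + (3 * C * (1 + v) * exp (- v / 2) + norm (b v)) * normal_density v h u)"
        by (simp add: norm_mult)
    qed
  qed measurable
  have "b v = (LINT u|lborel. normal_density v h u * b v)"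
    using h by simp
  also have "\<dots> = (LINT u|lborel. normal_density v h u * b u - normal_density v h u * (b u - b v))" by (simp add: algebra_simps)
  also have "\<dots> = (LINT u|lborel. normal_density v h u * b u) - (LINT u|lborel. normal_density v h u * (b u - b v))"
  proof (rule Bochner_Integration.integral_diff[OF nbint])
    have "integrable lborel (\<lambda>u. normal_density v h u * b u - normal_density v h u * b v)"
      by (intro Bochner_Integration.integrable_diff nbint integrable_mult_left integrable_of_real ndv)
    then show "integrable lborel (\<lambda>u. normal_density v h u * (b u - b v))" by (simp add: right_diff_distrib)
  qed
  finally have bveq: "b v = (LINT u|lborel. normal_density v h u * b u) - (LINT u|lborel. normal_density v h u * (b u - b v))" .
  have dev: "norm (LINT u|lborel. normal_density v h u * (b u - b v)) \<le> 3 * C * (1 + v) * (h + exp (- v / 2))"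
  proof -
    have "norm (LINT u|lborel. normal_density v h u * (b u - b v)) \<le> 
       (LINT u|lborel. 3 * C * (1 + v) * (normal_density v h u * \<bar>u - v\<bar> + exp (- v / 2) * normal_density v h u))"
    proof (rule Bochner_Integration.integral_norm_bound_integral)
      have "integrable lborel (\<lambda>u. normal_density v h u * b u - normal_density v h u * b v)"
        by (intro Bochner_Integration.integrable_diff nbint integrable_mult_left integrable_of_real ndv)
      then show "integrable lborel (\<lambda>u. normal_density v h u * (b u - b v))" by (simp add: right_diff_distrib)
      show "integrable lborel (\<lambda>u. 3 * C * (1 + v) * (normal_density v h u * \<bar>u - v\<bar> + exp (- v / 2) * normal_density v h u))"
        by (intro integrable_mult_right Bochner_Integration.integrable_add normal_density_mean_abs h ndv)
      fix u
      have "normal_density v h u * norm (b u - b v) \<le> normal_density v h u * (3 * C * (1 + v) * (\<bar>u - v\<bar> + exp (- v / 2)))"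
        by (intro mult_left_mono bl) auto
      also have "\<dots> = 3 * C * (1 + v) * (normal_density v h u * \<bar>u - v\<bar> + exp (- v / 2) * normal_density v h u)"
        by (simp add: algebra_simps)
      finally show "norm (normal_density v h u * (b u - b v)) \<le> 3 * C * (1 + v) * (normal_density v h u * \<bar>u - v\<bar> + exp (- v / 2) * normal_density v h u)"
        by (simp add: norm_mult)
    qed
    also have "\<dots> = 3 * C * (1 + v) * ((LINT u|lborel. normal_density v h u * \<bar>u - v\<bar>) + exp (- v / 2) * (LINT u|lborel. normal_density v h u))"
      by (subst integral_mult_right_zero, subst Bochner_Integration.integral_add) 
         (use normal_density_mean_abs(1)[OF h(1), of v] ndv in auto)
    also have "\<dots> \<le> 3 * C * (1 + v) * (h + exp (- v / 2))"
      using normal_density_mean_abs(2)[OF h(1), of v] h pos v by (intro mult_left_mono) auto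
    finally show ?thesis .
  qed
  have "norm (b v) \<le> JB * v ^ 3 + 3 * C * (1 + v) * (h + exp (- v / 2))"
    using norm_triangle_ineq4[of "LINT u|lborel. normal_density v h u * b u" "LINT u|lborel. normal_density v h u * (b u - b v)"]
      avg dev unfolding bveq[symmetric] by linarith
  also have "\<dots> = tauber_bound C K c v"
    unfolding tauber_bound_def JB_def \<eta>_def L_def T_def h_def by simp
  finally have "exp 1 * norm (b v) \<le> exp 1 * tauber_bound C K c v" by (intro mult_left_mono) auto
  moreover have "norm (b v) = norm (B v) * exp (- 1)" using v by (simp add: b_def norm_mult)
  moreover have "exp 1 * exp (- 1) = (1::real)" by (simp add: exp_add[symmetric])
  ultimately show ?thesis by (metis mult.commute mult.left_commute mult.right_neutral)
qed

text \<open>The pointwise bound is of the desired order only for large \<open>v\<close>; on the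
  remaining bounded range the linear growth of \<open>B\<close> is absorbed into the
  constant.\<close>

theorem tauberian:
  fixes B \<Phi> :: "_ \<Rightarrow> complex"
  assumes meas: "B \<in> borel_measurable borel" and B0: "\<And>u. u < 0 \<Longrightarrow> B u = 0"
    and bnd: "\<And>u. u \<ge> 0 \<Longrightarrow> norm (B u) \<le> C * (1 + u)"
    and lip: "\<And>u v. 0 \<le> u \<Longrightarrow> 0 \<le> v \<Longrightarrow> norm (B u - B v) \<le> C * (1 + u + v) * (\<bar>u - v\<bar> + exp (- min u v))"
    and lap: "\<And>s. Re s > 0 \<Longrightarrow> (LINT u|lborel. B u * exp (- (s * of_real u))) = \<Phi> s"
    and hol: "\<And>T. T \<ge> 3 \<Longrightarrow> \<Phi> holomorphic_on zregion c 10 T"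
    and bnd\<Phi>: "\<And>T s. T \<ge> 3 \<Longrightarrow> s \<in> zregion c 10 T \<Longrightarrow> norm (\<Phi> s) \<le> K * ln T ^ 10"
    and pos: "c > 0" "c \<le> 1" "K > 0" "C > 0"
  shows "\<exists>D. \<forall>v\<ge>0. norm (B v) \<le> D / (1 + v)\<^sup>2"
proof -
  have "(\<lambda>v. exp 1 * tauber_bound C K c v) \<in> O(\<lambda>v. 1 / v ^ 2)"
    using tauber_bound_bigo[of c K C] pos by simp
  then obtain D where D: "\<forall>\<^sub>F v in at_top. norm (exp 1 * tauber_bound C K c v) \<le> D * norm (1 / v ^ 2 :: real)"
    by (elim landau_o.bigE)
  then obtain v0 where v0: "\<And>v. v \<ge> v0 \<Longrightarrow> norm (exp 1 * tauber_bound C K c v) \<le> D * norm (1 / v ^ 2 :: real)"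
    by (auto simp: eventually_at_top_linorder)
  define v1 where "v1 = max 3 v0"
  show ?thesis
  proof (intro exI allI impI)
    fix v :: real assume v: "v \<ge> 0"
    show "norm (B v) \<le> (4 * \<bar>D\<bar> + C * (1 + v1) ^ 3) / (1 + v)\<^sup>2"
    proof (cases "v \<ge> v1")
      case True
      then have v3: "v \<ge> 3" "v \<ge> v0" by (auto simp: v1_def)
      have "norm (B v) \<le> exp 1 * tauber_bound C K c v"
        by (rule tauberian_pointwise[OF meas B0 bnd lip lap hol bnd\<Phi> pos v3(1)])
      also have "\<dots> \<le> norm (exp 1 * tauber_bound C K c v)" by simp
      also have "\<dots> \<le> D * norm (1 / v ^ 2)" by (rule v0[OF v3(2)])
      also have "\<dots> \<le> \<bar>D\<bar> * norm (1 / v ^ 2)" by (intro mult_right_mono) auto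
      also have "\<dots> = \<bar>D\<bar> / v\<^sup>2" by simp
      also have "\<dots> \<le> \<bar>D\<bar> / ((1 + v) / 2)\<^sup>2"
        using v3 by (intro divide_left_mono power_mono mult_pos_pos zero_less_power) auto
      also have "\<dots> = 4 * \<bar>D\<bar> / (1 + v)\<^sup>2" by (simp add: power_divide)
      also have "\<dots> \<le> (4 * \<bar>D\<bar> + C * (1 + v1) ^ 3) / (1 + v)\<^sup>2"
        using pos by (intro divide_right_mono) (auto simp: v1_def)
      finally show ?thesis .
    next
      case False
      have "norm (B v) * (1 + v)\<^sup>2 \<le> (C * (1 + v)) * (1 + v)\<^sup>2" using bnd[OF v] by (intro mult_right_mono) auto
      also have "\<dots> = C * (1 + v) ^ 3" by (simp add: power3_eq_cube power2_eq_square)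
      also have "\<dots> \<le> C * (1 + v1) ^ 3" using False v pos by (intro mult_left_mono power_mono) auto
      finally have "norm (B v) * (1 + v)\<^sup>2 \<le> 4 * \<bar>D\<bar> + C * (1 + v1) ^ 3" by simp
      then show ?thesis using v by (subst pos_le_divide_eq) auto
    qed
  qed
qed

section \<open>Dirichlet series and characters\<close>

text \<open>The term \<open>n = 0\<close> vanishes because \<open>0 powr z = 0\<close>. The sum is
  unordered, so rearrangements are available wherever it converges absolutely.\<close>

definition dser :: "(nat \<Rightarrow> complex) \<Rightarrow> complex \<Rightarrow> complex" where
  "dser a s = (\<Sum>\<^sub>\<infinity>n. a n * of_nat n powr (- s))"

section \<open>Absolutely convergent Dirichlet series and their products\<close>

lemma norm_nat_powr: "norm (of_nat n powr s :: complex) = (if n = 0 then 0 else real n powr Re s)"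
  by (simp add: norm_powr_real_powr)

lemma summable_on_nat_powr:
  assumes "\<sigma> > 1"
  shows "(\<lambda>n. real n powr (- \<sigma>)) summable_on UNIV"
  using assms by (intro norm_summable_imp_summable_on) (auto simp: summable_real_powr_iff)

lemma summable_on_ln_nat_powr:
  assumes "\<sigma> > 1"
  shows "(\<lambda>n. ln (real n) * real n powr (- \<sigma>)) summable_on UNIV"
proof -
  define e where "e = (\<sigma> - 1) / 2"
  have e: "e > 0" using assms by (simp add: e_def)
  have "(\<lambda>n. (1 / e) * real n powr (- ((\<sigma> + 1) / 2))) summable_on UNIV"
    using assms by (intro summable_on_cmult_right summable_on_nat_powr) auto
  then show ?thesis
  proof (rule summable_on_comparison_test)
    fix n :: nat
    show "0 \<le> ln (real n) * real n powr (- \<sigma>)" by (cases "n = 0") auto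
    show "ln (real n) * real n powr (- \<sigma>) \<le> (1 / e) * real n powr (- ((\<sigma> + 1) / 2))"
    proof (cases "n = 0")
      case False
      then have "ln (real n) \<le> real n powr e / e" using e by (intro ln_powr_bound) auto
      then have "ln (real n) * real n powr (- \<sigma>) \<le> real n powr e / e * real n powr (- \<sigma>)"
        by (intro mult_right_mono) auto
      also have "\<dots> = (1 / e) * real n powr (e + - \<sigma>)" by (simp add: powr_add[symmetric])
      also have "e + - \<sigma> = - ((\<sigma> + 1) / 2)" by (simp add: e_def field_simps)
      finally show ?thesis .
    qed auto
  qed
qed

lemma norm_dterm: "norm (a n * of_nat n powr (- s)) = norm (a n) * real n powr (- Re s)"
  by (simp add: norm_mult norm_nat_powr)

lemma abs_summable_on_dser:
  assumes "\<And>n. norm (a n) \<le> 1" "Re s > 1"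
  shows "(\<lambda>n. norm (a n * of_nat n powr (- s))) summable_on UNIV"
proof (rule summable_on_comparison_test[OF summable_on_nat_powr[OF assms(2)]])
  fix n show "norm (a n * of_nat n powr (- s)) \<le> real n powr (- Re s)"
    unfolding norm_dterm using assms(1)[of n] by (intro mult_left_le_one_le) auto
qed auto

lemma abs_summable_on_dser_ln:
  assumes "\<And>n. n > 0 \<Longrightarrow> norm (a n) \<le> ln (real n)" "Re s > 1"
  shows "(\<lambda>n. norm (a n * of_nat n powr (- s))) summable_on UNIV"
proof (rule summable_on_comparison_test[OF summable_on_ln_nat_powr[OF assms(2)]])
  fix n show "norm (a n * of_nat n powr (- s)) \<le> ln (real n) * real n powr (- Re s)"
    unfolding norm_dterm using assms(1)[of n] by (cases "n = 0") (auto intro: mult_right_mono)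
qed auto

text \<open>Fubini for the bijection between pairs \<open>(d, m)\<close> and pairs of a number with
  a divisor. It serves Dirichlet series and, in the non-vanishing proof, Lambert series.\<close>

lemma infsum_divisor_convolution:
  fixes F :: "nat \<Rightarrow> nat \<Rightarrow> complex"
  assumes sm: "(\<lambda>(d,m). norm (F d m)) summable_on ({1..} \<times> {1..})"
  shows "(\<lambda>n. \<Sum>d | d dvd n. F d (n div d)) summable_on {1..}"
    "(\<Sum>\<^sub>\<infinity>(d,m)\<in>{1..}\<times>{1..}. F d m) = (\<Sum>\<^sub>\<infinity>n\<in>{1..}. \<Sum>d | d dvd n. F d (n div d))"
proof -
  have sm': "(\<lambda>(d,m). F d m) summable_on ({1..} \<times> {1..})"
    by (rule abs_summable_summable) (use sm in \<open>simp add: case_prod_unfold\<close>)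
  define S where "S = (SIGMA n:{1::nat..}. {d. d dvd n})"
  have bij: "bij_betw (\<lambda>(n,d). (d, n div d)) S ({1..} \<times> {1..})"
  proof (rule bij_betwI[where g = "\<lambda>(d,m). (d * m, d)"])
    have *: "1 \<le> d" "1 \<le> k" if "1 \<le> d * k" for d k :: nat
      using that by (cases d; cases k; simp)+
    show "(\<lambda>(n,d). (d, n div d)) \<in> S \<rightarrow> {1..} \<times> {1..}"
    proof (rule Pi_I)
      fix x assume "x \<in> S"
      then obtain d k where "x = (d * k, d)" "1 \<le> d * k" unfolding S_def by (auto elim: dvdE)
      then show "(\<lambda>(n,d). (d, n div d)) x \<in> {1..} \<times> {1..}" using *[of d k] by simp
    qed
    show "(\<lambda>(d,m). (d * m, d)) \<in> {1..} \<times> {1..} \<rightarrow> S" by (auto simp: S_def)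
    fix x assume "x \<in> S"
    then show "(\<lambda>(d,m). (d * m, d)) ((\<lambda>(n,d). (d, n div d)) x) = x" unfolding S_def by auto
  next
    fix y :: "nat \<times> nat" assume "y \<in> {1..} \<times> {1..}"
    then show "(\<lambda>(n,d). (d, n div d)) ((\<lambda>(d,m). (d * m, d)) y) = y" by auto
  qed
  have 1: "(\<lambda>(n,d). F d (n div d)) summable_on S"
    using sm' summable_on_reindex_bij_betw[OF bij, of "\<lambda>(d,m). F d m"] by (simp add: case_prod_unfold)
  have fin: "infsum (\<lambda>d. F d (n div d)) {d. d dvd n} = (\<Sum>d | d dvd n. F d (n div d))" if "n \<in> {1..}" for n
    using that by (intro infsum_finite) auto
  have "(\<lambda>n. infsum (\<lambda>d. F d (n div d)) {d. d dvd n}) summable_on {1..}"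
    using 1 unfolding S_def by (rule summable_on_Sigma_banach[where f = "\<lambda>n d. F d (n div d)"])
  then show "(\<lambda>n. \<Sum>d | d dvd n. F d (n div d)) summable_on {1..}"
    by (rule summable_on_cong[THEN iffD1, rotated]) (use fin in auto)
  have "(\<Sum>\<^sub>\<infinity>(d,m)\<in>{1..}\<times>{1..}. F d m) = (\<Sum>\<^sub>\<infinity>(n,d)\<in>S. F d (n div d))"
    using infsum_reindex_bij_betw[OF bij, of "\<lambda>(d,m). F d m"] by (simp add: case_prod_unfold)
  also have "\<dots> = (\<Sum>\<^sub>\<infinity>n\<in>{1..}. infsum (\<lambda>d. F d (n div d)) {d. d dvd n})"
    unfolding S_def by (rule infsum_Sigma'_banach[symmetric]) (use 1 S_def in auto)
  also have "\<dots> = (\<Sum>\<^sub>\<infinity>n\<in>{1..}. \<Sum>d | d dvd n. F d (n div d))"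
    by (rule infsum_cong) (use fin in auto)
  finally show "(\<Sum>\<^sub>\<infinity>(d,m)\<in>{1..}\<times>{1..}. F d m) = (\<Sum>\<^sub>\<infinity>n\<in>{1..}. \<Sum>d | d dvd n. F d (n div d))" .
qed

lemma dser_Ici: "dser a s = (\<Sum>\<^sub>\<infinity>n\<in>{1..}. a n * of_nat n powr (- s))"
  unfolding dser_def by (rule infsum_cong_neutral) (auto simp: Suc_le_eq)

lemma abs_summable_on_product:
  fixes f g :: "nat \<Rightarrow> complex"
  assumes "(\<lambda>n. norm (f n)) summable_on A" "(\<lambda>n. norm (g n)) summable_on B"
  shows "(\<lambda>(d,m). norm (f d * g m)) summable_on (A \<times> B)"
    "infsum f A * infsum g B = (\<Sum>\<^sub>\<infinity>(d,m)\<in>A\<times>B. f d * g m)"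
proof -
  show 1: "(\<lambda>(d,m). norm (f d * g m)) summable_on (A \<times> B)"
  proof (rule summable_on_SigmaI)
    show "((\<lambda>m. (\<lambda>(d,m). norm (f d * g m)) (d, m)) has_sum (norm (f d) * infsum (\<lambda>m. norm (g m)) B)) B" for d
      using has_sum_cmult_right[OF has_sum_infsum[OF assms(2)], of "norm (f d)"] by (simp add: norm_mult)
    show "(\<lambda>d. norm (f d) * infsum (\<lambda>m. norm (g m)) B) summable_on A"
      using assms(1) by (rule summable_on_cmult_left)
  qed auto
  have "(\<Sum>\<^sub>\<infinity>(d,m)\<in>A\<times>B. f d * g m) = (\<Sum>\<^sub>\<infinity>d\<in>A. \<Sum>\<^sub>\<infinity>m\<in>B. f d * g m)"
    by (rule infsum_Sigma'_banach[symmetric], rule abs_summable_summable) (use 1 in \<open>simp add: case_prod_unfold\<close>)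
  also have "\<dots> = (\<Sum>\<^sub>\<infinity>d\<in>A. f d * infsum g B)" 
    using abs_summable_summable[OF assms(2)] by (simp add: infsum_cmult_right)
  also have "\<dots> = infsum f A * infsum g B" 
    using abs_summable_summable[OF assms(1)] by (simp add: infsum_cmult_left)
  finally show "infsum f A * infsum g B = (\<Sum>\<^sub>\<infinity>(d,m)\<in>A\<times>B. f d * g m)" by simp
qed

lemma nat_powr_mult: "(of_nat (d * m) powr s :: complex) = of_nat d powr s * of_nat m powr s"
proof -
  have "(complex_of_real (real d) * complex_of_real (real m)) powr s = complex_of_real (real d) powr s * complex_of_real (real m) powr s"
    by (rule powr_times_real) auto
  then show ?thesis by simp
qed

lemma dser_mult:
  assumes "(\<lambda>n. norm (a n * of_nat n powr (- s))) summable_on UNIV" "(\<lambda>n. norm (b n * of_nat n powr (- s))) summable_on UNIV"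
  shows "dser a s * dser b s = dser (\<lambda>n. \<Sum>d | d dvd n. a d * b (n div d)) s"
proof -
  have s: "(\<lambda>n. norm (a n * of_nat n powr (- s))) summable_on {1..}" "(\<lambda>n. norm (b n * of_nat n powr (- s))) summable_on {1..}"
    using assms by (auto intro: summable_on_subset_banach)
  have "dser a s * dser b s = (\<Sum>\<^sub>\<infinity>(d,m)\<in>{1..}\<times>{1..}. (a d * of_nat d powr (- s)) * (b m * of_nat m powr (- s)))"
    unfolding dser_Ici by (rule abs_summable_on_product(2)[OF s])
  also have "\<dots> = (\<Sum>\<^sub>\<infinity>n\<in>{1..}. \<Sum>d | d dvd n. (a d * of_nat d powr (- s)) * (b (n div d) * of_nat (n div d) powr (- s)))"
    by (rule infsum_divisor_convolution(2)[OF abs_summable_on_product(1)[OF s]])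
  also have "\<dots> = dser (\<lambda>n. \<Sum>d | d dvd n. a d * b (n div d)) s"
    unfolding dser_Ici
  proof (rule infsum_cong)
    fix n :: nat
    have "(a d * of_nat d powr (- s)) * (b (n div d) * of_nat (n div d) powr (- s)) = a d * b (n div d) * of_nat n powr (- s)" if "d dvd n" for d
      using nat_powr_mult[of d "n div d" "- s"] that by simp
    then show "(\<Sum>d | d dvd n. (a d * of_nat d powr (- s)) * (b (n div d) * of_nat (n div d) powr (- s))) = 
        (\<Sum>d | d dvd n. a d * b (n div d)) * of_nat n powr (- s)"
      unfolding sum_distrib_right by (intro sum.cong) auto
  qed
  finally show ?thesis .
qed

section \<open>Dirichlet characters, Euler products and the 3-4-1 inequality\<close>

definition dchar :: "nat \<Rightarrow> (nat \<Rightarrow> complex) \<Rightarrow> bool" where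
  "dchar l \<xi> \<longleftrightarrow> l > 0 \<and> \<xi> 1 = 1 \<and> (\<forall>m n. \<xi> (m * n) = \<xi> m * \<xi> n) \<and> (\<forall>n. \<xi> (n + l) = \<xi> n) \<and> (\<forall>n. \<xi> n \<noteq> 0 \<longleftrightarrow> coprime n l)"

lemma dcharD:
  assumes "dchar l \<xi>"
  shows "l > 0" "\<xi> 1 = 1" "\<xi> (Suc 0) = 1" "\<xi> (m * n) = \<xi> m * \<xi> n" "\<xi> (n + l) = \<xi> n" "\<xi> n = 0 \<longleftrightarrow> \<not> coprime n l"
  using assms by (auto simp: dchar_def)

lemma periodic_mod:
  fixes f :: "nat \<Rightarrow> 'a"
  assumes "\<And>n. f (n + l) = f n"
  shows "f (n mod l) = f n"
proof -
  have "f (m + k * l) = f m" for m k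
  proof (induction k)
    case (Suc k)
    have "f (m + Suc k * l) = f ((m + k * l) + l)" by (simp add: algebra_simps)
    then show ?case using assms Suc by simp
  qed auto
  from this[of "n mod l" "n div l"] show ?thesis by simp
qed

lemma dchar_mod: "dchar l \<xi> \<Longrightarrow> \<xi> (n mod l) = \<xi> n"
  by (rule periodic_mod) (rule dcharD)

lemma dchar_cong: 
  assumes "dchar l \<xi>" "[m = n] (mod l)"
  shows "\<xi> m = \<xi> n"
proof -
  have "\<xi> m = \<xi> (m mod l)" by (rule dchar_mod[OF assms(1), symmetric])
  also have "m mod l = n mod l" using assms(2) by (simp add: unique_euclidean_semiring_class.cong_def)
  also have "\<xi> (n mod l) = \<xi> n" by (rule dchar_mod[OF assms(1)])
  finally show ?thesis .
qed

lemma dchar_power: 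
  assumes "dchar l \<xi>"
  shows "\<xi> (n ^ k) = \<xi> n ^ k"
  by (induction k) (simp_all add: dcharD(3,4)[OF assms])

text \<open>By Euler's theorem the value at a unit is a root of unity of order dividing
  \<open>totient l\<close>.\<close>

lemma norm_dchar: 
  assumes "dchar l \<xi>"
  shows "norm (\<xi> n) = (if coprime n l then 1 else 0)"
proof (cases "coprime n l")
  case True
  have "\<xi> n ^ totient l = \<xi> (n ^ totient l)" using dchar_power[OF assms] by simp
  also have "\<dots> = \<xi> 1" by (intro dchar_cong[OF assms] euler_theorem True)
  finally have "norm (\<xi> n) ^ totient l = 1" by (metis assms dcharD(2) norm_one norm_power)
  moreover have "totient l > 0" using dcharD(1)[OF assms] by simp
  ultimately have "norm (\<xi> n) = 1" using power_eq_imp_eq_base[of "norm (\<xi> n)" "totient l" 1] by simp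
  then show ?thesis using True by simp
next
  case False
  then have "\<xi> n = 0" using dcharD(6)[OF assms, of n] by blast
  then show ?thesis using False by simp
qed

lemma norm_dchar_le: "dchar l \<xi> \<Longrightarrow> norm (\<xi> n) \<le> 1"
  by (subst norm_dchar) auto

text \<open>Modulus 1 puts \<zeta> into the same family, so the bounds for characters serve for the
  Moebius sums as well.\<close>

lemma dchar_one: "dchar 1 (\<lambda>_. 1)"
  by (simp add: dchar_def)

lemma dchar_principal: 
  assumes "l > 0" shows "dchar l (\<lambda>n. if coprime n l then 1 else 0)"
proof -
  have 1: "coprime (n + l) l \<longleftrightarrow> coprime n l" for n
    by (simp only: coprime_iff_gcd_eq_1 gcd_add1)
  show ?thesis unfolding dchar_def
  proof (intro conjI allI)
    show "l > 0" by fact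
    show "(if coprime (n + l) l then 1 else 0) = (if coprime n l then 1 else 0 :: complex)" for n
      by (simp only: 1)
  qed auto
qed

lemma dchar_square: "dchar l \<xi> \<Longrightarrow> dchar l (\<lambda>n. (\<xi> n)\<^sup>2)"
  unfolding dchar_def by (simp only: power_mult_distrib power_one zero_eq_power2 simp_thms)

text \<open>The sieve of Eratosthenes: multiplying by the factor at \<open>p\<close> subtracts the
  terms divisible by \<open>p\<close>.\<close>

lemma dser_euler_finite:
  assumes \<xi>: "dchar l \<xi>" and s: "Re s > 1" and A: "finite A" "\<And>p. p \<in> A \<Longrightarrow> prime p"
  shows "dser \<xi> s * (\<Prod>p\<in>A. 1 - \<xi> p * of_nat p powr (- s)) = (\<Sum>\<^sub>\<infinity>n\<in>{n. n \<ge> 1 \<and> (\<forall>p\<in>A. \<not> p dvd n)}. \<xi> n * of_nat n powr (- s))"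
  using A
proof (induction A rule: finite_induct)
  case empty
  have "{n. n \<ge> 1 \<and> (\<forall>p\<in>{}. \<not> p dvd n)} = {1::nat..}" by auto
  then show ?case by (simp add: dser_Ici)
next
  case (insert p A)
  define f where "f = (\<lambda>n. \<xi> n * of_nat n powr (- s))"
  define S where "S = {n::nat. n \<ge> 1 \<and> (\<forall>p\<in>A. \<not> p dvd n)}"
  have p: "prime p" using insert by auto
  have sf: "f summable_on X" for X
    using abs_summable_summable[OF abs_summable_on_dser[OF norm_dchar_le[OF \<xi>] s]] unfolding f_def
    by (rule summable_on_subset_banach) auto
  have S': "{n. n \<ge> 1 \<and> (\<forall>q\<in>insert p A. \<not> q dvd n)} = S - (\<lambda>n. p * n) ` S"
  proof (intro equalityI subsetI)
    fix n assume n: "n \<in> S - (\<lambda>n. p * n) ` S"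
    have "\<not> p dvd n"
    proof
      assume "p dvd n"
      then obtain k where k: "n = p * k" by (auto elim: dvdE)
      then have "k \<in> S" using n by (auto simp: S_def intro!: Nat.gr0I simp: Suc_le_eq)
      then show False using n k by auto
    qed
    then show "n \<in> {n. n \<ge> 1 \<and> (\<forall>q\<in>insert p A. \<not> q dvd n)}" using n by (auto simp: S_def)
  qed (auto simp: S_def)
  have sub: "(\<lambda>n. p * n) ` S \<subseteq> S"
  proof
    fix m assume "m \<in> (\<lambda>n. p * n) ` S"
    then obtain n where n: "m = p * n" "n \<in> S" by auto
    have "\<not> q dvd p * n" if "q \<in> A" for q
    proof
      assume d: "q dvd p * n"
      have q: "prime q" using insert that by auto
      then have "q dvd p \<or> q dvd n" using d prime_dvd_mult_iff by blast
      then show False using n that q p insert.hyps by (auto simp: S_def dest: primes_dvd_imp_eq)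
    qed
    then show "m \<in> S" using n p by (auto simp: S_def Suc_le_eq prime_gt_0_nat)
  qed
  have "infsum f (S - (\<lambda>n. p * n) ` S) = infsum f S - infsum f ((\<lambda>n. p * n) ` S)"
    by (rule infsum_Diff[OF sf sf sub])
  also have "infsum f ((\<lambda>n. p * n) ` S) = infsum (f \<circ> (\<lambda>n. p * n)) S"
    using p by (intro infsum_reindex) (auto simp: inj_on_def prime_gt_0_nat)
  also have "\<dots> = infsum (\<lambda>n. \<xi> p * of_nat p powr (- s) * f n) S"
    by (intro infsum_cong) (simp add: f_def dcharD(4)[OF \<xi>] nat_powr_mult[simplified] mult_ac)
  also have "\<dots> = \<xi> p * of_nat p powr (- s) * infsum f S" by (rule infsum_cmult_right) (use sf in auto)
  finally have "infsum f (S - (\<lambda>n. p * n) ` S) = (1 - \<xi> p * of_nat p powr (- s)) * infsum f S" by (simp add: algebra_simps)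
  moreover have "infsum f S = dser \<xi> s * (\<Prod>p\<in>A. 1 - \<xi> p * of_nat p powr (- s))"
    using insert.IH insert.prems unfolding f_def S_def by simp
  moreover have "(\<Prod>p\<in>insert p A. 1 - \<xi> p * of_nat p powr (- s)) = (1 - \<xi> p * of_nat p powr (- s)) * (\<Prod>p\<in>A. 1 - \<xi> p * of_nat p powr (- s))"
    using insert.hyps by simp
  ultimately have "dser \<xi> s * (\<Prod>p\<in>insert p A. 1 - \<xi> p * of_nat p powr (- s)) = infsum f (S - (\<lambda>n. p * n) ` S)"
    by (simp only: mult.left_commute)
  then show ?case unfolding S' f_def .
qed

text \<open>After sieving by all primes below \<open>N\<close>, only \<open>n = 1\<close> and
  integers \<open>n \<ge> N\<close> remain, and the latter lie in the tail of a convergent series.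
  Stated as a limit of series times finite product, the Euler product needs no infinite product, and
  non-vanishing can be read off directly.\<close>

lemma dser_euler_limit:
  assumes \<xi>: "dchar l \<xi>" and s: "Re s > 1"
  shows "(\<lambda>N. dser \<xi> s * (\<Prod>p | prime p \<and> p < N. 1 - \<xi> p * of_nat p powr (- s))) \<longlonglongrightarrow> 1"
proof -
  define f where "f = (\<lambda>n. \<xi> n * of_nat n powr (- s))"
  have asf: "(\<lambda>n. norm (f n)) summable_on X" for X
    using abs_summable_on_dser[OF norm_dchar_le[OF \<xi>] s] unfolding f_def
    by (rule summable_on_subset_banach) auto
  have sf: "f summable_on X" for X using abs_summable_summable[OF asf] .
  have tail: "(\<lambda>N. infsum (\<lambda>n. norm (f n)) {N..}) \<longlonglongrightarrow> 0"
  proof -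
    have "infsum (\<lambda>n. norm (f n)) {N..} = infsum (\<lambda>n. norm (f n)) UNIV - (\<Sum>n<N. norm (f n))" for N
    proof -
      have "{N..} = UNIV - {..<N}" by auto
      then show ?thesis using infsum_Diff[OF asf asf, of "{..<N}" UNIV] by simp
    qed
    moreover have "(\<lambda>N. \<Sum>n<N. norm (f n)) \<longlonglongrightarrow> infsum (\<lambda>n. norm (f n)) UNIV"
      using has_sum_imp_sums[OF has_sum_infsum[OF asf[of UNIV]]] by (simp add: sums_def)
    ultimately show ?thesis using tendsto_diff[OF tendsto_const[of "infsum (\<lambda>n. norm (f n)) UNIV"]] by fastforce
  qed
  have bd: "norm (dser \<xi> s * (\<Prod>p | prime p \<and> p < N. 1 - \<xi> p * of_nat p powr (- s)) - 1) \<le> infsum (\<lambda>n. norm (f n)) {N..}" if N: "N \<ge> 2" for N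
  proof -
    define S where "S = {n::nat. n \<ge> 1 \<and> (\<forall>p\<in>{p. prime p \<and> p < N}. \<not> p dvd n)}"
    have "dser \<xi> s * (\<Prod>p | prime p \<and> p < N. 1 - \<xi> p * of_nat p powr (- s)) = infsum f S"
      unfolding f_def S_def by (rule dser_euler_finite[OF \<xi> s]) auto
    also have "S = insert 1 (S - {1})" by (auto simp: S_def)
    also have "infsum f \<dots> = f 1 + infsum f (S - {1})" by (rule infsum_insert) (use sf in auto)
    finally have "dser \<xi> s * (\<Prod>p | prime p \<and> p < N. 1 - \<xi> p * of_nat p powr (- s)) - 1 = infsum f (S - {1})"
      using dcharD(3)[OF \<xi>] by (simp add: f_def)
    also have "norm \<dots> \<le> infsum (\<lambda>n. norm (f n)) (S - {1})" by (rule norm_infsum_bound[OF asf])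
    also have "\<dots> \<le> infsum (\<lambda>n. norm (f n)) {N..}"
    proof (rule infsum_mono_neutral[OF asf asf])
      fix n assume "n \<in> (S - {1}) - {N..}"
      then have n: "n \<ge> 2" "n < N" "\<And>p. prime p \<Longrightarrow> p < N \<Longrightarrow> \<not> p dvd n" by (auto simp: S_def)
      obtain p where "prime p" "p dvd n" using n(1) prime_factor_nat[of n] by auto
      then have False using n dvd_imp_le[of p n] by fastforce
      then show "norm (f n) \<le> 0" ..
    qed auto
    finally show ?thesis .
  qed
  have "(\<lambda>N. dser \<xi> s * (\<Prod>p | prime p \<and> p < N. 1 - \<xi> p * of_nat p powr (- s)) - 1) \<longlonglongrightarrow> 0"
    by (rule Lim_null_comparison[OF _ tail]) (use bd in \<open>auto intro: eventually_sequentiallyI[of 2]\<close>)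
  then show ?thesis by (simp add: LIM_zero_iff)
qed

text \<open>The logarithm of the left side is minus a power series whose coefficients are
  nonnegative multiples of \<open>3 + 4 cos x + cos (2 x) = 2 (1 + cos x)^2\<close>. Working with a
  single factor avoids logarithms of L-functions.\<close>

lemma three_four_one_factor:
  fixes z :: complex
  assumes r: "0 \<le> r" "r < 1" and z: "norm z = 1"
  shows "(1 - r) ^ 3 * norm (1 - of_real r * z) ^ 4 * norm (1 - of_real r * z\<^sup>2) \<le> 1"
proof -
  have pos: "1 - of_real r * w \<noteq> 0" if "norm w = 1" for w :: complex
  proof
    assume "1 - of_real r * w = 0"
    then have "norm (of_real r * w) = 1" by (metis eq_iff_diff_eq_0 norm_one)
    then show False using that r by (simp add: norm_mult)
  qed
  \<comment> \<open>The logarithm series with its index starting at 0: the term \<open>n = 0\<close>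
    is a division by zero and counts as 0.\<close>
  have L: "(\<lambda>n. Re ((of_real r * w) ^ n) / real n) sums - ln (norm (1 - of_real r * w))" if w: "norm w = 1" for w :: complex
  proof -
    have "(\<lambda>n. - ((- (- (of_real r * w))) ^ n) / of_nat n) sums ln (1 + - (of_real r * w))"
      by (rule Ln_series') (use r w in \<open>simp add: norm_mult\<close>)
    from sums_Re[OF this] have "(\<lambda>n. - (Re ((of_real r * w) ^ n) / real n)) sums Re (Ln (1 - of_real r * w))"
      by (simp add: Re_divide_of_nat)
    from sums_minus[OF this] show ?thesis using pos[OF w] by simp
  qed
  have z2: "norm (z\<^sup>2) = 1" using z by (simp add: norm_power)
  have SS: "(\<lambda>n. 3 * (Re ((of_real r * 1) ^ n) / real n) + 4 * (Re ((of_real r * z) ^ n) / real n) + Re ((of_real r * z\<^sup>2) ^ n) / real n)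
      sums (3 * - ln (norm (1 - of_real r * 1 :: complex)) + 4 * - ln (norm (1 - of_real r * z)) + - ln (norm (1 - of_real r * z\<^sup>2)))"
    by (intro sums_add sums_mult L) (use z z2 in auto)
  have "0 \<le> 3 * - ln (norm (1 - of_real r * 1 :: complex)) + 4 * - ln (norm (1 - of_real r * z)) + - ln (norm (1 - of_real r * z\<^sup>2))"
  proof (rule sums_le[OF _ sums_zero SS])
    fix n
    define w where "w = z ^ n"
    have w: "(Re w)\<^sup>2 + (Im w)\<^sup>2 = 1" using z by (simp add: w_def cmod_power2[symmetric] norm_power)
    have "3 * (Re ((of_real r * 1) ^ n) / real n) + 4 * (Re ((of_real r * z) ^ n) / real n) + Re ((of_real r * z\<^sup>2) ^ n) / real n
       = r ^ n / real n * (3 + 4 * Re w + Re (w\<^sup>2))"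
      by (simp add: power_mult_distrib w_def power_mult[symmetric] mult.commute[of 2] flip: of_real_power) (simp add: algebra_simps add_divide_distrib)
    also have "3 + 4 * Re w + Re (w\<^sup>2) = 2 * (1 + Re w)\<^sup>2"
      using w by (simp add: Re_power2 power2_eq_square algebra_simps)
    finally show "0 \<le> 3 * (Re ((of_real r * 1) ^ n) / real n) + 4 * (Re ((of_real r * z) ^ n) / real n) + Re ((of_real r * z\<^sup>2) ^ n) / real n"
      using r by simp
  qed
  also have "norm (1 - of_real r * 1 :: complex) = 1 - r"
    using r by (metis abs_of_pos diff_gt_0_iff_gt mult.right_neutral norm_of_real of_real_1 of_real_diff)
  finally have "ln ((1 - r) ^ 3 * norm (1 - of_real r * z) ^ 4 * norm (1 - of_real r * z\<^sup>2)) \<le> 0"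
    using r pos[OF z] pos[OF z2] by (simp add: ln_mult ln_realpow)
  then show ?thesis using r pos[OF z] pos[OF z2] by (subst (asm) ln_le_zero_iff) auto
qed

text \<open>The factor inequality is applied prime by prime to the reciprocal Euler factors, and the
  limit of the Euler products is taken. With the principal character of the same modulus in the
  first place, all three factors are 1 at the primes dividing \<open>l\<close>.\<close>

lemma three_four_one:
  assumes \<xi>: "dchar l \<xi>" and \<sigma>: "\<sigma> > 1"
  defines "\<xi>0 \<equiv> (\<lambda>n. if coprime n l then 1 else 0)"
  shows "1 \<le> norm (dser \<xi>0 (of_real \<sigma>)) ^ 3 * norm (dser \<xi> (Complex \<sigma> t)) ^ 4 * norm (dser (\<lambda>n. \<xi> n ^ 2) (Complex \<sigma> (2 * t)))"
proof -
  have c0: "dchar l \<xi>0" unfolding \<xi>0_def by (rule dchar_principal) (rule dcharD(1)[OF \<xi>])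
  define P where "P = (\<lambda>\<psi> s N. \<Prod>p | prime p \<and> p < N. 1 - \<psi> p * of_nat p powr (- s) :: complex)"
  define D where "D = norm (dser \<xi>0 (of_real \<sigma>)) ^ 3 * norm (dser \<xi> (Complex \<sigma> t)) ^ 4 * norm (dser (\<lambda>n. \<xi> n ^ 2) (Complex \<sigma> (2 * t)))"
  have lim: "(\<lambda>N. norm (dser \<xi>0 (of_real \<sigma>) * P \<xi>0 (of_real \<sigma>) N) ^ 3 * norm (dser \<xi> (Complex \<sigma> t) * P \<xi> (Complex \<sigma> t) N) ^ 4
     * norm (dser (\<lambda>n. \<xi> n ^ 2) (Complex \<sigma> (2 * t)) * P (\<lambda>n. \<xi> n ^ 2) (Complex \<sigma> (2 * t)) N)) \<longlonglongrightarrow> norm (1::complex) ^ 3 * norm (1::complex) ^ 4 * norm (1::complex)"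
    unfolding P_def using \<sigma> by (intro tendsto_mult tendsto_power tendsto_norm dser_euler_limit[OF c0] dser_euler_limit[OF \<xi>] dser_euler_limit[OF dchar_square[OF \<xi>]]) auto
  have "norm (P \<xi>0 (of_real \<sigma>) N) ^ 3 * norm (P \<xi> (Complex \<sigma> t) N) ^ 4 * norm (P (\<lambda>n. \<xi> n ^ 2) (Complex \<sigma> (2 * t)) N) \<le> 1" for N
  proof -
    have "norm (P \<xi>0 (of_real \<sigma>) N) ^ 3 * norm (P \<xi> (Complex \<sigma> t) N) ^ 4 * norm (P (\<lambda>n. \<xi> n ^ 2) (Complex \<sigma> (2 * t)) N) = 
      (\<Prod>p | prime p \<and> p < N. norm (1 - \<xi>0 p * of_nat p powr (- of_real \<sigma>)) ^ 3 * norm (1 - \<xi> p * of_nat p powr (- Complex \<sigma> t)) ^ 4 * norm (1 - \<xi> p ^ 2 * of_nat p powr (- Complex \<sigma> (2 * t))))"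
      unfolding P_def by (simp add: prod_norm[symmetric] prod.distrib prod_power_distrib)
    also have "\<dots> \<le> 1"
    proof (rule prod_le_1, rule conjI)
      fix p assume "p \<in> {p. prime p \<and> p < N}"
      then have p: "prime p" "p \<ge> 2" by (auto intro: prime_ge_2_nat)
      show "norm (1 - \<xi>0 p * of_nat p powr (- of_real \<sigma>)) ^ 3 * norm (1 - \<xi> p * of_nat p powr (- Complex \<sigma> t)) ^ 4 * norm (1 - \<xi> p ^ 2 * of_nat p powr (- Complex \<sigma> (2 * t))) \<le> 1"
      proof (cases "coprime p l")
        case False
        then have "\<xi> p = 0" "\<xi>0 p = 0" using dcharD(6)[OF \<xi>, of p] by (auto simp: \<xi>0_def)
        then show ?thesis by simp
      next
        case True
        define r where "r = real p powr (- \<sigma>)"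
        define y where "y = exp (- \<i> * of_real (t * ln (real p)))"
        have r: "0 \<le> r" "r < 1"
        proof -
          show "0 \<le> r" by (simp add: r_def)
          have "real p powr (- \<sigma>) < real p powr 0" using p \<sigma> by (intro powr_less_mono) auto
          then show "r < 1" using p by (simp add: r_def)
        qed
        have pw: "of_nat p powr (- Complex \<sigma> u) = of_real r * exp (- \<i> * of_real (u * ln (real p)))" for u
        proof -
          have "(of_nat p powr (- Complex \<sigma> u) :: complex) = exp (- Complex \<sigma> u * of_real (ln (real p)))"
            using p by (simp add: powr_def Ln_of_nat)
          also have "- Complex \<sigma> u * of_real (ln (real p)) = of_real (- \<sigma> * ln (real p)) + (- \<i> * of_real (u * ln (real p)))"
            by (simp add: Complex_eq algebra_simps)
          also have "exp \<dots> = of_real (exp (- \<sigma> * ln (real p))) * exp (- \<i> * of_real (u * ln (real p)))"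
            by (simp only: exp_add exp_of_real)
          finally show ?thesis using p by (simp add: r_def powr_def)
        qed
        have y2: "exp (- \<i> * of_real (2 * t * ln (real p))) = y\<^sup>2"
          unfolding y_def exp_double[symmetric] by (simp add: algebra_simps)
        have p0: "(of_nat p powr (- of_real \<sigma>) :: complex) = of_real r" 
          using pw[of 0] by (simp add: Complex_eq)
        have ny: "norm (\<xi> p * y) = 1" using norm_dchar[OF \<xi>, of p] True by (simp add: norm_mult y_def)
        have n0: "norm (1 - \<xi>0 p * of_real r) = 1 - r"
          using True r by (simp add: \<xi>0_def) (metis abs_of_pos diff_gt_0_iff_gt norm_of_real of_real_1 of_real_diff)
        show ?thesis
          using three_four_one_factor[OF r ny]
          unfolding p0 n0 pw y2 y_def[symmetric] by (simp add: mult_ac power_mult_distrib)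
      qed
    qed auto
    finally show ?thesis .
  qed
  then have "norm (dser \<xi>0 (of_real \<sigma>) * P \<xi>0 (of_real \<sigma>) N) ^ 3 * norm (dser \<xi> (Complex \<sigma> t) * P \<xi> (Complex \<sigma> t) N) ^ 4
     * norm (dser (\<lambda>n. \<xi> n ^ 2) (Complex \<sigma> (2 * t)) * P (\<lambda>n. \<xi> n ^ 2) (Complex \<sigma> (2 * t)) N) \<le> D" for N
  proof -
    have "norm (dser \<xi>0 (of_real \<sigma>) * P \<xi>0 (of_real \<sigma>) N) ^ 3 * norm (dser \<xi> (Complex \<sigma> t) * P \<xi> (Complex \<sigma> t) N) ^ 4
     * norm (dser (\<lambda>n. \<xi> n ^ 2) (Complex \<sigma> (2 * t)) * P (\<lambda>n. \<xi> n ^ 2) (Complex \<sigma> (2 * t)) N) = 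
       D * (norm (P \<xi>0 (of_real \<sigma>) N) ^ 3 * norm (P \<xi> (Complex \<sigma> t) N) ^ 4 * norm (P (\<lambda>n. \<xi> n ^ 2) (Complex \<sigma> (2 * t)) N))"
      by (simp add: D_def norm_mult power_mult_distrib mult_ac)
    also have "\<dots> \<le> D * 1" by (intro mult_left_mono) (use \<open>\<And>N. _ \<le> 1\<close> in \<open>auto simp: D_def\<close>)
    finally show ?thesis by simp
  qed
  then have "norm (1::complex) ^ 3 * norm (1::complex) ^ 4 * norm (1::complex) \<le> D"
    by (intro LIMSEQ_le_const2[OF lim]) auto
  then show ?thesis by (simp add: D_def)
qed

section \<open>Continuation to the right half plane\<close>

text \<open>Bounded coefficients with mean \<alpha> and bounded discrepancy. This covers every
  character at once, with \<open>\<alpha> = 0\<close> in the nontrivial case.\<close>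

locale mean_coeffs =
  fixes a :: "nat \<Rightarrow> complex" and \<alpha> :: complex and E :: real
  assumes a_le: "norm (a n) \<le> 1"
    and disc: "norm ((\<Sum>n=1..N. a n) - \<alpha> * of_nat N) \<le> E"
begin

definition psum :: "nat \<Rightarrow> complex" where "psum N = (\<Sum>n=1..N. a n)"

text \<open>Equal to \<open>s (s - 1)\<close> times the integral of
  \<open>(psum N - \<alpha> x) x^(-s-1)\<close> over the interval from \<open>N\<close> to
  \<open>N + 1\<close>. This is summation by parts with the main term removed: the bracket stays
  bounded, so the series converges for \<open>Re s > 0\<close>, while the factor
  \<open>s - 1\<close> cancels the pole.\<close>

definition hterm :: "nat \<Rightarrow> complex \<Rightarrow> complex" where
  "hterm N s = (s - 1) * psum N * (of_nat N powr (- s) - of_nat (Suc N) powr (- s))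
     - \<alpha> * s * (of_nat N powr (1 - s) - of_nat (Suc N) powr (1 - s))"

text \<open>The continuation of \<open>(s - 1)\<close> times the Dirichlet series of \<open>a\<close> to \<open>Re s > 0\<close>.\<close>

definition H :: "complex \<Rightarrow> complex" where
  "H s = \<alpha> * s + (\<Sum>N. hterm (Suc N) s)"

lemma E_nonneg: "E \<ge> 0" using disc[of 0] by simp

lemma norm_alpha: "norm \<alpha> \<le> 1 + E"
proof -
  have "norm \<alpha> = norm (a 1 - (a 1 - \<alpha>))" by simp
  also have "\<dots> \<le> norm (a 1) + norm (a 1 - \<alpha>)" by (rule norm_triangle_ineq4)
  finally show ?thesis using disc[of 1] a_le[of 1] by simp
qed

lemma norm_psum: "norm (psum N) \<le> real N"
  unfolding psum_def using sum_norm_le[of "{1..N}" a "\<lambda>_. 1"] a_le by simp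

text \<open>The integral behind \<open>hterm\<close> is estimated as an increment of its
  antiderivative, by the mean value inequality on the segment from \<open>N\<close> to
  \<open>N + 1\<close>. There the discrepancy is at most
  \<open>E + norm \<alpha> \<le> 2 * E + 1\<close>.\<close>

lemma norm_hterm_le:
  assumes N: "N \<ge> 1" and s: "Re s > 0"
  shows "norm (hterm N s) \<le> norm s * norm (s - 1) * (2 * E + 1) * real N powr (- Re s - 1)"
proof -
  define \<psi> where "\<psi> = (\<lambda>w. \<alpha> * s * w powr (1 - s) - (s - 1) * psum N * w powr (- s))"
  define B where "B = norm s * norm (s - 1) * (2 * E + 1) * real N powr (- Re s - 1)"
  define S where "S = cbox (Complex (real N) 0) (Complex (real N + 1) 0)"
  have Sc: "convex S" unfolding S_def by (rule convex_box)
  have SD: "\<exists>u. w = of_real u \<and> real N \<le> u \<and> u \<le> real N + 1" if "w \<in> S" for w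
    using that by (intro exI[of _ "Re w"]) (auto simp: S_def cbox_def Basis_complex_def complex_eq_iff)
  have "norm (\<psi> (of_nat (Suc N)) - \<psi> (of_nat N)) \<le> B * norm (of_nat (Suc N) - of_nat N :: complex)"
  proof (rule field_differentiable_bound[OF Sc, where f' = "\<lambda>w. s * (s - 1) * w powr (- s - 1) * (psum N - \<alpha> * w)"])
    fix w assume w: "w \<in> S"
    then obtain u where u: "w = of_real u" "real N \<le> u" "u \<le> real N + 1" using SD by blast
    have u0: "u > 0" using u N by linarith
    have wn: "w \<notin> \<real>\<^sub>\<le>\<^sub>0" "w \<noteq> 0" using u u0 by (auto simp: complex_nonpos_Reals_iff)
    have "((\<lambda>w. w powr (1 - s)) has_field_derivative (1 - s) * w powr (1 - s - 1)) (at w)"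
      by (rule has_field_derivative_powr[OF wn(1)])
    moreover have "((\<lambda>w. w powr (- s)) has_field_derivative (- s) * w powr (- s - 1)) (at w)"
      by (rule has_field_derivative_powr[OF wn(1)])
    ultimately have "(\<psi> has_field_derivative \<alpha> * s * ((1 - s) * w powr (1 - s - 1)) - (s - 1) * psum N * ((- s) * w powr (- s - 1))) (at w)"
      unfolding \<psi>_def by (intro DERIV_diff DERIV_cmult)
    also have "w powr (1 - s - 1) = w * w powr (- s - 1)" using wn(2) by (simp add: powr_diff powr_minus field_simps)
    also have "\<alpha> * s * ((1 - s) * (w * w powr (- s - 1))) - (s - 1) * psum N * ((- s) * w powr (- s - 1)) = s * (s - 1) * w powr (- s - 1) * (psum N - \<alpha> * w)"
      by (simp add: algebra_simps)
    finally show "(\<psi> has_field_derivative s * (s - 1) * w powr (- s - 1) * (psum N - \<alpha> * w)) (at w within S)"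
      by (rule has_field_derivative_at_within)
    have 1: "norm (w powr (- s - 1)) \<le> real N powr (- Re s - 1)"
    proof -
      have "norm (w powr (- s - 1)) = u powr (- Re s - 1)" using u0 by (simp add: u norm_powr_real_powr)
      also have "\<dots> \<le> real N powr (- Re s - 1)" using u N s by (intro powr_mono2') auto
      finally show ?thesis .
    qed
    have 2: "norm (psum N - \<alpha> * w) \<le> 2 * E + 1"
    proof -
      have "psum N - \<alpha> * w = (psum N - \<alpha> * of_nat N) - \<alpha> * of_real (u - real N)" by (simp add: u algebra_simps)
      also have "norm \<dots> \<le> norm (psum N - \<alpha> * of_nat N) + norm (\<alpha> * of_real (u - real N))" by (rule norm_triangle_ineq4)
      also have "norm (\<alpha> * of_real (u - real N)) \<le> norm \<alpha> * 1" unfolding norm_mult norm_of_real using u by (intro mult_left_mono) auto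
      finally show ?thesis using disc[of N] norm_alpha by (simp add: psum_def)
    qed
    show "norm (s * (s - 1) * w powr (- s - 1) * (psum N - \<alpha> * w)) \<le> B"
    proof -
      have "norm s * norm (s - 1) * norm (w powr (- s - 1)) * norm (psum N - \<alpha> * w) \<le> norm s * norm (s - 1) * real N powr (- Re s - 1) * (2 * E + 1)"
        using 1 2 E_nonneg by (intro mult_mono mult_left_mono) auto
      then show ?thesis by (simp add: B_def norm_mult mult_ac)
    qed
  qed (auto simp: S_def cbox_def Basis_complex_def)
  moreover have "\<psi> (of_nat (Suc N)) - \<psi> (of_nat N) = hterm N s" by (simp add: \<psi>_def hterm_def algebra_simps)
  ultimately show ?thesis by (simp add: B_def)
qed

lemma summable_hterm_norm:
  assumes "Re s > 0"
  shows "summable (\<lambda>N. norm (hterm (Suc N) s))"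
proof (rule summable_comparison_test')
  have "summable (\<lambda>N. real N powr (- Re s - 1))" using assms by (simp add: summable_real_powr_iff)
  then have "summable (\<lambda>N. real (Suc N) powr (- Re s - 1))" by (subst summable_Suc_iff)
  then show "summable (\<lambda>N. norm s * norm (s - 1) * (2 * E + 1) * real (Suc N) powr (- Re s - 1))" by (rule summable_mult)
  show "norm (norm (hterm (Suc N) s)) \<le> norm s * norm (s - 1) * (2 * E + 1) * real (Suc N) powr (- Re s - 1)" if "N \<ge> 0" for N
    using norm_hterm_le[of "Suc N" s] assms by simp
qed

lemma summable_hterm: "Re s > 0 \<Longrightarrow> summable (\<lambda>N. hterm (Suc N) s)"
  using summable_hterm_norm by (rule summable_norm_cancel)

lemma holomorphic_H: "H holomorphic_on {s. Re s > 0}"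
proof -
  let ?S = "{s. Re s > 0}"
  have op: "open ?S" by (simp add: open_halfspace_Re_gt)
  have "(\<lambda>s. \<Sum>N. hterm (Suc N) s) holomorphic_on ?S"
  proof (rule holomorphic_uniform_sequence[OF op, of "\<lambda>n s. \<Sum>N<n. hterm (Suc N) s"])
    show "(\<lambda>s. \<Sum>N<n. hterm (Suc N) s) holomorphic_on ?S" for n
      unfolding hterm_def by (intro holomorphic_intros)
    fix x assume x: "x \<in> ?S"
    define d where "d = Re x / 2"
    have d: "d > 0" using x by (simp add: d_def)
    have cb: "Re s \<ge> d \<and> norm s \<le> norm x + d" if "s \<in> cball x d" for s
    proof -
      have "norm (x - s) \<le> d" using that by (simp add: dist_norm)
      then have "\<bar>Re (x - s)\<bar> \<le> d" using abs_Re_le_cmod[of "x - s"] by linarith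
      moreover have "norm s \<le> norm x + norm (x - s)" using norm_triangle_ineq4[of x "x - s"] by simp
      moreover have "Re x = 2 * d" by (simp add: d_def)
      ultimately show ?thesis using \<open>norm (x - s) \<le> d\<close> by auto
    qed
    define K where "K = (norm x + d) * (norm x + d + 1) * (2 * E + 1)"
    have "uniform_limit (cball x d) (\<lambda>n s. \<Sum>N<n. hterm (Suc N) s) (\<lambda>s. \<Sum>N. hterm (Suc N) s) sequentially"
    proof (rule Weierstrass_m_test)
      fix n s assume s: "s \<in> cball x d"
      note c = cb[OF s]
      have "norm (hterm (Suc n) s) \<le> norm s * norm (s - 1) * (2 * E + 1) * real (Suc n) powr (- Re s - 1)"
        using c d by (intro norm_hterm_le) auto
      also have "\<dots> \<le> (norm x + d) * (norm x + d + 1) * (2 * E + 1) * real (Suc n) powr (- d - 1)"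
      proof (intro mult_mono)
        show "norm (s - 1) \<le> norm x + d + 1" using c norm_triangle_ineq4[of s 1] by simp
        show "real (Suc n) powr (- Re s - 1) \<le> real (Suc n) powr (- d - 1)" using c by (intro powr_mono) auto
      qed (use c d E_nonneg in auto)
      finally show "norm (hterm (Suc n) s) \<le> K * real (Suc n) powr (- d - 1)" by (simp add: K_def)
    next
      have "summable (\<lambda>N. real N powr (- d - 1))" using d by (simp add: summable_real_powr_iff)
      then have "summable (\<lambda>N. real (Suc N) powr (- d - 1))" by (subst summable_Suc_iff)
      then show "summable (\<lambda>n. K * real (Suc n) powr (- d - 1))" by (rule summable_mult)
    qed
    moreover have "cball x d \<subseteq> ?S" using cb d by fastforce
    ultimately show "\<exists>d>0. cball x d \<subseteq> ?S \<and> uniform_limit (cball x d) (\<lambda>n s. \<Sum>N<n. hterm (Suc N) s) (\<lambda>s. \<Sum>N. hterm (Suc N) s) sequentially"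
      using d by blast
  qed
  then show ?thesis unfolding H_def[abs_def] by (intro holomorphic_intros)
qed

text \<open>Undoes the summation by parts at a finite stage. The summand \<open>\<alpha> * s\<close>
  is the lower boundary term of the telescoping main part.\<close>

lemma hterm_partial_sum:
  "(\<Sum>N<M. hterm (Suc N) s) + \<alpha> * s = (s - 1) * ((\<Sum>n=1..M. a n * of_nat n powr (- s)) - psum M * of_nat (Suc M) powr (- s)) + \<alpha> * s * of_nat (Suc M) powr (1 - s)"
proof (induction M)
  case (Suc M)
  have p: "psum (Suc M) = psum M + a (Suc M)" by (simp add: psum_def)
  have "(\<Sum>N<Suc M. hterm (Suc N) s) + \<alpha> * s = ((\<Sum>N<M. hterm (Suc N) s) + \<alpha> * s) + hterm (Suc M) s" by simp
  also have "\<dots> = (s - 1) * ((\<Sum>n=1..M. a n * of_nat n powr (- s)) - psum M * of_nat (Suc M) powr (- s)) + \<alpha> * s * of_nat (Suc M) powr (1 - s) + hterm (Suc M) s"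
    by (simp only: Suc.IH)
  also have "\<dots> = (s - 1) * ((\<Sum>n=1..Suc M. a n * of_nat n powr (- s)) - psum (Suc M) * of_nat (Suc (Suc M)) powr (- s)) + \<alpha> * s * of_nat (Suc (Suc M)) powr (1 - s)"
    by (simp only: hterm_def p) (simp add: algebra_simps del: of_nat_Suc)
  finally show ?case .
qed (simp add: psum_def)

text \<open>Comparison with the telescoping differences of \<open>2 / sqrt (n - 1)\<close>, in place
  of an integral test.\<close>

lemma powr_three_halves_le:
  assumes "M \<ge> 2"
  shows "summable (\<lambda>i. real (i + M) powr (- 3 / 2))" "(\<Sum>i. real (i + M) powr (- 3 / 2)) \<le> 4 / sqrt (real M)"
proof -
  define f where "f = (\<lambda>i. 2 / sqrt (real (i + M) - 1))"
  have "f \<longlonglongrightarrow> 0" unfolding f_def by real_asymp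
  then have tel: "(\<lambda>i. f i - f (Suc i)) sums (f 0 - 0)" by (rule telescope_sums')
  have le: "real (i + M) powr (- 3 / 2) \<le> f i - f (Suc i)" for i
  proof -
    define x y where "x = sqrt (real (i + M) - 1)" and "y = sqrt (real (i + M))"
    have x: "x > 0" "x \<le> y" "x\<^sup>2 = real (i + M) - 1" "y\<^sup>2 = real (i + M)" using assms by (auto simp: x_def y_def)
    have w: "real (i + M) > 0" using assms by simp
    have "real (i + M) powr (3 / 2) = real (i + M) powr (1 + 1 / 2)" by simp
    also have "\<dots> = real (i + M) powr 1 * real (i + M) powr (1 / 2)" by (rule powr_add)
    also have "\<dots> = y\<^sup>2 * y" unfolding powr_one[OF less_imp_le[OF w]] powr_half_sqrt[OF less_imp_le[OF w]] x(4)[unfolded y_def] y_def ..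
    finally have "real (i + M) powr (- 3 / 2) = 1 / (y\<^sup>2 * y)" 
      using powr_minus_divide[of "real (i + M)" "3 / 2"] by simp
    also have "\<dots> \<le> 2 / x - 2 / y"
    proof -
      have "(y - x) * (y + x) = 1" using x(3,4) by (simp add: algebra_simps power2_eq_square)
      then have yx: "y - x = 1 / (y + x)" using x(1,2) by (simp add: field_simps)
      have "2 / x - 2 / y = 2 * (y - x) / (x * y)" using x(1,2) by (simp add: field_simps)
      also have "\<dots> = 2 / ((y + x) * (x * y))" unfolding yx by simp
      finally have e: "2 / x - 2 / y = 2 / ((y + x) * (x * y))" .
      have "1 / (y\<^sup>2 * y) = 2 / ((y + y) * (y * y))" using x(1,2) by (simp add: power2_eq_square field_simps)
      also have "\<dots> \<le> 2 / ((y + x) * (x * y))" using x by (intro divide_left_mono mult_mono mult_pos_pos) auto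
      finally show ?thesis using e by simp
    qed
    finally show ?thesis by (simp add: f_def x_def y_def)
  qed
  show s: "summable (\<lambda>i. real (i + M) powr (- 3 / 2))"
    by (rule summable_comparison_test'[OF sums_summable[OF tel], of 0]) (use le in auto)
  have "(\<Sum>i. real (i + M) powr (- 3 / 2)) \<le> f 0" 
    using suminf_le[OF le s sums_summable[OF tel]] sums_unique[OF tel] by simp
  also have "f 0 \<le> 4 / sqrt (real M)"
  proof -
    have "sqrt (real M / 4) \<le> sqrt (real M - 1)" using assms by (intro real_sqrt_le_mono) auto
    then have "sqrt (real M) / 2 \<le> sqrt (real M - 1)" by (simp add: real_sqrt_divide)
    then have "2 / sqrt (real M - 1) \<le> 2 / (sqrt (real M) / 2)" using assms by (intro divide_left_mono) auto
    then show ?thesis by (simp add: f_def)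
  qed
  finally show "(\<Sum>i. real (i + M) powr (- 3 / 2)) \<le> 4 / sqrt (real M)" .
qed

text \<open>The exponent \<open>- Re s - 1\<close> is split as
  \<open>(1/2 - Re s) + (- 3/2)\<close>: the first part is frozen at the start of the tail, the
  second is summed. This gives one bound for all \<open>Re s \<ge> 1/2\<close>.\<close>

lemma H_tail:
  assumes s: "Re s \<ge> 1/2"
  shows "norm (H s - ((\<Sum>N<Suc M. hterm (Suc N) s) + \<alpha> * s)) \<le> norm s * norm (s - 1) * (2 * E + 1) * (4 * real (M + 2) powr (- Re s))"
proof -
  define Q where "Q = norm s * norm (s - 1) * (2 * E + 1)"
  have Q: "Q \<ge> 0" using E_nonneg by (simp add: Q_def)
  have sm: "summable (\<lambda>N. hterm (Suc N) s)" using s by (intro summable_hterm) auto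
  have smn: "summable (\<lambda>N. norm (hterm (Suc (N + Suc M)) s))"
    using summable_hterm_norm[of s] s by (subst summable_iff_shift[of "\<lambda>N. norm (hterm (Suc N) s)"]) auto
  have "H s - ((\<Sum>N<Suc M. hterm (Suc N) s) + \<alpha> * s) = (\<Sum>N. hterm (Suc (N + Suc M)) s)"
    unfolding H_def using suminf_split_initial_segment[OF sm, of "Suc M"] by simp
  also have "norm \<dots> \<le> (\<Sum>N. norm (hterm (Suc (N + Suc M)) s))" by (rule summable_norm[OF smn])
  also have "\<dots> \<le> (\<Sum>N. Q * real (M + 2) powr (1 / 2 - Re s) * real (N + (M + 2)) powr (- 3 / 2))"
  proof (rule suminf_le[OF _ smn])
    show "summable (\<lambda>N. Q * real (M + 2) powr (1 / 2 - Re s) * real (N + (M + 2)) powr (- 3 / 2))"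
      by (intro summable_mult powr_three_halves_le) auto
    fix N
    have "norm (hterm (Suc (N + Suc M)) s) \<le> Q * real (Suc (N + Suc M)) powr (- Re s - 1)"
      unfolding Q_def using s by (intro norm_hterm_le) auto
    also have "Suc (N + Suc M) = N + (M + 2)" by simp
    also have "real (N + (M + 2)) powr (- Re s - 1) = real (N + (M + 2)) powr (1 / 2 - Re s) * real (N + (M + 2)) powr (- 3 / 2)"
    proof -
      have "- Re s - 1 = (1 / 2 - Re s) + (- 3 / 2)" by simp
      then show ?thesis by (simp only: powr_add)
    qed
    also have "real (N + (M + 2)) powr (1 / 2 - Re s) \<le> real (M + 2) powr (1 / 2 - Re s)"
      using s by (intro powr_mono2') auto
    finally show "norm (hterm (Suc (N + Suc M)) s) \<le> Q * real (M + 2) powr (1 / 2 - Re s) * real (N + (M + 2)) powr (- 3 / 2)"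
      using Q by (simp add: mult_left_mono mult_right_mono mult.assoc)
  qed
  also have "\<dots> = Q * real (M + 2) powr (1 / 2 - Re s) * (\<Sum>N. real (N + (M + 2)) powr (- 3 / 2))"
    by (intro suminf_mult powr_three_halves_le) auto
  also have "\<dots> \<le> Q * real (M + 2) powr (1 / 2 - Re s) * (4 / sqrt (real (M + 2)))"
    using Q by (intro mult_left_mono powr_three_halves_le) auto
  also have "real (M + 2) powr (1 / 2 - Re s) = sqrt (real (M + 2)) * real (M + 2) powr (- Re s)"
    by (simp only: diff_conv_add_uminus powr_add) (simp add: powr_half_sqrt)
  also have "Q * (sqrt (real (M + 2)) * real (M + 2) powr (- Re s)) * (4 / sqrt (real (M + 2))) = Q * (4 * real (M + 2) powr (- Re s))"
    by (simp add: field_simps)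
  finally show ?thesis by (simp add: Q_def)
qed

lemma H_eq_dser:
  assumes s: "Re s > 1"
  shows "H s = (s - 1) * dser a s"
proof -
  have lim1: "(\<lambda>M. (\<Sum>N<M. hterm (Suc N) s) + \<alpha> * s) \<longlonglongrightarrow> H s"
    unfolding H_def using summable_LIMSEQ[OF summable_hterm[of s]] s
    by (subst add.commute) (intro tendsto_add tendsto_const, auto)
  have ps: "(\<lambda>M. \<Sum>n=1..M. a n * of_nat n powr (- s)) \<longlonglongrightarrow> dser a s"
  proof -
    have "(\<lambda>n. a n * of_nat n powr (- s)) sums dser a s"
      unfolding dser_def by (rule has_sum_imp_sums[OF has_sum_infsum[OF abs_summable_summable[OF abs_summable_on_dser[OF a_le s]]]])
    then have "(\<lambda>M. \<Sum>n<Suc M. a n * of_nat n powr (- s)) \<longlonglongrightarrow> dser a s"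
      unfolding sums_def by (rule LIMSEQ_Suc)
    moreover have "(\<Sum>n<Suc M. a n * of_nat n powr (- s)) = (\<Sum>n=1..M. a n * of_nat n powr (- s))" for M
      by (intro sum.mono_neutral_cong_right) auto
    ultimately show ?thesis by simp
  qed
  have p0: "(\<lambda>M. real (Suc M) powr (1 - Re s)) \<longlonglongrightarrow> 0" using s by real_asymp
  have q1: "(\<lambda>M. psum M * of_nat (Suc M) powr (- s)) \<longlonglongrightarrow> 0"
  proof (rule Lim_null_comparison[OF _ p0], intro always_eventually allI)
    fix M
    have "norm (psum M * of_nat (Suc M) powr (- s)) \<le> real (Suc M) * real (Suc M) powr (- Re s)"
      unfolding norm_mult norm_nat_powr using norm_psum[of M] by (intro mult_mono) auto
    also have "\<dots> = real (Suc M) powr (1 - Re s)" by (simp add: powr_diff powr_minus divide_inverse)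
    finally show "norm (psum M * of_nat (Suc M) powr (- s)) \<le> real (Suc M) powr (1 - Re s)" .
  qed
  have q2: "(\<lambda>M. of_nat (Suc M) powr (1 - s) :: complex) \<longlonglongrightarrow> 0"
    by (rule Lim_null_comparison[OF _ p0], intro always_eventually allI) (simp add: norm_nat_powr del: of_nat_Suc)
  have "(\<lambda>M. (s - 1) * ((\<Sum>n=1..M. a n * of_nat n powr (- s)) - psum M * of_nat (Suc M) powr (- s)) + \<alpha> * s * of_nat (Suc M) powr (1 - s))
     \<longlonglongrightarrow> (s - 1) * (dser a s - 0) + \<alpha> * s * 0"
    by (intro tendsto_add tendsto_mult tendsto_diff tendsto_const ps q1 q2)
  then have "(\<lambda>M. (\<Sum>N<M. hterm (Suc N) s) + \<alpha> * s) \<longlonglongrightarrow> (s - 1) * dser a s"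
    unfolding hterm_partial_sum by simp
  then show ?thesis using lim1 LIMSEQ_unique by blast
qed

text \<open>The series is cut at an \<open>M\<close> of size \<open>T\<close>. So close to the line,
  \<open>n powr (1 - Re s)\<close> stays bounded for all \<open>n\<close> up to the cut, so the
  finite part behaves like a harmonic sum. In the tail, \<open>norm s\<close> is at most
  \<open>2 * T\<close> and is cancelled by \<open>1 / M\<close>.\<close>

lemma H_upper:
  assumes T: "T \<ge> 3" and s: "Re s \<ge> 1 - 1 / (2 * ln T)" "Re s \<le> 3" "\<bar>Im s\<bar> \<le> T"
  shows "norm (H s) \<le> (40 + 60 * E) * (norm (s - 1) * ln T + norm s)"
proof -
  define M where "M = nat \<lceil>T\<rceil>"
  have M: "T \<le> real M" "real M \<le> T + 1"
    using T unfolding M_def by linarith+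
  have lT: "ln T \<ge> 1"
  proof -
    have "exp 1 \<le> T" using T exp_le by linarith
    then show ?thesis using T by (simp add: ln_ge_iff)
  qed
  have half: "Re s \<ge> 1/2"
  proof -
    have "1 / (2 * ln T) \<le> 1 / (2 * 1)" using lT by (intro divide_left_mono) auto
    then show ?thesis using s by linarith
  qed
  have lM: "ln (real (M + 1)) \<le> 2 * ln T"
  \<comment> \<open>From \<open>M + 1 \<le> T^2\<close> the logarithm at the cut is at most
    \<open>2 * ln T\<close>; against the width \<open>1 / (2 * ln T)\<close> this makes the exponent
    in \<open>pw\<close> at most 1, whence \<open>exp 1 \<le> 3\<close>.\<close>
  proof -
    have "3 * T \<le> T * T" using T by (intro mult_right_mono) auto
    moreover have "real (M + 1) \<le> 3 * T" using M T by simp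
    ultimately have "real (M + 1) \<le> T ^ 2" unfolding power2_eq_square by linarith
    then have "ln (real (M + 1)) \<le> ln (T ^ 2)" using M T by (subst ln_le_cancel_iff) auto
    then show ?thesis using T by (simp add: ln_realpow)
  qed
  have pw: "real n powr (1 - Re s) \<le> 3" if n: "1 \<le> n" "n \<le> M + 1" for n
  proof -
    have ln: "ln (real n) \<le> ln (real (M + 1))" "ln (real n) \<ge> 0" using n by auto
    have "(1 - Re s) * ln (real n) \<le> (1 / (2 * ln T)) * ln (real n)" using s ln by (intro mult_right_mono) auto
    also have "\<dots> \<le> (1 / (2 * ln T)) * (2 * ln T)" using ln lM lT by (intro mult_left_mono) auto
    also have "\<dots> = 1" using lT by simp
    finally have "exp ((1 - Re s) * ln (real n)) \<le> exp 1" by (subst exp_le_cancel_iff)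
    then have "exp ((1 - Re s) * ln (real n)) \<le> 3" using exp_le by linarith
    then show ?thesis using n by (simp add: powr_def)
  qed
  have pw1: "real n powr (- Re s) \<le> 3 * (1 / real n)" if n: "1 \<le> n" "n \<le> M + 1" for n
  proof -
    have "real n powr (- Re s) = real n powr (1 - Re s) / real n" using n by (simp add: powr_diff powr_minus field_simps)
    also have "\<dots> \<le> 3 / real n" using pw[OF n] by (intro divide_right_mono) auto
    finally show ?thesis by simp
  qed
  obtain M' where M': "M = Suc M'" using M T by (cases M) auto
  have t1: "norm (\<Sum>n=1..M. a n * of_nat n powr (- s)) \<le> 9 * ln T"
  proof -
    have "norm (\<Sum>n=1..M. a n * of_nat n powr (- s)) \<le> (\<Sum>n=1..M. 3 * (1 / real n))"
    proof (rule sum_norm_le)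
      fix n assume n: "n \<in> {1..M}"
      have "norm (a n * of_nat n powr (- s)) \<le> 1 * real n powr (- Re s)"
        unfolding norm_mult norm_nat_powr using n a_le[of n] by (intro mult_mono) auto
      then show "norm (a n * of_nat n powr (- s)) \<le> 3 * (1 / real n)" using pw1[of n] n by simp
    qed
    also have "\<dots> = 3 * (\<Sum>n=1..M. 1 / real n)" by (simp add: sum_distrib_left)
    also have "\<dots> \<le> 3 * (1 + ln (real M))" using M' by (intro mult_left_mono harm_le) auto
    also have "\<dots> \<le> 3 * (1 + ln (real (M + 1)))" using M' by simp
    also have "\<dots> \<le> 9 * ln T" using lM lT by simp
    finally show ?thesis .
  qed
  have t2: "norm (psum M * of_nat (Suc M) powr (- s)) \<le> 3"
  proof -
    have "norm (psum M * of_nat (Suc M) powr (- s)) \<le> real (Suc M) * (3 * (1 / real (Suc M)))"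
      unfolding norm_mult norm_nat_powr using norm_psum[of M] pw1[of "Suc M"] by (intro mult_mono) auto
    also have "\<dots> = 3" by (simp del: of_nat_Suc)
    finally show ?thesis .
  qed
  have t3: "norm (\<alpha> * s * of_nat (Suc M) powr (1 - s)) \<le> (1 + E) * norm s * 3"
    unfolding norm_mult norm_nat_powr using pw[of "Suc M"] norm_alpha E_nonneg by (intro mult_mono) auto
  have t4: "norm s * norm (s - 1) * (2 * E + 1) * (4 * real (M' + 2) powr (- Re s)) \<le> norm (s - 1) * (2 * E + 1) * 24"
  proof -
    have "norm s \<le> \<bar>Re s\<bar> + \<bar>Im s\<bar>" by (rule cmod_le)
    then have ns: "norm s \<le> 2 * T" using s half T by linarith
    have "real (M' + 2) powr (- Re s) \<le> 3 * (1 / real (M' + 2))" using M' by (intro pw1) auto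
    also have "\<dots> \<le> 3 * (1 / T)" using M M' T by (intro mult_left_mono divide_left_mono) auto
    finally have "norm s * real (M' + 2) powr (- Re s) \<le> 2 * T * (3 * (1 / T))" using ns T by (intro mult_mono) auto
    then have "norm s * real (M' + 2) powr (- Re s) \<le> 6" using T by simp
    then have "norm (s - 1) * (2 * E + 1) * 4 * (norm s * real (M' + 2) powr (- Re s)) \<le> norm (s - 1) * (2 * E + 1) * 4 * 6"
      using E_nonneg by (intro mult_left_mono) auto
    then show ?thesis by (simp add: mult_ac)
  qed
  define Z where "Z = (\<Sum>N<Suc M'. hterm (Suc N) s) + \<alpha> * s"
  have "Z = (s - 1) * ((\<Sum>n=1..M. a n * of_nat n powr (- s)) - psum M * of_nat (Suc M) powr (- s)) + \<alpha> * s * of_nat (Suc M) powr (1 - s)"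
    unfolding Z_def M' by (rule hterm_partial_sum)
  also have "norm \<dots> \<le> norm (s - 1) * (norm (\<Sum>n=1..M. a n * of_nat n powr (- s)) + norm (psum M * of_nat (Suc M) powr (- s))) + norm (\<alpha> * s * of_nat (Suc M) powr (1 - s))"
    by (intro order_trans[OF norm_triangle_ineq] add_right_mono order_trans[OF norm_mult_ineq] mult_left_mono norm_triangle_ineq4) auto
  also have "\<dots> \<le> norm (s - 1) * (9 * ln T + 3) + (1 + E) * norm s * 3"
    using t1 t2 t3 by (intro add_mono mult_left_mono) auto
  finally have Z: "norm Z \<le> norm (s - 1) * (9 * ln T + 3) + (1 + E) * norm s * 3" .
  have "norm (H s) \<le> norm Z + norm (H s - Z)" using norm_triangle_ineq[of Z "H s - Z"] by simp
  also have "norm (H s - Z) \<le> norm (s - 1) * (2 * E + 1) * 24"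
    unfolding Z_def using H_tail[OF half, of M'] t4 by linarith
  finally have "norm (H s) \<le> norm (s - 1) * (9 * ln T + 3) + (1 + E) * norm s * 3 + norm (s - 1) * (2 * E + 1) * 24" using Z by linarith
  also have "norm (s - 1) * (9 * ln T + 3) \<le> norm (s - 1) * (12 * ln T)" using lT by (intro mult_left_mono) auto
  also have "norm (s - 1) * (2 * E + 1) * 24 \<le> norm (s - 1) * (2 * E + 1) * (24 * ln T)" using lT E_nonneg by (intro mult_left_mono) auto
  also have "norm (s - 1) * (12 * ln T) + (1 + E) * norm s * 3 + norm (s - 1) * (2 * E + 1) * (24 * ln T) = (36 + 48 * E) * (norm (s - 1) * ln T) + (3 + 3 * E) * norm s"
    by (simp add: algebra_simps)
  also have "\<dots> \<le> (40 + 60 * E) * (norm (s - 1) * ln T) + (40 + 60 * E) * norm s"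
    using E_nonneg lT by (intro add_mono mult_right_mono) auto
  finally show ?thesis by (simp add: distrib_left)
qed

end

section \<open>Non-vanishing for real characters\<close>

lemma divisor_sum_prime_power_mult:
  fixes x :: "nat \<Rightarrow> real"
  assumes mult: "\<And>m n. x (m * n) = x m * x n" "x 1 = 1" and p: "prime p" "\<not> p dvd m" "m > 0"
  shows "(\<Sum>d | d dvd p ^ k * m. x d) = (\<Sum>i\<le>k. x p ^ i) * (\<Sum>d | d dvd m. x d)"
proof -
  have xp: "x (p ^ i) = x p ^ i" for i by (induction i) (use mult in auto)
  have pp: "p ^ i > 0" for i using p by (simp add: prime_gt_0_nat)
  have cop: "coprime (p ^ i) d" if "d dvd m" for i d
  proof -
    have "\<not> p dvd d" using p that by (auto dest: dvd_trans)
    then have "coprime p d" using p by (intro prime_imp_coprime) auto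
    then show ?thesis by simp
  qed
  have "(\<Sum>i\<le>k. x p ^ i) * (\<Sum>d | d dvd m. x d) = (\<Sum>(i,d)\<in>{..k} \<times> {d. d dvd m}. x (p ^ i * d))"
    unfolding sum_product sum.cartesian_product by (simp only: mult(1) xp)
  also have "\<dots> = (\<Sum>d\<in>(\<lambda>(i,d). p ^ i * d) ` ({..k} \<times> {d. d dvd m}). x d)"
  proof (rule sum.reindex_cong[symmetric, where l = "\<lambda>(i,d). p ^ i * d"])
    show "inj_on (\<lambda>(i,d). p ^ i * d) ({..k} \<times> {d. d dvd m})"
    proof (rule inj_onI, clarify)
      fix i d j e assume d: "d dvd m" and e: "e dvd m" and eq: "p ^ i * d = p ^ j * e"
      have nd: "\<not> p dvd d" "\<not> p dvd e" using d e p by (auto dest: dvd_trans)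
      have d0: "d > 0" "e > 0" using d e p(3) by (auto intro!: Nat.gr0I)
      have "multiplicity p (p ^ i * d) = i" "multiplicity p (p ^ j * e) = j"
        using nd d0 p by (auto simp: prime_elem_multiplicity_mult_distrib not_dvd_imp_multiplicity_0)
      then have "i = j" using eq by simp
      then show "i = j \<and> d = e" using eq prime_gt_0_nat[OF p(1)] by simp
    qed
  qed auto
  also have "(\<lambda>(i,d). p ^ i * d) ` ({..k} \<times> {d. d dvd m}) = {d. d dvd p ^ k * m}"
  proof (intro equalityI subsetI)
    fix d assume "d \<in> {d. d dvd p ^ k * m}"
    then have "d dvd p ^ k * m" by simp
    then obtain b c where bc: "d = b * c" "b dvd p ^ k" "c dvd m" by (rule division_decomp[THEN exE]) auto
    then obtain i where "i \<le> k" "b = p ^ i" using divides_primepow_nat[OF p(1)] by auto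
    then show "d \<in> (\<lambda>(i,d). p ^ i * d) ` ({..k} \<times> {d. d dvd m})" using bc by (intro image_eqI[of _ _ "(i, c)"]) auto
  qed (auto intro!: mult_dvd_mono le_imp_power_dvd)
  finally show ?thesis by simp
qed

text \<open>The divisor sum is multiplicative, and at a prime power it is a geometric sum with ratio
  0, 1 or -1: never negative, and at least 1 for even exponents. The powers of 4 supply infinitely
  many arguments with value at least 1.\<close>

lemma real_character_divisor_sum:
  fixes x :: "nat \<Rightarrow> real"
  assumes mult: "\<And>m n. x (m * n) = x m * x n" "x 1 = 1" and vals: "\<And>n. x n \<in> {0, 1, -1}"
  shows "m > 0 \<Longrightarrow> (\<Sum>d | d dvd m. x d) \<ge> 0" "(\<Sum>d | d dvd (2::nat) ^ (2 * i). x d) \<ge> 1"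
proof -
  have geo: "(\<Sum>i\<le>k. x p ^ i) \<ge> 0" "even k \<Longrightarrow> (\<Sum>i\<le>k. x p ^ i) \<ge> 1" for p k
  proof -
    have g: "(\<Sum>i\<le>k. (-1::real) ^ i) = (if even k then 1 else 0)" by (induction k) auto
    have g0: "(\<Sum>i\<le>k. (0::real) ^ i) = 1" by (induction k) auto
    consider "x p = 0" | "x p = 1" | "x p = -1" using vals[of p] by auto
    then show "(\<Sum>i\<le>k. x p ^ i) \<ge> 0" "even k \<Longrightarrow> (\<Sum>i\<le>k. x p ^ i) \<ge> 1"
      by (cases; simp add: g g0)+
  qed
  show "(\<Sum>d | d dvd m. x d) \<ge> 0" if "m > 0"
    using that
  proof (induction m rule: less_induct)
    case (less m)
    show ?case
    proof (cases "m = 1")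
      case True then show ?thesis using mult by simp
    next
      case False
      then obtain p where p: "prime p" "p dvd m" using prime_factor_nat by blast
      obtain m' where m': "m = p ^ multiplicity p m * m'" "\<not> p dvd m'"
        using multiplicity_decompose'[of m p] less.prems p by (metis gr0_conv_Suc nat.simps(3) not_prime_unit)
      have m'0: "m' > 0" using m' less.prems by (cases m') auto
      have "m' < m"
      proof -
        have "m' \<noteq> m" using m'(2) p(2) by auto
        moreover have "m' dvd m" using m'(1) by (metis dvd_triv_right)
        ultimately show ?thesis using less.prems dvd_imp_le by fastforce
      qed
      have "(\<Sum>d | d dvd m. x d) = (\<Sum>i\<le>multiplicity p m. x p ^ i) * (\<Sum>d | d dvd m'. x d)"
        by (subst m'(1)) (rule divisor_sum_prime_power_mult[OF mult p(1) m'(2) m'0])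
      then show ?thesis using geo(1)[of p "multiplicity p m"] less.IH[OF \<open>m' < m\<close> m'0] by simp
    qed
  qed
  have "(\<Sum>d | d dvd (2::nat) ^ (2 * i) * 1. x d) = (\<Sum>j\<le>2 * i. x 2 ^ j) * (\<Sum>d | d dvd (1::nat). x d)"
    by (rule divisor_sum_prime_power_mult[OF mult]) auto
  then show "(\<Sum>d | d dvd (2::nat) ^ (2 * i). x d) \<ge> 1" using geo(2)[of "2 * i" 2] mult by simp
qed

lemma abel_sum_real:
  fixes a b :: "nat \<Rightarrow> real"
  shows "(\<Sum>n=1..N. a n * b n) = (\<Sum>n=1..N. a n) * b N + (\<Sum>n=1..<N. (\<Sum>k=1..n. a k) * (b n - b (Suc n)))"
proof (induction N)
  case (Suc N)
  then show ?case by (cases "N = 0") (auto simp: algebra_simps)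
qed auto

text \<open>The arithmetic-geometric mean inequality, applied to the terms with indices
  \<open>i\<close> and \<open>n - 1 - i\<close>, whose product is independent of
  \<open>i\<close>.\<close>

lemma geometric_sum_ge:
  fixes y :: real
  assumes "0 < y" "y < 1" "n \<ge> 1"
  shows "(1 - y ^ (2 * n)) / (1 - y\<^sup>2) \<ge> real n * y ^ (n - 1)"
proof -
  have y2: "y\<^sup>2 \<noteq> 1" using assms by (simp add: power2_eq_1_iff)
  have g: "(1 - y ^ (2 * n)) / (1 - y\<^sup>2) = (\<Sum>i<n. (y\<^sup>2) ^ i)"
    using y2 by (simp add: sum_gp_strict power_mult)
  have r: "(\<Sum>i<n. (y\<^sup>2) ^ i) = (\<Sum>i<n. (y\<^sup>2) ^ (n - Suc i))" by (rule sum.nat_diff_reindex[symmetric])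
  have "2 * (real n * y ^ (n - 1)) = (\<Sum>i<n. 2 * y ^ (n - 1))" by simp
  also have "\<dots> \<le> (\<Sum>i<n. (y\<^sup>2) ^ i + (y\<^sup>2) ^ (n - Suc i))"
  proof (rule sum_mono)
    fix i assume "i \<in> {..<n}"
    then have e: "n - 1 = i + (n - Suc i)" by auto
    have "0 \<le> (y ^ i - y ^ (n - Suc i))\<^sup>2" by simp
    then have "2 * (y ^ i * y ^ (n - Suc i)) \<le> (y ^ i)\<^sup>2 + (y ^ (n - Suc i))\<^sup>2" by (simp add: power2_eq_square algebra_simps)
    then show "2 * y ^ (n - 1) \<le> (y\<^sup>2) ^ i + (y\<^sup>2) ^ (n - Suc i)"
      unfolding e power_add by (simp add: power_mult[symmetric] mult.commute)
  qed
  also have "\<dots> = 2 * (\<Sum>i<n. (y\<^sup>2) ^ i)" unfolding sum.distrib using r by simp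
  finally show ?thesis unfolding g by simp
qed

text \<open>Monsky's argument: compare the Lambert series of \<open>x\<close> with \<open>1 / (1 - t)\<close> times the vanishing sum.\<close>

lemma real_character_L1_nonzero:
  fixes x :: "nat \<Rightarrow> real"
  assumes mult: "\<And>m n. x (m * n) = x m * x n" "x 1 = 1" and vals: "\<And>n. x n \<in> {0, 1, -1}"
    and bnd: "\<And>N. \<bar>\<Sum>n=1..N. x n\<bar> \<le> E" and lim: "(\<lambda>N. \<Sum>n=1..N. x n / real n) \<longlonglongrightarrow> 0"
  shows False
proof -
  have x1: "\<bar>x n\<bar> \<le> 1" for n using vals[of n] by auto
  have main: "(\<Sum>i<K. t ^ (2 ^ (2 * i))) \<le> E" if t: "0 < t" "t < 1" for t and K :: nat
  proof -
    \<comment> \<open>The kernel \<open>t^n / (1 - t^n)\<close> of the Lambert series compared with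
      its singular part at \<open>t = 1\<close>. In the limit the sum of \<open>x n / n\<close>
      vanishes, so replacing one by the other only changes the sign. The kernel \<open>b\<close>
      decreases from 1 to 0, so the bounded partial sums of \<open>x\<close> bound the result
      uniformly in \<open>t\<close>.\<close>
    define b where "b = (\<lambda>n. 1 / (real n * (1 - t)) - t ^ n / (1 - t ^ n))"
    have tn: "t ^ n < 1" if "n \<ge> 1" for n using t that by (simp add: power_less_one_iff)
    have b1: "b 1 = 1" using t by (simp add: b_def field_simps)
    \<comment> \<open>Clearing denominators, the claim is \<open>n (n + 1) t^n \<le> u * v\<close>
      with geometric sums \<open>u\<close> and \<open>v\<close>. Their lower bounds multiply to
      \<open>n (n + 1) y^(2n-1)\<close>, which suffices as \<open>t = y^2\<close> and
      \<open>y < 1\<close>.\<close>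
    have dec: "b n \<ge> b (Suc n)" if n: "n \<ge> 1" for n
    proof -
      define y where "y = sqrt t"
      have y: "0 < y" "y < 1" "y\<^sup>2 = t" using t by (auto simp: y_def)
      define u v where "u = (1 - t ^ n) / (1 - t)" and "v = (1 - t ^ Suc n) / (1 - t)"
      have tp: "t ^ k = y ^ (2 * k)" for k by (simp add: y(3)[symmetric] power_mult)
      have u: "u \<ge> real n * y ^ (n - 1)" unfolding u_def tp using geometric_sum_ge[OF y(1,2) n] by (simp add: y(3))
      have v: "v \<ge> real (Suc n) * y ^ n" unfolding v_def tp using geometric_sum_ge[OF y(1,2), of "Suc n"] by (simp add: y(3))
      have up: "u > 0" "v > 0" using tn[OF n] tn[of "Suc n"] t by (auto simp: u_def v_def)
      have "real n * real (Suc n) * t ^ n \<le> (real n * y ^ (n - 1)) * (real (Suc n) * y ^ n)"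
      proof -
        have "t ^ n = y ^ (n - 1) * y ^ n * y" unfolding tp using n by (simp add: power_add[symmetric] mult_2 flip: power_Suc2)
        also have "\<dots> \<le> y ^ (n - 1) * y ^ n * 1" using y by (intro mult_left_mono) auto
        finally have "real n * real (Suc n) * t ^ n \<le> real n * real (Suc n) * (y ^ (n - 1) * y ^ n)" by (intro mult_left_mono) auto
        then show ?thesis by (simp only: mult_ac)
      qed
      also have "\<dots> \<le> u * v" using u v up y by (intro mult_mono) auto
      finally have uv: "t ^ n / (u * v) \<le> 1 / (real n * real (Suc n))" using up n by (simp add: field_simps del: of_nat_Suc)
      have "(1 - t) * (b n - b (Suc n)) = 1 / (real n * real (Suc n)) - t ^ n / (u * v)"
      proof -
        have e1: "1 / (real n * (1 - t)) - 1 / (real (Suc n) * (1 - t)) = 1 / (real n * real (Suc n)) / (1 - t)"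
        proof -
          have "1 / real n - 1 / real (Suc n) = 1 / (real n * real (Suc n))" using n by (simp add: field_simps)
          then have "(1 / real n - 1 / real (Suc n)) / (1 - t) = 1 / (real n * real (Suc n)) / (1 - t)" by simp
          then show ?thesis by (simp add: diff_divide_distrib)
        qed
        have e2: "t ^ n / (1 - t ^ n) - t ^ Suc n / (1 - t ^ Suc n) = t ^ n * (1 - t) / ((1 - t ^ n) * (1 - t ^ Suc n))"
          using tn[OF n] tn[of "Suc n"] by (simp add: field_simps)
        have e3: "t ^ n / (u * v) = (1 - t) * (t ^ n * (1 - t) / ((1 - t ^ n) * (1 - t ^ Suc n)))"
          using t by (simp add: u_def v_def field_simps)
        have "b n - b (Suc n) = 1 / (real n * real (Suc n)) / (1 - t) - t ^ n * (1 - t) / ((1 - t ^ n) * (1 - t ^ Suc n))"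
          unfolding e1[symmetric] e2[symmetric] b_def by simp
        moreover have "(1 - t) * (X / (1 - t) - Y) = X - (1 - t) * Y" for X Y using t by (simp add: right_diff_distrib)
        ultimately show ?thesis unfolding e3 by (simp only:)
      qed
      then have "(1 - t) * (b n - b (Suc n)) \<ge> 0" using uv by simp
      then show ?thesis using t by (simp add: zero_le_mult_iff)
    qed
    have blim: "b \<longlonglongrightarrow> 0"
    proof -
      have l0: "(\<lambda>n. t ^ n) \<longlonglongrightarrow> 0" using t by (intro LIMSEQ_power_zero) auto
      have "(\<lambda>n. t ^ n / (1 - t ^ n)) \<longlonglongrightarrow> 0 / (1 - 0)" by (intro tendsto_divide tendsto_diff tendsto_const l0) auto
      moreover have "(\<lambda>n. 1 / (real n * (1 - t))) \<longlonglongrightarrow> 0" using t by real_asymp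
      ultimately show ?thesis unfolding b_def using tendsto_diff by fastforce
    qed
    have b0: "b n \<ge> 0" if "n \<ge> 1" for n
    proof (rule LIMSEQ_le_const2[OF blim])
      have "b m \<le> b n" if "m \<ge> n" for m using that
      proof (induction m rule: dec_induct)
        case (step m) then show ?case using dec[of m] \<open>n \<ge> 1\<close> by simp
      qed auto
      then show "\<exists>N. \<forall>m\<ge>N. b m \<le> b n" by blast
    qed
    have E0: "E \<ge> 0" using bnd[of 0] by simp
    have part: "\<bar>\<Sum>n=1..N. x n * b n\<bar> \<le> E" if N: "N \<ge> 1" for N
    proof -
      have "\<bar>\<Sum>n=1..N. x n * b n\<bar> \<le> \<bar>(\<Sum>n=1..N. x n) * b N\<bar> + \<bar>\<Sum>n=1..<N. (\<Sum>k=1..n. x k) * (b n - b (Suc n))\<bar>"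
        unfolding abel_sum_real by (rule abs_triangle_ineq)
      also have "\<bar>(\<Sum>n=1..N. x n) * b N\<bar> \<le> E * b N" unfolding abs_mult using bnd[of N] b0[OF N] E0 by (intro mult_mono) auto
      also have "\<bar>\<Sum>n=1..<N. (\<Sum>k=1..n. x k) * (b n - b (Suc n))\<bar> \<le> (\<Sum>n=1..<N. E * (b n - b (Suc n)))"
      proof (rule order_trans[OF sum_abs sum_mono])
        fix n assume "n \<in> {1..<N}"
        then have "b n - b (Suc n) \<ge> 0" using dec[of n] by simp
        then show "\<bar>(\<Sum>k=1..n. x k) * (b n - b (Suc n))\<bar> \<le> E * (b n - b (Suc n))" unfolding abs_mult using bnd[of n] E0 by (intro mult_mono) auto
      qed
      also have "\<dots> = E * (b 1 - b N)"
      proof -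
        have "(\<Sum>n=1..<N. b n - b (Suc n)) = b 1 - b N" using N by (induction N rule: dec_induct) auto
        then show ?thesis by (simp add: sum_distrib_left[symmetric])
      qed
      finally show ?thesis by (simp add: b1[unfolded One_nat_def] algebra_simps)
    qed
    define F where "F = (\<lambda>d m. complex_of_real (x d * t ^ (d * m)))"
    have gs: "((\<lambda>m. t ^ (d * m)) has_sum (t ^ d / (1 - t ^ d))) {1..}" if d: "d \<ge> 1" for d
    proof -
      have td: "t ^ d < 1" "t ^ d \<ge> 0" using tn[OF d] t by auto
      have "(\<lambda>m. (t ^ d) ^ m) sums (1 / (1 - t ^ d))" using td by (intro geometric_sums) auto
      then have "(\<lambda>m. (t ^ d) ^ (Suc m)) sums (1 / (1 - t ^ d) - 1)" by (subst sums_Suc_iff) simp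
      also have "1 / (1 - t ^ d) - 1 = t ^ d / (1 - t ^ d)" using td by (simp add: field_simps)
      finally have "(\<lambda>m. t ^ (d * Suc m)) sums (t ^ d / (1 - t ^ d))" by (simp only: power_mult)
      then have hsu: "((\<lambda>m. t ^ (d * Suc m)) has_sum (t ^ d / (1 - t ^ d))) UNIV"
        using t by (intro norm_summable_imp_has_sum) (auto simp: sums_iff)
      have "bij_betw Suc UNIV {1..}" by (rule bij_betwI[of _ _ _ "\<lambda>n. n - 1"]) auto
      from has_sum_reindex_bij_betw[OF this, of "\<lambda>m. t ^ (d * m)"] hsu show ?thesis by blast
    qed
    have Fs: "(\<lambda>(d,m). norm (F d m)) summable_on ({1..} \<times> {1..})"
    proof (rule summable_on_SigmaI)
      fix d :: nat assume d: "d \<in> {1..}"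
      show "((\<lambda>m. (\<lambda>(d,m). norm (F d m)) (d, m)) has_sum (\<bar>x d\<bar> * (t ^ d / (1 - t ^ d)))) {1..}"
        using has_sum_cmult_right[OF gs[of d], of "\<bar>x d\<bar>"] d t by (simp add: F_def norm_mult norm_power)
    next
      have s1: "(\<lambda>d. (1 / (1 - t)) * t ^ d) summable_on {1..}"
        using has_sum_imp_summable[OF gs[of 1]] by (intro summable_on_cmult_right) simp
      show "(\<lambda>d. \<bar>x d\<bar> * (t ^ d / (1 - t ^ d))) summable_on {1..}"
      proof (rule summable_on_comparison_test[OF s1])
        fix d :: nat assume d: "d \<in> {1..}"
        have "t ^ d \<le> t ^ 1" using d t by (intro power_decreasing) auto
        then have "1 - t \<le> 1 - t ^ d" by simp
        then have "t ^ d / (1 - t ^ d) \<le> t ^ d / (1 - t)" using t by (intro divide_left_mono) auto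
        then have "\<bar>x d\<bar> * (t ^ d / (1 - t ^ d)) \<le> 1 * (t ^ d / (1 - t))"
          using x1[of d] t tn[of d] d by (intro mult_mono) auto
        then show "\<bar>x d\<bar> * (t ^ d / (1 - t ^ d)) \<le> (1 / (1 - t)) * t ^ d" by simp
        show "0 \<le> \<bar>x d\<bar> * (t ^ d / (1 - t ^ d))" using t tn[of d] d by auto
      qed
    qed (auto simp: F_def)
    \<comment> \<open>Expanding each kernel geometrically and grouping by \<open>m\<close> turns the
      Lambert series of \<open>x\<close> into the power series with the nonnegative coefficients
      \<open>r m\<close>.\<close>
    define r where "r = (\<lambda>m. \<Sum>d | d dvd m. x d)"
    have r0: "r m \<ge> 0" if "m > 0" for m unfolding r_def by (rule real_character_divisor_sum(1)[OF mult vals that])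
    have r1: "r (2 ^ (2 * i)) \<ge> 1" for i unfolding r_def by (rule real_character_divisor_sum(2)[OF mult vals])
    have conv: "(\<Sum>d | d dvd m. F d (m div d)) = complex_of_real (r m * t ^ m)" for m
    proof -
      have "(\<Sum>d | d dvd m. F d (m div d)) = (\<Sum>d | d dvd m. complex_of_real (x d * t ^ m))"
        by (intro sum.cong) (auto simp: F_def)
      then show ?thesis by (simp add: r_def sum_distrib_right)
    qed
    have rs: "(\<lambda>m. complex_of_real (r m * t ^ m)) summable_on {1..}"
      using infsum_divisor_convolution(1)[OF Fs] unfolding conv .
    have total: "(\<Sum>\<^sub>\<infinity>d\<in>{1..}. complex_of_real (x d * (t ^ d / (1 - t ^ d)))) = (\<Sum>\<^sub>\<infinity>m\<in>{1..}. complex_of_real (r m * t ^ m))"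
    proof -
      have "(\<Sum>\<^sub>\<infinity>(d,m)\<in>{1..}\<times>{1..}. F d m) = (\<Sum>\<^sub>\<infinity>d\<in>{1..}. \<Sum>\<^sub>\<infinity>m\<in>{1..}. F d m)"
        by (rule infsum_Sigma'_banach[symmetric], rule abs_summable_summable) (use Fs in \<open>simp add: case_prod_unfold\<close>)
      also have "\<dots> = (\<Sum>\<^sub>\<infinity>d\<in>{1..}. complex_of_real (x d * (t ^ d / (1 - t ^ d))))"
      proof (rule infsum_cong)
        fix d :: nat assume d: "d \<in> {1..}"
        have "((\<lambda>m. complex_of_real (x d * t ^ (d * m))) has_sum complex_of_real (x d * (t ^ d / (1 - t ^ d)))) {1..}"
          using d by (intro has_sum_of_real has_sum_cmult_right gs) auto
        then show "(\<Sum>\<^sub>\<infinity>m\<in>{1..}. F d m) = complex_of_real (x d * (t ^ d / (1 - t ^ d)))"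
          unfolding F_def by (rule infsumI)
      qed
      finally show ?thesis using infsum_divisor_convolution(2)[OF Fs] unfolding conv by simp
    qed
    have sx: "(\<lambda>d. norm (x d * (t ^ d / (1 - t ^ d)))) summable_on {1..}"
    proof (rule summable_on_comparison_test)
      show "(\<lambda>d. (1 / (1 - t)) * t ^ d) summable_on {1..}"
        using has_sum_imp_summable[OF gs[of 1]] by (intro summable_on_cmult_right) simp
      fix d :: nat assume d: "d \<in> {1..}"
      have "t ^ d \<le> t ^ 1" using d t by (intro power_decreasing) auto
      then have "1 - t \<le> 1 - t ^ d" by simp
      then have "t ^ d / (1 - t ^ d) \<le> t ^ d / (1 - t)" using t by (intro divide_left_mono) auto
      then have "\<bar>x d\<bar> * (t ^ d / (1 - t ^ d)) \<le> 1 * (t ^ d / (1 - t))"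
        using x1[of d] t tn[of d] d by (intro mult_mono) auto
      then show "norm (x d * (t ^ d / (1 - t ^ d))) \<le> (1 / (1 - t)) * t ^ d" using t tn[of d] d by (simp add: abs_mult)
      show "0 \<le> norm (x d * (t ^ d / (1 - t ^ d)))" by simp
    qed
    define X where "X = (\<Sum>\<^sub>\<infinity>d\<in>{1..}. x d * (t ^ d / (1 - t ^ d)))"
    have rs': "(\<lambda>m. r m * t ^ m) summable_on {1..}" using summable_on_Re[OF rs] by simp
    have hsX: "((\<lambda>d. x d * (t ^ d / (1 - t ^ d))) has_sum X) {1..}"
      unfolding X_def by (rule has_sum_infsum[OF abs_summable_summable[OF sx]])
    have Xr: "X = (\<Sum>\<^sub>\<infinity>m\<in>{1..}. r m * t ^ m)"
    proof -
      have "complex_of_real X = (\<Sum>\<^sub>\<infinity>d\<in>{1..}. complex_of_real (x d * (t ^ d / (1 - t ^ d))))"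
        by (rule infsumI[symmetric, OF has_sum_of_real[OF hsX]])
      also have "\<dots> = (\<Sum>\<^sub>\<infinity>m\<in>{1..}. complex_of_real (r m * t ^ m))" by (rule total)
      also have "\<dots> = complex_of_real (\<Sum>\<^sub>\<infinity>m\<in>{1..}. r m * t ^ m)"
        by (rule infsumI[OF has_sum_of_real[OF has_sum_infsum[OF rs']]])
      finally show ?thesis by (rule of_real_eq_iff[THEN iffD1])
    qed
    have XE: "\<bar>X\<bar> \<le> E"
    proof -
      have "((\<lambda>d. x d * (t ^ d / (1 - t ^ d))) has_sum X) UNIV"
        by (rule has_sum_cong_neutral[THEN iffD1, OF _ _ _ hsX]) (auto simp: Suc_le_eq)
      then have "(\<lambda>d. x d * (t ^ d / (1 - t ^ d))) sums X" by (rule has_sum_imp_sums)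
      then have "(\<lambda>N. \<Sum>d<Suc N. x d * (t ^ d / (1 - t ^ d))) \<longlonglongrightarrow> X" unfolding sums_def by (rule LIMSEQ_Suc)
      moreover have "(\<Sum>d<Suc N. x d * (t ^ d / (1 - t ^ d))) = (\<Sum>d=1..N. x d * (t ^ d / (1 - t ^ d)))" for N
        by (intro sum.mono_neutral_right) (auto simp: not_less_eq_eq)
      ultimately have l1: "(\<lambda>N. \<Sum>d=1..N. x d * (t ^ d / (1 - t ^ d))) \<longlonglongrightarrow> X" by simp
      have "(\<lambda>N. 1 / (1 - t) * (\<Sum>n=1..N. x n / real n) - (\<Sum>d=1..N. x d * (t ^ d / (1 - t ^ d)))) \<longlonglongrightarrow> 1 / (1 - t) * 0 - X"
        by (intro tendsto_diff tendsto_mult tendsto_const lim l1)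
      moreover have "1 / (1 - t) * (\<Sum>n=1..N. x n / real n) - (\<Sum>d=1..N. x d * (t ^ d / (1 - t ^ d))) = (\<Sum>n=1..N. x n * b n)" for N
        by (simp add: b_def right_diff_distrib sum_subtractf sum_distrib_left mult_ac)
      ultimately have "(\<lambda>N. \<Sum>n=1..N. x n * b n) \<longlonglongrightarrow> - X" by simp
      then have "(\<lambda>N. \<bar>\<Sum>n=1..N. x n * b n\<bar>) \<longlonglongrightarrow> \<bar>- X\<bar>" by (rule tendsto_rabs)
      then have "\<bar>- X\<bar> \<le> E" by (rule LIMSEQ_le_const2) (use part in blast)
      then show ?thesis by simp
    qed
    have "(\<Sum>i<K. t ^ (2 ^ (2 * i))) \<le> (\<Sum>i<K. r (2 ^ (2 * i)) * t ^ (2 ^ (2 * i)))"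
      using r1 t by (intro sum_mono) (simp add: mult_le_cancel_right1)
    also have "\<dots> = (\<Sum>m\<in>(\<lambda>i. 2 ^ (2 * i)) ` {..<K}. r m * t ^ m)"
      by (subst sum.reindex) (auto simp: inj_on_def)
    also have "\<dots> = (\<Sum>\<^sub>\<infinity>m\<in>(\<lambda>i. 2 ^ (2 * i)) ` {..<K}. r m * t ^ m)" by simp
    also have "\<dots> \<le> (\<Sum>\<^sub>\<infinity>m\<in>{1..}. r m * t ^ m)"
      by (rule infsum_mono_neutral) (use rs' r0 t in auto)
    also have "\<dots> \<le> E" using XE unfolding Xr by simp
    finally show ?thesis .
  qed
  \<comment> \<open>As \<open>t\<close> tends to 1 from the left, the \<open>K\<close> retained
    powers tend to \<open>K\<close>, which exceeds the uniform bound \<open>E\<close>.\<close>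
  obtain K :: nat where K: "real K > E" using reals_Archimedean2 by blast
  have "((\<lambda>t. \<Sum>i<K. t ^ (2 ^ (2 * i))) \<longlongrightarrow> (\<Sum>i<K. 1 ^ (2 ^ (2 * i)))) (at_left (1::real))"
    by (intro tendsto_intros)
  moreover have "\<forall>\<^sub>F t in at_left (1::real). (\<Sum>i<K. t ^ (2 ^ (2 * i))) \<le> E"
    using eventually_at_left_real[of 0 "1::real", OF zero_less_one] by eventually_elim (use main in auto)
  ultimately have "(\<Sum>i<K. (1::real) ^ (2 ^ (2 * i))) \<le> E" by (rule tendsto_upperbound) auto
  then show False using K by simp
qed

section \<open>Bounds near the line of absolute convergence\<close>

definition cmean :: "nat \<Rightarrow> (nat \<Rightarrow> complex) \<Rightarrow> complex" where
  "cmean l \<xi> = (\<Sum>n<l. \<xi> n) / of_nat l"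

text \<open>The discrepancy from the mean over one period is itself periodic, so it is bounded by
  its values on the first period.\<close>

lemma dchar_mean_coeffs:
  assumes \<xi>: "dchar l \<xi>"
  shows "mean_coeffs \<xi> (cmean l \<xi>) (2 * real l)"
proof
  fix N
  show "norm (\<xi> N) \<le> 1" by (rule norm_dchar_le[OF \<xi>])
  have l: "l > 0" by (rule dcharD(1)[OF \<xi>])
  have per: "\<xi> (n + l) = \<xi> n" for n by (rule dcharD(5)[OF \<xi>])
  define S where "S = (\<Sum>n<l. \<xi> n)"
  have nS: "norm S \<le> real l" unfolding S_def using sum_norm_le[of "{..<l}" \<xi> "\<lambda>_. 1"] norm_dchar_le[OF \<xi>] by simp
  have full: "(\<Sum>n\<in>{N<..N+l}. \<xi> n) = S" for N
  proof (induction N)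
    case 0
    have "{0<..0+l} = insert l {0<..<l}" "{..<l} = insert 0 {0<..<l}" using l by auto
    moreover have "\<xi> l = \<xi> 0" using per[of 0] by simp
    ultimately show ?case unfolding S_def by simp
  next
    case (Suc N)
    have "insert (Suc N) {Suc N<..Suc N+l} = insert (N + l + 1) {N<..N+l}" using l by auto
    then have "sum \<xi> (insert (Suc N) {Suc N<..Suc N+l}) = sum \<xi> (insert (N + l + 1) {N<..N+l})" by simp
    then have "\<xi> (Suc N) + sum \<xi> {Suc N<..Suc N+l} = \<xi> (N + l + 1) + sum \<xi> {N<..N+l}" by simp
    moreover have "\<xi> (N + l + 1) = \<xi> (Suc N)" using per[of "Suc N"] by (simp add: add_ac)
    ultimately show ?case using Suc by simp
  qed
  define D where "D = (\<lambda>N. (\<Sum>n=1..N. \<xi> n) - cmean l \<xi> * of_nat N)"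
  have "D (N + l) = D N" for N
  proof -
    have "{1..N+l} = {1..N} \<union> {N<..N+l}" by auto
    then have "(\<Sum>n=1..N+l. \<xi> n) = (\<Sum>n=1..N. \<xi> n) + S" using full[of N] by (simp only:) (subst sum.union_disjoint, auto)
    moreover have "cmean l \<xi> * of_nat l = S" using l by (simp add: cmean_def S_def)
    ultimately show ?thesis by (simp add: D_def algebra_simps)
  qed
  then have "D N = D (N mod l)" by (rule periodic_mod[symmetric])
  also have "norm \<dots> \<le> norm (\<Sum>n=1..N mod l. \<xi> n) + norm (cmean l \<xi> * of_nat (N mod l))"
    unfolding D_def by (rule norm_triangle_ineq4)
  also have "norm (\<Sum>n=1..N mod l. \<xi> n) \<le> real (N mod l)"
    using sum_norm_le[of "{1..N mod l}" \<xi> "\<lambda>_. 1"] norm_dchar_le[OF \<xi>] by simp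
  also have "norm (cmean l \<xi> * of_nat (N mod l)) \<le> 1 * real (N mod l)"
    unfolding norm_mult norm_of_nat using nS l by (intro mult_right_mono) (auto simp: cmean_def S_def norm_divide)
  also have "real (N mod l) + 1 * real (N mod l) \<le> 2 * real l" using l mod_less_divisor[of l N] by simp
  finally show "norm ((\<Sum>n=1..N. \<xi> n) - cmean l \<xi> * of_nat N) \<le> 2 * real l" by (simp add: D_def)
qed

definition nontrivial_dchar :: "nat \<Rightarrow> (nat \<Rightarrow> complex) \<Rightarrow> bool" where
  "nontrivial_dchar l \<xi> \<longleftrightarrow> dchar l \<xi> \<and> (\<exists>g. coprime g l \<and> \<xi> g \<noteq> 1)"

text \<open>Multiplication by \<open>g\<close> permutes the residues, so the sum over a period is
  fixed under multiplication by \<open>\<xi> g \<noteq> 1\<close>.\<close>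

lemma cmean_nontrivial:
  assumes "nontrivial_dchar l \<xi>"
  shows "cmean l \<xi> = 0"
proof -
  from assms obtain g where \<xi>: "dchar l \<xi>" and g: "coprime g l" "\<xi> g \<noteq> 1" by (auto simp: nontrivial_dchar_def)
  have l: "l > 0" by (rule dcharD(1)[OF \<xi>])
  have inj: "inj_on (\<lambda>n. g * n mod l) {..<l}"
  proof (rule inj_onI)
    fix m n assume mn: "m \<in> {..<l}" "n \<in> {..<l}" "g * m mod l = g * n mod l"
    then have "[g * m = g * n] (mod l)" by (simp add: unique_euclidean_semiring_class.cong_def)
    then have "[m = n] (mod l)" using g by (simp add: cong_mult_lcancel_nat)
    then show "m = n" using mn by (simp add: unique_euclidean_semiring_class.cong_def)
  qed
  have "(\<lambda>n. g * n mod l) ` {..<l} = {..<l}"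
    by (rule endo_inj_surj[OF _ _ inj]) (use l in auto)
  then have "(\<Sum>n<l. \<xi> n) = (\<Sum>n\<in>(\<lambda>n. g * n mod l) ` {..<l}. \<xi> n)" by simp
  also have "\<dots> = (\<Sum>n<l. \<xi> (g * n mod l))" by (subst sum.reindex[OF inj]) simp
  also have "\<dots> = \<xi> g * (\<Sum>n<l. \<xi> n)"
    unfolding sum_distrib_left by (intro sum.cong refl) (simp only: dchar_mod[OF \<xi>] dcharD(4)[OF \<xi>])
  finally have "(1 - \<xi> g) * (\<Sum>n<l. \<xi> n) = 0" by (simp add: algebra_simps)
  then show ?thesis using g by (simp add: cmean_def)
qed

definition HH :: "nat \<Rightarrow> (nat \<Rightarrow> complex) \<Rightarrow> complex \<Rightarrow> complex" where
  "HH l \<xi> = mean_coeffs.H \<xi> (cmean l \<xi>)"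

text \<open>The constant \<open>40 + 60 * E\<close> of \<open>H_upper\<close> at the discrepancy
  \<open>E = 2 * l\<close>.\<close>

definition CU :: "nat \<Rightarrow> real" where "CU l = 40 + 120 * real l"

lemma CU_pos: "CU l \<ge> 40" by (simp add: CU_def)

lemma HH_holomorphic: "dchar l \<xi> \<Longrightarrow> HH l \<xi> holomorphic_on {s. Re s > 0}"
  unfolding HH_def by (rule mean_coeffs.holomorphic_H[OF dchar_mean_coeffs])

lemma HH_dser: "dchar l \<xi> \<Longrightarrow> Re s > 1 \<Longrightarrow> HH l \<xi> s = (s - 1) * dser \<xi> s"
  unfolding HH_def by (rule mean_coeffs.H_eq_dser[OF dchar_mean_coeffs])

lemma HH_upper:
  assumes "dchar l \<xi>" "T \<ge> 3" "Re s \<ge> 1 - 1 / (2 * ln T)" "Re s \<le> 3" "\<bar>Im s\<bar> \<le> T"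
  shows "norm (HH l \<xi> s) \<le> CU l * (norm (s - 1) * ln T + norm s)"
  using mean_coeffs.H_upper[OF dchar_mean_coeffs[OF assms(1)] assms(2-)] unfolding HH_def CU_def by simp

lemma HH_1: "dchar l \<xi> \<Longrightarrow> HH l \<xi> 1 = cmean l \<xi>"
proof -
  assume \<xi>: "dchar l \<xi>"
  interpret mean_coeffs \<xi> "cmean l \<xi>" "2 * real l" by (rule dchar_mean_coeffs[OF \<xi>])
  have "hterm (Suc N) 1 = 0" for N by (simp add: hterm_def del: of_nat_Suc)
  then show ?thesis unfolding HH_def H_def by simp
qed

text \<open>The L-function continued to \<open>Re s > 0\<close>. At \<open>s = 1\<close> the
  quotient takes the default value 0, so this form serves only away from 1; \<open>Lent\<close>
  repairs the point.\<close>

definition Lq :: "nat \<Rightarrow> (nat \<Rightarrow> complex) \<Rightarrow> complex \<Rightarrow> complex" where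
  "Lq l \<xi> s = HH l \<xi> s / (s - 1)"

lemma Lq_dser: "dchar l \<xi> \<Longrightarrow> Re s > 1 \<Longrightarrow> Lq l \<xi> s = dser \<xi> s"
  unfolding Lq_def by (subst HH_dser) auto

lemma ln_ge_1: "T \<ge> 3 \<Longrightarrow> ln T \<ge> (1::real)"
proof -
  assume "T \<ge> 3"
  then have "exp 1 \<le> T" using exp_le by linarith
  then show ?thesis using \<open>T \<ge> 3\<close> by (simp add: ln_ge_iff)
qed

lemma Lq_upper:
  assumes \<xi>: "dchar l \<xi>" and T: "T \<ge> 3" and s: "Re s \<ge> 1 - 1 / (2 * ln T)" "Re s \<le> 3" "1/2 \<le> \<bar>Im s\<bar>" "\<bar>Im s\<bar> \<le> T"
  shows "norm (Lq l \<xi> s) \<le> 4 * CU l * ln T"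
proof -
  have "\<bar>Im (s - 1)\<bar> \<le> norm (s - 1)" by (rule abs_Im_le_cmod)
  then have n1: "norm (s - 1) \<ge> 1/2" using s by simp
  have "norm s \<le> norm (s - 1) + 1" using norm_triangle_ineq[of "s - 1" 1] by simp
  also have "\<dots> \<le> 3 * norm (s - 1)" using n1 by simp
  also have "\<dots> \<le> 3 * (norm (s - 1) * ln T)" using ln_ge_1[OF T] n1 by (simp add: mult_le_cancel_left1)
  finally have "norm s \<le> 3 * (norm (s - 1) * ln T)" .
  then have "norm (s - 1) * ln T + norm s \<le> 4 * (norm (s - 1) * ln T)" by linarith
  then have "CU l * (norm (s - 1) * ln T + norm s) \<le> CU l * (4 * (norm (s - 1) * ln T))"
    using CU_pos[of l] by (intro mult_left_mono) auto
  then have "norm (HH l \<xi> s) \<le> (4 * CU l * ln T) * norm (s - 1)" using HH_upper[OF \<xi> T s(1,2,4)] by (simp add: mult_ac)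
  then show ?thesis unfolding Lq_def norm_divide using n1 by (subst pos_divide_le_eq) auto
qed

lemma Lq_holomorphic: "dchar l \<xi> \<Longrightarrow> Lq l \<xi> holomorphic_on ({s. Re s > 0} - {1})"
  unfolding Lq_def[abs_def] by (intro holomorphic_intros holomorphic_on_subset[OF HH_holomorphic]) auto

text \<open>Cauchy's inequality on a disc of radius \<open>1 / (8 * ln T)\<close>, which costs one
  further logarithm. As \<open>ln (T + 1) \<le> 2 * ln T\<close>, the disc stays in the region of
  \<open>Lq_upper\<close> at height \<open>T + 1\<close>.\<close>

lemma Lq_deriv_bound:
  assumes \<xi>: "dchar l \<xi>" and T: "T \<ge> 3" and s: "Re s \<ge> 1 - 1 / (8 * ln T)" "Re s \<le> 2" "1 \<le> \<bar>Im s\<bar>" "\<bar>Im s\<bar> \<le> T"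
  shows "norm (deriv (Lq l \<xi>) s) \<le> 64 * CU l * (ln T)\<^sup>2"
proof -
  define r where "r = 1 / (8 * ln T)"
  have lT: "ln T \<ge> 1" by (rule ln_ge_1[OF T])
  have r: "r > 0" "r \<le> 1/8" using lT by (auto simp: r_def field_simps)
  have lT1: "ln (T + 1) \<le> 2 * ln T" "ln (T + 1) \<ge> 1"
  proof -
    have "3 * T \<le> T * T" using T by (intro mult_right_mono) auto
    then have "T + 1 \<le> T ^ 2" unfolding power2_eq_square using T by linarith
    then have "ln (T + 1) \<le> ln (T ^ 2)" using T by (subst ln_le_cancel_iff) auto
    then show "ln (T + 1) \<le> 2 * ln T" using T by (simp add: ln_realpow)
    show "ln (T + 1) \<ge> 1" using T by (intro ln_ge_1) auto
  qed
  have cb: "Re z \<ge> 1 - 1 / (2 * ln (T + 1)) \<and> Re z \<le> 3 \<and> 1/2 \<le> \<bar>Im z\<bar> \<and> \<bar>Im z\<bar> \<le> T + 1" if z: "norm (s - z) \<le> r" for z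
  proof -
    have "\<bar>Re (s - z)\<bar> \<le> r" "\<bar>Im (s - z)\<bar> \<le> r" using z abs_Re_le_cmod[of "s - z"] abs_Im_le_cmod[of "s - z"] by linarith+
    then have d: "\<bar>Re s - Re z\<bar> \<le> r" "\<bar>Im s - Im z\<bar> \<le> r" by auto
    have "1 / (2 * (2 * ln T)) \<le> 1 / (2 * ln (T + 1))" using lT1 by (intro divide_left_mono) auto
    moreover have "1 / (2 * (2 * ln T)) = 2 * r" by (simp add: r_def)
    ultimately have "2 * r \<le> 1 / (2 * ln (T + 1))" by simp
    then show ?thesis using d r s unfolding r_def[symmetric] by auto
  qed
  have pos: "1 / (2 * ln (T + 1)) \<le> 1/2" using lT1 by (simp add: field_simps)
  have sub: "cball s r \<subseteq> {s. Re s > 0} - {1}"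
  proof
    fix z assume "z \<in> cball s r"
    then have "norm (s - z) \<le> r" by (simp add: dist_norm)
    from cb[OF this] show "z \<in> {s. Re s > 0} - {1}" using pos by auto
  qed
  have hol: "Lq l \<xi> holomorphic_on cball s r" by (rule holomorphic_on_subset[OF Lq_holomorphic[OF \<xi>] sub])
  have "norm ((deriv ^^ 1) (Lq l \<xi>) s) \<le> fact 1 * (4 * CU l * ln (T + 1)) / r ^ 1"
  proof (rule Cauchy_inequality)
    show "Lq l \<xi> holomorphic_on ball s r" by (rule holomorphic_on_subset[OF hol]) auto
    show "continuous_on (cball s r) (Lq l \<xi>)" using hol by (rule holomorphic_on_imp_continuous_on)
    fix z assume "norm (s - z) = r"
    then have "norm (s - z) \<le> r" by simp
    from cb[OF this] show "norm (Lq l \<xi> z) \<le> 4 * CU l * ln (T + 1)" using T by (intro Lq_upper[OF \<xi>]) auto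
  qed (use r in auto)
  also have "fact 1 * (4 * CU l * ln (T + 1)) / r ^ 1 = 4 * CU l * ln (T + 1) * (8 * ln T)" by (simp add: r_def)
  also have "\<dots> \<le> 4 * CU l * (2 * ln T) * (8 * ln T)" using lT1 lT CU_pos[of l] by (intro mult_right_mono mult_left_mono) auto
  finally show ?thesis by (simp add: power2_eq_square)
qed

section \<open>Lower bounds from the 3-4-1 inequality\<close>

lemma principal_upper:
  assumes l: "l > 0" and \<sigma>: "1 < \<sigma>" "\<sigma> \<le> 2"
  shows "norm (dser (\<lambda>n. if coprime n l then 1 else 0) (of_real \<sigma>)) \<le> 5 * CU l / (\<sigma> - 1)"
proof -
  let ?\<xi>0 = "\<lambda>n. if coprime n l then 1 else 0 :: complex"
  have c0: "dchar l ?\<xi>0" by (rule dchar_principal[OF l])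
  have "norm (HH l ?\<xi>0 (of_real \<sigma>)) \<le> CU l * (norm (of_real \<sigma> - 1 :: complex) * ln 3 + norm (of_real \<sigma> :: complex))"
    using \<sigma> ln_ge_1[of 3] by (intro HH_upper[OF c0]) (auto intro: order_trans[of _ 1])
  also have "norm (of_real \<sigma> - 1 :: complex) = \<sigma> - 1" using \<sigma> by (metis abs_of_pos diff_gt_0_iff_gt norm_of_real of_real_1 of_real_diff)
  also have "norm (of_real \<sigma> :: complex) = \<sigma>" using \<sigma> by simp
  also have "CU l * ((\<sigma> - 1) * ln 3 + \<sigma>) \<le> CU l * 5"
  proof (intro mult_left_mono)
    have "ln (3::real) \<le> 3 - 1" by (rule ln_le_minus_one) auto
    then have "(\<sigma> - 1) * ln 3 \<le> 1 * 2" using \<sigma> by (intro mult_mono) auto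
    then show "(\<sigma> - 1) * ln 3 + \<sigma> \<le> 5" using \<sigma> by simp
  qed (use CU_pos[of l] in auto)
  finally have "norm (HH l ?\<xi>0 (of_real \<sigma>)) \<le> 5 * CU l" by simp
  moreover have "norm (HH l ?\<xi>0 (of_real \<sigma>)) = (\<sigma> - 1) * norm (dser ?\<xi>0 (of_real \<sigma>))"
  proof -
    have "norm (of_real \<sigma> - 1 :: complex) = \<sigma> - 1" using \<sigma> by (metis abs_of_pos diff_gt_0_iff_gt norm_of_real of_real_1 of_real_diff)
    then show ?thesis using HH_dser[OF c0, of "of_real \<sigma>"] \<sigma> by (simp add: norm_mult)
  qed
  ultimately show ?thesis using \<sigma> by (subst pos_le_divide_eq) (auto simp: mult.commute)
qed

text \<open>The 3-4-1 inequality solved for its middle factor. The principal series contributes at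
  most its pole, cubed, and the squared character is bounded by a logarithm at twice the height; the
  constant is \<open>5^3 * 8 = 1000\<close>.\<close>

lemma dser_lower:
  assumes \<xi>: "dchar l \<xi>" and T: "T \<ge> 3" and \<sigma>: "1 < \<sigma>" "\<sigma> \<le> 2" and t: "1 \<le> \<bar>t\<bar>" "\<bar>t\<bar> \<le> T"
  shows "norm (dser \<xi> (Complex \<sigma> t)) ^ 4 \<ge> (\<sigma> - 1) ^ 3 / (1000 * CU l ^ 4 * ln T)"
proof -
  have lT: "ln T \<ge> 1" by (rule ln_ge_1[OF T])
  define D0 D1 D2 where "D0 = norm (dser (\<lambda>n. if coprime n l then 1 else 0) (of_real \<sigma>))"
    and "D1 = norm (dser \<xi> (Complex \<sigma> t))" and "D2 = norm (dser (\<lambda>n. \<xi> n ^ 2) (Complex \<sigma> (2 * t)))"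
  have "1 \<le> D0 ^ 3 * D1 ^ 4 * D2" unfolding D0_def D1_def D2_def using three_four_one[OF \<xi> \<sigma>(1)] by simp
  also have "\<dots> \<le> (5 * CU l / (\<sigma> - 1)) ^ 3 * D1 ^ 4 * (8 * CU l * ln T)"
  proof (intro mult_mono power_mono mult_nonneg_nonneg)
    show "D0 \<le> 5 * CU l / (\<sigma> - 1)" unfolding D0_def by (rule principal_upper[OF dcharD(1)[OF \<xi>] \<sigma>])
    have "D2 = norm (Lq l (\<lambda>n. \<xi> n ^ 2) (Complex \<sigma> (2 * t)))"
      unfolding D2_def using \<sigma> by (subst Lq_dser[OF dchar_square[OF \<xi>]]) auto
    also have "\<dots> \<le> 4 * CU l * ln (2 * T)"
    proof (rule Lq_upper[OF dchar_square[OF \<xi>]])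
      have "1 / (2 * ln (2 * T)) \<ge> 0" using T by simp
      then show "1 - 1 / (2 * ln (2 * T)) \<le> Re (Complex \<sigma> (2 * t))" using \<sigma> by (simp only: complex.sel)
    qed (use \<sigma> t T in auto)
    also have "ln (2 * T) \<le> 2 * ln T"
    proof -
      have "ln (2 * T) \<le> ln (T * T)" using T by (subst ln_le_cancel_iff) auto
      then show ?thesis using T by (simp add: ln_mult)
    qed
    finally show "D2 \<le> 8 * CU l * ln T" using CU_pos[of l] by simp
  qed (use \<sigma> CU_pos[of l] lT in \<open>auto simp: D0_def D1_def D2_def\<close>)
  also have "\<dots> = D1 ^ 4 * (1000 * CU l ^ 4 * ln T / (\<sigma> - 1) ^ 3)"
    by (simp add: power_divide power_mult_distrib power3_eq_cube power4_eq_xxxx mult_ac)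
  finally have "1 \<le> D1 ^ 4 * (1000 * CU l ^ 4 * ln T / (\<sigma> - 1) ^ 3)" .
  moreover have "(\<sigma> - 1) ^ 3 > 0" "1000 * CU l ^ 4 * ln T > 0" using \<sigma> CU_pos[of l] lT by auto
  ultimately show ?thesis unfolding D1_def[symmetric] by (simp add: field_simps)
qed

text \<open>At distance \<delta> to the right of the line, \<open>dser_lower\<close> gives a value
  of order \<open>(\<delta>^3 / ln T)^(1/4)\<close>. Moving left by \<open>2 * \<delta>\<close>
  loses at most a multiple of \<open>\<delta> * (ln T)^2\<close>. With
  \<open>\<delta> = a / (ln T)^9\<close> both are of order \<open>(ln T)^(-7)\<close>, and a small
  \<open>a\<close> makes the gain, of order \<open>a^(3/4)\<close>, exceed the loss, of order
  \<open>a\<close>.\<close>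

lemma Lq_lower:
  assumes \<xi>: "dchar l \<xi>"
  shows "\<exists>a m. 0 < a \<and> a \<le> 1/8 \<and> 0 < m \<and> (\<forall>T s. T \<ge> 3 \<and> 1 \<le> \<bar>Im s\<bar> \<and> \<bar>Im s\<bar> \<le> T \<and> 1 - a / ln T ^ 9 \<le> Re s \<and> Re s \<le> 2 \<longrightarrow> norm (Lq l \<xi> s) \<ge> m / ln T ^ 7)"
proof -
  define c0 where "c0 = 1 / (1000 * CU l ^ 4)"
  define C3 where "C3 = 64 * CU l"
  \<comment> \<open>Chosen so that \<open>(4 * a * C3)^4 \<le> c0 * a^3\<close>: the value on the
    right is then twice the loss from the derivative.\<close>
  define a where "a = min (1/8) (c0 / (256 * C3 ^ 4))"
  have CU: "CU l > 0" using CU_pos[of l] by simp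
  have c: "c0 > 0" "C3 > 0" using CU by (auto simp: c0_def C3_def)
  have a: "0 < a" "a \<le> 1/8" "a \<le> c0 / (256 * C3 ^ 4)" using c by (auto simp: a_def)
  have main: "norm (Lq l \<xi> s) \<ge> 2 * a * C3 / ln T ^ 7"
    if T: "T \<ge> 3" and t: "1 \<le> \<bar>Im s\<bar>" "\<bar>Im s\<bar> \<le> T" and s: "1 - a / ln T ^ 9 \<le> Re s" "Re s \<le> 2" for T s
  proof -
    define L where "L = ln T"
    have L: "L \<ge> 1" unfolding L_def by (rule ln_ge_1[OF T])
    define \<delta> where "\<delta> = a / L ^ 9"
    have L9: "L ^ 9 \<ge> L" using L by (intro self_le_power) auto
    have Lp: "L ^ k > 0" for k using L by simp
    have \<delta>: "\<delta> > 0" "\<delta> \<le> 1 / (8 * L)" "\<delta> \<le> 1/8"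
    proof -
      show "\<delta> > 0" using a L by (simp add: \<delta>_def)
      have "\<delta> \<le> (1/8) / L" unfolding \<delta>_def using a L L9 by (intro frac_le) auto
      then show "\<delta> \<le> 1 / (8 * L)" by simp
      also have "\<dots> \<le> 1 / (8 * 1)" using L by (intro divide_left_mono) auto
      finally show "\<delta> \<le> 1/8" by simp
    qed
    have right: "norm (Lq l \<xi> (Complex \<sigma> (Im s))) \<ge> 4 * a * C3 / L ^ 7" if \<sigma>: "1 + \<delta> \<le> \<sigma>" "\<sigma> \<le> 2" for \<sigma>
    proof (rule power_le_imp_le_base)
      have "(4 * a * C3 / L ^ 7) ^ Suc 3 = (256 * C3 ^ 4 * a) * a ^ 3 / L ^ 28"
      proof -
        have "(L ^ 7) ^ Suc 3 = L ^ 28" by (simp flip: power_mult)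
        then have "(4 * a * C3 / L ^ 7) ^ Suc 3 = (4 * a * C3) ^ 4 / L ^ 28" by (simp only: power_divide) simp
        also have "(4 * a * C3) ^ 4 = (256 * C3 ^ 4 * a) * a ^ 3" by (simp add: power4_eq_xxxx power3_eq_cube)
        finally show ?thesis .
      qed
      also have "\<dots> \<le> c0 * a ^ 3 / L ^ 28"
        using a c by (intro divide_right_mono mult_right_mono) (auto simp: field_simps)
      also have "\<dots> = \<delta> ^ 3 / (1000 * CU l ^ 4 * L)"
        using L by (simp add: c0_def \<delta>_def power_divide power_mult[symmetric] flip: power_Suc2) 
      also have "\<dots> \<le> (\<sigma> - 1) ^ 3 / (1000 * CU l ^ 4 * L)" using \<sigma> \<delta> CU L by (intro divide_right_mono power_mono) auto
      also have "\<dots> \<le> norm (dser \<xi> (Complex \<sigma> (Im s))) ^ 4" unfolding L_def using \<sigma> \<delta> t by (intro dser_lower[OF \<xi> T]) auto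
      also have "dser \<xi> (Complex \<sigma> (Im s)) = Lq l \<xi> (Complex \<sigma> (Im s))" using \<sigma> \<delta> by (subst Lq_dser[OF \<xi>]) auto
      finally show "(4 * a * C3 / L ^ 7) ^ Suc 3 \<le> norm (Lq l \<xi> (Complex \<sigma> (Im s))) ^ Suc 3" by (simp add: eval_nat_numeral)
    qed simp
    define q where "q = a * C3 / L ^ 7"
    have mpos: "q > 0" using a c Lp[of 7] by (simp add: q_def)
    have qe: "4 * a * C3 / L ^ 7 = 4 * q" "2 * a * C3 / L ^ 7 = 2 * q" by (simp_all add: q_def)
    show ?thesis
    proof (cases "Re s \<ge> 1 + \<delta>")
      case True
      show ?thesis using right[OF True s(2)] mpos unfolding L_def[symmetric] complex_surj qe by linarith
    next
      case False
      define s1 where "s1 = Complex (1 + \<delta>) (Im s)"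
      define S where "S = cbox (Complex (1 - \<delta>) (Im s)) (Complex (1 + \<delta>) (Im s))"
      have Sc: "convex S" unfolding S_def by (rule convex_box)
      have S: "Re z \<ge> 1 - \<delta> \<and> Re z \<le> 1 + \<delta> \<and> Im z = Im s" if "z \<in> S" for z
        using that by (auto simp: S_def cbox_def Basis_complex_def)
      have op: "open ({s. Re s > 0} - {1::complex})" by (intro open_Diff open_halfspace_Re_gt) auto
      have "norm (Lq l \<xi> s1 - Lq l \<xi> s) \<le> C3 * L\<^sup>2 * norm (s1 - s)"
      proof (rule field_differentiable_bound[OF Sc])
        fix z assume z: "z \<in> S"
        note zz = S[OF z]
        have "z \<in> {s. Re s > 0} - {1}" using zz \<delta> t by auto
        then have "(Lq l \<xi> has_field_derivative deriv (Lq l \<xi>) z) (at z)"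
          using Lq_holomorphic[OF \<xi>] op by (rule holomorphic_derivI[rotated 2])
        then show "(Lq l \<xi> has_field_derivative deriv (Lq l \<xi>) z) (at z within S)" by (rule has_field_derivative_at_within)
        show "norm (deriv (Lq l \<xi>) z) \<le> C3 * L\<^sup>2"
          unfolding C3_def L_def using zz \<delta> t L_def by (intro Lq_deriv_bound[OF \<xi> T]) auto
      qed (use False s \<delta> in \<open>auto simp: S_def s1_def cbox_def Basis_complex_def \<delta>_def L_def\<close>)
      also have "norm (s1 - s) \<le> 2 * \<delta>"
      proof -
        have "s1 - s = of_real (1 + \<delta> - Re s)" by (simp add: s1_def complex_eq_iff)
        then show ?thesis using False s by (simp only: norm_of_real) (simp add: \<delta>_def L_def)
      qed
      finally have "norm (Lq l \<xi> s1 - Lq l \<xi> s) \<le> C3 * L\<^sup>2 * (2 * \<delta>)" using c by (simp add: mult_left_mono)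
      also have "\<dots> = 2 * q"
      proof -
        have "L ^ 9 = L\<^sup>2 * L ^ 7" by (simp add: power_add[symmetric])
        moreover have "X \<noteq> 0 \<Longrightarrow> C3 * X * (2 * (a / (X * Y))) = 2 * (a * C3 / Y)" for X Y by simp
        ultimately show ?thesis unfolding \<delta>_def q_def using Lp[of 2] by (metis less_irrefl)
      qed
      finally have "norm (Lq l \<xi> s1 - Lq l \<xi> s) \<le> 2 * q" .
      moreover have "norm (Lq l \<xi> s1) \<ge> 4 * a * C3 / L ^ 7" unfolding s1_def using \<delta> by (intro right) auto
      moreover have "norm (Lq l \<xi> s1) \<le> norm (Lq l \<xi> s1 - Lq l \<xi> s) + norm (Lq l \<xi> s)" using norm_triangle_ineq[of "Lq l \<xi> s1 - Lq l \<xi> s" "Lq l \<xi> s"] by simp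
      ultimately show ?thesis unfolding L_def[symmetric] qe by linarith
    qed
  qed
  show ?thesis by (rule exI[of _ a], rule exI[of _ "2 * a * C3"]) (use a c main in auto)
qed

section \<open>Non-vanishing on the line of absolute convergence\<close>

lemma open_right_half: "open {s::complex. Re s > 0}"
  by (rule open_halfspace_Re_gt)

text \<open>A zero would make the series times its finite Euler products vanish identically, against
  their limit 1.\<close>

lemma dser_nonzero:
  assumes \<xi>: "dchar l \<xi>" and s: "Re s > 1"
  shows "dser \<xi> s \<noteq> 0"
proof
  assume "dser \<xi> s = 0"
  then have "(\<lambda>N::nat. 0::complex) \<longlonglongrightarrow> 1" using dser_euler_limit[OF \<xi> s] by simp
  then show False by (simp add: LIMSEQ_const_iff)
qed

lemma holomorphic_Lipschitz_horizontal:
  assumes hol: "G holomorphic_on {s. Re s > 0}"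
  shows "\<exists>M\<ge>0. \<forall>\<sigma>. 1 \<le> \<sigma> \<and> \<sigma> \<le> 2 \<longrightarrow> norm (G (Complex \<sigma> t) - G (Complex 1 t)) \<le> M * (\<sigma> - 1)"
proof -
  define S where "S = cbox (Complex 1 t) (Complex 2 t)"
  have Sc: "convex S" "compact S" by (simp_all add: S_def)
  have S: "Re z \<ge> 1" if "z \<in> S" for z using that by (auto simp: S_def cbox_def Basis_complex_def)
  have "deriv G holomorphic_on {s. Re s > 0}" by (rule holomorphic_deriv[OF hol open_right_half])
  moreover have "S \<subseteq> {s. Re s > 0}" using S by force
  ultimately have "continuous_on S (deriv G)" by (rule holomorphic_on_imp_continuous_on[OF holomorphic_on_subset])
  then have "bounded (deriv G ` S)" using Sc by (intro compact_imp_bounded compact_continuous_image)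
  then obtain M where M: "M > 0" "\<And>z. z \<in> S \<Longrightarrow> norm (deriv G z) \<le> M" by (auto simp: bounded_pos)
  have "norm (G (Complex \<sigma> t) - G (Complex 1 t)) \<le> M * (\<sigma> - 1)" if \<sigma>: "1 \<le> \<sigma>" "\<sigma> \<le> 2" for \<sigma>
  proof -
    have "norm (G (Complex \<sigma> t) - G (Complex 1 t)) \<le> M * norm (Complex \<sigma> t - Complex 1 t)"
    proof (rule field_differentiable_bound[OF Sc(1)])
      fix z assume z: "z \<in> S"
      then have "z \<in> {s. Re s > 0}" using S by force
      then have "(G has_field_derivative deriv G z) (at z)"
        using hol open_right_half by (rule holomorphic_derivI[rotated 2])
      then show "(G has_field_derivative deriv G z) (at z within S)" by (rule has_field_derivative_at_within)
      show "norm (deriv G z) \<le> M" by (rule M(2)[OF z])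
    qed (use \<sigma> in \<open>auto simp: S_def cbox_def Basis_complex_def\<close>)
    also have "Complex \<sigma> t - Complex 1 t = of_real (\<sigma> - 1)" by (simp add: complex_eq_iff)
    also have "norm (of_real (\<sigma> - 1) :: complex) = \<sigma> - 1" using \<sigma> by (simp only: norm_of_real)
    finally show ?thesis .
  qed
  then show ?thesis using M(1) by (intro exI[of _ M]) auto
qed

text \<open>A zero would force the \<open>3\<close>-\<open>4\<close>-\<open>1\<close> product, which is at least \<open>1\<close>, to be \<open>O(\<sigma> - 1)\<close>.\<close>

lemma line_nonvanishing:
  assumes \<xi>: "dchar l \<xi>" and hol: "G holomorphic_on {s. Re s > 0}" and A: "A \<ge> 0"
    and G: "\<And>\<sigma>. 1 < \<sigma> \<Longrightarrow> \<sigma> \<le> 2 \<Longrightarrow> norm (dser \<xi> (Complex \<sigma> t)) \<le> A * norm (G (Complex \<sigma> t))"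
    and G2: "\<And>\<sigma>. 1 < \<sigma> \<Longrightarrow> dser (\<lambda>n. (\<xi> n)\<^sup>2) (Complex \<sigma> (2 * t)) = G2 (Complex \<sigma> (2 * t))"
    and cont: "continuous_on (cbox (Complex 1 (2 * t)) (Complex 2 (2 * t))) G2"
  shows "G (Complex 1 t) \<noteq> 0"
proof
  assume zero: "G (Complex 1 t) = 0"
  obtain M where M: "M \<ge> 0" "\<And>\<sigma>. 1 \<le> \<sigma> \<and> \<sigma> \<le> 2 \<Longrightarrow> norm (G (Complex \<sigma> t)) \<le> M * (\<sigma> - 1)"
    using holomorphic_Lipschitz_horizontal[OF hol, of t] zero by auto
  have "bounded (G2 ` cbox (Complex 1 (2 * t)) (Complex 2 (2 * t)))"
    by (intro compact_imp_bounded compact_continuous_image cont compact_cbox)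
  then obtain B where B: "B > 0" "\<And>z. z \<in> cbox (Complex 1 (2 * t)) (Complex 2 (2 * t)) \<Longrightarrow> norm (G2 z) \<le> B"
    by (auto simp: bounded_pos)
  define K where "K = 125 * CU l ^ 3 * (A * M) ^ 4 * B"
  have K0: "K \<ge> 0" using CU_pos[of l] A M B by (simp add: K_def)
  have main: "1 \<le> K * (\<sigma> - 1)" if \<sigma>: "1 < \<sigma>" "\<sigma> \<le> 2" for \<sigma>
  proof -
    define D0 D1 D2 where "D0 = norm (dser (\<lambda>n. if coprime n l then 1 else 0) (of_real \<sigma>))"
      and "D1 = norm (dser \<xi> (Complex \<sigma> t))" and "D2 = norm (dser (\<lambda>n. \<xi> n ^ 2) (Complex \<sigma> (2 * t)))"
    have "1 \<le> D0 ^ 3 * D1 ^ 4 * D2" unfolding D0_def D1_def D2_def using three_four_one[OF \<xi> \<sigma>(1)] by simp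
    also have "\<dots> \<le> (5 * CU l / (\<sigma> - 1)) ^ 3 * (A * (M * (\<sigma> - 1))) ^ 4 * B"
    proof (intro mult_mono power_mono mult_nonneg_nonneg)
      show "D0 \<le> 5 * CU l / (\<sigma> - 1)" unfolding D0_def by (rule principal_upper[OF dcharD(1)[OF \<xi>] \<sigma>])
      have "D1 \<le> A * norm (G (Complex \<sigma> t))" unfolding D1_def by (rule G[OF \<sigma>])
      also have "\<dots> \<le> A * (M * (\<sigma> - 1))" using A M(2)[of \<sigma>] \<sigma> by (intro mult_left_mono) auto
      finally show "D1 \<le> A * (M * (\<sigma> - 1))" .
      show "D2 \<le> B" unfolding D2_def G2[OF \<sigma>(1)] using \<sigma> by (intro B) (auto simp: cbox_def Basis_complex_def)
    qed (use \<sigma> CU_pos[of l] A M B in \<open>auto simp: D0_def D1_def D2_def\<close>)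
    also have "\<dots> = K * ((\<sigma> - 1) ^ 4 / (\<sigma> - 1) ^ 3)"
      by (simp add: K_def power_divide power_mult_distrib)
    also have "(\<sigma> - 1) ^ 4 / (\<sigma> - 1) ^ 3 = \<sigma> - 1" using \<sigma> by (simp add: power4_eq_xxxx power3_eq_cube)
    finally show ?thesis .
  qed
  \<comment> \<open>At \<open>\<sigma> = 1 + 1 / (K + 1)\<close> the lower bound 1 would be at most
    \<open>K / (K + 1)\<close>, which is less than 1.\<close>
  have "1 \<le> K * (1 / (K + 1))" using main[of "1 + 1 / (K + 1)"] K0 by (simp add: field_simps)
  then show False using K0 by (simp add: field_simps)
qed

text \<open>For a nontrivial character \<open>HH\<close> vanishes at 1, so its derivative there is
  the value that fills the removable singularity of \<open>Lq\<close>.\<close>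

definition Lent :: "nat \<Rightarrow> (nat \<Rightarrow> complex) \<Rightarrow> complex \<Rightarrow> complex" where
  "Lent l \<xi> s = (if s = 1 then deriv (HH l \<xi>) 1 else Lq l \<xi> s)"

lemma Lent_holomorphic:
  assumes "nontrivial_dchar l \<xi>"
  shows "Lent l \<xi> holomorphic_on {s. Re s > 0}"
proof -
  have \<xi>: "dchar l \<xi>" using assms by (simp add: nontrivial_dchar_def)
  have H1: "HH l \<xi> 1 = 0" unfolding HH_1[OF \<xi>] by (rule cmean_nontrivial[OF assms])
  have "(\<lambda>z. if z = 1 then deriv (HH l \<xi>) 1 else (HH l \<xi> z - HH l \<xi> 1) / (z - 1)) holomorphic_on {s. Re s > 0}"
    by (rule pole_lemma[OF HH_holomorphic[OF \<xi>]]) (simp add: interior_open[OF open_right_half])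
  also have "(\<lambda>z. if z = 1 then deriv (HH l \<xi>) 1 else (HH l \<xi> z - HH l \<xi> 1) / (z - 1)) = Lent l \<xi>"
    by (auto simp: Lent_def Lq_def H1 fun_eq_iff)
  finally show ?thesis .
qed

lemma Lent_dser: "dchar l \<xi> \<Longrightarrow> Re s > 1 \<Longrightarrow> Lent l \<xi> s = dser \<xi> s"
  unfolding Lent_def using Lq_dser by auto

text \<open>Bridge to the elementary statement: a zero of the L-function at 1 means that the partial
  sums of \<open>x n / n\<close> tend to 0. The passage is quantitative, since the tail of
  \<open>H\<close> carries a factor \<open>s - 1\<close> that can be divided out before letting
  \<open>s\<close> tend to 1 from the right.\<close>

lemma real_character_Lent_nonzero:
  assumes nt: "nontrivial_dchar l \<xi>" and real: "\<And>n. coprime n l \<Longrightarrow> (\<xi> n)\<^sup>2 = 1"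
  shows "Lent l \<xi> 1 \<noteq> 0"
proof
  assume zero: "Lent l \<xi> 1 = 0"
  have \<xi>: "dchar l \<xi>" using nt by (simp add: nontrivial_dchar_def)
  have al: "cmean l \<xi> = 0" by (rule cmean_nontrivial[OF nt])
  interpret mean_coeffs \<xi> 0 "2 * real l" using dchar_mean_coeffs[OF \<xi>] unfolding al .
  define x where "x = (\<lambda>n. Re (\<xi> n))"
  have vals0: "\<xi> n \<in> {0, 1, -1}" for n
    using real[of n] dcharD(6)[OF \<xi>, of n] by (cases "coprime n l") (auto simp: power2_eq_1_iff)
  have xr: "\<xi> n = of_real (x n)" for n using vals0[of n] by (auto simp: x_def complex_eq_iff)
  have vals: "x n \<in> {0, 1, -1}" for n using vals0[of n] by (auto simp: x_def)
  have mult: "x (m * n) = x m * x n" for m n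
    using dcharD(4)[OF \<xi>, of m n] unfolding xr of_real_mult[symmetric] by (rule of_real_eq_iff[THEN iffD1])
  have x1: "x 1 = 1" using dcharD(2)[OF \<xi>] by (simp add: x_def)
  have bnd: "\<bar>\<Sum>n=1..N. x n\<bar> \<le> 2 * real l" for N
  proof -
    have "norm (\<Sum>n=1..N. \<xi> n) \<le> 2 * real l" using disc[of N] by simp
    also have "(\<Sum>n=1..N. \<xi> n) = of_real (\<Sum>n=1..N. x n)" by (simp add: xr)
    finally show ?thesis by (simp only: norm_of_real)
  qed
  have Hh: "HH l \<xi> = H" unfolding HH_def al ..
  have key: "\<bar>\<Sum>n=1..Suc M. x n / real n\<bar> \<le> 100 * (real l + 1) / real (M + 2)" for M
  proof -
    define P where "P = (\<lambda>s::complex. \<Sum>n=1..Suc M. \<xi> n * of_nat n powr (- s))"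
    define R where "R = (\<lambda>s::complex. psum (Suc M) * of_nat (Suc (Suc M)) powr (- s))"
    \<comment> \<open>The error of the truncated L-series after its boundary term \<open>R\<close>.
      For \<open>s > 1\<close> it is the tail of \<open>H\<close> over \<open>s - 1\<close>, hence
      \<open>O(1 / M)\<close> uniformly; by continuity this persists at
      \<open>s = 1\<close>.\<close>
    define W where "W = (\<lambda>s. Lent l \<xi> s - (P s - R s))"
    have Wh: "W holomorphic_on {s. Re s > 0}"
      unfolding W_def P_def R_def by (intro holomorphic_intros Lent_holomorphic[OF nt])
    have Wc: "isCont W 1"
      using holomorphic_on_imp_continuous_on[OF Wh] by (simp add: continuous_on_eq_continuous_at[OF open_right_half])
    define s where "s = (\<lambda>k. of_real (1 + 1 / real (Suc k)) :: complex)"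
    have "(\<lambda>k. 1 + 1 / real (Suc k)) \<longlonglongrightarrow> 1" by real_asymp
    then have "s \<longlonglongrightarrow> of_real 1" unfolding s_def by (rule tendsto_of_real)
    then have Wl: "(\<lambda>k. norm (W (s k))) \<longlonglongrightarrow> norm (W 1)"
      by (intro tendsto_norm isCont_tendsto_compose[OF Wc]) simp
    have Wb: "norm (W (s k)) \<le> 8 * (4 * real l + 1) / real (M + 2)" for k
    proof -
      define \<sigma> where "\<sigma> = 1 + 1 / real (Suc k)"
      have \<sigma>: "1 < \<sigma>" "\<sigma> \<le> 2" by (auto simp: \<sigma>_def field_simps)
      have sk: "s k = of_real \<sigma>" by (simp add: s_def \<sigma>_def)
      have ne: "s k - 1 \<noteq> 0" using \<sigma> unfolding sk by (simp add: complex_eq_iff)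
      have "H (s k) - ((\<Sum>N<Suc M. hterm (Suc N) (s k)) + 0 * s k) = (s k - 1) * W (s k)"
        unfolding hterm_partial_sum using ne by (simp add: W_def P_def R_def Lent_def Lq_def Hh field_simps)
      then have "norm ((s k - 1) * W (s k)) \<le> norm (s k) * norm (s k - 1) * (2 * (2 * real l) + 1) * (4 * real (M + 2) powr (- Re (s k)))"
        using H_tail[of "s k" M] \<sigma> by (simp only:) (simp add: sk)
      then have "norm (s k - 1) * norm (W (s k)) \<le> norm (s k - 1) * (norm (s k) * (4 * real l + 1) * (4 * real (M + 2) powr (- Re (s k))))"
        by (simp only: norm_mult) (simp add: mult_ac)
      then have "norm (W (s k)) \<le> norm (s k) * (4 * real l + 1) * (4 * real (M + 2) powr (- Re (s k)))"
        using ne by (subst (asm) mult_le_cancel_left_pos) auto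
      also have "\<dots> \<le> 2 * (4 * real l + 1) * (4 * real (M + 2) powr (- 1))"
      proof (intro mult_mono)
        show "real (M + 2) powr (- Re (s k)) \<le> real (M + 2) powr (- 1)" using \<sigma> unfolding sk by (intro powr_mono) auto
        show "norm (s k) \<le> 2" unfolding sk using \<sigma> by simp
      qed auto
      also have "\<dots> = 8 * (4 * real l + 1) / real (M + 2)" by (simp add: powr_minus divide_inverse)
      finally show ?thesis .
    qed
    have W1: "norm (W 1) \<le> 8 * (4 * real l + 1) / real (M + 2)"
      by (rule LIMSEQ_le_const2[OF Wl]) (use Wb in blast)
    have powr1: "of_nat n powr (- 1 :: complex) = 1 / of_nat n" for n
      by (cases "n = 0") (simp_all add: powr_minus divide_inverse)
    have P1: "P 1 = of_real (\<Sum>n=1..Suc M. x n / real n)" by (simp add: P_def powr1 xr del: sum.cl_ivl_Suc of_nat_Suc)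
    have "psum (Suc M) = of_real (\<Sum>n=1..Suc M. x n)" by (simp add: psum_def xr del: sum.cl_ivl_Suc)
    then have "norm (psum (Suc M)) \<le> 2 * real l" using bnd[of "Suc M"] by (simp only: norm_of_real)
    then have R1: "norm (R 1) \<le> 2 * real l / real (M + 2)"
      unfolding R_def powr1 by (simp add: norm_mult norm_divide divide_right_mono del: of_nat_Suc)
    have "P 1 = R 1 - W 1" by (simp add: W_def zero)
    then have "norm (P 1) \<le> norm (R 1) + norm (W 1)" by (simp only: norm_triangle_ineq4)
    also have "\<dots> \<le> 2 * real l / real (M + 2) + 8 * (4 * real l + 1) / real (M + 2)" by (rule add_mono[OF R1 W1])
    also have "\<dots> = (34 * real l + 8) / real (M + 2)" by (simp add: add_divide_distrib[symmetric])
    also have "\<dots> \<le> 100 * (real l + 1) / real (M + 2)" by (intro divide_right_mono) auto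
    finally show ?thesis unfolding P1 norm_of_real .
  qed
  have "(\<lambda>M. 100 * (real l + 1) / real (M + 2)) \<longlonglongrightarrow> 0" by real_asymp
  then have "(\<lambda>M. \<Sum>n=1..Suc M. x n / real n) \<longlonglongrightarrow> 0"
    by (rule Lim_null_comparison[rotated]) (use key in \<open>simp del: sum.cl_ivl_Suc\<close>)
  then have "(\<lambda>M. \<Sum>n=1..M. x n / real n) \<longlonglongrightarrow> 0" by (rule LIMSEQ_imp_Suc)
  then show False by (rule real_character_L1_nonzero[OF mult x1 vals bnd])
qed

text \<open>The 3-4-1 argument needs the series of the squared character to stay bounded near
  \<open>1 + 2 i t\<close>. This holds if \<open>t \<noteq> 0\<close>, or if the square is
  nontrivial. In the remaining case the character is real and \<open>t = 0\<close>: the square has a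
  pole at 1, and \<open>real_character_Lent_nonzero\<close> takes over.\<close>

lemma Lent_line_nonzero:
  assumes nt: "nontrivial_dchar l \<xi>"
  shows "Lent l \<xi> (Complex 1 t) \<noteq> 0"
proof -
  have \<xi>: "dchar l \<xi>" using nt by (simp add: nontrivial_dchar_def)
  have \<xi>2: "dchar l (\<lambda>n. (\<xi> n)\<^sup>2)" by (rule dchar_square[OF \<xi>])
  have box: "Re z \<ge> 1 \<and> Im z = 2 * t" if "z \<in> cbox (Complex 1 (2 * t)) (Complex 2 (2 * t))" for z
    using that by (auto simp: cbox_def Basis_complex_def)
  have G: "norm (dser \<xi> (Complex \<sigma> t)) \<le> 1 * norm (Lent l \<xi> (Complex \<sigma> t))" if "1 < \<sigma>" "\<sigma> \<le> 2" for \<sigma>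
    using that by (subst Lent_dser[OF \<xi>]) auto
  consider "t \<noteq> 0" | "t = 0" "nontrivial_dchar l (\<lambda>n. (\<xi> n)\<^sup>2)" | "t = 0" "\<not> nontrivial_dchar l (\<lambda>n. (\<xi> n)\<^sup>2)" by blast
  then show ?thesis
  proof cases
    case 1
    have "continuous_on (cbox (Complex 1 (2 * t)) (Complex 2 (2 * t))) (Lq l (\<lambda>n. (\<xi> n)\<^sup>2))"
      using box 1 by (intro holomorphic_on_imp_continuous_on holomorphic_on_subset[OF Lq_holomorphic[OF \<xi>2]]) force
    then show ?thesis
      by (intro line_nonvanishing[OF \<xi> Lent_holomorphic[OF nt] _ G]) (auto simp: Lq_dser[OF \<xi>2])
  next
    case 2
    have "continuous_on (cbox (Complex 1 (2 * t)) (Complex 2 (2 * t))) (Lent l (\<lambda>n. (\<xi> n)\<^sup>2))"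
      using box by (intro holomorphic_on_imp_continuous_on holomorphic_on_subset[OF Lent_holomorphic[OF 2(2)]]) force
    then show ?thesis
      by (intro line_nonvanishing[OF \<xi> Lent_holomorphic[OF nt] _ G]) (auto simp: Lent_dser[OF \<xi>2])
  next
    case 3
    then have "(\<xi> n)\<^sup>2 = 1" if "coprime n l" for n using \<xi>2 that by (auto simp: nontrivial_dchar_def)
    from real_character_Lent_nonzero[OF nt this] show ?thesis using 3 by (simp add: Complex_eq)
  qed
qed

text \<open>\<open>HH\<close> is \<open>s - 1\<close> times \<zeta>, so its value at 1 is the
  residue 1. Away from 1 the factor \<open>s - 1\<close> has modulus at least \<open>abs t\<close>,
  and the general argument applies with that loss.\<close>

lemma zeta_line_nonzero: "HH 1 (\<lambda>_. 1) (Complex 1 t) \<noteq> 0"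
proof (cases "t = 0")
  case True
  then show ?thesis using HH_1[OF dchar_one] by (simp add: Complex_eq cmean_def)
next
  case False
  have box: "Re z \<ge> 1 \<and> Im z = 2 * t" if "z \<in> cbox (Complex 1 (2 * t)) (Complex 2 (2 * t))" for z
    using that by (auto simp: cbox_def Basis_complex_def)
  have "continuous_on (cbox (Complex 1 (2 * t)) (Complex 2 (2 * t))) (Lq 1 (\<lambda>_. 1))"
    using box False by (intro holomorphic_on_imp_continuous_on holomorphic_on_subset[OF Lq_holomorphic[OF dchar_one]]) force
  moreover have "norm (dser (\<lambda>_. 1) (Complex \<sigma> t)) \<le> (1 / \<bar>t\<bar>) * norm (HH 1 (\<lambda>_. 1) (Complex \<sigma> t))" if "1 < \<sigma>" for \<sigma>
  proof -
    have "\<bar>t\<bar> \<le> norm (Complex \<sigma> t - 1)" using abs_Im_le_cmod[of "Complex \<sigma> t - 1"] by simp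
    then have "\<bar>t\<bar> * norm (dser (\<lambda>_. 1) (Complex \<sigma> t)) \<le> norm (Complex \<sigma> t - 1) * norm (dser (\<lambda>_. 1) (Complex \<sigma> t))"
      by (rule mult_right_mono) simp
    also have "\<dots> = norm (HH 1 (\<lambda>_. 1) (Complex \<sigma> t))" using that by (subst HH_dser[OF dchar_one]) (auto simp: norm_mult)
    finally show ?thesis using False by (simp add: field_simps)
  qed
  ultimately show ?thesis
    by (intro line_nonvanishing[OF dchar_one HH_holomorphic[OF dchar_one], where A = "1 / \<bar>t\<bar>" and ?G2.0 = "Lq 1 (\<lambda>_. 1)"]) (auto simp: Lq_dser[OF dchar_one] simp del: One_nat_def)
qed

text \<open>Compactness settles the heights up to 1, which the quantitative bounds for
  \<open>Lq\<close> exclude because of the possible pole. A compact set inside the open set of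
  non-zeros has a neighbourhood of fixed width there, and continuous functions on a compact box have
  bounds.\<close>

lemma nonvanishing_box:
  assumes hol: "G holomorphic_on {s. Re s > 0}" and line: "\<And>t. G (Complex 1 t) \<noteq> 0" and right: "\<And>s. Re s > 1 \<Longrightarrow> G s \<noteq> 0"
  shows "\<exists>\<rho> m M. 0 < \<rho> \<and> \<rho> \<le> 1/2 \<and> 0 < m \<and> 0 < M \<and> (\<forall>s. 1 - \<rho> \<le> Re s \<and> Re s \<le> 2 \<and> \<bar>Im s\<bar> \<le> 1 \<longrightarrow> norm (G s) \<ge> m \<and> norm (deriv G s) \<le> M)"
proof -
  define S where "S = cbox (Complex 1 (- 1)) (Complex 2 1)"
  define U where "U = {s. Re s > 0} \<inter> G -` (- {0})"
  have "open U" unfolding U_def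
    by (rule continuous_open_preimage[OF holomorphic_on_imp_continuous_on[OF hol] open_right_half]) auto
  moreover have "S \<subseteq> U"
  proof
    fix s assume "s \<in> S"
    then have "Re s \<ge> 1" by (auto simp: S_def cbox_def Basis_complex_def)
    moreover have "G s \<noteq> 0"
    proof (cases "Re s = 1")
      case True
      then have "s = Complex 1 (Im s)" by (simp add: complex_eq_iff)
      then show ?thesis using line[of "Im s"] by metis
    next
      case False
      then show ?thesis using right[of s] \<open>Re s \<ge> 1\<close> by simp
    qed
    ultimately show "s \<in> U" by (auto simp: U_def)
  qed
  moreover have "compact S" by (simp add: S_def)
  ultimately obtain e where e: "e > 0" "(\<Union>x\<in>S. cball x e) \<subseteq> U"
    using compact_subset_open_imp_cball_epsilon_subset by metis
  define \<rho> where "\<rho> = min e (1/2)"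
  have \<rho>: "0 < \<rho>" "\<rho> \<le> 1/2" "\<rho> \<le> e" using e by (auto simp: \<rho>_def)
  define V where "V = cbox (Complex (1 - \<rho>) (- 1)) (Complex 2 1)"
  have V: "s \<in> V \<longleftrightarrow> 1 - \<rho> \<le> Re s \<and> Re s \<le> 2 \<and> \<bar>Im s\<bar> \<le> 1" for s by (auto simp: V_def cbox_def Basis_complex_def)
  have VU: "s \<in> U" if s: "s \<in> V" for s
  proof -
    define x where "x = Complex (max 1 (Re s)) (Im s)"
    have "x \<in> S" using s by (auto simp: V x_def S_def cbox_def Basis_complex_def)
    moreover have "x - s = of_real (max 1 (Re s) - Re s)" by (simp add: x_def complex_eq_iff)
    then have "dist x s \<le> e" unfolding dist_norm using s \<rho> by (simp only: norm_of_real V) auto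
    ultimately show ?thesis using e(2) by force
  qed
  have sub: "V \<subseteq> {s. Re s > 0}" using \<rho> by (auto simp: V)
  have cV: "compact V" "V \<noteq> {}" using \<rho> V[of 1] by (auto simp: V_def)
  have "continuous_on V (\<lambda>s. norm (G s))"
    by (intro continuous_on_norm holomorphic_on_imp_continuous_on holomorphic_on_subset[OF hol sub])
  then obtain z where z: "z \<in> V" "\<And>s. s \<in> V \<Longrightarrow> norm (G z) \<le> norm (G s)"
    using continuous_attains_inf[OF cV] by blast
  have "deriv G holomorphic_on {s. Re s > 0}" by (rule holomorphic_deriv[OF hol open_right_half])
  then have "continuous_on V (deriv G)" using sub by (rule holomorphic_on_imp_continuous_on[OF holomorphic_on_subset])
  then have "bounded (deriv G ` V)" using cV by (intro compact_imp_bounded compact_continuous_image)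
  then obtain M where M: "M > 0" "\<And>z. z \<in> V \<Longrightarrow> norm (deriv G z) \<le> M" by (auto simp: bounded_pos)
  have "norm (G z) > 0" using VU[OF z(1)] by (simp add: U_def)
  then show ?thesis using \<rho> M z(2) unfolding V by (intro exI[of _ \<rho>] exI[of _ "norm (G z)"] exI[of _ M]) auto
qed

section \<open>Bounds throughout the zero-free region\<close>

lemma zregion_facts:
  assumes T: "T \<ge> 3" and c: "0 < c" "c \<le> a" "c \<le> \<rho>" and z: "z \<in> zregion c 10 T"
  shows "1 - \<rho> \<le> Re (1 + z)" "1 - a / ln T ^ 9 \<le> Re (1 + z)" "Re (1 + z) \<le> 2" "\<bar>Im (1 + z)\<bar> \<le> T"
proof -
  have lT: "ln T \<ge> 1" by (rule ln_ge_1[OF T])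
  have "c / ln T ^ 10 \<le> c / 1" using c lT by (intro divide_left_mono) auto
  \<comment> \<open>The spare logarithm lets one exponent serve both the width of the region and the
    growth of the function.\<close>
  moreover have "c / ln T ^ 10 \<le> a / ln T ^ 9" using c lT by (intro frac_le power_increasing) auto
  ultimately show "1 - \<rho> \<le> Re (1 + z)" "1 - a / ln T ^ 9 \<le> Re (1 + z)" "Re (1 + z) \<le> 2" "\<bar>Im (1 + z)\<bar> \<le> T"
    using z c by (auto simp: zregion_def)
qed

text \<open>\<open>1 / HH\<close> at \<open>1 + s\<close> is
  \<open>1 / (s * \<zeta>(1 + s))\<close>, the Laplace transform of the sums of
  \<open>mu n / n\<close> in logarithmic scale; it is regular at \<open>s = 0\<close>. Low heights
  come from \<open>nonvanishing_box\<close>, the others from \<open>Lq_lower\<close>.\<close>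

lemma zeta_reciprocal_region:
  "\<exists>c K. 0 < c \<and> c \<le> 1 \<and> 0 < K \<and> (\<forall>T\<ge>3. (\<lambda>s. 1 / HH 1 (\<lambda>_. 1) (1 + s)) holomorphic_on zregion c 10 T \<and>
     (\<forall>s\<in>zregion c 10 T. norm (1 / HH 1 (\<lambda>_. 1) (1 + s)) \<le> K * ln T ^ 10))"
proof -
  let ?G = "HH 1 (\<lambda>_. 1)"
  have hol: "?G holomorphic_on {s. Re s > 0}" by (rule HH_holomorphic[OF dchar_one])
  have "?G s \<noteq> 0" if "Re s > 1" for s using that dser_nonzero[OF dchar_one that] by (subst HH_dser[OF dchar_one]) auto
  from nonvanishing_box[OF hol zeta_line_nonzero this]
  obtain \<rho> m M where \<rho>: "0 < \<rho>" "\<rho> \<le> 1/2" "0 < m"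
    and box: "\<And>s. 1 - \<rho> \<le> Re s \<Longrightarrow> Re s \<le> 2 \<Longrightarrow> \<bar>Im s\<bar> \<le> 1 \<Longrightarrow> norm (?G s) \<ge> m" by blast
  from Lq_lower[OF dchar_one] obtain a n where a: "0 < a" "a \<le> 1/8" "0 < n"
    and far: "\<And>T s. T \<ge> 3 \<Longrightarrow> 1 \<le> \<bar>Im s\<bar> \<Longrightarrow> \<bar>Im s\<bar> \<le> T \<Longrightarrow> 1 - a / ln T ^ 9 \<le> Re s \<Longrightarrow> Re s \<le> 2 \<Longrightarrow> norm (Lq 1 (\<lambda>_. 1) s) \<ge> n / ln T ^ 7" by blast
  define c where "c = min a \<rho>"
  have c: "0 < c" "c \<le> a" "c \<le> \<rho>" using a \<rho> by (auto simp: c_def)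
  define q where "q = min m n"
  have q: "q > 0" "q \<le> m" "q \<le> n" using a \<rho> by (auto simp: q_def)
  have low: "norm (?G (1 + s)) \<ge> q / ln T ^ 10" if T: "T \<ge> 3" and s: "s \<in> zregion c 10 T" for T s
  proof -
    note F = zregion_facts[OF T c s]
    have lT: "ln T \<ge> 1" by (rule ln_ge_1[OF T])
    show ?thesis
    proof (cases "\<bar>Im s\<bar> \<le> 1")
      case True
      have "q / ln T ^ 10 \<le> m / 1" using q lT \<rho> by (intro frac_le) auto
      also have "\<dots> \<le> norm (?G (1 + s))" using box[of "1 + s"] F True by simp
      finally show ?thesis .
    next
      case False
      have "q / ln T ^ 10 \<le> n / ln T ^ 7" using q lT a by (intro frac_le power_increasing) auto
      also have "\<dots> \<le> norm (Lq 1 (\<lambda>_. 1) (1 + s))" using F False by (intro far[OF T]) auto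
      also have "\<dots> \<le> norm (Lq 1 (\<lambda>_. 1) (1 + s)) * norm s"
        using False abs_Im_le_cmod[of s] by (intro mult_le_cancel_left1[THEN iffD2]) auto
      also have "\<dots> = norm (Lq 1 (\<lambda>_. 1) (1 + s) * s)" by (simp only: norm_mult)
      also have "Lq 1 (\<lambda>_. 1) (1 + s) * s = ?G (1 + s)" using False by (auto simp: Lq_def)
      finally show ?thesis .
    qed
  qed
  have pos: "q / ln T ^ 10 > 0" if "T \<ge> 3" for T using q ln_ge_1[OF that] by simp
  have up: "norm (1 / ?G (1 + s)) \<le> (1 / q) * ln T ^ 10" if T: "T \<ge> 3" and s: "s \<in> zregion c 10 T" for T s
  proof -
    have "1 / norm (?G (1 + s)) \<le> 1 / (q / ln T ^ 10)" using low[OF T s] pos[OF T] by (intro frac_le) auto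
    then show ?thesis by (simp add: norm_divide)
  qed
  have hl: "(\<lambda>s. 1 / ?G (1 + s)) holomorphic_on zregion c 10 T" if T: "T \<ge> 3" for T
  proof (intro holomorphic_intros)
    have "(?G \<circ> (\<lambda>s. 1 + s)) holomorphic_on zregion c 10 T"
      using zregion_facts(1)[OF T c] \<rho> by (intro holomorphic_on_compose_gen[OF _ hol] holomorphic_intros) force
    then show "(\<lambda>s. ?G (1 + s)) holomorphic_on zregion c 10 T" by (simp only: o_def)
    show "?G (1 + s) \<noteq> 0" if "s \<in> zregion c 10 T" for s using low[OF T that] pos[OF T] by auto
  qed
  show ?thesis using c \<rho> q up hl by (intro exI[of _ c] exI[of _ "1 / q"]) auto
qed

text \<open>Above height 1 the quotient is at most \<open>(ln T)^2\<close> divided by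
  \<open>(ln T)^(-7)\<close>, up to a constant, so the exponent 10 leaves room. The divisor
  \<open>1 + s\<close> comes from the Laplace transform of a summatory function.\<close>

lemma log_derivative_region:
  assumes nt: "nontrivial_dchar l \<xi>"
  shows "\<exists>c K. 0 < c \<and> c \<le> 1 \<and> 0 < K \<and> (\<forall>T\<ge>3. (\<lambda>s. - deriv (Lent l \<xi>) (1 + s) / Lent l \<xi> (1 + s) / (1 + s)) holomorphic_on zregion c 10 T \<and>
     (\<forall>s\<in>zregion c 10 T. norm (- deriv (Lent l \<xi>) (1 + s) / Lent l \<xi> (1 + s) / (1 + s)) \<le> K * ln T ^ 10))"
proof -
  let ?G = "Lent l \<xi>"
  have \<xi>: "dchar l \<xi>" using nt by (simp add: nontrivial_dchar_def)
  have hol: "?G holomorphic_on {s. Re s > 0}" by (rule Lent_holomorphic[OF nt])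
  have hold: "deriv ?G holomorphic_on {s. Re s > 0}" by (rule holomorphic_deriv[OF hol open_right_half])
  have "?G s \<noteq> 0" if "Re s > 1" for s using that dser_nonzero[OF \<xi> that] by (subst Lent_dser[OF \<xi>]) auto
  from nonvanishing_box[OF hol Lent_line_nonzero[OF nt] this]
  obtain \<rho> m M where \<rho>: "0 < \<rho>" "\<rho> \<le> 1/2" "0 < m" "0 < M"
    and box: "\<And>s. 1 - \<rho> \<le> Re s \<Longrightarrow> Re s \<le> 2 \<Longrightarrow> \<bar>Im s\<bar> \<le> 1 \<Longrightarrow> norm (?G s) \<ge> m \<and> norm (deriv ?G s) \<le> M" by blast
  from Lq_lower[OF \<xi>] obtain a n where a: "0 < a" "a \<le> 1/8" "0 < n"
    and far: "\<And>T s. T \<ge> 3 \<Longrightarrow> 1 \<le> \<bar>Im s\<bar> \<Longrightarrow> \<bar>Im s\<bar> \<le> T \<Longrightarrow> 1 - a / ln T ^ 9 \<le> Re s \<Longrightarrow> Re s \<le> 2 \<Longrightarrow> norm (Lq l \<xi> s) \<ge> n / ln T ^ 7" by blast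
  define c where "c = min a \<rho>"
  have c: "0 < c" "c \<le> a" "c \<le> \<rho>" using a \<rho> by (auto simp: c_def)
  define K where "K = M / m + 64 * CU l / n"
  have K: "K > 0" "M / m \<le> K" "64 * CU l / n \<le> K" using a \<rho> CU_pos[of l] by (auto simp: K_def add_pos_pos)
  have main: "?G (1 + s) \<noteq> 0 \<and> norm (deriv ?G (1 + s)) / norm (?G (1 + s)) \<le> K * ln T ^ 10" if T: "T \<ge> 3" and s: "s \<in> zregion c 10 T" for T s
  proof -
    note F = zregion_facts[OF T c s]
    have lT: "ln T \<ge> 1" by (rule ln_ge_1[OF T])
    show ?thesis
    proof (cases "\<bar>Im s\<bar> \<le> 1")
      case True
      have b: "norm (?G (1 + s)) \<ge> m" "norm (deriv ?G (1 + s)) \<le> M" using box[of "1 + s"] F True by auto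
      have "norm (deriv ?G (1 + s)) / norm (?G (1 + s)) \<le> M / m" using b \<rho> by (intro frac_le) auto
      also have "\<dots> \<le> K * 1" using K by simp
      also have "\<dots> \<le> K * ln T ^ 10" using K lT by (intro mult_left_mono) auto
      finally show ?thesis using b \<rho> by auto
    next
      case False
      have ne: "1 + s \<noteq> 1" using False by auto
      have "Lq l \<xi> holomorphic_on ({s. Re s > 0} - {1})" by (rule Lq_holomorphic[OF \<xi>])
      have Geq: "?G (1 + s) = Lq l \<xi> (1 + s)" using ne by (simp add: Lent_def)
      \<comment> \<open>\<open>Lent\<close> and \<open>Lq\<close> differ only at the point 1, so
        they agree in a neighbourhood of any other point.\<close>
      have "deriv ?G (1 + s) = deriv (Lq l \<xi>) (1 + s)"
      proof (rule deriv_cong_ev[OF _ refl])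
        have "\<forall>\<^sub>F x in nhds (1 + s). x \<in> - {1}" using ne by (intro eventually_nhds_in_open) auto
        then show "\<forall>\<^sub>F x in nhds (1 + s). ?G x = Lq l \<xi> x" by eventually_elim (auto simp: Lent_def)
      qed
      moreover have "norm (deriv (Lq l \<xi>) (1 + s)) \<le> 64 * CU l * (ln T)\<^sup>2"
      proof (rule Lq_deriv_bound[OF \<xi> T])
        have "a / ln T ^ 9 \<le> (1/8) / ln T" using a lT self_le_power[of "ln T" 9] by (intro frac_le) auto
        then show "1 - 1 / (8 * ln T) \<le> Re (1 + s)" using F(2) by simp
      qed (use F False in auto)
      ultimately have d: "norm (deriv ?G (1 + s)) \<le> 64 * CU l * (ln T)\<^sup>2" by simp
      have g: "norm (?G (1 + s)) \<ge> n / ln T ^ 7" unfolding Geq using F False by (intro far[OF T]) auto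
      have p: "n / ln T ^ 7 > 0" using a lT by simp
      have "norm (deriv ?G (1 + s)) / norm (?G (1 + s)) \<le> 64 * CU l * (ln T)\<^sup>2 / (n / ln T ^ 7)"
        using d g p CU_pos[of l] by (intro frac_le) auto
      also have "\<dots> = 64 * CU l / n * ln T ^ 9" by (simp add: power_add[symmetric])
      also have "\<dots> \<le> K * ln T ^ 10" using K lT by (intro mult_mono power_increasing) auto
      finally show ?thesis using g p by auto
    qed
  qed
  have re: "Re (1 + s) \<ge> 1/2" if "T \<ge> 3" "s \<in> zregion c 10 T" for T s
    using zregion_facts(1)[OF that(1) c that(2)] \<rho> by simp
  have up: "norm (- deriv ?G (1 + s) / ?G (1 + s) / (1 + s)) \<le> (2 * K) * ln T ^ 10" if T: "T \<ge> 3" and s: "s \<in> zregion c 10 T" for T s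
  proof -
    have n1: "norm (1 + s) \<ge> 1/2" using re[OF T s] complex_Re_le_cmod[of "1 + s"] by linarith
    have "norm (- deriv ?G (1 + s) / ?G (1 + s) / (1 + s)) = norm (deriv ?G (1 + s)) / norm (?G (1 + s)) / norm (1 + s)"
      by (simp only: norm_divide norm_minus_cancel)
    also have "\<dots> \<le> (K * ln T ^ 10) / (1/2)" using main[OF T s] n1 K ln_ge_1[OF T] by (intro frac_le) auto
    finally show ?thesis by simp
  qed
  have hl: "(\<lambda>s. - deriv ?G (1 + s) / ?G (1 + s) / (1 + s)) holomorphic_on zregion c 10 T" if T: "T \<ge> 3" for T
  proof -
    have sh: "(\<lambda>s. f (1 + s)) holomorphic_on zregion c 10 T" if "f holomorphic_on {s. Re s > 0}" for f
    proof -
      have "(f \<circ> (\<lambda>s. 1 + s)) holomorphic_on zregion c 10 T"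
        using re[OF T] by (intro holomorphic_on_compose_gen[OF _ that] holomorphic_intros) force
      then show ?thesis by (simp only: o_def)
    qed
    have "1 + s \<noteq> 0" if "s \<in> zregion c 10 T" for s
    proof
      assume "1 + s = 0"
      then have "Re (1 + s) = Re 0" by (simp only:)
      then show False using re[OF T that] by simp
    qed
    then show ?thesis using main[OF T] by (intro holomorphic_on_divide holomorphic_on_minus sh[OF hol] sh[OF hold] holomorphic_intros) auto
  qed
  show ?thesis using c \<rho> K up hl by (intro exI[of _ c] exI[of _ "2 * K"]) auto
qed

section \<open>Applying the Tauberian theorem\<close>

lemma laplace_half_line:
  fixes s :: complex
  assumes s: "Re s > 0"
  shows "has_bochner_integral lborel (\<lambda>u. indicator {c..} u *\<^sub>R exp (- (s * of_real u))) (exp (- (s * of_real c)) / s)"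
proof -
  have s0: "s \<noteq> 0" using s by auto
  define f where "f = (\<lambda>u::real. exp (- (s * of_real u)))"
  define F where "F = (\<lambda>u::real. - exp (- (s * of_real u)) / s)"
  have nf: "norm (f u) = exp (- (Re s * u))" for u by (simp add: f_def)
  have meas: "f \<in> borel_measurable borel" unfolding f_def by measurable
  have int1: "integrable lborel (\<lambda>u. indicator {c..} u *\<^sub>R f u)"
  proof (rule Bochner_Integration.integrable_bound[OF has_bochner_integral_iff[THEN iffD1, THEN conjunct1, OF exp_indicator_integral[OF s, of c]]])
    show "(\<lambda>u. indicator {c..} u *\<^sub>R f u) \<in> borel_measurable lborel" using meas by simp
    show "AE u in lborel. norm (indicator {c..} u *\<^sub>R f u) \<le> norm (indicator {c..} u * exp (- (Re s * u)))"
      by (simp add: nf indicator_def)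
  qed
  have int2: "integrable lborel (\<lambda>u. indicator {c<..} u *\<^sub>R f u)"
  proof (rule Bochner_Integration.integrable_bound[OF int1])
    show "(\<lambda>u. indicator {c<..} u *\<^sub>R f u) \<in> borel_measurable lborel" using meas by simp
    show "AE u in lborel. norm (indicator {c<..} u *\<^sub>R f u) \<le> norm (indicator {c..} u *\<^sub>R f u)"
      by (simp add: indicator_def)
  qed
  have Fd: "(F has_vector_derivative f x) (at x)" for x
  proof -
    have "((\<lambda>z. - exp (- (s * z)) / s) has_field_derivative exp (- (s * of_real x))) (at (of_real x))"
      using s0 by (auto intro!: derivative_eq_intros simp: field_simps)
    then show ?thesis unfolding F_def f_def by (rule has_vector_derivative_real_field)
  qed
  have "(LBINT u=ereal c..\<infinity>. f u) = 0 - F c"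
  proof (rule interval_integral_FTC_integrable)
    show "isCont f x" for x unfolding f_def by (intro continuous_intros)
    show "set_integrable lborel (einterval (ereal c) \<infinity>) f" using int2 by (simp add: set_integrable_def)
    have "isCont F c" unfolding F_def using s0 by (intro continuous_intros) auto
    then have "(F \<longlongrightarrow> F c) (at_right c)" by (simp add: isCont_def filterlim_at_split)
    then show "((F \<circ> real_of_ereal) \<longlongrightarrow> F c) (at_right (ereal c))" by (simp add: ereal_tendsto_simps)
    have ex: "((\<lambda>u. exp (- (c * u))) \<longlongrightarrow> 0) at_top" if "c > 0" for c :: real using that by real_asymp
    have "((\<lambda>u. exp (- (Re s * u)) / norm s) \<longlongrightarrow> 0 / norm s) at_top"
      using s0 by (intro tendsto_divide tendsto_const ex s) simp
    then have "((\<lambda>u. exp (- (Re s * u)) / norm s) \<longlongrightarrow> 0) at_top" by simp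
    then have "((\<lambda>u. norm (F u)) \<longlongrightarrow> 0) at_top" by (simp add: F_def norm_divide)
    then have "(F \<longlongrightarrow> 0) at_top" by (rule tendsto_norm_zero_cancel)
    then show "((F \<circ> real_of_ereal) \<longlongrightarrow> 0) (at_left \<infinity>)" by (simp add: ereal_tendsto_simps)
  qed (use Fd in auto)
  then have "(LINT u|lborel. indicator {c<..} u *\<^sub>R f u) = exp (- (s * of_real c)) / s"
    unfolding interval_integral_to_infinity_eq set_lebesgue_integral_def by (simp add: F_def)
  \<comment> \<open>The fundamental theorem is applied on the open half-line; the end point has
    measure zero.\<close>
  moreover have "(LINT u|lborel. indicator {c..} u *\<^sub>R f u) = (LINT u|lborel. indicator {c<..} u *\<^sub>R f u)"
  proof (rule integral_cong_AE)
    show "(\<lambda>u. indicator {c..} u *\<^sub>R f u) \<in> borel_measurable lborel" using meas by simp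
    show "(\<lambda>u. indicator {c<..} u *\<^sub>R f u) \<in> borel_measurable lborel" using meas by simp
    show "AE u in lborel. indicator {c..} u *\<^sub>R f u = indicator {c<..} u *\<^sub>R f u"
      using AE_lborel_singleton[of c] by eventually_elim (auto simp: indicator_def)
  qed
  ultimately show ?thesis using int1 by (simp add: has_bochner_integral_iff f_def)
qed

definition summ :: "(nat \<Rightarrow> complex) \<Rightarrow> real \<Rightarrow> complex" where
  "summ a u = (\<Sum>n=1..nat \<lfloor>exp u\<rfloor>. a n)"

lemma summ_measurable: "summ a \<in> borel_measurable borel"
proof -
  have fl: "(\<lambda>u::real. \<lfloor>exp u\<rfloor>) \<in> measurable borel (count_space UNIV)" by measurable
  from measurable_compose[OF fl, of "\<lambda>k::int. \<Sum>n=1..nat k. a n" borel] show ?thesis by (simp add: summ_def[abs_def])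
qed

lemma floor_exp_bounds:
  assumes "u \<ge> (0::real)"
  shows "nat \<lfloor>exp u\<rfloor> \<ge> 1" "real (nat \<lfloor>exp u\<rfloor>) \<le> exp u" "real (nat \<lfloor>exp u\<rfloor>) > exp u - 1" "exp u \<le> 2 * real (nat \<lfloor>exp u\<rfloor>)"
    "ln (real (nat \<lfloor>exp u\<rfloor>)) \<le> u"
proof -
  have "exp u \<ge> 1" using assms by simp
  then show 1: "nat \<lfloor>exp u\<rfloor> \<ge> 1" and 2: "real (nat \<lfloor>exp u\<rfloor>) \<le> exp u" and 3: "real (nat \<lfloor>exp u\<rfloor>) > exp u - 1" by linarith+
  show "exp u \<le> 2 * real (nat \<lfloor>exp u\<rfloor>)" using 1 3 by linarith
  have "ln (real (nat \<lfloor>exp u\<rfloor>)) \<le> ln (exp u)" using 1 2 assms by (subst ln_le_cancel_iff) auto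
  then show "ln (real (nat \<lfloor>exp u\<rfloor>)) \<le> u" by simp
qed

lemma summ_neg: "u < 0 \<Longrightarrow> summ a u = 0"
proof -
  assume "u < 0"
  then have "exp u < 1" by simp
  then have "\<lfloor>exp u\<rfloor> \<le> 0" by linarith
  then show ?thesis by (simp add: summ_def)
qed

lemma summ_ln: "N \<ge> 1 \<Longrightarrow> summ a (ln (real N)) = (\<Sum>n=1..N. a n)"
  by (simp add: summ_def)

lemma nat_powr_uminus: "n \<ge> 1 \<Longrightarrow> (of_nat n :: complex) powr (- s) = exp (- (s * of_real (ln (real n))))"
  by (simp add: powr_def Ln_of_nat)

text \<open>The summatory function is a sum of steps, the \<open>n\<close>-th one starting at
  \<open>u = ln n\<close>. For fixed \<open>u\<close> only finitely many have begun, and absolute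
  convergence of the Dirichlet series justifies integrating term by term.\<close>

lemma laplace_summ:
  assumes s: "Re s > 0" and sm: "(\<lambda>n. norm (a n * of_nat n powr (- s))) summable_on UNIV"
  shows "(LINT u|lborel. summ a u * exp (- (s * of_real u))) = dser a s / s"
proof -
  define f where "f = (\<lambda>n u. a (Suc n) * (indicator {ln (real (Suc n))..} u *\<^sub>R exp (- (s * of_real u))))"
  have hb: "has_bochner_integral lborel (f n) (a (Suc n) * of_nat (Suc n) powr (- s) / s)" for n
    using has_bochner_integral_mult_right[OF laplace_half_line[OF s, of "ln (real (Suc n))"], of "a (Suc n)"]
    unfolding f_def by (subst nat_powr_uminus) (auto simp del: of_nat_Suc)
  have nf: "norm (f n u) = norm (a (Suc n)) * (indicator {ln (real (Suc n))..} u * exp (- (Re s * u)))" for n u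
    by (simp add: f_def norm_mult indicator_def)
  have nint: "(LINT u|lborel. norm (f n u)) = norm (a (Suc n) * of_nat (Suc n) powr (- s)) / Re s" for n
  proof -
    have "(LINT u|lborel. norm (f n u)) = norm (a (Suc n)) * (exp (- (Re s * ln (real (Suc n)))) / Re s)"
      unfolding nf by (rule has_bochner_integral_integral_eq[OF has_bochner_integral_mult_right[OF exp_indicator_integral[OF s]]])
    also have "exp (- (Re s * ln (real (Suc n)))) = norm (of_nat (Suc n) powr (- s) :: complex)"
      by (subst nat_powr_uminus) (auto simp del: of_nat_Suc)
    finally show ?thesis by (simp add: norm_mult del: of_nat_Suc)
  qed
  have finN: "f n u = 0" if "n \<notin> {..<nat \<lfloor>exp u\<rfloor>}" for n u
  proof -
    have "exp u < real (Suc n)" using that by simp linarith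
    then have "u < ln (real (Suc n))" by (metis exp_gt_zero less_trans ln_exp ln_less_cancel_iff)
    then show ?thesis by (simp add: f_def)
  qed
  have fsum: "(\<Sum>n. f n u) = summ a u * exp (- (s * of_real u))" for u
  proof -
    have "(\<Sum>n. f n u) = (\<Sum>n<nat \<lfloor>exp u\<rfloor>. f n u)" by (rule suminf_finite) (use finN in auto)
    also have "\<dots> = (\<Sum>n<nat \<lfloor>exp u\<rfloor>. a (Suc n) * exp (- (s * of_real u)))"
    proof (rule sum.cong[OF refl])
      fix n assume "n \<in> {..<nat \<lfloor>exp u\<rfloor>}"
      then have "real (Suc n) \<le> exp u" by simp linarith
      then have "ln (real (Suc n)) \<le> u" by (metis exp_gt_zero ln_exp ln_le_cancel_iff of_nat_0_less_iff zero_less_Suc)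
      then show "f n u = a (Suc n) * exp (- (s * of_real u))" by (simp add: f_def)
    qed
    also have "\<dots> = (\<Sum>n<nat \<lfloor>exp u\<rfloor>. a (Suc n)) * exp (- (s * of_real u))" by (simp add: sum_distrib_right)
    also have "(\<Sum>n<nat \<lfloor>exp u\<rfloor>. a (Suc n)) = summ a u"
      unfolding summ_def by (rule sum.reindex_bij_witness[of _ "\<lambda>n. n - 1" Suc]) auto
    finally show ?thesis .
  qed
  have sms: "summable (\<lambda>n. norm (a n * of_nat n powr (- s)))" using sm by (rule summable_on_imp_summable)
  have "(\<lambda>i. integral\<^sup>L lborel (f i)) sums (LINT u|lborel. (\<Sum>i. f i u))"
  proof (rule sums_integral)
    show "integrable lborel (f i)" for i by (rule has_bochner_integral_iff[THEN iffD1, THEN conjunct1, OF hb])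
    show "AE u in lborel. summable (\<lambda>i. norm (f i u))"
      using finN by (intro always_eventually allI summable_finite[of "{..<nat \<lfloor>exp u\<rfloor>}" for u]) auto
    show "summable (\<lambda>i. LINT u|lborel. norm (f i u))"
      unfolding nint using sms summable_Suc_iff[of "\<lambda>n. norm (a n * of_nat n powr (- s))"] by (intro summable_divide) blast
  qed
  then have "(\<lambda>n. a (Suc n) * of_nat (Suc n) powr (- s) / s) sums (LINT u|lborel. summ a u * exp (- (s * of_real u)))"
    unfolding fsum has_bochner_integral_integral_eq[OF hb] .
  moreover have "(\<lambda>n. a (Suc n) * of_nat (Suc n) powr (- s) / s) sums (dser a s / s)"
  proof (rule sums_divide)
    have "(\<lambda>n. a n * of_nat n powr (- s)) sums dser a s"
      unfolding dser_def by (rule has_sum_imp_sums[OF has_sum_infsum[OF abs_summable_summable[OF sm]]])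
    then show "(\<lambda>n. a (Suc n) * of_nat (Suc n) powr (- s)) sums dser a s"
      by (subst sums_Suc_iff) simp
  qed
  ultimately show ?thesis by (rule sums_unique2)
qed

lemma dser_derivative:
  assumes a: "\<And>n. norm (a n) \<le> 1" and s: "Re s > 1"
  shows "(dser a has_field_derivative - dser (\<lambda>n. a n * of_real (ln (real n))) s) (at s)"
proof -
  define \<sigma> where "\<sigma> = (1 + Re s) / 2"
  have \<sigma>: "1 < \<sigma>" "\<sigma> < Re s" using s by (auto simp: \<sigma>_def)
  define S where "S = {z::complex. Re z > \<sigma>}"
  have S: "open S" "s \<in> S" using \<sigma> by (auto simp: S_def open_halfspace_Re_gt)
  obtain g g' where g: "\<forall>x\<in>S. ((\<lambda>n. a n * of_nat n powr (- x)) sums g x) \<and>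
      ((\<lambda>n. - (a n * of_real (ln (real n)) * of_nat n powr (- x))) sums g' x) \<and> (g has_field_derivative g' x) (at x)"
  proof (rule series_and_derivative_comparison[OF S(1)])
    show "summable (\<lambda>n. real n powr (- \<sigma>))" using \<sigma> by (simp add: summable_real_powr_iff)
    fix n :: nat and x :: complex assume x: "x \<in> S"
    show "((\<lambda>x. a n * of_nat n powr (- x)) has_field_derivative - (a n * of_real (ln (real n)) * of_nat n powr (- x))) (at x)"
    proof (cases "n = 0")
      case False
      then have "((\<lambda>x. a n * exp (- (x * of_real (ln (real n))))) has_field_derivative - (a n * of_real (ln (real n)) * exp (- (x * of_real (ln (real n)))))) (at x)"
        by (auto intro!: derivative_eq_intros)
      then show ?thesis using False by (simp add: nat_powr_uminus)
    qed simp
  next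
    show "\<forall>\<^sub>F n in sequentially. \<forall>x\<in>S. norm (a n * of_nat n powr (- x)) \<le> real n powr (- \<sigma>)"
    proof (intro eventually_sequentiallyI[of 1] ballI)
      fix n :: nat and x :: complex assume n: "1 \<le> n" and x: "x \<in> S"
      have "norm (a n) * real n powr (- Re x) \<le> 1 * real n powr (- \<sigma>)"
        using a[of n] x n by (intro mult_mono powr_mono) (auto simp: S_def)
      then show "norm (a n * of_nat n powr (- x)) \<le> real n powr (- \<sigma>)" by (simp only: norm_dterm mult_1_left)
    qed
  qed blast
  have gd: "g x = dser a x" if "x \<in> S" for x
  proof -
    have "Re x > 1" using that \<sigma> by (simp add: S_def)
    have "(\<lambda>n. a n * of_nat n powr (- x)) sums dser a x"
      unfolding dser_def by (rule has_sum_imp_sums[OF has_sum_infsum[OF abs_summable_summable[OF abs_summable_on_dser[OF a \<open>Re x > 1\<close>]]]])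
    then show ?thesis using g that sums_unique2 by blast
  qed
  have "norm (a n * of_real (ln (real n))) \<le> ln (real n)" if "n > 0" for n
    using that a[of n] mult_right_mono[OF a[of n], of "ln (real n)"] by (simp add: norm_mult)
  then have "(\<lambda>n. norm (a n * of_real (ln (real n)) * of_nat n powr (- s))) summable_on UNIV"
    by (rule abs_summable_on_dser_ln[OF _ s])
  then have "(\<lambda>n. a n * of_real (ln (real n)) * of_nat n powr (- s)) sums dser (\<lambda>n. a n * of_real (ln (real n))) s"
    unfolding dser_def by (intro has_sum_imp_sums has_sum_infsum) (rule abs_summable_summable)
  then have "(\<lambda>n. - (a n * of_real (ln (real n)) * of_nat n powr (- s))) sums - dser (\<lambda>n. a n * of_real (ln (real n))) s"
    by (rule sums_minus)
  then have "g' s = - dser (\<lambda>n. a n * of_real (ln (real n))) s" using g S(2) sums_unique2 by blast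
  then have "(g has_field_derivative - dser (\<lambda>n. a n * of_real (ln (real n))) s) (at s)" using g S(2) by auto
  then show ?thesis by (rule has_field_derivative_transform_within_open[OF _ S]) (rule gd)
qed

section \<open>The Moebius and twisted von Mangoldt sums\<close>

definition twisted_mangoldt :: "(nat \<Rightarrow> complex) \<Rightarrow> nat \<Rightarrow> complex" where
  "twisted_mangoldt \<xi> n = of_real (mangoldt n) * \<xi> n"

lemma norm_twisted_mangoldt: "dchar l \<xi> \<Longrightarrow> norm (twisted_mangoldt \<xi> n) \<le> mangoldt n"
  unfolding twisted_mangoldt_def norm_mult norm_of_real
  using mult_left_mono[OF norm_dchar_le, of l \<xi> "\<bar>mangoldt n\<bar>" n] mangoldt_nonneg[of n] by simp

lemma twisted_mangoldt_summable:
  assumes "dchar l \<xi>" "Re s > 1"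
  shows "(\<lambda>n. norm (twisted_mangoldt \<xi> n * of_nat n powr (- s))) summable_on UNIV"
  by (rule abs_summable_on_dser_ln[OF _ assms(2)]) (rule order_trans[OF norm_twisted_mangoldt[OF assms(1)] mangoldt_le])

text \<open>Complete multiplicativity pulls the character out of the divisor sum, and the divisor
  sum of \<Lambda> is \<open>ln n\<close>. So the series times the L-series is the L-series with
  weights \<open>ln n\<close>, that is, minus its derivative.\<close>

lemma dser_log_derivative:
  assumes nt: "nontrivial_dchar l \<xi>" and s: "Re s > 1"
  shows "dser (twisted_mangoldt \<xi>) s = - deriv (Lent l \<xi>) s / Lent l \<xi> s"
proof -
  have \<xi>: "dchar l \<xi>" using nt by (simp add: nontrivial_dchar_def)
  have "dser (twisted_mangoldt \<xi>) s * dser \<xi> s = dser (\<lambda>n. \<Sum>d | d dvd n. twisted_mangoldt \<xi> d * \<xi> (n div d)) s"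
    by (rule dser_mult[OF twisted_mangoldt_summable[OF \<xi> s] abs_summable_on_dser[OF norm_dchar_le[OF \<xi>] s]])
  also have "\<dots> = dser (\<lambda>n. \<xi> n * of_real (ln (real n))) s"
  proof -
    have "(\<Sum>d | d dvd n. twisted_mangoldt \<xi> d * \<xi> (n div d)) = \<xi> n * of_real (ln (real n))" if "n \<ge> 1" for n
    proof -
      have "(\<Sum>d | d dvd n. twisted_mangoldt \<xi> d * \<xi> (n div d)) = (\<Sum>d | d dvd n. of_real (mangoldt d) * \<xi> n)"
      proof (rule sum.cong[OF refl])
        fix d assume "d \<in> {d. d dvd n}"
        then have "d * (n div d) = n" by simp
        then have "\<xi> d * \<xi> (n div d) = \<xi> n" using dcharD(4)[OF \<xi>, of d "n div d"] by simp
        then show "twisted_mangoldt \<xi> d * \<xi> (n div d) = of_real (mangoldt d) * \<xi> n" by (simp add: twisted_mangoldt_def)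
      qed
      also have "\<dots> = of_real (\<Sum>d | d dvd n. mangoldt d) * \<xi> n" by (simp only: sum_distrib_right of_real_sum)
      also have "(\<Sum>d | d dvd n. mangoldt d :: real) = ln (real n)" using that by (subst mangoldt_sum) auto
      finally show ?thesis by (simp add: mult.commute)
    qed
    then show ?thesis unfolding dser_Ici by (intro infsum_cong) auto
  qed
  also have "\<dots> = - deriv (dser \<xi>) s"
    using DERIV_imp_deriv[OF dser_derivative[OF norm_dchar_le[OF \<xi>] s]] by simp
  also have "deriv (dser \<xi>) s = deriv (Lent l \<xi>) s"
  proof (rule deriv_cong_ev[OF _ refl])
    have "\<forall>\<^sub>F x in nhds s. x \<in> {z. Re z > 1}" using s by (intro eventually_nhds_in_open open_halfspace_Re_gt) auto
    then show "\<forall>\<^sub>F x in nhds s. dser \<xi> x = Lent l \<xi> x" by eventually_elim (simp add: Lent_dser[OF \<xi>])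
  qed
  finally show ?thesis using dser_nonzero[OF \<xi> s] by (simp add: Lent_dser[OF \<xi> s] field_simps)
qed

lemma dser_mu_eq:
  assumes s: "Re s > 1"
  shows "dser mu s * dser (\<lambda>_. 1) s = 1"
proof -
  have "dser mu s * dser (\<lambda>_. 1) s = dser (\<lambda>n. \<Sum>d | d dvd n. mu d * 1) s"
    by (rule dser_mult; rule abs_summable_on_dser[OF _ s]) (use norm_mu_le in auto)
  also have "\<dots> = (\<Sum>\<^sub>\<infinity>n\<in>{1::nat..}. if n = 1 then 1 else 0)"
    unfolding dser_Ici by (intro infsum_cong) (auto simp: mu_divisor_sum_1)
  also have "\<dots> = (\<Sum>\<^sub>\<infinity>n\<in>{1::nat}. 1)" by (intro infsum_cong_neutral) auto
  finally show ?thesis by simp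
qed

text \<open>The term \<open>exp (- u)\<close> is the rounding of \<open>exp u\<close> to an integer,
  relative to its size. It is the reason for the same term in the Lipschitz hypothesis of
  \<open>tauberian\<close>, which step functions must be able to satisfy.\<close>

lemma harmonic_gap:
  assumes u: "0 \<le> u" "u \<le> v"
  shows "(\<Sum>n\<in>{nat \<lfloor>exp u\<rfloor><..nat \<lfloor>exp v\<rfloor>}. 1 / real n) \<le> (v - u) + 2 * exp (- u)"
proof -
  define m M where "m = nat \<lfloor>exp u\<rfloor>" and "M = nat \<lfloor>exp v\<rfloor>"
  note fu = floor_exp_bounds[OF u(1)] and fv = floor_exp_bounds[of v]
  have m: "m \<ge> 1" "exp u \<le> 2 * real m" "real m > exp u - 1" using fu by (auto simp: m_def)
  have mM: "m \<le> M" unfolding m_def M_def using u by (intro nat_mono floor_mono) auto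
  have M: "ln (real M) \<le> v" using fv u by (simp add: M_def)
  have gap: "(\<Sum>n\<in>{m<..M}. 1 / real n) \<le> ln (real M) - ln (real m)" using mM
  proof (induction M rule: dec_induct)
    case (step n)
    have "ln (real n / real (Suc n)) \<le> real n / real (Suc n) - 1" using m step by (intro ln_le_minus_one) auto
    also have "real n / real (Suc n) - 1 = - (1 / real (Suc n))" by (simp add: field_simps)
    finally have "1 / real (Suc n) \<le> ln (real (Suc n)) - ln (real n)" using m step by (simp add: ln_div)
    moreover have "{m<..Suc n} = insert (Suc n) {m<..n}" using step by auto
    ultimately show ?case using step.IH by simp
  qed simp
  have "ln (exp u / real m) \<le> exp u / real m - 1" using m by (intro ln_le_minus_one) auto
  moreover have "ln (exp u / real m) = u - ln (real m)" using m by (subst ln_div) auto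
  moreover have "exp u / real m \<le> 1 + 1 / real m" using m by (simp add: field_simps)
  moreover have "1 / real m \<le> 2 * exp (- u)" using m by (simp add: exp_minus field_simps)
  ultimately have "u - ln (real m) \<le> 2 * exp (- u)" by linarith
  then show ?thesis using gap M unfolding m_def[symmetric] M_def[symmetric] by linarith
qed

lemma summ_diff: "u \<le> v \<Longrightarrow> summ a v - summ a u = (\<Sum>n\<in>{nat \<lfloor>exp u\<rfloor><..nat \<lfloor>exp v\<rfloor>}. a n)"
proof -
  assume "u \<le> v"
  then have "nat \<lfloor>exp u\<rfloor> \<le> nat \<lfloor>exp v\<rfloor>" by (intro nat_mono floor_mono) auto
  then have "{1..nat \<lfloor>exp v\<rfloor>} = {1..nat \<lfloor>exp u\<rfloor>} \<union> {nat \<lfloor>exp u\<rfloor><..nat \<lfloor>exp v\<rfloor>}" by auto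
  then have "summ a v = summ a u + (\<Sum>n\<in>{nat \<lfloor>exp u\<rfloor><..nat \<lfloor>exp v\<rfloor>}. a n)"
    unfolding summ_def by (simp only:) (subst sum.union_disjoint, auto)
  then show ?thesis by simp
qed

text \<open>The Tauberian theorem for the sums of \<open>mu n / n\<close> in logarithmic scale.
  Their Laplace transform is the series of \<mu> at \<open>1 + s\<close> divided by
  \<open>s\<close>; this \<open>s\<close> combines with \<zeta> to give \<open>HH\<close>, so
  nothing singular is left at 0.\<close>

theorem mu_harm_bound: "\<exists>C. \<forall>n\<ge>1. norm (mu_harm n) \<le> C / (1 + ln (real n))\<^sup>2"
proof -
  define a where "a = (\<lambda>n. mu n / of_nat n)"
  have na: "norm (a n) \<le> 1 / real n" for n
    using norm_mu_le[of n] by (simp add: a_def norm_divide divide_right_mono)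
  obtain c K where c: "0 < c" "c \<le> 1" "0 < K"
    and reg: "\<And>T. T \<ge> 3 \<Longrightarrow> (\<lambda>s. 1 / HH 1 (\<lambda>_. 1) (1 + s)) holomorphic_on zregion c 10 T"
      "\<And>T s. T \<ge> 3 \<Longrightarrow> s \<in> zregion c 10 T \<Longrightarrow> norm (1 / HH 1 (\<lambda>_. 1) (1 + s)) \<le> K * ln T ^ 10"
    using zeta_reciprocal_region by metis
  have "\<exists>D. \<forall>v\<ge>0. norm (summ a v) \<le> D / (1 + v)\<^sup>2"
  proof (rule tauberian[where C = 2, OF summ_measurable summ_neg _ _ _ reg c])
    fix u :: real assume u: "u \<ge> 0"
    note f = floor_exp_bounds[OF u]
    have "norm (summ a u) \<le> (\<Sum>n=1..nat \<lfloor>exp u\<rfloor>. 1 / real n)"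
      unfolding summ_def by (rule sum_norm_le) (rule na)
    also have "\<dots> \<le> 1 + ln (real (nat \<lfloor>exp u\<rfloor>))" by (rule harm_le[OF f(1)])
    finally show "norm (summ a u) \<le> 2 * (1 + u)" using f(5) u by simp
  next
    have ord: "norm (summ a u - summ a v) \<le> 2 * (1 + u + v) * (\<bar>u - v\<bar> + exp (- min u v))" if uv: "0 \<le> u" "u \<le> v" for u v
    proof -
      have "norm (summ a u - summ a v) = norm (summ a v - summ a u)" by (rule norm_minus_commute)
      also have "\<dots> \<le> (\<Sum>n\<in>{nat \<lfloor>exp u\<rfloor><..nat \<lfloor>exp v\<rfloor>}. 1 / real n)"
        unfolding summ_diff[OF uv(2)] by (rule sum_norm_le) (rule na)
      also have "\<dots> \<le> (v - u) + 2 * exp (- u)" by (rule harmonic_gap[OF uv])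
      also have "\<dots> \<le> 2 * ((v - u) + exp (- u))" using uv by simp
      also have "\<dots> \<le> 2 * (1 + u + v) * ((v - u) + exp (- u))" using uv by (intro mult_right_mono add_nonneg_nonneg) auto
      finally show ?thesis using uv by (simp add: min_def)
    qed
    fix u v :: real assume uv: "0 \<le> u" "0 \<le> v"
    show "norm (summ a u - summ a v) \<le> 2 * (1 + u + v) * (\<bar>u - v\<bar> + exp (- min u v))"
    proof (cases "u \<le> v")
      case True then show ?thesis using ord uv by blast
    next
      case False
      then show ?thesis using ord[of v u] uv by (simp add: norm_minus_commute abs_minus_commute min.commute add_ac)
    qed
  next
    fix s :: complex assume s: "Re s > 0"
    have trm: "a n * of_nat n powr (- s) = mu n * of_nat n powr (- (1 + s))" for n
    proof (cases "n = 0")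
      case False
      have "(of_nat n :: complex) powr (- (1 + s)) = of_nat n powr (- s - 1)" by (rule arg_cong[of _ _ "\<lambda>z. of_nat n powr z"]) simp
      also have "\<dots> = of_nat n powr (- s) / of_nat n powr 1" by (rule powr_diff)
      finally show ?thesis using False by (simp add: a_def)
    qed simp
    have "(\<lambda>n. norm (a n * of_nat n powr (- s))) summable_on UNIV"
      unfolding trm using s by (intro abs_summable_on_dser norm_mu_le) simp
    then have "(LINT u|lborel. summ a u * exp (- (s * of_real u))) = dser a s / s" by (rule laplace_summ[OF s])
    also have "dser a s = dser mu (1 + s)" unfolding dser_def trm ..
    also have "dser mu (1 + s) / s = 1 / HH 1 (\<lambda>_. 1) (1 + s)"
    proof -
      have r: "Re (1 + s) > 1" using s by simp
      have "HH 1 (\<lambda>_. 1) (1 + s) = s * dser (\<lambda>_. 1) (1 + s)" by (subst HH_dser[OF dchar_one r]) simp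
      moreover have "dser (\<lambda>_. 1) (1 + s) \<noteq> 0" using dser_mu_eq[OF r] by auto
      moreover from this have "dser mu (1 + s) = 1 / dser (\<lambda>_. 1) (1 + s)"
        using dser_mu_eq[OF r] by (simp only: eq_divide_eq if_True simp_thms not_False_eq_True)
      ultimately show ?thesis by simp
    qed
    finally show "(LINT u|lborel. summ a u * exp (- (s * of_real u))) = 1 / HH 1 (\<lambda>_. 1) (1 + s)" .
  qed auto
  then obtain D where D: "\<And>v. v \<ge> 0 \<Longrightarrow> norm (summ a v) \<le> D / (1 + v)\<^sup>2" by blast
  have "norm (mu_harm n) \<le> D / (1 + ln (real n))\<^sup>2" if n: "n \<ge> 1" for n
    using D[of "ln (real n)"] n by (simp add: summ_ln mu_harm_def a_def)
  then show ?thesis by blast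
qed

text \<open>On short intervals \<Lambda> is bounded trivially by its largest possible logarithm. The
  Lipschitz estimate then carries a factor of size \<open>v\<close>, which is why
  \<open>tauberian\<close> admits the factor \<open>1 + u + v\<close>.\<close>

theorem twisted_psi_bound:
  assumes nt: "nontrivial_dchar l \<xi>"
  shows "\<exists>C. \<forall>N\<ge>1. norm (\<Sum>n=1..N. twisted_mangoldt \<xi> n) \<le> C * real N / (1 + ln (real N))\<^sup>2"
proof -
  have \<xi>: "dchar l \<xi>" using nt by (simp add: nontrivial_dchar_def)
  define a where "a = twisted_mangoldt \<xi>"
  have na: "norm (a n) \<le> mangoldt n" for n unfolding a_def by (rule norm_twisted_mangoldt[OF \<xi>])
  \<comment> \<open>Normalized by \<open>exp u\<close>, the Chebyshev sum is bounded, and its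
    Laplace transform at \<open>s\<close> is that of the unnormalized sum at
    \<open>1 + s\<close>.\<close>
  define B where "B = (\<lambda>u. of_real (exp (- u)) * summ a u)"
  obtain c K where c: "0 < c" "c \<le> 1" "0 < K"
    and reg: "\<And>T. T \<ge> 3 \<Longrightarrow> (\<lambda>s. - deriv (Lent l \<xi>) (1 + s) / Lent l \<xi> (1 + s) / (1 + s)) holomorphic_on zregion c 10 T"
      "\<And>T s. T \<ge> 3 \<Longrightarrow> s \<in> zregion c 10 T \<Longrightarrow> norm (- deriv (Lent l \<xi>) (1 + s) / Lent l \<xi> (1 + s) / (1 + s)) \<le> K * ln T ^ 10"
    using log_derivative_region[OF nt] by blast
  have sb: "norm (summ a u) \<le> 4 * exp u" if u: "u \<ge> 0" for u
  proof -
    have "norm (summ a u) \<le> (\<Sum>n=1..nat \<lfloor>exp u\<rfloor>. mangoldt n)"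
      unfolding summ_def by (rule sum_norm_le) (rule na)
    also have "\<dots> \<le> 4 * real (nat \<lfloor>exp u\<rfloor>)" by (rule sum_mangoldt_le)
    finally show ?thesis using floor_exp_bounds(2)[OF u] by linarith
  qed
  have "\<exists>D. \<forall>v\<ge>0. norm (B v) \<le> D / (1 + v)\<^sup>2"
  proof (rule tauberian[where C = 4, OF _ _ _ _ _ reg c])
    show "B \<in> borel_measurable borel" unfolding B_def using summ_measurable[of a] by measurable
    show "B u = 0" if "u < 0" for u using that by (simp add: B_def summ_neg)
  next
    fix u :: real assume u: "u \<ge> 0"
    have "norm (B u) \<le> exp (- u) * (4 * exp u)"
      unfolding B_def norm_mult using sb[OF u] by (intro mult_mono) auto
    also have "\<dots> = 4" by (simp add: exp_minus)
    finally show "norm (B u) \<le> 4 * (1 + u)" using u by simp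
  next
    have ord: "norm (B u - B v) \<le> 4 * (1 + u + v) * (\<bar>u - v\<bar> + exp (- min u v))" if uv: "0 \<le> u" "u \<le> v" for u v
    proof -
      define m M where "m = nat \<lfloor>exp u\<rfloor>" and "M = nat \<lfloor>exp v\<rfloor>"
      have v0: "v \<ge> 0" using uv by simp
      have mM: "m \<le> M" unfolding m_def M_def using uv by (intro nat_mono floor_mono) auto
      have "norm (summ a v - summ a u) \<le> (\<Sum>n\<in>{m<..M}. ln (real M))"
        unfolding summ_diff[OF uv(2)] m_def[symmetric] M_def[symmetric]
      proof (rule sum_norm_le)
        fix n assume n: "n \<in> {m<..M}"
        then have "mangoldt n \<le> ln (real n)" by (intro mangoldt_le) auto
        also have "\<dots> \<le> ln (real M)" using n by (subst ln_le_cancel_iff) auto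
        finally show "norm (a n) \<le> ln (real M)" using na[of n] by simp
      qed
      also have "\<dots> = real (M - m) * ln (real M)" by simp
      also have "\<dots> \<le> (exp v - exp u + 1) * v"
      proof (intro mult_mono)
        show "real (M - m) \<le> exp v - exp u + 1"
          unfolding of_nat_diff[OF mM] using floor_exp_bounds(3)[OF uv(1)] floor_exp_bounds(2)[OF v0]
          unfolding m_def M_def by linarith
        show "ln (real M) \<le> v" using floor_exp_bounds(5)[OF v0] by (simp add: M_def)
      qed (use uv floor_exp_bounds(1)[OF v0] in \<open>auto simp: M_def\<close>)
      finally have d: "norm (summ a v - summ a u) \<le> (exp v - exp u + 1) * v" .
      have ee: "exp (- u) * exp u = 1" "exp (- v) * exp v = 1" "exp (- v) * exp u = exp (- (v - u))"
        unfolding exp_add[symmetric] by simp_all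
      have ev: "1 - exp (- (v - u)) \<le> v - u" using exp_ge_add_one_self[of "- (v - u)"] by linarith
      have "B u - B v = of_real (exp (- u) - exp (- v)) * summ a u - of_real (exp (- v)) * (summ a v - summ a u)"
        by (simp add: B_def algebra_simps)
      then have "norm (B u - B v) \<le> norm (of_real (exp (- u) - exp (- v)) * summ a u) + norm (of_real (exp (- v)) * (summ a v - summ a u))"
        by (simp only: norm_triangle_ineq4)
      also have "norm (of_real (exp (- u) - exp (- v)) * summ a u) \<le> (exp (- u) - exp (- v)) * (4 * exp u)"
        unfolding norm_mult norm_of_real using uv sb[OF uv(1)] by (intro mult_mono) auto
      also have "\<dots> = 4 * (exp (- u) * exp u - exp (- v) * exp u)" by (simp only: left_diff_distrib right_diff_distrib mult_ac)
      also have "\<dots> = 4 * (1 - exp (- (v - u)))" unfolding ee ..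
      also have "\<dots> \<le> 4 * (v - u)" using ev by simp
      also have "norm (of_real (exp (- v)) * (summ a v - summ a u)) \<le> exp (- v) * ((exp v - exp u + 1) * v)"
        unfolding norm_mult using d by (intro mult_mono) auto
      also have "\<dots> = v * (exp (- v) * exp v - exp (- v) * exp u + exp (- v))"
        by (simp only: left_diff_distrib right_diff_distrib distrib_left distrib_right mult_ac mult_1_left mult_1_right)
      also have "\<dots> = v * (1 - exp (- (v - u)) + exp (- v))" unfolding ee ..
      also have "\<dots> \<le> v * ((v - u) + exp (- u))" using ev uv v0 by (intro mult_left_mono add_mono) auto
      also have "4 * (v - u) + v * ((v - u) + exp (- u)) \<le> 4 * (1 + u + v) * ((v - u) + exp (- u))"
      proof -
        have e0: "exp (- u) > 0" by simp
        define X where "X = (v - u) + exp (- u)"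
        have X: "X \<ge> 0" "v - u \<le> X" using uv e0 by (auto simp: X_def)
        have "4 * (v - u) + v * X \<le> 4 * X + (4 * u + 4 * v) * X"
          using X uv by (intro add_mono mult_right_mono mult_left_mono) auto
        also have "\<dots> = 4 * (1 + u + v) * X" by (simp add: algebra_simps)
        finally show ?thesis unfolding X_def .
      qed
      finally show ?thesis using uv by (simp add: min_def)
    qed
    fix u v :: real assume uv: "0 \<le> u" "0 \<le> v"
    show "norm (B u - B v) \<le> 4 * (1 + u + v) * (\<bar>u - v\<bar> + exp (- min u v))"
    proof (cases "u \<le> v")
      case True then show ?thesis using ord uv by blast
    next
      case False
      then show ?thesis using ord[of v u] uv by (simp add: norm_minus_commute abs_minus_commute min.commute add_ac)
    qed
  next
    fix s :: complex assume s: "Re s > 0"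
    have r: "Re (1 + s) > 1" "Re (1 + s) > 0" using s by auto
    have "B u * exp (- (s * of_real u)) = summ a u * exp (- ((1 + s) * of_real u))" for u
      by (simp add: B_def algebra_simps exp_of_real[symmetric] flip: exp_add)
    then have "(LINT u|lborel. B u * exp (- (s * of_real u))) = dser a (1 + s) / (1 + s)"
      using laplace_summ[OF r(2) twisted_mangoldt_summable[OF \<xi> r(1)]] by (simp add: a_def)
    then show "(LINT u|lborel. B u * exp (- (s * of_real u))) = - deriv (Lent l \<xi>) (1 + s) / Lent l \<xi> (1 + s) / (1 + s)"
      unfolding a_def dser_log_derivative[OF nt r(1)] .
  qed auto
  then obtain D where D: "\<And>v. v \<ge> 0 \<Longrightarrow> norm (B v) \<le> D / (1 + v)\<^sup>2" by blast
  have "norm (\<Sum>n=1..N. twisted_mangoldt \<xi> n) \<le> D * real N / (1 + ln (real N))\<^sup>2" if n: "N \<ge> 1" for N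
  proof -
    have "B (ln (real N)) = (\<Sum>n=1..N. a n) / of_nat N" using n by (simp add: B_def summ_ln exp_minus divide_inverse mult.commute)
    then have "norm (\<Sum>n=1..N. a n) / real N \<le> D / (1 + ln (real N))\<^sup>2" using D[of "ln (real N)"] n by (simp add: norm_divide)
    then show ?thesis using n by (simp add: a_def pos_divide_le_eq mult_ac)
  qed
  then show ?thesis by blast
qed

section \<open>Primes in residue classes\<close>

text \<open>Apply \<open>ln y \<le> y - 1\<close> to the sixth root \<open>y\<close> of
  \<open>x\<close>; cubing \<open>1 + ln x \<le> 6 * y\<close> gives
  \<open>216 = 6^3\<close>.\<close>

lemma ln_cube_le_sqrt:
  assumes "x \<ge> (1::real)"
  shows "(1 + ln x) ^ 3 \<le> 216 * sqrt x" "(1 + ln x)\<^sup>2 \<le> 216 * sqrt x"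
proof -
  define y where "y = x powr (1 / 6)"
  have y: "y > 0" using assms by (simp add: y_def)
  have "ln y \<le> y - 1" using y by (rule ln_le_minus_one)
  moreover have "ln y = ln x / 6" using assms by (simp add: y_def ln_powr)
  ultimately have "1 + ln x \<le> 6 * y" by simp
  moreover have l0: "ln x \<ge> 0" using assms by simp
  ultimately have "(1 + ln x) ^ 3 \<le> (6 * y) ^ 3" by (intro power_mono) auto
  also have "\<dots> = 216 * y ^ 3" by (simp add: power_mult_distrib)
  also have "y ^ 3 = x powr (1 / 2)" using assms by (simp add: y_def powr_power)
  also have "\<dots> = sqrt x" using assms by (simp add: powr_half_sqrt)
  finally show 3: "(1 + ln x) ^ 3 \<le> 216 * sqrt x" .
  have "(1 + ln x)\<^sup>2 \<le> (1 + ln x) ^ 3" using l0 by (intro power_increasing) auto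
  then show "(1 + ln x)\<^sup>2 \<le> 216 * sqrt x" using 3 by simp
qed

lemma sqrt_ln_le:
  assumes "x \<ge> (1::real)"
  shows "sqrt x * (1 + ln x) \<le> 216 * x / (1 + ln x)\<^sup>2" "sqrt x \<le> 216 * x / (1 + ln x)\<^sup>2" "1 \<le> 216 * x / (1 + ln x)\<^sup>2"
proof -
  have l0: "ln x \<ge> 0" using assms by simp
  have p: "(1 + ln x)\<^sup>2 > 0" using l0 by (intro zero_less_power) linarith
  have s: "sqrt x * sqrt x = x" "sqrt x \<ge> 1" using assms by auto
  have "sqrt x * (1 + ln x) * (1 + ln x)\<^sup>2 = sqrt x * (1 + ln x) ^ 3" by (simp add: power2_eq_square power3_eq_cube)
  also have "\<dots> \<le> sqrt x * (216 * sqrt x)" using s by (intro mult_left_mono ln_cube_le_sqrt assms) auto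
  also have "\<dots> = 216 * x" using s(1) by (simp add: mult_ac)
  finally show 1: "sqrt x * (1 + ln x) \<le> 216 * x / (1 + ln x)\<^sup>2" using p by (simp only: pos_le_divide_eq)
  have "sqrt x * 1 \<le> sqrt x * (1 + ln x)" using l0 s by (intro mult_left_mono) auto
  then show "sqrt x \<le> 216 * x / (1 + ln x)\<^sup>2" using 1 by linarith
  then show "1 \<le> 216 * x / (1 + ln x)\<^sup>2" using s(2) by linarith
qed

lemma card_square_le: "real (card {j. 1 \<le> j \<and> j * j \<le> (N::nat)}) \<le> sqrt (real N)" "finite {j. 1 \<le> j \<and> j * j \<le> (N::nat)}"
proof -
  have sub: "{j. 1 \<le> j \<and> j * j \<le> N} \<subseteq> {1..nat \<lfloor>sqrt (real N)\<rfloor>}"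
  proof
    fix j assume "j \<in> {j. 1 \<le> j \<and> j * j \<le> N}"
    then have j: "1 \<le> j" "j * j \<le> N" by auto
    then have "real j * real j \<le> real N" by (metis of_nat_le_iff of_nat_mult)
    then have "real j \<le> sqrt (real N)" by (intro real_le_rsqrt) (simp add: power2_eq_square)
    then show "j \<in> {1..nat \<lfloor>sqrt (real N)\<rfloor>}" using j by (simp add: le_nat_floor)
  qed
  have "card {j. 1 \<le> j \<and> j * j \<le> N} \<le> card {1..nat \<lfloor>sqrt (real N)\<rfloor>}" by (rule card_mono[OF _ sub]) simp
  then have "card {j. 1 \<le> j \<and> j * j \<le> N} \<le> nat \<lfloor>sqrt (real N)\<rfloor>" by simp
  then have "real (card {j. 1 \<le> j \<and> j * j \<le> N}) \<le> real (nat \<lfloor>sqrt (real N)\<rfloor>)" by (rule of_nat_mono)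
  also have "\<dots> \<le> sqrt (real N)" by (intro of_nat_floor) simp
  finally show "real (card {j. 1 \<le> j \<and> j * j \<le> N}) \<le> sqrt (real N)" .
  show "finite {j. 1 \<le> j \<and> j * j \<le> N}" by (rule finite_subset[OF sub]) simp
qed

text \<open>The at most \<open>sqrt N\<close> indices with \<open>j * j \<le> N\<close> count 1
  each; for the others \<open>ln j\<close> is at least half of \<open>ln N\<close>. This gives
  \<open>220 = 216 + 4\<close>.\<close>

lemma sum_inverse_log_square:
  assumes N: "N \<ge> 1"
  shows "(\<Sum>j=1..N. 1 / (1 + ln (real j))\<^sup>2) \<le> 220 * real N / (1 + ln (real N))\<^sup>2"
proof -
  have N1: "real N \<ge> 1" using N by simp
  have lN: "ln (real N) \<ge> 0" using N1 by simp
  have "(\<Sum>j=1..N. 1 / (1 + ln (real j))\<^sup>2) \<le> (\<Sum>j=1..N. 4 / (1 + ln (real N))\<^sup>2 + (if j * j \<le> N then 1 else 0))"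
  proof (rule sum_mono)
    fix j assume j: "j \<in> {1..N}"
    have lj: "ln (real j) \<ge> 0" using j by simp
    show "1 / (1 + ln (real j))\<^sup>2 \<le> 4 / (1 + ln (real N))\<^sup>2 + (if j * j \<le> N then 1 else 0)"
    proof (cases "j * j \<le> N")
      case True
      have "1\<^sup>2 \<le> (1 + ln (real j))\<^sup>2" using lj by (intro power_mono) auto
      then have "1 / (1 + ln (real j))\<^sup>2 \<le> 1" by (simp add: divide_le_eq_1)
      moreover have "4 / (1 + ln (real N))\<^sup>2 \<ge> 0" by simp
      ultimately have "1 / (1 + ln (real j))\<^sup>2 \<le> 4 / (1 + ln (real N))\<^sup>2 + 1" by linarith
      then show ?thesis using True by simp
    next
      case False
      then have "real N \<le> real j * real j" by (metis linear of_nat_le_iff of_nat_mult)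
      then have "ln (real N) \<le> ln (real j * real j)" using j N by (subst ln_le_cancel_iff) auto
      then have "ln (real N) \<le> 2 * ln (real j)" using j by (simp add: ln_mult)
      then have "1 + ln (real N) \<le> 2 * (1 + ln (real j))" by simp
      then have "(1 + ln (real N))\<^sup>2 \<le> (2 * (1 + ln (real j)))\<^sup>2" using lN by (intro power_mono) auto
      also have "\<dots> = 4 * (1 + ln (real j))\<^sup>2" by (simp only: power_mult_distrib) simp
      finally have le: "(1 + ln (real N))\<^sup>2 \<le> 4 * (1 + ln (real j))\<^sup>2" .
      have "(1 + ln (real N))\<^sup>2 > 0" "(1 + ln (real j))\<^sup>2 > 0" using lN lj by (auto intro!: zero_less_power add_pos_nonneg)
      then have "1 / (1 + ln (real j))\<^sup>2 \<le> 4 / (1 + ln (real N))\<^sup>2" using le by (simp only: divide_le_eq pos_le_divide_eq) (simp add: field_simps)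
      then show ?thesis using False by simp
    qed
  qed
  also have "\<dots> = 4 * real N / (1 + ln (real N))\<^sup>2 + real (card {j. 1 \<le> j \<and> j * j \<le> N})"
  proof -
    have sq: "j \<le> N" if "j * j \<le> N" for j using le_square[of j] that by (rule order_trans)
    have "x \<in> {1..N} \<inter> {j. j * j \<le> N} \<longleftrightarrow> x \<in> {j. 1 \<le> j \<and> j * j \<le> N}" for x using sq[of x] by auto
    then have "{1..N} \<inter> {j. j * j \<le> N} = {j. 1 \<le> j \<and> j * j \<le> N}" by (simp only: set_eq_iff simp_thms)
    then have "(\<Sum>j=1..N. if j * j \<le> N then 1 else (0::real)) = real (card {j. 1 \<le> j \<and> j * j \<le> N})"
      by (simp add: sum.If_cases)
    then show ?thesis by (simp add: sum.distrib)
  qed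
  also have "\<dots> \<le> 4 * real N / (1 + ln (real N))\<^sup>2 + 216 * real N / (1 + ln (real N))\<^sup>2"
    using card_square_le(1)[of N] sqrt_ln_le(2)[OF N1] by simp
  also have "\<dots> = 220 * real N / (1 + ln (real N))\<^sup>2" by (simp only: add_divide_distrib[symmetric]) simp
  finally show ?thesis .
qed

text \<open>A proper prime power \<open>p^k \<le> N\<close> has \<open>p \<le> sqrt N\<close> and,
  as \<open>ln 2 \<ge> 1/2\<close>, an exponent of at most \<open>2 * ln N\<close>; it suffices to
  count such pairs.\<close>

lemma card_proper_prime_powers:
  assumes N: "N \<ge> 1"
  shows "real (card {n. n \<le> N \<and> primepow n \<and> \<not> prime n}) \<le> 432 * real N / (1 + ln (real N))\<^sup>2"
proof -
  have N1: "real N \<ge> 1" using N by simp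
  define S where "S = {j. 1 \<le> j \<and> j * j \<le> N}"
  define K where "K = nat \<lfloor>2 * ln (real N)\<rfloor>"
  have "{n. n \<le> N \<and> primepow n \<and> \<not> prime n} \<subseteq> (\<lambda>(p, k). p ^ k) ` (S \<times> {1..K})"
  proof
    fix n assume "n \<in> {n. n \<le> N \<and> primepow n \<and> \<not> prime n}"
    then obtain p k where n: "n \<le> N" "prime p" "k > 0" "n = p ^ k" "\<not> prime n" by (auto simp: primepow_def)
    have p2: "p \<ge> 2" using n(2) by (rule prime_ge_2_nat)
    have "k \<noteq> 1" using n by auto
    then have k2: "k \<ge> 2" using n by simp
    have "p * p = p ^ 2" by (simp add: power2_eq_square)
    also have "\<dots> \<le> p ^ k" using p2 k2 by (intro power_increasing) auto
    finally have pS: "p \<in> S" using n p2 by (simp add: S_def)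
    have "2 ^ k \<le> p ^ k" using p2 by (rule power_mono) simp
    also have "\<dots> \<le> N" using n(1,4) by (simp only:)
    finally have "(2::nat) ^ k \<le> N" .
    then have "(2::real) ^ k \<le> real N" by (metis of_nat_le_iff of_nat_numeral of_nat_power)
    then have "ln ((2::real) ^ k) \<le> ln (real N)" using N by (subst ln_le_cancel_iff) auto
    then have "real k * ln 2 \<le> ln (real N)" by (simp add: ln_realpow)
    moreover have "real k * (1/2) \<le> real k * ln 2" using ln2_ge_two_thirds by (intro mult_left_mono) auto
    ultimately have "real k \<le> 2 * ln (real N)" by simp
    then have "k \<in> {1..K}" using n by (simp add: K_def le_nat_floor)
    then show "n \<in> (\<lambda>(p, k). p ^ k) ` (S \<times> {1..K})" using pS n by (auto intro!: image_eqI[of _ _ "(p, k)"])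
  qed
  then have "card {n. n \<le> N \<and> primepow n \<and> \<not> prime n} \<le> card (S \<times> {1..K})"
    using card_square_le(2)[of N] by (intro surj_card_le) (auto simp: S_def)
  then have "real (card {n. n \<le> N \<and> primepow n \<and> \<not> prime n}) \<le> real (card S) * real K" by (simp add: card_cartesian_product flip: of_nat_mult)
  also have "\<dots> \<le> sqrt (real N) * (2 * (1 + ln (real N)))"
  proof (intro mult_mono)
    show "real (card S) \<le> sqrt (real N)" unfolding S_def by (rule card_square_le)
    have "real K \<le> 2 * ln (real N)" unfolding K_def using N1 by (intro of_nat_floor) simp
    then show "real K \<le> 2 * (1 + ln (real N))" by simp
  qed auto
  also have "\<dots> = 2 * (sqrt (real N) * (1 + ln (real N)))" by simp
  also have "\<dots> \<le> 2 * (216 * real N / (1 + ln (real N))\<^sup>2)" using sqrt_ln_le(1)[OF N1] by (intro mult_left_mono) auto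
  finally show ?thesis by simp
qed

text \<open>Only the deviation of \<open>f\<close> from \<delta> is summed over the primes, so
  constants are regular without any count of the primes, and the property is linear in
  \<open>f\<close>.\<close>

definition prime_regular :: "(nat \<Rightarrow> complex) \<Rightarrow> complex \<Rightarrow> bool" where
  "prime_regular f \<delta> \<longleftrightarrow> (\<exists>C. \<forall>n\<ge>1. norm (\<Sum>p | prime p \<and> p \<le> n. f p - \<delta>) \<le> C * real n / (1 + ln (real n))\<^sup>2)"

text \<open>Partial summation removes the weight \<open>ln p\<close> from
  \<open>twisted_psi_bound\<close>; the proper prime powers are too few to matter. The constant is
  \<open>2 + 4 * 220 = 882\<close> times \<open>D\<close> from the summation, and 432 from the prime
  powers.\<close>

lemma prime_regular_nontrivial:
  assumes nt: "nontrivial_dchar l \<xi>"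
  shows "prime_regular \<xi> 0"
proof -
  have \<xi>: "dchar l \<xi>" using nt by (simp add: nontrivial_dchar_def)
  define a where "a = twisted_mangoldt \<xi>"
  have na: "norm (a n) \<le> mangoldt n" for n unfolding a_def by (rule norm_twisted_mangoldt[OF \<xi>])
  from twisted_psi_bound[OF nt] obtain D where D: "\<And>N. N \<ge> 1 \<Longrightarrow> norm (\<Sum>n=1..N. a n) \<le> D * real N / (1 + ln (real N))\<^sup>2"
    unfolding a_def by blast
  have D0: "D \<ge> 0" using D[of 1] norm_ge_zero[of "\<Sum>n=1..1. a n"] by (simp del: norm_ge_zero)
  \<comment> \<open>The \<open>max\<close> keeps the denominator away from \<open>ln 1 = 0\<close>,
    so that \<open>r\<close> lies between 0 and 2 everywhere; from 2 on it is
    \<open>1 / ln n\<close>.\<close>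
  define r where "r = (\<lambda>n. 1 / ln (real (max 2 n)))"
  define c where "c = (\<lambda>n. complex_of_real (r n))"
  have ln2: "ln 2 \<ge> (1/2::real)" using ln2_ge_two_thirds by simp
  have lnm: "ln (real (max 2 n)) \<ge> 1/2" for n
  proof -
    have "ln 2 \<le> ln (real (max 2 n))" by (subst ln_le_cancel_iff) auto
    then show ?thesis using ln2 by linarith
  qed
  have r2: "0 < r n" "r n \<le> 2" for n using lnm[of n] by (auto simp: r_def divide_simps)
  have rd: "\<bar>r j - r (j - 1)\<bar> \<le> 4 / real (j - 1)" if j: "j \<ge> 2" for j
  proof (cases "j = 2")
    case True then show ?thesis by (simp add: r_def)
  next
    case False
    then have j3: "j \<ge> 3" using j by simp
    define x y where "x = ln (real (j - 1))" and "y = ln (real j)"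
    have mx: "max 2 (j - 1) = j - 1" "max 2 j = j" using j3 by auto
    have xy: "x \<ge> 1/2" "y \<ge> 1/2" using lnm[of "j - 1"] lnm[of j] by (simp_all only: x_def y_def mx)
    have "ln (real j / real (j - 1)) \<le> real j / real (j - 1) - 1" using j3 by (intro ln_le_minus_one) auto
    moreover have "real j / real (j - 1) - 1 = 1 / real (j - 1)" using j3 by (simp add: field_simps of_nat_diff)
    moreover have "ln (real j / real (j - 1)) = y - x" using j3 by (simp add: x_def y_def ln_div)
    ultimately have d: "y - x \<le> 1 / real (j - 1)" by simp
    have yx: "x \<le> y" unfolding x_def y_def using j3 by (subst ln_le_cancel_iff) auto
    have rr: "r j = 1 / y" "r (j - 1) = 1 / x" by (simp_all only: r_def x_def y_def mx)
    have "1 / y - 1 / x = - ((y - x) / (x * y))" using xy by (simp add: diff_frac_eq minus_divide_left mult.commute)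
    moreover have "(y - x) / (x * y) \<ge> 0" using xy yx by simp
    ultimately have "\<bar>1 / y - 1 / x\<bar> = (y - x) / (x * y)" by linarith
    also have "\<dots> \<le> (1 / real (j - 1)) / (1/2 * (1/2))" using xy d by (intro frac_le mult_mono) auto
    finally show ?thesis unfolding rr by simp
  qed
  have S: "norm (\<Sum>n=1..N. a n * c n) \<le> 882 * D * real N / (1 + ln (real N))\<^sup>2" if N: "N \<ge> 1" for N
  proof -
    define X where "X = real N / (1 + ln (real N))\<^sup>2"
    have "norm (\<Sum>n=1..N. a n * c n) \<le> norm ((\<Sum>i=1..N. a i) * c N) + norm (\<Sum>j=1..N. (\<Sum>i=1..j-1. a i) * (c j - c (j - 1)))"
      by (subst abel_sum[of a c N]) (rule norm_triangle_ineq4)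
    also have "norm ((\<Sum>i=1..N. a i) * c N) \<le> (D * real N / (1 + ln (real N))\<^sup>2) * 2"
      unfolding norm_mult using D[OF N] r2[of N] order_trans[OF norm_ge_zero D[OF N]] by (intro mult_mono) (auto simp: c_def)
    also have "\<dots> = 2 * D * X" by (simp add: X_def)
    also have "norm (\<Sum>j=1..N. (\<Sum>i=1..j-1. a i) * (c j - c (j - 1))) \<le> (\<Sum>j=1..N. if j = 1 then 0 else 4 * D / (1 + ln (real (j - 1)))\<^sup>2)"
    proof (rule sum_norm_le)
      fix j assume "j \<in> {1..N}"
      show "norm ((\<Sum>i=1..j-1. a i) * (c j - c (j - 1))) \<le> (if j = 1 then 0 else 4 * D / (1 + ln (real (j - 1)))\<^sup>2)"
      proof (cases "j = 1")
        case False
        then have j: "j \<ge> 2" "j - 1 \<ge> 1" using \<open>j \<in> {1..N}\<close> by auto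
        have "norm (c j - c (j - 1)) \<le> 4 / real (j - 1)" unfolding c_def of_real_diff[symmetric] norm_of_real by (rule rd[OF j(1)])
        then have "norm ((\<Sum>i=1..j-1. a i) * (c j - c (j - 1))) \<le> (D * real (j - 1) / (1 + ln (real (j - 1)))\<^sup>2) * (4 / real (j - 1))"
          unfolding norm_mult using D[OF j(2)] order_trans[OF norm_ge_zero D[OF j(2)]] by (intro mult_mono) auto
        also have "\<dots> = 4 * D / (1 + ln (real (j - 1)))\<^sup>2" using j by simp
        finally show ?thesis using False by simp
      qed simp
    qed
    also have "\<dots> = (\<Sum>j=2..N. 4 * D / (1 + ln (real (j - 1)))\<^sup>2)"
      by (rule sum.mono_neutral_cong_right) auto
    also have "\<dots> = 4 * D * (\<Sum>i=1..N-1. 1 / (1 + ln (real i))\<^sup>2)"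
      unfolding sum_distrib_left by (rule sum.reindex_bij_witness[of _ Suc "\<lambda>j. j - 1"]) auto
    also have "\<dots> \<le> 4 * D * (\<Sum>i=1..N. 1 / (1 + ln (real i))\<^sup>2)" using D0 by (intro mult_left_mono sum_mono2) auto
    also have "\<dots> \<le> 4 * D * (220 * real N / (1 + ln (real N))\<^sup>2)" using D0 by (intro mult_left_mono sum_inverse_log_square[OF N]) auto
    also have "\<dots> = 880 * D * X" by (simp add: X_def)
    also have "2 * D * X + 880 * D * X = 882 * D * real N / (1 + ln (real N))\<^sup>2" by (simp add: X_def)
    finally show ?thesis by simp
  qed
  have "norm (\<Sum>p | prime p \<and> p \<le> N. \<xi> p - 0) \<le> (882 * D + 432) * real N / (1 + ln (real N))\<^sup>2" if N: "N \<ge> 1" for N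
  proof -
    define P where "P = {p. prime p \<and> p \<le> N}"
    define Q where "Q = {n. n \<le> N \<and> primepow n \<and> \<not> prime n}"
    have fin: "finite P" "finite Q" by (auto simp: P_def Q_def)
    have ppos: "n \<ge> 2" if "primepow n" for n :: nat using primepow_gt_Suc_0[OF that] by simp
    have "(\<Sum>n=1..N. a n * c n) = (\<Sum>n\<in>P \<union> Q. a n * c n)"
    proof (rule sum.mono_neutral_right)
      show "P \<union> Q \<subseteq> {1..N}"
      proof
        fix n assume "n \<in> P \<union> Q"
        then consider "prime n" "n \<le> N" | "primepow n" "n \<le> N" unfolding P_def Q_def by blast
        then show "n \<in> {1..N}"
        proof cases
          case 1
          then show ?thesis using prime_ge_1_nat[of n] by simp
        next
          case 2
          then show ?thesis using ppos[of n] by simp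
        qed
      qed
      show "\<forall>n\<in>{1..N} - (P \<union> Q). a n * c n = 0" by (auto simp: P_def Q_def a_def twisted_mangoldt_def mangoldt_def)
    qed simp
    also have "\<dots> = (\<Sum>n\<in>P. a n * c n) + (\<Sum>n\<in>Q. a n * c n)" using fin by (intro sum.union_disjoint) (auto simp: P_def Q_def)
    also have "(\<Sum>n\<in>P. a n * c n) = (\<Sum>p\<in>P. \<xi> p)"
    proof (rule sum.cong[OF refl])
      fix p assume "p \<in> P"
      then have p: "prime p" "p \<ge> 2" by (auto simp: P_def prime_ge_2_nat)
      then have "ln (real p) > 0" by simp
      then show "a p * c p = \<xi> p" using p by (simp add: a_def twisted_mangoldt_def c_def r_def max_def)
    qed
    finally have "(\<Sum>p\<in>P. \<xi> p) = (\<Sum>n=1..N. a n * c n) - (\<Sum>n\<in>Q. a n * c n)" by simp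
    then have "norm (\<Sum>p\<in>P. \<xi> p) \<le> norm (\<Sum>n=1..N. a n * c n) + norm (\<Sum>n\<in>Q. a n * c n)" by (simp only: norm_triangle_ineq4)
    also have "norm (\<Sum>n\<in>Q. a n * c n) \<le> (\<Sum>n\<in>Q. 1)"
    proof (rule sum_norm_le)
      fix n assume "n \<in> Q"
      then have "primepow n" unfolding Q_def by blast
      then have n: "n \<ge> 2" by (rule ppos)
      then have lp: "ln (real n) > 0" by simp
      have "norm (a n) \<le> ln (real n)" using na[of n] mangoldt_le[of n] n by simp
      then have "norm (a n) * (1 / ln (real n)) \<le> ln (real n) * (1 / ln (real n))" using lp by (intro mult_right_mono) auto
      then show "norm (a n * c n) \<le> 1" using n lp by (simp add: norm_mult c_def r_def max_def norm_divide)
    qed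
    also have "(\<Sum>n\<in>Q. 1) = real (card Q)" by simp
    also have "\<dots> \<le> 432 * real N / (1 + ln (real N))\<^sup>2" unfolding Q_def by (rule card_proper_prime_powers[OF N])
    finally have "norm (\<Sum>p\<in>P. \<xi> p) \<le> 882 * D * real N / (1 + ln (real N))\<^sup>2 + 432 * real N / (1 + ln (real N))\<^sup>2" using S[OF N] by simp
    then show ?thesis by (simp add: P_def add_divide_distrib[symmetric] distrib_right)
  qed
  then show ?thesis unfolding prime_regular_def by blast
qed

lemma prime_regular_principal:
  assumes l: "l > 0"
  shows "prime_regular (\<lambda>n. if coprime n l then 1 else 0) 1"
  unfolding prime_regular_def
proof (intro exI allI impI)
  fix n :: nat assume n: "n \<ge> 1"
  let ?P = "{p. prime p \<and> p \<le> n}"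
  have fin: "finite ?P" by simp
  have "norm (\<Sum>p\<in>?P. (if coprime p l then 1 else 0) - 1 :: complex) \<le> (\<Sum>p\<in>?P. if p \<in> {1..l} then 1 else 0)"
  proof (rule sum_norm_le)
    fix p assume "p \<in> ?P"
    then have p: "prime p" by simp
    have "p \<in> {1..l}" if "\<not> coprime p l"
    proof -
      have "p dvd l" using prime_imp_coprime[OF p, of l] that by blast
      then show ?thesis using l dvd_imp_le prime_ge_1_nat[OF p] by auto
    qed
    then show "norm ((if coprime p l then 1 else 0) - 1 :: complex) \<le> (if p \<in> {1..l} then 1 else 0)" by auto
  qed
  also have "\<dots> = real (card (?P \<inter> {1..l}))" using fin by (simp add: sum.If_cases Int_def)
  also have "card (?P \<inter> {1..l}) \<le> card {1..l}" by (rule card_mono) auto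
  also have "real (card {1..l}) \<le> real l * (216 * real n / (1 + ln (real n))\<^sup>2)"
    using sqrt_ln_le(3)[of "real n"] n mult_left_mono[of 1 "216 * real n / (1 + ln (real n))\<^sup>2" "real l"] by simp
  also have "\<dots> = (216 * real l) * real n / (1 + ln (real n))\<^sup>2" by simp
  finally show "norm (\<Sum>p\<in>?P. (if coprime p l then 1 else 0) - 1 :: complex) \<le> (216 * real l) * real n / (1 + ln (real n))\<^sup>2" by simp
qed

lemma prime_regular_dchar:
  assumes \<xi>: "dchar l \<xi>"
  shows "\<exists>\<delta>. prime_regular \<xi> \<delta>"
proof (cases "nontrivial_dchar l \<xi>")
  case True
  then show ?thesis using prime_regular_nontrivial by blast
next
  case False
  then have "\<xi> n = (if coprime n l then 1 else 0)" for n using \<xi> dcharD(6)[OF \<xi>, of n] by (auto simp: nontrivial_dchar_def)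
  then have "\<xi> = (\<lambda>n. if coprime n l then 1 else 0)" by (rule ext)
  then show ?thesis using prime_regular_principal[OF dcharD(1)[OF \<xi>]] by auto
qed

section \<open>Linear combinations of regular functions\<close>

lemma prime_regular_cmult:
  assumes "prime_regular f \<delta>"
  shows "prime_regular (\<lambda>n. c * f n) (c * \<delta>)"
proof -
  obtain C where C: "\<And>n. n \<ge> 1 \<Longrightarrow> norm (\<Sum>p | prime p \<and> p \<le> n. f p - \<delta>) \<le> C * real n / (1 + ln (real n))\<^sup>2"
    using assms by (auto simp: prime_regular_def)
  have "norm (\<Sum>p | prime p \<and> p \<le> n. c * f p - c * \<delta>) \<le> (norm c * C) * real n / (1 + ln (real n))\<^sup>2" if "n \<ge> 1" for n
  proof -
    have "(\<Sum>p | prime p \<and> p \<le> n. c * f p - c * \<delta>) = c * (\<Sum>p | prime p \<and> p \<le> n. f p - \<delta>)"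
      unfolding sum_distrib_left by (simp only: right_diff_distrib)
    then have "norm (\<Sum>p | prime p \<and> p \<le> n. c * f p - c * \<delta>) = norm c * norm (\<Sum>p | prime p \<and> p \<le> n. f p - \<delta>)" by (simp only: norm_mult)
    also have "\<dots> \<le> norm c * (C * real n / (1 + ln (real n))\<^sup>2)" by (intro mult_left_mono C that) simp
    finally show ?thesis by simp
  qed
  then show ?thesis unfolding prime_regular_def by blast
qed

lemma prime_regular_add:
  assumes "prime_regular f \<delta>" "prime_regular g \<epsilon>"
  shows "prime_regular (\<lambda>n. f n + g n) (\<delta> + \<epsilon>)"
proof -
  obtain C where C: "\<And>n. n \<ge> 1 \<Longrightarrow> norm (\<Sum>p | prime p \<and> p \<le> n. f p - \<delta>) \<le> C * real n / (1 + ln (real n))\<^sup>2"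
    using assms by (auto simp: prime_regular_def)
  obtain D where D: "\<And>n. n \<ge> 1 \<Longrightarrow> norm (\<Sum>p | prime p \<and> p \<le> n. g p - \<epsilon>) \<le> D * real n / (1 + ln (real n))\<^sup>2"
    using assms by (auto simp: prime_regular_def)
  have "norm (\<Sum>p | prime p \<and> p \<le> n. f p + g p - (\<delta> + \<epsilon>)) \<le> (C + D) * real n / (1 + ln (real n))\<^sup>2" if "n \<ge> 1" for n
  proof -
    have "(\<Sum>p | prime p \<and> p \<le> n. f p + g p - (\<delta> + \<epsilon>)) = (\<Sum>p | prime p \<and> p \<le> n. f p - \<delta>) + (\<Sum>p | prime p \<and> p \<le> n. g p - \<epsilon>)"
      unfolding sum.distrib[symmetric] by (intro sum.cong refl) simp
    then have "norm (\<Sum>p | prime p \<and> p \<le> n. f p + g p - (\<delta> + \<epsilon>)) \<le> norm (\<Sum>p | prime p \<and> p \<le> n. f p - \<delta>) + norm (\<Sum>p | prime p \<and> p \<le> n. g p - \<epsilon>)"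
      by (simp only: norm_triangle_ineq)
    also have "\<dots> \<le> C * real n / (1 + ln (real n))\<^sup>2 + D * real n / (1 + ln (real n))\<^sup>2" by (intro add_mono C D that)
    finally show ?thesis by (simp add: add_divide_distrib distrib_right)
  qed
  then show ?thesis unfolding prime_regular_def by blast
qed

lemma prime_regular_zero: "prime_regular (\<lambda>_. 0) 0"
  unfolding prime_regular_def by (intro exI[of _ 0]) simp

lemma prime_regular_sum:
  assumes "finite A" "\<And>i. i \<in> A \<Longrightarrow> \<exists>\<delta>. prime_regular (f i) \<delta>"
  shows "\<exists>\<delta>. prime_regular (\<lambda>n. \<Sum>i\<in>A. f i n) \<delta>"
  using assms
proof (induction A rule: finite_induct)
  case empty
  then show ?case using prime_regular_zero by auto
next
  case (insert i A)
  then obtain \<delta> \<epsilon> where "prime_regular (f i) \<delta>" "prime_regular (\<lambda>n. \<Sum>i\<in>A. f i n) \<epsilon>" by blast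
  from prime_regular_add[OF this] show ?case using insert by auto
qed

section \<open>Functions on the units as combinations of characters\<close>

definition unit_supported :: "nat \<Rightarrow> (nat \<Rightarrow> complex) \<Rightarrow> bool" where
  "unit_supported l f \<longleftrightarrow> (\<forall>n. f (n + l) = f n) \<and> (\<forall>n. \<not> coprime n l \<longrightarrow> f n = 0)"

lemma unit_supported_cong:
  assumes "unit_supported l f" "[m = n] (mod l)"
  shows "f m = f n"
proof -
  have "f (k mod l) = f k" for k by (rule periodic_mod) (use assms in \<open>simp add: unit_supported_def\<close>)
  then show ?thesis using assms(2) by (metis unique_euclidean_semiring_class.cong_def)
qed

text \<open>The eigenvalue at \<open>g\<close> is read off at \<open>n = 1\<close> as
  \<open>f g / f 1\<close>, so \<open>f / f 1\<close> is completely multiplicative and hence a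
  character. If \<open>f 1 = 0\<close>, then \<open>f\<close> vanishes identically.\<close>

lemma joint_eigenfunction_regular:
  assumes l: "l > 0" and f: "unit_supported l f" and e: "\<And>g. coprime g l \<Longrightarrow> \<exists>\<zeta>. \<forall>n. f (g * n) = \<zeta> * f n"
  shows "\<exists>\<delta>. prime_regular f \<delta>"
proof (cases "f 1 = 0")
  case True
  have "f n = 0" for n
  proof (cases "coprime n l")
    case True
    then obtain \<zeta> where "\<forall>m. f (n * m) = \<zeta> * f m" using e by blast
    then have "f (n * 1) = \<zeta> * f 1" by blast
    then show ?thesis using \<open>f 1 = 0\<close> by simp
  qed (use f in \<open>simp add: unit_supported_def\<close>)
  then have "f = (\<lambda>_. 0)" by (rule ext)
  then show ?thesis using prime_regular_zero by auto
next
  case False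
  define \<xi> where "\<xi> = (\<lambda>n. f n / f 1)"
  have mult: "f (m * n) * f 1 = f m * f n" for m n
  proof (cases "coprime m l")
    case True
    then obtain \<zeta> where z: "\<forall>n. f (m * n) = \<zeta> * f n" using e by blast
    then have "f (m * 1) = \<zeta> * f 1" by blast
    then show ?thesis using z by simp
  next
    case False
    then have "\<not> coprime (m * n) l" by simp
    then show ?thesis using False f by (simp add: unit_supported_def)
  qed
  have nz: "f n \<noteq> 0" if c: "coprime n l" for n
  proof
    assume z: "f n = 0"
    obtain m where m: "[n * m = 1] (mod l)" using cong_solve_coprime_nat[OF c] by auto
    have "f (n * m) = f 1" by (rule unit_supported_cong[OF f m])
    then show False using mult[of n m] z False by simp
  qed
  have "dchar l \<xi>"
    unfolding dchar_def
  proof (intro conjI allI)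
    show "\<xi> (m * n) = \<xi> m * \<xi> n" for m n using mult[of m n] False by (simp add: \<xi>_def field_simps)
    show "\<xi> n \<noteq> 0 \<longleftrightarrow> coprime n l" for n using nz[of n] f False by (auto simp: \<xi>_def unit_supported_def)
  qed (use l False f in \<open>auto simp: \<xi>_def unit_supported_def\<close>)
  then obtain \<delta> where "prime_regular \<xi> \<delta>" using prime_regular_dchar by blast
  from prime_regular_cmult[OF this, of "f 1"] False show ?thesis by (auto simp: \<xi>_def)
qed

text \<open>Averaging over the powers of a unit splits a function into eigenfunctions of multiplication by that unit;
  doing this for all units in turn leaves multiples of characters.\<close>

lemma unit_supported_regular_aux:
  assumes l: "l > 0" and A: "finite A"
  shows "unit_supported l f \<Longrightarrow> (\<And>g. coprime g l \<Longrightarrow> g mod l \<notin> A \<Longrightarrow> \<exists>\<zeta>. \<forall>n. f (g * n) = \<zeta> * f n) \<Longrightarrow> \<exists>\<delta>. prime_regular f \<delta>"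
  using A
proof (induction A arbitrary: f rule: finite_induct)
  case empty
  then show ?case by (intro joint_eigenfunction_regular[OF l]) auto
next
  case (insert h A)
  note f = insert.prems(1)
  show ?case
  proof (cases "coprime h l")
    case False
    show ?thesis
    proof (rule insert.IH[OF f])
      fix g assume g: "coprime g l" "g mod l \<notin> A"
      then have "g mod l \<noteq> h" using False by (metis coprime_mod_left_iff l less_irrefl)
      then show "\<exists>\<zeta>. \<forall>n. f (g * n) = \<zeta> * f n" using insert.prems(2)[of g] g by blast
    qed
  next
    case True
    define M where "M = totient l"
    have M: "M > 0" using l by (simp add: M_def)
    have hM: "[h ^ M = 1] (mod l)" unfolding M_def by (rule euler_theorem[OF True])
    define \<omega> where "\<omega> = exp (2 * of_real pi * \<i> * of_nat 1 / of_nat M :: complex)"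
    have wk: "\<omega> ^ k = exp (2 * of_real pi * \<i> * of_nat k / of_nat M)" for k
      unfolding \<omega>_def exp_of_nat_mult[symmetric] by (simp add: field_simps)
    have w1: "\<omega> ^ k = 1 \<longleftrightarrow> M dvd k" for k unfolding wk using M by (intro complex_root_unity_eq_1) simp
    have w0: "\<omega> \<noteq> 0" by (simp add: \<omega>_def)
    \<comment> \<open>The projection of \<open>f\<close> onto the eigenspace of multiplication by
      \<open>h\<close> with eigenvalue \<open>\<omega>^(-r)\<close>; as \<open>h^M\<close> is 1
      modulo \<open>l\<close>, every eigenvalue is an \<open>M\<close>-th root of unity.\<close>
    define P where "P = (\<lambda>r n. (1 / of_nat M) * (\<Sum>k<M. \<omega> ^ (r * k) * f (h ^ k * n)))"
    have fper: "f (n + l) = f n" for n using f by (simp add: unit_supported_def)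
    have us: "unit_supported l (P r)" for r
    proof -
      have "f (h ^ k * (n + l)) = f (h ^ k * n)" for k n
        by (rule unit_supported_cong[OF f]) (simp add: distrib_left unique_euclidean_semiring_class.cong_def)
      moreover have "f (h ^ k * n) = 0" if "\<not> coprime n l" for k n using f that by (simp add: unit_supported_def)
      ultimately show ?thesis by (simp add: unit_supported_def P_def)
    qed
    have eig_h: "P r (h * n) = inverse (\<omega> ^ r) * P r n" for r n
    proof -
      \<comment> \<open>Replacing \<open>n\<close> by \<open>h * n\<close> shifts the summation
        index, and the shift is cyclic because \<open>F M = F 0\<close>.\<close>
      define F where "F = (\<lambda>k. \<omega> ^ (r * k) * f (h ^ k * n))"
      have "\<omega> ^ r * (\<Sum>k<M. \<omega> ^ (r * k) * f (h ^ k * (h * n))) = (\<Sum>k<M. F (Suc k))"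
        unfolding sum_distrib_left F_def by (intro sum.cong refl) (simp add: power_add algebra_simps)
      also have "\<dots> = (\<Sum>k<M. F k) + F M - F 0" using sum.lessThan_Suc_shift[of F M] by simp
      also have "F M = F 0"
      proof -
        have "[h ^ M * n = 1 * n] (mod l)" using hM by (rule cong_scalar_right)
        then have "f (h ^ M * n) = f (1 * n)" by (rule unit_supported_cong[OF f])
        moreover have "\<omega> ^ (r * M) = 1" by (simp add: w1)
        ultimately show ?thesis by (simp add: F_def)
      qed
      finally have "\<omega> ^ r * (\<Sum>k<M. \<omega> ^ (r * k) * f (h ^ k * (h * n))) = (\<Sum>k<M. F k)" by simp
      then have "\<omega> ^ r * P r (h * n) = P r n" by (simp add: P_def F_def)
      then show ?thesis using w0 by (simp add: field_simps)
    qed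
    have "\<exists>\<delta>. prime_regular (P r) \<delta>" for r
    proof (rule insert.IH[OF us])
      fix g assume g: "coprime g l" "g mod l \<notin> A"
      show "\<exists>\<zeta>. \<forall>n. P r (g * n) = \<zeta> * P r n"
      proof (cases "g mod l = h")
        case True
        have "P r (g * n) = P r (h * n)" for n
          by (rule unit_supported_cong[OF us], rule cong_scalar_right)
             (use True in \<open>auto simp: unique_euclidean_semiring_class.cong_def\<close>)
        then show ?thesis using eig_h by metis
      next
        case False
        \<comment> \<open>Multiplication by \<open>g\<close> commutes with multiplication by powers
          of \<open>h\<close>, so an eigenvalue already obtained for \<open>f\<close> passes to each
          projection.\<close>
        then obtain \<zeta> where z: "\<And>n. f (g * n) = \<zeta> * f n" using insert.prems(2)[of g] g by blast
        have eg: "f (h ^ k * (g * n)) = \<zeta> * f (h ^ k * n)" for k n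
          using z[of "h ^ k * n"] by (simp only: mult.left_commute)
        have "(\<Sum>k<M. \<omega> ^ (r * k) * f (h ^ k * (g * n))) = \<zeta> * (\<Sum>k<M. \<omega> ^ (r * k) * f (h ^ k * n))" for n
          unfolding sum_distrib_left by (intro sum.cong refl, subst eg) (rule mult.left_commute)
        then have "P r (g * n) = \<zeta> * P r n" for n by (simp add: P_def)
        then show ?thesis by blast
      qed
    qed
    then have "\<exists>\<delta>. prime_regular (\<lambda>n. \<Sum>r<M. P r n) \<delta>" by (intro prime_regular_sum) auto
    moreover have "(\<Sum>r<M. P r n) = f n" for n
    proof -
      \<comment> \<open>Orthogonality of the roots of unity: summed over \<open>r\<close>, only the
        term \<open>k = 0\<close> survives, so the projections add up to \<open>f\<close>.\<close>
      have orth: "(\<Sum>r<M. \<omega> ^ (r * k)) = (if k = 0 then of_nat M else 0)" if k: "k < M" for k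
      proof (cases "k = 0")
        case False
        have "\<omega> ^ k \<noteq> 1" using False k by (simp add: w1 nat_dvd_not_less)
        then have "(\<Sum>r<M. (\<omega> ^ k) ^ r) = ((\<omega> ^ k) ^ M - 1) / (\<omega> ^ k - 1)" by (rule geometric_sum)
        also have "(\<omega> ^ k) ^ M = 1" by (simp add: w1 flip: power_mult)
        finally show ?thesis using False by (simp add: power_mult[symmetric] mult.commute)
      qed simp
      have "(\<Sum>r<M. P r n) = (1 / of_nat M) * (\<Sum>r<M. \<Sum>k<M. \<omega> ^ (r * k) * f (h ^ k * n))" by (simp add: P_def sum_distrib_left)
      also have "(\<Sum>r<M. \<Sum>k<M. \<omega> ^ (r * k) * f (h ^ k * n)) = (\<Sum>k<M. (\<Sum>r<M. \<omega> ^ (r * k)) * f (h ^ k * n))"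
        by (subst sum.swap) (simp add: sum_distrib_right)
      also have "\<dots> = (\<Sum>k<M. if k = 0 then of_nat M * f n else 0)" by (intro sum.cong refl) (simp add: orth)
      also have "\<dots> = of_nat M * f n" using M by simp
      finally show ?thesis using M by simp
    qed
    ultimately show ?thesis by simp
  qed
qed

lemma prime_regular_residue_class:
  assumes l: "l > 0" and j: "coprime j l"
  shows "\<exists>\<delta>. prime_regular (\<lambda>n. if [n = j] (mod l) then 1 else 0) \<delta>"
\<comment> \<open>With all residues declared exceptional, the eigenvalue hypothesis is
  vacuous.\<close>
proof (rule unit_supported_regular_aux[OF l, of "{..<l}"])
  have "\<not> [n = j] (mod l)" if "\<not> coprime n l" for n
  proof
    assume "[n = j] (mod l)"
    then have "coprime n l \<longleftrightarrow> coprime j l" using l by (metis coprime_mod_left_iff unique_euclidean_semiring_class.cong_def less_irrefl)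
    then show False using j that by blast
  qed
  then show "unit_supported l (\<lambda>n. if [n = j] (mod l) then 1 else 0)"
    by (auto simp: unit_supported_def unique_euclidean_semiring_class.cong_def)
qed (use l in auto)

section \<open>Differentiating in the weight\<close>

lemma norm_exp_minus_1_le:
  fixes w :: complex
  assumes "norm w \<le> 1/2"
  shows "norm (exp w - 1) \<le> 2 * norm w"
proof -
  have "norm (exp w - exp 0) \<le> 2 * norm (w - 0)"
  proof (rule field_differentiable_bound[where S = "cball 0 (1/2)" and f' = exp])
    show "(exp has_field_derivative exp z) (at z within cball 0 (1/2))" for z :: complex
      by (rule DERIV_exp[THEN has_field_derivative_at_within])
    show "norm (exp z) \<le> 2" if "z \<in> cball 0 (1/2)" for z :: complex
      using that exp_bound_lemma[of z] by simp
  qed (use assms in auto)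
  then show ?thesis by simp
qed

lemma deriv_exponential_sum:
  fixes c :: "nat \<Rightarrow> complex" and e :: "nat \<Rightarrow> nat"
  assumes "finite A"
  shows "(deriv ^^ Suc m) (\<lambda>w. (\<Sum>d\<in>A. c d * exp (of_nat (e d) * w)) + \<delta>) = (\<lambda>w. \<Sum>d\<in>A. c d * of_nat (e d) ^ Suc m * exp (of_nat (e d) * w))"
proof (induction m)
  case 0
  have "((\<lambda>w. (\<Sum>d\<in>A. c d * exp (of_nat (e d) * w)) + \<delta>) has_field_derivative (\<Sum>d\<in>A. c d * of_nat (e d) ^ Suc 0 * exp (of_nat (e d) * w))) (at w)" for w
    by (auto intro!: derivative_eq_intros sum.cong)
  then show ?case by (auto simp: fun_eq_iff intro!: DERIV_imp_deriv)
next
  case (Suc m)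
  have "((\<lambda>w. \<Sum>d\<in>A. c d * of_nat (e d) ^ Suc m * exp (of_nat (e d) * w)) has_field_derivative (\<Sum>d\<in>A. c d * of_nat (e d) ^ Suc (Suc m) * exp (of_nat (e d) * w))) (at w)" for w
    by (auto intro!: derivative_eq_intros sum.cong simp: mult_ac)
  then have "deriv (\<lambda>w. \<Sum>d\<in>A. c d * of_nat (e d) ^ Suc m * exp (of_nat (e d) * w)) = (\<lambda>w. \<Sum>d\<in>A. c d * of_nat (e d) ^ Suc (Suc m) * exp (of_nat (e d) * w))"
    by (intro ext DERIV_imp_deriv)
  then show ?case using Suc.IH by simp
qed

text \<open>The constant \<open>\<delta>\<close> in the uniform estimate disappears after differentiating in the weight variable.\<close>

lemma mu_omega_power_bound:
  assumes f: "\<And>p. norm (f p) \<le> 1" and reg: "prime_regular f \<delta>" and m: "m \<ge> 1"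
  shows "\<exists>K. \<forall>N. ln (real N) \<ge> 16 \<longrightarrow>
     norm (\<Sum>d=2..N. mu d * of_nat (omega d) ^ m * f (least_prime_factor d) / of_nat d) \<le> K * ln (1 + ln (real N)) ^ m / sqrt (ln (real N))"
proof -
  \<comment> \<open>The mean \<delta> comes from an existence statement without a bound on its size,
    while \<open>main_estimate\<close> asks for norm at most 1; rescaling \<open>f\<close> and
    \<delta> by \<open>B\<close> settles this.\<close>
  define B where "B = max 1 (norm \<delta>)"
  have B: "B \<ge> 1" "norm \<delta> \<le> B" by (auto simp: B_def)
  obtain C1 where C1: "\<And>n. n \<ge> 1 \<Longrightarrow> norm (mu_harm n) \<le> C1 / (1 + ln (real n))\<^sup>2" using mu_harm_bound by blast
  define g where "g = (\<lambda>n. (1 / of_real B) * f n)"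
  define \<epsilon> where "\<epsilon> = (1 / of_real B) * \<delta>"
  obtain C2 where C2: "\<And>n. n \<ge> 1 \<Longrightarrow> norm (\<Sum>p | prime p \<and> p \<le> n. g p - \<epsilon>) \<le> C2 * real n / (1 + ln (real n))\<^sup>2"
    using prime_regular_cmult[OF reg, of "1 / of_real B"] unfolding prime_regular_def g_def \<epsilon>_def by blast
  have g: "norm (g p) \<le> 1" for p using f[of p] B by (simp add: g_def norm_divide divide_le_eq)
  have \<epsilon>: "norm \<epsilon> \<le> 1" using B by (simp add: \<epsilon>_def norm_divide divide_le_eq)
  from main_estimate[OF C1 g \<epsilon> C2] obtain K where
    K: "\<And>N v. ln (real N) \<ge> 16 \<Longrightarrow> norm v \<le> 1 \<Longrightarrow> norm v * ln (1 + ln (real N)) \<le> 2 \<Longrightarrow>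
      norm ((\<Sum>d=2..N. mu d * (1 - v) ^ omega d * g (least_prime_factor d) / of_nat d) + \<epsilon>) \<le> K / sqrt (ln (real N))"
    by blast
  obtain q where q: "m = Suc q" using m by (cases m) auto
  have "norm (\<Sum>d=2..N. mu d * of_nat (omega d) ^ m * f (least_prime_factor d) / of_nat d) \<le> (B * fact m * K) * ln (1 + ln (real N)) ^ m / sqrt (ln (real N))"
    if N: "ln (real N) \<ge> 16" for N
  proof -
    define LL where "LL = ln (1 + ln (real N))"
    have LL: "LL \<ge> 2"
    proof -
      have "exp (2::real) = exp 1 * exp 1" by (simp flip: exp_add)
      also have "\<dots> \<le> 3 * 3" by (intro mult_mono exp_le) auto
      finally have "exp 2 \<le> 1 + ln (real N)" using N by linarith
      then show ?thesis unfolding LL_def using N by (subst ln_ge_iff) auto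
    qed
    \<comment> \<open>On the circle of this radius \<open>norm (1 - exp w) \<le> 2 * R\<close>,
      which meets both conditions on \<open>v\<close>: at most 1 because \<open>LL \<ge> 2\<close>,
      and \<open>norm v * LL \<le> 2\<close>.\<close>
    define R where "R = 1 / LL"
    have R: "R > 0" "R \<le> 1/2" using LL by (auto simp: R_def divide_simps)
    define c where "c = (\<lambda>d. mu d * g (least_prime_factor d) / of_nat d)"
    define F where "F = (\<lambda>w. (\<Sum>d=2..N. c d * exp (of_nat (omega d) * w)) + \<epsilon>)"
    have Fh: "F holomorphic_on S" for S unfolding F_def by (intro holomorphic_intros)
    have "norm ((deriv ^^ m) F 0) \<le> fact m * (K / sqrt (ln (real N))) / R ^ m"
    proof (rule Cauchy_inequality[OF Fh holomorphic_on_imp_continuous_on[OF Fh] R(1)])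
      fix w :: complex assume "norm (0 - w) = R"
      then have w: "norm w = R" by simp
      have v: "norm (1 - exp w) \<le> 2 * R" using norm_exp_minus_1_le[of w] w R by (simp add: norm_minus_commute)
      have "F w = (\<Sum>d=2..N. mu d * (1 - (1 - exp w)) ^ omega d * g (least_prime_factor d) / of_nat d) + \<epsilon>"
      proof -
        have "exp (of_nat (omega d) * w) = (1 - (1 - exp w)) ^ omega d" for d by (simp add: exp_of_nat_mult)
        then show ?thesis unfolding F_def c_def by (simp add: mult_ac)
      qed
      also have "norm \<dots> \<le> K / sqrt (ln (real N))"
      proof (rule K[OF N])
        show "norm (1 - exp w) \<le> 1" using v R by simp
        have "norm (1 - exp w) * LL \<le> 2 * R * LL" using v LL by (intro mult_right_mono) auto
        then show "norm (1 - exp w) * ln (1 + ln (real N)) \<le> 2" using LL by (simp add: R_def LL_def[symmetric])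
      qed
      finally show "norm (F w) \<le> K / sqrt (ln (real N))" .
    qed
    also have "(deriv ^^ m) F 0 = (\<Sum>d=2..N. c d * of_nat (omega d) ^ m)"
      unfolding F_def q by (subst deriv_exponential_sum) auto
    finally have b: "norm (\<Sum>d=2..N. c d * of_nat (omega d) ^ m) \<le> fact m * (K / sqrt (ln (real N))) * LL ^ m"
      by (simp add: R_def power_divide)
    have "(\<Sum>d=2..N. mu d * of_nat (omega d) ^ m * f (least_prime_factor d) / of_nat d) = of_real B * (\<Sum>d=2..N. c d * of_nat (omega d) ^ m)"
      unfolding sum_distrib_left using B by (intro sum.cong refl) (simp add: c_def g_def)
    then have "norm (\<Sum>d=2..N. mu d * of_nat (omega d) ^ m * f (least_prime_factor d) / of_nat d) = B * norm (\<Sum>d=2..N. c d * of_nat (omega d) ^ m)"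
      using B by (simp add: norm_mult)
    also have "\<dots> \<le> B * (fact m * (K / sqrt (ln (real N))) * LL ^ m)" using b B by (intro mult_left_mono) auto
    finally show ?thesis by (simp add: LL_def)
  qed
  then show ?thesis by blast
qed

section \<open>From integers to real \<open>x\<close>, and the final statement\<close>

lemma moebius_omega_sum_eq:
  assumes "x \<ge> 0"
  shows "complex_of_real (moebius_omega_sum k j l x) =
    (\<Sum>d=2..nat \<lfloor>x\<rfloor>. mu d * of_nat (omega d) ^ (k - 1) * (if [least_prime_factor d = j] (mod l) then 1 else 0) / of_nat d)"
proof -
  have "{n. 2 \<le> n \<and> real n \<le> x \<and> [least_prime_factor n = j] (mod l)} = {d \<in> {2..nat \<lfloor>x\<rfloor>}. [least_prime_factor d = j] (mod l)}"
    using assms by (auto simp: le_nat_floor) (metis assms le_nat_iff of_nat_floor of_nat_le_iff order_trans le_floor_iff of_int_of_nat_eq)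
  then have "moebius_omega_sum k j l x = (\<Sum>d=2..nat \<lfloor>x\<rfloor>. if [least_prime_factor d = j] (mod l) then real_of_int (moebius_mu d) * real (omega d) ^ (k - 1) / real d else 0)"
    unfolding moebius_omega_sum_def by (simp only:) (rule sum.inter_filter, simp)
  then show ?thesis by (simp only: of_real_sum) (intro sum.cong, auto)
qed

text \<open>Only the change from the integer part \<open>N\<close> to \<open>x\<close> is left:
  \<open>ln N\<close> lies between \<open>ln x / 2\<close> and \<open>ln x\<close>. The factor
  \<open>2^k\<close> collects \<open>2^(k-1)\<close> from the double logarithm and 2 from the square
  root.\<close>

lemma moebius_omega_sum_bound:
  assumes k: "k \<ge> 4" and l: "l > 0" and j: "coprime j l"
  shows "\<exists>K. \<forall>\<^sub>F x::real in at_top. \<bar>moebius_omega_sum k j l x\<bar> \<le> K * (ln (ln x) powr (real k + 1/2) / sqrt (ln x))"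
proof -
  define f where "f = (\<lambda>n. if [n = j] (mod l) then 1 else 0 :: complex)"
  obtain \<delta> where reg: "prime_regular f \<delta>" using prime_regular_residue_class[OF l j] unfolding f_def by blast
  have f: "norm (f p) \<le> 1" for p by (simp add: f_def)
  have m: "k - 1 \<ge> 1" using k by simp
  from mu_omega_power_bound[OF f reg m] obtain K where
    K: "\<And>N. ln (real N) \<ge> 16 \<Longrightarrow> norm (\<Sum>d=2..N. mu d * of_nat (omega d) ^ (k - 1) * f (least_prime_factor d) / of_nat d) \<le> K * ln (1 + ln (real N)) ^ (k - 1) / sqrt (ln (real N))"
    by blast
  define g where "g = (\<lambda>x::real. ln (ln x) powr (real k + 1/2) / sqrt (ln x))"
  have "\<forall>\<^sub>F x::real in at_top. x \<ge> 4" "\<forall>\<^sub>F x::real in at_top. ln x \<ge> 32" "\<forall>\<^sub>F x::real in at_top. ln (ln x) \<ge> 1"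
    by real_asymp+
  then have "\<forall>\<^sub>F x::real in at_top. \<bar>moebius_omega_sum k j l x\<bar> \<le> (\<bar>K\<bar> * 2 ^ k) * g x"
  proof eventually_elim
    case (elim x)
    define N where "N = nat \<lfloor>x\<rfloor>"
    have N: "real N \<le> x" "real N > x - 1" using elim unfolding N_def by linarith+
    have sN: "sqrt x \<le> real N"
    proof -
      have "2 \<le> sqrt x" using elim by (simp add: real_le_rsqrt)
      then have "2 * sqrt x \<le> sqrt x * sqrt x" using elim by (intro mult_right_mono) auto
      then have "2 * sqrt x \<le> x" using elim by simp
      then show ?thesis using N elim \<open>2 \<le> sqrt x\<close> by linarith
    qed
    have Np: "real N > 0" using N elim by linarith
    have "ln (sqrt x) \<le> ln (real N)" using sN elim Np by (subst ln_le_cancel_iff) auto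
    then have lN: "ln x / 2 \<le> ln (real N)" using elim by (simp add: ln_sqrt)
    have lN2: "ln (real N) \<le> ln x" using N elim Np by (subst ln_le_cancel_iff) auto
    have lN16: "ln (real N) \<ge> 16" using lN elim by linarith
    have LL: "0 \<le> ln (1 + ln (real N))" "ln (1 + ln (real N)) \<le> 2 * ln (ln x)"
    proof -
      show "0 \<le> ln (1 + ln (real N))" using lN16 by simp
      have "2 * ln x \<le> ln x * ln x" using elim by (intro mult_right_mono) auto
      then have "1 + ln (real N) \<le> ln x * ln x" using lN2 elim by linarith
      then have "ln (1 + ln (real N)) \<le> ln (ln x * ln x)" using lN16 elim by (subst ln_le_cancel_iff) auto
      then show "ln (1 + ln (real N)) \<le> 2 * ln (ln x)" using elim by (simp add: ln_mult)
    qed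
    have sq: "sqrt (ln x) \<le> 2 * sqrt (ln (real N))"
    proof -
      have "sqrt (ln x) \<le> sqrt (4 * ln (real N))" using lN lN16 by (intro real_sqrt_le_mono) linarith
      then show ?thesis by (simp add: real_sqrt_mult)
    qed
    have "\<bar>moebius_omega_sum k j l x\<bar> = norm (complex_of_real (moebius_omega_sum k j l x))" by simp
    also have "complex_of_real (moebius_omega_sum k j l x) = (\<Sum>d=2..N. mu d * of_nat (omega d) ^ (k - 1) * f (least_prime_factor d) / of_nat d)"
      using elim unfolding N_def f_def by (intro moebius_omega_sum_eq) simp
    also have "norm \<dots> \<le> K * ln (1 + ln (real N)) ^ (k - 1) / sqrt (ln (real N))" by (rule K[OF lN16])
    also have "\<dots> \<le> \<bar>K\<bar> * (2 * ln (ln x)) ^ (k - 1) / (sqrt (ln x) / 2)"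
      using LL sq elim lN16 by (intro frac_le mult_mono power_mono) auto
    also have "\<dots> = \<bar>K\<bar> * 2 ^ Suc (k - 1) * (ln (ln x) ^ (k - 1) / sqrt (ln x))" by (simp add: power_mult_distrib)
    also have "Suc (k - 1) = k" using k by simp
    also have "\<bar>K\<bar> * 2 ^ k * (ln (ln x) ^ (k - 1) / sqrt (ln x)) \<le> \<bar>K\<bar> * 2 ^ k * g x"
    \<comment> \<open>As \<open>ln (ln x) \<ge> 1\<close>, the exponent \<open>k - 1\<close> may be
      raised to the one claimed.\<close>
    proof -
      have "ln (ln x) ^ (k - 1) = ln (ln x) powr real (k - 1)" using elim by (subst powr_realpow) auto
      also have "\<dots> \<le> ln (ln x) powr (real k + 1/2)" using elim k by (intro powr_mono) auto
      finally show ?thesis unfolding g_def using elim by (intro mult_left_mono divide_right_mono) auto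
    qed
    finally show ?case .
  qed
  then show ?thesis unfolding g_def by blast
qed

theorem theorem6p5:
  fixes k l :: nat
  assumes "k \<ge> 4"
  shows "(\<exists>K::real. \<forall>j::nat. 1 \<le> j \<and> j \<le> l \<and> coprime j l \<longrightarrow>
            (\<forall>\<^sub>F x::real in at_top.
               \<bar>moebius_omega_sum k j l x\<bar> \<le> K * (ln (ln x) powr (real k + 1/2) / sqrt (ln x))))
       \<and> (\<forall>j::nat. 1 \<le> j \<and> j \<le> l \<and> coprime j l \<longrightarrow>
            (moebius_omega_sum k j l \<longlongrightarrow> 0) at_top)"
proof -
  define g where "g = (\<lambda>x::real. ln (ln x) powr (real k + 1/2) / sqrt (ln x))"
  have "\<forall>j. \<exists>K. 1 \<le> j \<and> j \<le> l \<and> coprime j l \<longrightarrow> (\<forall>\<^sub>F x::real in at_top. \<bar>moebius_omega_sum k j l x\<bar> \<le> K * g x)"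
  proof
    fix j
    show "\<exists>K. 1 \<le> j \<and> j \<le> l \<and> coprime j l \<longrightarrow> (\<forall>\<^sub>F x::real in at_top. \<bar>moebius_omega_sum k j l x\<bar> \<le> K * g x)"
    proof (cases "1 \<le> j \<and> j \<le> l \<and> coprime j l")
      case True
      then have "l > 0" by linarith
      from moebius_omega_sum_bound[OF assms this, of j] True show ?thesis unfolding g_def by blast
    qed blast
  qed
  from choice[OF this] obtain Kf where Kf: "\<And>j. 1 \<le> j \<Longrightarrow> j \<le> l \<Longrightarrow> coprime j l \<Longrightarrow> \<forall>\<^sub>F x::real in at_top. \<bar>moebius_omega_sum k j l x\<bar> \<le> Kf j * g x"
    by blast
  \<comment> \<open>The sum of all the constants makes the bound independent of \<open>j\<close>;
    there are only \<open>l\<close> candidates.\<close>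
  define K where "K = (\<Sum>j=1..l. \<bar>Kf j\<bar>)"
  have bound: "\<forall>\<^sub>F x::real in at_top. \<bar>moebius_omega_sum k j l x\<bar> \<le> K * g x" if j: "1 \<le> j" "j \<le> l" "coprime j l" for j
  proof -
    have "\<bar>Kf j\<bar> \<le> K" unfolding K_def by (rule member_le_sum) (use j in auto)
    then have KK: "Kf j \<le> K" by linarith
    have "\<forall>\<^sub>F x::real in at_top. ln x \<ge> 0" by real_asymp
    with Kf[OF j] show ?thesis
    proof eventually_elim
      case (elim x)
      have "g x \<ge> 0" using elim by (simp add: g_def)
      then have "Kf j * g x \<le> K * g x" using KK by (intro mult_right_mono)
      then show ?case using elim by linarith
    qed
  qed
  have "(g \<longlongrightarrow> 0) at_top"
  proof -
    have "((\<lambda>x::real. ln (ln x) powr a / sqrt (ln x)) \<longlongrightarrow> 0) at_top" if "a > 0" for a :: real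
      using that by real_asymp
    then show ?thesis unfolding g_def by simp
  qed
  then have "((\<lambda>x. K * g x) \<longlongrightarrow> 0) at_top" by (rule tendsto_mult_right_zero)
  then have "(moebius_omega_sum k j l \<longlongrightarrow> 0) at_top" if j: "1 \<le> j" "j \<le> l" "coprime j l" for j
    by (rule Lim_null_comparison[rotated]) (use bound[OF j] in simp)
  then show ?thesis using bound unfolding g_def by blast
qed

end
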